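(* Let $\phi(\cdot)$ be an admissible kernel and let $T>0$. For any given initial datum $x=(x_0,x_1)\in M_2$, the stochastic delay differential equation $$\begin{cases}dy(t)=\Big[y(t)\mu_y+\displaystyle\int_{-d}^0y(t+s)\,\phi(t)(ds)\Big]dt+y(t)\sigma_y^\top dZ(t),\\ y(0)=x_0,\quad y(s)=x_1(s)\ \text{ for } s\in[-d,0),\end{cases}$$ admits a unique strong (in the probabilistic sense) solution $y$ in the space $L^2(\Omega;C([0,T];\mathbb R))$, which depends continuously on $x$. Moreover, this solution belongs to $L^p(\Omega;C([0,T];\mathbb R))$ for all $p\ge2$.
   Context: $Z$ is an $n$-dimensional Brownian motion on $(\Omega,\mathcal F,P)$ with augmented natural filtration $\mathbb F$; $d>0$, $\mu_y\in\mathbb R$, $\sigma_y\in\mathbb R^n$. $M_2=\mathbb R\times L^2([-d,0);\mathbb R)$ with its Hilbert norm. $\mathcal M^0$ is the set of (signed) Radon measures on $[-d,0]$ with no atom at $0$, ordered by $\phi\le\psi$ iff $\int g\,d\phi\le\int g\,d\psi$ for all nonnegative continuous $g$. $K\subset\mathcal M^0$ is a set having an order minimum (an element $\nu\in K$ with $\nu\le\phi$ for all $\phi\in K$). An admissible kernel is a map $\phi(\cdot):\Omega\times[0,\infty)\to K$ such that $(\omega,t)\mapsto\phi(t,\omega)(A)$ is progressively measurable for each Borel $A\subset[-d,0)$ and, for every $T>0$, there is a constant $c_T\ge0$ with $\sup_{0\le t\le T}\|\phi(t,\omega)\|\le c_T$ $P$-a.s. (total variation norm). Meaning of the equation: for $\omega\in\Omega$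 and $z\in C([-d,T];\mathbb R)$ put $(\mathcal N_T(\omega)z)(t)=\int_{-d}^0z(t+s)\,\phi(t,\omega)(ds)$, $0\le t\le T$; $\mathcal N_T(\omega)$ denotes also the continuous linear extension $L^2([-d,T];\mathbb R)\to L^2([0,T];\mathbb R)$ of this operator (obtained in the paper from the bound $\|\mathcal N_T(\omega)z\|_{L^2([0,T])}\le c_T\|z\|_{L^2([-d,T])}$ on continuous $z$). A (strong) solution is an $\mathbb F$-adapted continuous process $y$ on $[0,T]$ such that, $P$-a.s., for all $t\in[0,T]$, $$y(t)=x_0+\mu_y\int_0^ty(u)du+\int_0^t(\mathcal N_T\bar y^{x_1})(u)du+\int_0^ty(u)\sigma_y^\top dZ(u),$$ where $\bar y^{x_1}=x_1$ on $[-d,0)$ and $\bar y^{x_1}=y$ on $[0,T]$.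
   Formalization: The bound ‖N_T(ω)z‖_{L²([0,T])} ≤ c‖z‖_{L²([-d,T])} on continuous z, with a deterministic constant c, is assumed for the given T; it does not follow from admissibility, e.g. φ(t)=δ_{-d/2-t} for t<d/2 gives z(-d/2), so no L² extension exists. *)

theory Defs
  imports "HOL-Probability.Probability"
begin

section \<open>Brownian filtration and the stochastic integral\<close>

definition natural_filtration ::
  "'a measure \<Rightarrow> (real \<Rightarrow> 'a \<Rightarrow> 'b::topological_space) \<Rightarrow> real \<Rightarrow> 'a measure"
where
  "natural_filtration M Z t =
     sigma (space M) {Z s -` B \<inter> space M | s B. s \<in> {0..t} \<and> B \<in> sets borel}"

(* The underlying probability space is not assumed complete; the null sets adjoined are those
   of M. For complete M this is the usual augmentation. *)
definition augmented_filtration ::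
  "'a measure \<Rightarrow> (real \<Rightarrow> 'a \<Rightarrow> 'b::topological_space) \<Rightarrow> real \<Rightarrow> 'a measure"
where
  "augmented_filtration M Z t =
     sigma (space M) (sets (natural_filtration M Z t) \<union> null_sets M)"

definition brownian_motion :: "'a measure \<Rightarrow> (real \<Rightarrow> 'a \<Rightarrow> real^'n) \<Rightarrow> bool" where
  "brownian_motion M Z \<longleftrightarrow>
     (\<forall>t\<ge>0. Z t \<in> borel_measurable M) \<and>
     (AE \<omega> in M. Z 0 \<omega> = 0) \<and>
     (AE \<omega> in M. continuous_on {0..} (\<lambda>t. Z t \<omega>)) \<and>
     (\<forall>s t. 0 \<le> s \<and> s < t \<longrightarrow>
        distributed M lborel (\<lambda>\<omega>. Z t \<omega> - Z s \<omega>)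
          (\<lambda>x. ennreal (\<Prod>i\<in>UNIV. normal_density 0 (sqrt (t - s)) (x $ i))) \<and>
        prob_space.indep_set M (sets (natural_filtration M Z s))
          {(\<lambda>\<omega>. Z t \<omega> - Z s \<omega>) -` B \<inter> space M | B. B \<in> sets borel})"

definition adapted_on :: "(real \<Rightarrow> 'a measure) \<Rightarrow> real \<Rightarrow> (real \<Rightarrow> 'a \<Rightarrow> 'b::topological_space) \<Rightarrow> bool"
where
  "adapted_on F T X \<longleftrightarrow> (\<forall>t\<in>{0..T}. X t \<in> borel_measurable (F t))"

definition progressive_on ::
  "(real \<Rightarrow> 'a measure) \<Rightarrow> real \<Rightarrow> (real \<Rightarrow> 'a \<Rightarrow> 'b::topological_space) \<Rightarrow> bool"
where
  "progressive_on F T X \<longleftrightarrow>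
     (\<forall>t\<in>{0..T}. (\<lambda>(s, \<omega>). X s \<omega>) \<in> borel_measurable (restrict_space borel {0..t} \<Otimes>\<^sub>M F t))"

definition continuous_paths_on ::
  "'a measure \<Rightarrow> real \<Rightarrow> (real \<Rightarrow> 'a \<Rightarrow> 'b::topological_space) \<Rightarrow> bool"
where
  "continuous_paths_on M T X \<longleftrightarrow> (\<forall>\<omega>\<in>space M. continuous_on {0..T} (\<lambda>t. X t \<omega>))"

(* Data (m, \<tau>, \<xi>) of the simple process
   \<Sum>j<m. \<xi> j * 1_(\<tau> j, \<tau> (j+1)] with \<xi> j bounded and F(\<tau> j)-measurable. *)
definition simple_integrand ::
  "'a measure \<Rightarrow> (real \<Rightarrow> 'a measure) \<Rightarrow> real \<Rightarrow> nat \<Rightarrow> (nat \<Rightarrow> real) \<Rightarrow> (nat \<Rightarrow> 'a \<Rightarrow> real^'n) \<Rightarrow> bool"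
where
  "simple_integrand M F T m \<tau> \<xi> \<longleftrightarrow>
     0 \<le> \<tau> 0 \<and> \<tau> m \<le> T \<and> (\<forall>j<m. \<tau> j \<le> \<tau> (Suc j)) \<and>
     (\<forall>j<m. \<xi> j \<in> borel_measurable (F (\<tau> j)) \<and> (\<exists>C. \<forall>\<omega>\<in>space M. norm (\<xi> j \<omega>) \<le> C))"

definition simple_process ::
  "nat \<Rightarrow> (nat \<Rightarrow> real) \<Rightarrow> (nat \<Rightarrow> 'a \<Rightarrow> real^'n) \<Rightarrow> real \<Rightarrow> 'a \<Rightarrow> real^'n"
where
  "simple_process m \<tau> \<xi> t \<omega> = (\<Sum>j<m. indicator {\<tau> j<..\<tau> (Suc j)} t *\<^sub>R \<xi> j \<omega>)"

definition simple_ito ::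
  "(real \<Rightarrow> 'a \<Rightarrow> real^'n) \<Rightarrow> nat \<Rightarrow> (nat \<Rightarrow> real) \<Rightarrow> (nat \<Rightarrow> 'a \<Rightarrow> real^'n) \<Rightarrow> real \<Rightarrow> 'a \<Rightarrow> real"
where
  "simple_ito Z m \<tau> \<xi> t \<omega> =
     (\<Sum>j<m. \<xi> j \<omega> \<bullet> (Z (min t (\<tau> (Suc j))) \<omega> - Z (min t (\<tau> j)) \<omega>))"

(* I is a continuous version of the integral of H (transposed) against Z on [0,T], for
   progressive H. The usual requirement is that for some simple processes H_k both
   \<integral>_0^T |H_k - H|^2 dt and sup_{t\<le>T} |\<integral>_0^t H_k dZ - I_t| tend to 0 in probability;
   after passing to a subsequence this is the same as almost sure convergence of both,
   which is what is written here. Existence of the H_k forces \<integral>_0^T |H|^2 dt < \<infinity> a.s.; the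
   time integral is an nn_integral so that it cannot vanish for want of integrability. *)
definition ito_integral ::
  "'a measure \<Rightarrow> (real \<Rightarrow> 'a measure) \<Rightarrow> (real \<Rightarrow> 'a \<Rightarrow> real^'n) \<Rightarrow> real \<Rightarrow>
   (real \<Rightarrow> 'a \<Rightarrow> real^'n) \<Rightarrow> (real \<Rightarrow> 'a \<Rightarrow> real) \<Rightarrow> bool"
where
  "ito_integral M F Z T H I \<longleftrightarrow>
     progressive_on F T H \<and> adapted_on F T I \<and> continuous_paths_on M T I \<and>
     (\<exists>m \<tau> \<xi>. (\<forall>k. simple_integrand M F T (m k) (\<tau> k) (\<xi> k)) \<and>
        (AE \<omega> in M.
           (\<lambda>k. \<integral>\<^sup>+t\<in>{0..T}. ennreal ((norm (simple_process (m k) (\<tau> k) (\<xi> k) t \<omega> - H t \<omega>))\<^sup>2) \<partial>lborel)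
             \<longlonglongrightarrow> 0 \<and>
           uniform_limit {0..T} (\<lambda>k t. simple_ito Z (m k) (\<tau> k) (\<xi> k) t \<omega>) (\<lambda>t. I t \<omega>) sequentially))"

section \<open>Square integrable functions\<close>

(* Elements of L^2 are represented by functions, identified up to Lebesgue null sets. *)
definition L2_space :: "real set \<Rightarrow> (real \<Rightarrow> real) set" where
  "L2_space S = {f. set_borel_measurable lborel S f \<and> set_integrable lborel S (\<lambda>s. (f s)\<^sup>2)}"

definition L2_norm :: "real set \<Rightarrow> (real \<Rightarrow> real) \<Rightarrow> real" where
  "L2_norm S f = sqrt (LINT s:S|lborel. (f s)\<^sup>2)"

definition M2_space :: "real \<Rightarrow> (real \<times> (real \<Rightarrow> real)) set" where
  "M2_space d = UNIV \<times> L2_space {-d..<0}"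

definition M2_norm :: "real \<Rightarrow> real \<times> (real \<Rightarrow> real) \<Rightarrow> real" where
  "M2_norm d x = sqrt ((fst x)\<^sup>2 + (L2_norm {-d..<0} (snd x))\<^sup>2)"

definition M2_dist :: "real \<Rightarrow> real \<times> (real \<Rightarrow> real) \<Rightarrow> real \<times> (real \<Rightarrow> real) \<Rightarrow> real" where
  "M2_dist d x x' = M2_norm d (fst x - fst x', \<lambda>s. snd x s - snd x' s)"

section \<open>The spaces of continuous processes with integrable supremum\<close>

definition sup_norm :: "real \<Rightarrow> (real \<Rightarrow> real) \<Rightarrow> real" where
  "sup_norm T f = (SUP t\<in>{0..T}. \<bar>f t\<bar>)"

definition LpC_space :: "'a measure \<Rightarrow> real \<Rightarrow> real \<Rightarrow> (real \<Rightarrow> 'a \<Rightarrow> real) set" where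
  "LpC_space M p T = {y. (\<forall>t\<in>{0..T}. y t \<in> borel_measurable M) \<and> continuous_paths_on M T y \<and>
     integrable M (\<lambda>\<omega>. sup_norm T (\<lambda>t. y t \<omega>) powr p)}"

definition LpC_norm :: "'a measure \<Rightarrow> real \<Rightarrow> real \<Rightarrow> (real \<Rightarrow> 'a \<Rightarrow> real) \<Rightarrow> real" where
  "LpC_norm M p T y = (\<integral>\<omega>. sup_norm T (\<lambda>t. y t \<omega>) powr p \<partial>M) powr (1 / p)"

section \<open>Signed measures on the delay interval\<close>

(* A signed Radon measure on the compact interval [-d,0] is a finite, countably additive real
   function of its Borel subsets; values at other sets are irrelevant. *)
definition borel_sets :: "real \<Rightarrow> real set set" where
  "borel_sets d = sets (restrict_space borel {-d..0})"

definition signed_measure :: "real \<Rightarrow> (real set \<Rightarrow> real) \<Rightarrow> bool" where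
  "signed_measure d \<phi> \<longleftrightarrow>
     (\<forall>A :: nat \<Rightarrow> real set. range A \<subseteq> borel_sets d \<and> disjoint_family A \<longrightarrow>
        (\<lambda>i. \<phi> (A i)) sums \<phi> (\<Union>i. A i))"

definition M0 :: "real \<Rightarrow> (real set \<Rightarrow> real) set" where
  "M0 d = {\<phi>. signed_measure d \<phi> \<and> \<phi> {0} = 0}"

(* Positive variation; ennreal truncates negative values to 0. *)
definition pos_part :: "real \<Rightarrow> (real set \<Rightarrow> real) \<Rightarrow> real measure" where
  "pos_part d \<phi> = measure_of {-d..0} (borel_sets d)
     (\<lambda>A. SUP B\<in>{B \<in> borel_sets d. B \<subseteq> A}. ennreal (\<phi> B))"

definition neg_part :: "real \<Rightarrow> (real set \<Rightarrow> real) \<Rightarrow> real measure" where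
  "neg_part d \<phi> = pos_part d (\<lambda>A. - \<phi> A)"

definition signed_integral :: "real \<Rightarrow> (real set \<Rightarrow> real) \<Rightarrow> (real \<Rightarrow> real) \<Rightarrow> real" where
  "signed_integral d \<phi> g = (\<integral>s. g s \<partial>pos_part d \<phi>) - (\<integral>s. g s \<partial>neg_part d \<phi>)"

definition total_variation :: "real \<Rightarrow> (real set \<Rightarrow> real) \<Rightarrow> real" where
  "total_variation d \<phi> = measure (pos_part d \<phi>) {-d..0} + measure (neg_part d \<phi>) {-d..0}"

definition measure_le :: "real \<Rightarrow> (real set \<Rightarrow> real) \<Rightarrow> (real set \<Rightarrow> real) \<Rightarrow> bool" where
  "measure_le d \<phi> \<psi> \<longleftrightarrow>
     (\<forall>g. continuous_on {-d..0} g \<and> (\<forall>s\<in>{-d..0}. 0 \<le> g s) \<longrightarrow>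
        signed_integral d \<phi> g \<le> signed_integral d \<psi> g)"

definition has_order_minimum :: "real \<Rightarrow> (real set \<Rightarrow> real) set \<Rightarrow> bool" where
  "has_order_minimum d K \<longleftrightarrow> (\<exists>\<nu>\<in>K. \<forall>\<phi>\<in>K. measure_le d \<nu> \<phi>)"

section \<open>Admissible kernels and the delay operator\<close>

definition admissible_kernel ::
  "'a measure \<Rightarrow> (real \<Rightarrow> 'a measure) \<Rightarrow> real \<Rightarrow> (real set \<Rightarrow> real) set \<Rightarrow>
   (real \<Rightarrow> 'a \<Rightarrow> real set \<Rightarrow> real) \<Rightarrow> bool"
where
  "admissible_kernel M F d K \<phi> \<longleftrightarrow>
     (\<forall>t\<ge>0. \<forall>\<omega>\<in>space M. \<phi> t \<omega> \<in> K) \<and>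
     (\<forall>A\<in>sets borel. A \<subseteq> {-d..<0} \<longrightarrow> (\<forall>T\<ge>0. progressive_on F T (\<lambda>t \<omega>. \<phi> t \<omega> A))) \<and>
     (\<forall>T>0. \<exists>c\<ge>0. AE \<omega> in M. \<forall>t\<in>{0..T}. total_variation d (\<phi> t \<omega>) \<le> c)"

(* The argument k is the path t \<mapsto> \<phi>(t,\<omega>) of the kernel. *)
definition delay_op :: "real \<Rightarrow> (real \<Rightarrow> real set \<Rightarrow> real) \<Rightarrow> (real \<Rightarrow> real) \<Rightarrow> real \<Rightarrow> real" where
  "delay_op d k z t = signed_integral d (k t) (\<lambda>s. z (t + s))"

definition is_delay_extension ::
  "real \<Rightarrow> real \<Rightarrow> (real \<Rightarrow> real set \<Rightarrow> real) \<Rightarrow> ((real \<Rightarrow> real) \<Rightarrow> real \<Rightarrow> real) \<Rightarrow> bool"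
where
  "is_delay_extension d T k L \<longleftrightarrow>
     (\<forall>z\<in>L2_space {-d..T}. L z \<in> L2_space {0..T}) \<and>
     (\<forall>z\<in>L2_space {-d..T}. \<forall>w\<in>L2_space {-d..T}. \<forall>a b. AE t in lborel. t \<in> {0..T} \<longrightarrow>
        L (\<lambda>s. a * z s + b * w s) t = a * L z t + b * L w t) \<and>
     (\<exists>C. \<forall>z\<in>L2_space {-d..T}. L2_norm {0..T} (L z) \<le> C * L2_norm {-d..T} z) \<and>
     (\<forall>z. continuous_on {-d..T} z \<longrightarrow>
        (AE t in lborel. t \<in> {0..T} \<longrightarrow> L z t = delay_op d k z t))"

(* By density the extension is unique up to null sets, so the choice is harmless. *)
definition delay_ext ::
  "real \<Rightarrow> real \<Rightarrow> (real \<Rightarrow> real set \<Rightarrow> real) \<Rightarrow> (real \<Rightarrow> real) \<Rightarrow> real \<Rightarrow> real"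
where
  "delay_ext d T k = (SOME L. is_delay_extension d T k L)"

(* The L^2 bound on continuous paths through which the extension, hence the equation, is defined.
   It does not follow from the bound on total variations when the kernel is
   time dependent: a unit mass at -d/2 - t, 0 \<le> t < d/2, turns z into the constant z(-d/2)
   on [0,d/2). *)
definition delay_L2_bounded ::
  "'a measure \<Rightarrow> real \<Rightarrow> real \<Rightarrow> (real \<Rightarrow> 'a \<Rightarrow> real set \<Rightarrow> real) \<Rightarrow> bool"
where
  "delay_L2_bounded M d T \<phi> \<longleftrightarrow>
     (\<exists>c\<ge>0. AE \<omega> in M. \<forall>z. continuous_on {-d..T} z \<longrightarrow>
        L2_norm {0..T} (delay_op d (\<lambda>t. \<phi> t \<omega>) z) \<le> c * L2_norm {-d..T} z)"

section \<open>Strong solutions\<close>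

definition extend_past :: "(real \<Rightarrow> real) \<Rightarrow> (real \<Rightarrow> real) \<Rightarrow> real \<Rightarrow> real" where
  "extend_past x1 y s = (if s < 0 then x1 s else y s)"

definition strong_solution ::
  "'a measure \<Rightarrow> (real \<Rightarrow> 'a \<Rightarrow> real^'n) \<Rightarrow> real \<Rightarrow> real \<Rightarrow> real \<Rightarrow> real^'n \<Rightarrow>
   (real \<Rightarrow> 'a \<Rightarrow> real set \<Rightarrow> real) \<Rightarrow> real \<times> (real \<Rightarrow> real) \<Rightarrow> (real \<Rightarrow> 'a \<Rightarrow> real) \<Rightarrow> bool"
where
  "strong_solution M Z d T \<mu>y \<sigma>y \<phi> x y \<longleftrightarrow>
     adapted_on (augmented_filtration M Z) T y \<and> continuous_paths_on M T y \<and>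
     (\<exists>I. ito_integral M (augmented_filtration M Z) Z T (\<lambda>t \<omega>. y t \<omega> *\<^sub>R \<sigma>y) I \<and>
        (AE \<omega> in M. \<forall>t\<in>{0..T}.
           y t \<omega> = fst x + \<mu>y * (LINT u:{0..t}|lborel. y u \<omega>)
             + (LINT u:{0..t}|lborel.
                  delay_ext d T (\<lambda>s. \<phi> s \<omega>) (extend_past (snd x) (\<lambda>s. y s \<omega>)) u)
             + I t \<omega>))"

end

theory Submission
  imports Defs
begin

text \<open>Put \<open>E t = exp (B t - |\<sigma>|^2 * t / 2)\<close> with \<open>B = \<sigma> \<bullet> Z\<close>. Writing \<open>y = E * u\<close> removes the stochastic integral:
  \<open>u\<close> solves a linear integral equation path by path, which Picard iteration settles. The datum in \<open>L^2\<close> enters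
  only through the delay operator applied to its extension by the constant \<open>x_0\<close>; the remainder \<open>y - x_0\<close>
  vanishes at \<open>0\<close> and is prolonged continuously by \<open>0\<close>.
  That \<open>y\<close> solves the original equation is Ito's formula in Foellmer's pathwise form: the quadratic
  variation of \<open>B\<close> along dyadic partitions converges almost surely, and then so do, uniformly in time, the
  dyadic sums of \<open>y\<close> against \<open>B\<close>.

  Uniqueness follows from the isometry and Gronwall's inequality; as the integral is given by unspecified
  approximating simple processes, a Lenglart inequality is needed to compare it with the dyadic ones.

  For moments, cut \<open>[0,T]\<close> into \<open>2^k\<close> cells. If \<open>B\<close> oscillates by at most \<open>8 \<rho>\<close> on each cell, the solution grows
  at most by the factor \<open>5 * exp (8 \<rho>)\<close> per cell, and chaining bounds the probability that this fails
  by \<open>4 * 2^k * exp (- q * 2^k)\<close>, where \<open>q\<close> is quadratic in \<open>\<rho>\<close>. For large \<open>\<rho>\<close> this beats every power of the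
  growth factor. The same estimate for differences of solutions gives continuity in the datum.\<close>

section \<open>Signed measures\<close>

text \<open>Two bounds on the kernel do different work. The variation bound \<open>c\<close>
  controls the delay term by a running supremum and drives all pathwise estimates. The L^2 bound
  \<open>cL\<close> yields the extension to square integrable data and, because it controls the
  drift by a time integral of the square, lets uniqueness close with second moments at fixed times.
  The obstacle to measurability is \<open>delay_ext\<close>, an arbitrary choice made separately for
  each sample point, about whose joint measurability nothing is known. Only its time integrals
  against continuous weights are shown to be adapted, by approximating the deterministic datum in
  L^2 by continuous functions, on which the operator is an explicit integral. The Picard iterates
  contain the extension only through such integrals, and the solution is their limit. The growth
  estimate has a random factor that depends neither on the initial value nor on the forcing; by
  linearity, one moment bound for this factor gives integrability of each solution as well as
  Lipschitz dependence on the datum.\<close>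

lemma borel_sets_iff: "A \<in> borel_sets d \<longleftrightarrow> A \<in> sets borel \<and> A \<subseteq> {-d..0}"
  unfolding borel_sets_def by (subst sets_restrict_space_iff) auto

lemma sigma_algebra_borel_sets: "sigma_algebra {-d..0} (borel_sets d)"
  using sets.sigma_algebra_axioms[of "restrict_space borel {-d..0::real}"]
  by (simp add: borel_sets_def space_restrict_space)

text \<open>The set function inside \<open>pos_part\<close>, given a name because
  \<open>measure_of\<close> falls back to the zero measure unless its argument is countably
  additive; that has to be proved about the bare function first.\<close>

definition pos_var :: "real => (real set => real) => real set => ennreal" where
  "pos_var d \<phi> A = (SUP B\<in>{B \<in> borel_sets d. B \<subseteq> A}. ennreal (\<phi> B))"

lemma pos_part_alt: "pos_part d \<phi> = measure_of {-d..0} (borel_sets d) (pos_var d \<phi>)"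
  by (simp add: pos_part_def pos_var_def[abs_def])

lemma borel_sets_subset_Pow: "borel_sets d \<subseteq> Pow {-d..0}"
  using borel_sets_iff by blast

lemma space_pos_part [simp]: "space (pos_part d \<phi>) = {-d..0}"
  unfolding pos_part_alt by (rule space_measure_of[OF borel_sets_subset_Pow])

lemma sets_pos_part: "sets (pos_part d \<phi>) = borel_sets d"
  unfolding pos_part_alt
  by (rule sigma_algebra.sets_measure_of_eq[OF sigma_algebra_borel_sets])

lemma space_neg_part [simp]: "space (neg_part d \<phi>) = {-d..0}"
  and sets_neg_part: "sets (neg_part d \<phi>) = borel_sets d"
  by (simp_all add: neg_part_def sets_pos_part)

locale signed_measure_locale =
  fixes d :: real and \<phi> :: "real set => real"
  assumes signed: "signed_measure d \<phi>"
begin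

lemma sums_disjoint:
  "(\<And>i::nat. A i \<in> borel_sets d) ==> disjoint_family A ==> (\<lambda>i. \<phi> (A i)) sums \<phi> (\<Union>i. A i)"
  using signed unfolding signed_measure_def by (auto simp: image_subset_iff)

lemma empty [simp]: "\<phi> {} = 0"
proof -
  have "(\<lambda>i::nat. \<phi> {}) sums \<phi> (\<Union>i::nat. {})"
    by (rule sums_disjoint) (auto simp: borel_sets_iff disjoint_family_on_def)
  then have "(\<lambda>i::nat. \<phi> {}) \<longlonglongrightarrow> 0" using sums_summable summable_LIMSEQ_zero by blast
  then show ?thesis by (simp add: LIMSEQ_const_iff)
qed

lemma Un: assumes "A \<in> borel_sets d" "B \<in> borel_sets d" "A \<inter> B = {}"
  shows "\<phi> (A \<union> B) = \<phi> A + \<phi> B"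
proof -
  have "(\<lambda>i. \<phi> (binaryset A B i)) sums \<phi> (\<Union>i. binaryset A B i)"
    using assms by (intro sums_disjoint)
      (auto simp: binaryset_def disjoint_family_on_def borel_sets_iff)
  moreover have "(\<lambda>i. \<phi> (binaryset A B i)) sums (\<phi> A + \<phi> B)"
    by (rule binaryset_sums) simp
  ultimately show ?thesis by (simp add: UN_binaryset_eq sums_unique2)
qed

lemma Diff: assumes "A \<in> borel_sets d" "B \<in> borel_sets d" "B \<subseteq> A"
  shows "\<phi> (A - B) = \<phi> A - \<phi> B"
proof -
  have "\<phi> ((A - B) \<union> B) = \<phi> (A - B) + \<phi> B"
    using assms by (intro Un) (auto simp: borel_sets_iff)
  moreover have "(A - B) \<union> B = A" using assms by auto
  ultimately show ?thesis by simp
qed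

lemma signed_measure_locale_uminus: "signed_measure_locale d (\<lambda>A. - \<phi> A)"
  using signed unfolding signed_measure_locale_def signed_measure_def
  by (auto intro: sums_minus)

text \<open>Competitors for two disjoint sets can be united, and the two suprema may then be taken
  one after the other.\<close>

lemma pos_var_superadditive:
  assumes "A \<in> borel_sets d" "B \<in> borel_sets d" "A \<inter> B = {}"
  shows "pos_var d \<phi> A + pos_var d \<phi> B \<le> pos_var d \<phi> (A \<union> B)"
proof -
  have *: "ennreal (\<phi> C) + ennreal (\<phi> D) \<le> pos_var d \<phi> (A \<union> B)"
    if C: "C \<in> borel_sets d" "C \<subseteq> A" and D: "D \<in> borel_sets d" "D \<subseteq> B" for C D
  proof -
    have mem: "ennreal (\<phi> X) \<le> pos_var d \<phi> (A \<union> B)" if "X \<in> borel_sets d" "X \<subseteq> A \<union> B" for X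
      unfolding pos_var_def using that by (intro SUP_upper) auto
    \<comment> \<open>\<open>ennreal\<close> sends negative numbers to 0, so it is additive only if
      both values are nonnegative. If one is negative, its summand disappears and the other set is a
      competitor by itself.\<close>
    consider "\<phi> C < 0" | "\<phi> D < 0" | "\<phi> C \<ge> 0" "\<phi> D \<ge> 0" by linarith
    then show ?thesis
    proof cases
      case 1 then show ?thesis using mem[of D] D by (simp add: ennreal_neg le_supI2)
    next
      case 2 then show ?thesis using mem[of C] C by (simp add: ennreal_neg le_supI1)
    next
      case 3
      have "\<phi> (C \<union> D) = \<phi> C + \<phi> D" using C D assms by (intro Un) auto
      moreover have "C \<union> D \<in> borel_sets d" using C D by (auto simp: borel_sets_iff)
      ultimately show ?thesis using mem[of "C \<union> D"] C D 3 by (auto simp: ennreal_plus[symmetric] simp del: ennreal_plus)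
    qed
  qed
  have e: "{} \<in> {C \<in> borel_sets d. C \<subseteq> X}" for X by (auto simp: borel_sets_iff)
  have "pos_var d \<phi> A + pos_var d \<phi> B = (SUP C\<in>{C \<in> borel_sets d. C \<subseteq> A}. ennreal (\<phi> C) + pos_var d \<phi> B)"
    unfolding pos_var_def[of d \<phi> A] using e by (subst ennreal_SUP_add_left) auto
  also have "... \<le> pos_var d \<phi> (A \<union> B)"
  proof (rule SUP_least)
    fix C assume C: "C \<in> {C \<in> borel_sets d. C \<subseteq> A}"
    have "ennreal (\<phi> C) + pos_var d \<phi> B = (SUP D\<in>{D \<in> borel_sets d. D \<subseteq> B}. ennreal (\<phi> C) + ennreal (\<phi> D))"
      unfolding pos_var_def[of d \<phi> B] using e by (subst ennreal_SUP_add_right) auto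
    also have "... \<le> pos_var d \<phi> (A \<union> B)" using * C by (intro SUP_least) auto
    finally show "ennreal (\<phi> C) + pos_var d \<phi> B \<le> pos_var d \<phi> (A \<union> B)" .
  qed
  finally show ?thesis .
qed

lemma pos_var_mono: "A \<subseteq> B ==> pos_var d \<phi> A \<le> pos_var d \<phi> B"
  unfolding pos_var_def by (rule SUP_subset_mono) auto

lemma pos_var_empty: "pos_var d \<phi> {} = 0"
proof -
  have "{B \<in> borel_sets d. B \<subseteq> {}} = {{}}" by (auto simp: borel_sets_iff)
  then show ?thesis by (simp add: pos_var_def)
qed

text \<open>One inequality is finite superadditivity together with monotonicity. For the other, a
  competitor \<open>B\<close> is cut into the pieces \<open>B \<inter> A i\<close>, whose values sum
  to that of \<open>B\<close>; dropping the negative pieces only increases the partial sums.\<close>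

lemma pos_var_countably_additive: "countably_additive (borel_sets d) (pos_var d \<phi>)"
proof (rule countably_additiveI)
  fix A :: "nat => real set"
  assume A: "range A \<subseteq> borel_sets d" and dis: "disjoint_family A" and "(\<Union>i. A i) \<in> borel_sets d"
  have A': "A i \<in> borel_sets d" for i using A by auto
  show "(\<Sum>i. pos_var d \<phi> (A i)) = pos_var d \<phi> (\<Union>i. A i)"
  proof (rule antisym)
    have UN: "(\<Union>i<n. A i) \<in> borel_sets d" for n using A' by (auto simp: borel_sets_iff)
    have fin: "(\<Sum>i<n. pos_var d \<phi> (A i)) \<le> pos_var d \<phi> (\<Union>i<n. A i)" for n
    proof (induction n)
      case 0 then show ?case by simp
    next
      case (Suc n)
      have "(\<Union>i<n. A i) \<inter> A n = {}" using disjoint_family_onD[OF dis, of _ n] by fastforce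
      then have "pos_var d \<phi> (\<Union>i<n. A i) + pos_var d \<phi> (A n) \<le> pos_var d \<phi> ((\<Union>i<n. A i) \<union> A n)"
        using UN A' by (intro pos_var_superadditive) auto
      moreover have "(\<Union>i<n. A i) \<union> A n = (\<Union>i<Suc n. A i)" by (auto simp: less_Suc_eq)
      ultimately have "pos_var d \<phi> (\<Union>i<n. A i) + pos_var d \<phi> (A n) \<le> pos_var d \<phi> (\<Union>i<Suc n. A i)"
        by simp
      with add_right_mono[OF Suc, of "pos_var d \<phi> (A n)"] show ?case
        unfolding sum.lessThan_Suc by (rule order_trans)
    qed
    show "(\<Sum>i. pos_var d \<phi> (A i)) \<le> pos_var d \<phi> (\<Union>i. A i)"
      unfolding suminf_eq_SUP
      by (intro SUP_least order_trans[OF fin] pos_var_mono) auto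
    show "pos_var d \<phi> (\<Union>i. A i) \<le> (\<Sum>i. pos_var d \<phi> (A i))"
      unfolding pos_var_def[of d \<phi> "\<Union>i. A i"]
    proof (rule SUP_least)
      fix B assume B: "B \<in> {B \<in> borel_sets d. B \<subseteq> (\<Union>i. A i)}"
      have "(\<lambda>i. \<phi> (B \<inter> A i)) sums \<phi> (\<Union>i. B \<inter> A i)"
        using B A' by (intro sums_disjoint disjoint_family_on_bisimulation[OF dis])
          (auto simp: borel_sets_iff)
      moreover have "(\<Union>i. B \<inter> A i) = B" using B by auto
      ultimately have "(\<lambda>n. \<Sum>i<n. \<phi> (B \<inter> A i)) \<longlonglongrightarrow> \<phi> B" by (simp add: sums_def)
      then have lim: "(\<lambda>n. ennreal (\<Sum>i<n. \<phi> (B \<inter> A i))) \<longlonglongrightarrow> ennreal (\<phi> B)" by (rule tendsto_ennrealI)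
      have "ennreal (\<Sum>i<n. \<phi> (B \<inter> A i)) \<le> (\<Sum>i. pos_var d \<phi> (A i))" for n
      proof -
        have "ennreal (\<Sum>i<n. \<phi> (B \<inter> A i)) \<le> ennreal (\<Sum>i<n. max 0 (\<phi> (B \<inter> A i)))"
          by (intro ennreal_leI sum_mono) auto
        also have "... = (\<Sum>i<n. ennreal (max 0 (\<phi> (B \<inter> A i))))" by (subst sum_ennreal) auto
        also have "... = (\<Sum>i<n. ennreal (\<phi> (B \<inter> A i)))" by (simp add: ennreal_max_0)
        also have "... \<le> (\<Sum>i<n. pos_var d \<phi> (A i))"
          unfolding pos_var_def using B A' by (intro sum_mono SUP_upper) (auto simp: borel_sets_iff)
        also have "... \<le> (\<Sum>i. pos_var d \<phi> (A i))" by (rule sum_le_suminf) auto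
        finally show ?thesis .
      qed
      then show "ennreal (\<phi> B) \<le> (\<Sum>i. pos_var d \<phi> (A i))" by (intro LIMSEQ_le_const2[OF lim]) auto
    qed
  qed
qed

lemma emeasure_pos_part: "A \<in> borel_sets d ==> emeasure (pos_part d \<phi>) A = pos_var d \<phi> A"
  unfolding pos_part_alt
  by (rule emeasure_measure_of_sigma[OF sigma_algebra_borel_sets _ pos_var_countably_additive])
     (auto simp: positive_def pos_var_empty)

text \<open>If the variation were infinite, splitting off a set of value at least \<open>1\<close> in absolute value
  could be repeated forever, producing a divergent series.\<close>

lemma bounded_values: "\<exists>c. \<forall>B\<in>borel_sets d. \<bar>\<phi> B\<bar> \<le> c"
proof (rule ccontr)
  define unb where "unb A \<longleftrightarrow> A \<in> borel_sets d \<and> (\<forall>c. \<exists>B\<in>borel_sets d. B \<subseteq> A \<and> \<bar>\<phi> B\<bar> > c)" for A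
  assume "\<not> ?thesis"
  then have unb0: "unb {-d..0}" unfolding unb_def by (auto simp: borel_sets_iff not_le)
  have step: "\<exists>A'. unb A' \<and> (A' \<subseteq> A \<and> \<bar>\<phi> (A - A')\<bar> \<ge> 1)" if u: "unb A" for A
  proof -
    \<comment> \<open>The margin \<open>\<bar>\<phi> A\<bar> + 1\<close> makes the value on
      \<open>A - B\<close> at least 1 in absolute value as well. So whichever half remains
      unbounded, the half that is split off has a large value.\<close>
    obtain B where B: "B \<in> borel_sets d" "B \<subseteq> A" "\<bar>\<phi> B\<bar> > \<bar>\<phi> A\<bar> + 1"
      using u unfolding unb_def by blast
    have Ab: "A \<in> borel_sets d" using that by (simp add: unb_def)
    have AB: "A - B \<in> borel_sets d" using Ab B by (auto simp: borel_sets_iff)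
    have 1: "\<bar>\<phi> (A - B)\<bar> \<ge> 1" using Diff[OF Ab B(1,2)] B(3) by linarith
    have "unb B \<or> unb (A - B)"
    proof (rule ccontr)
      assume "\<not> ?thesis"
      then have "\<not> unb B" "\<not> unb (A - B)" by blast+
      obtain c1 where c1: "\<And>C. C \<in> borel_sets d ==> C \<subseteq> B ==> \<bar>\<phi> C\<bar> \<le> c1"
        using \<open>\<not> unb B\<close> B(1) unfolding unb_def by (meson not_less)
      obtain c2 where c2: "\<And>C. C \<in> borel_sets d ==> C \<subseteq> A - B ==> \<bar>\<phi> C\<bar> \<le> c2"
        using \<open>\<not> unb (A - B)\<close> AB unfolding unb_def by (meson not_less)
      obtain C where C: "C \<in> borel_sets d" "C \<subseteq> A" "\<bar>\<phi> C\<bar> > c1 + c2"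
        using \<open>unb A\<close> unfolding unb_def by blast
      have "\<phi> ((C \<inter> B) \<union> (C - B)) = \<phi> (C \<inter> B) + \<phi> (C - B)"
        using C B by (intro Un) (auto simp: borel_sets_iff)
      moreover have "(C \<inter> B) \<union> (C - B) = C" by auto
      moreover have "\<bar>\<phi> (C \<inter> B)\<bar> \<le> c1" "\<bar>\<phi> (C - B)\<bar> \<le> c2"
        using C B by (auto intro!: c1 c2 simp: borel_sets_iff)
      ultimately show False using C(3) by simp
    qed
    then show ?thesis
    proof
      assume "unb B" then show ?thesis using 1 B by auto
    next
      assume "unb (A - B)"
      moreover have "A - (A - B) = B" using B by auto
      ultimately show ?thesis using B(3) by (intro exI[of _ "A - B"]) auto
    qed
  qed
  have "\<exists>A. \<forall>n::nat. unb (A n) \<and> (A (Suc n) \<subseteq> A n \<and> \<bar>\<phi> (A n - A (Suc n))\<bar> \<ge> 1)"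
    by (rule dependent_nat_choice) (use unb0 step in blast)+
  then obtain A where A: "\<And>n::nat. unb (A n)" "\<And>n. A (Suc n) \<subseteq> A n \<and> \<bar>\<phi> (A n - A (Suc n))\<bar> \<ge> 1"
    by metis
  have dec: "A n \<subseteq> A m" if "m \<le> n" for m n using that A(2) by (rule_tac lift_Suc_antimono_le) auto
  have "(\<lambda>n. \<phi> (A n - A (Suc n))) sums \<phi> (\<Union>n. A n - A (Suc n))"
  proof (rule sums_disjoint)
    show "A i - A (Suc i) \<in> borel_sets d" for i using A(1)[of i] A(1)[of "Suc i"]
      by (auto simp: unb_def borel_sets_iff)
    show "disjoint_family (\<lambda>i. A i - A (Suc i))"
      unfolding disjoint_family_on_def
    proof (intro ballI impI)
      fix m n :: nat assume "m \<noteq> n"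
      then consider "Suc m \<le> n" | "Suc n \<le> m" by linarith
      then show "(A m - A (Suc m)) \<inter> (A n - A (Suc n)) = {}"
        by cases (use dec in blast)+
    qed
  qed
  then have "(\<lambda>n. \<phi> (A n - A (Suc n))) \<longlonglongrightarrow> 0" using sums_summable summable_LIMSEQ_zero by blast
  then have "eventually (\<lambda>n. \<bar>\<phi> (A n - A (Suc n))\<bar> < 1) sequentially"
    by (auto simp: tendsto_iff dest!: spec[of _ 1])
  then show False using A(2) by (auto simp: eventually_sequentially not_less[symmetric])
qed

lemma finite_pos_part: "finite_measure (pos_part d \<phi>)"
proof
  obtain c where c: "\<forall>B\<in>borel_sets d. \<bar>\<phi> B\<bar> \<le> c" using bounded_values by blast
  have "pos_var d \<phi> {-d..0} \<le> ennreal c"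
    unfolding pos_var_def using c by (intro SUP_least ennreal_leI) fastforce
  also have "... < \<top>" by simp
  finally have "pos_var d \<phi> {-d..0} \<noteq> \<infinity>" by (metis infinity_ennreal_def less_irrefl)
  moreover have "{-d..0} \<in> borel_sets d" unfolding borel_sets_iff by simp
  ultimately show "emeasure (pos_part d \<phi>) (space (pos_part d \<phi>)) \<noteq> \<infinity>"
    unfolding space_pos_part by (metis emeasure_pos_part)
qed

lemma finite_neg_part: "finite_measure (neg_part d \<phi>)"
  unfolding neg_part_def by (rule signed_measure_locale.finite_pos_part[OF signed_measure_locale_uminus])

text \<open>For \<open>B\<close> inside \<open>A\<close> one has
  \<open>\<phi> B = \<phi> A - \<phi> (A - B)\<close>, and \<open>- \<phi> (A - B)\<close> competes
  for the negative variation of \<open>A\<close>. The opposite inequality is this one applied to the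
  negated measure, so both together give the Jordan decomposition.\<close>

lemma measure_pos_part_le:
  assumes A: "A \<in> borel_sets d"
  shows "measure (pos_part d \<phi>) A \<le> measure (neg_part d \<phi>) A + \<phi> A"
proof -
  interpret P: finite_measure "pos_part d \<phi>" by (rule finite_pos_part)
  interpret N: finite_measure "neg_part d \<phi>" by (rule finite_neg_part)
  interpret U: signed_measure_locale d "\<lambda>A. - \<phi> A" by (rule signed_measure_locale_uminus)
  have *: "\<phi> B \<le> measure (neg_part d \<phi>) A + \<phi> A" if B: "B \<in> borel_sets d" "B \<subseteq> A" for B
  proof -
    have "A - B \<in> borel_sets d" using A B by (auto simp: borel_sets_iff)
    then have "ennreal (- \<phi> (A - B)) \<le> pos_var d (\<lambda>A. - \<phi> A) A"
      unfolding pos_var_def by (intro SUP_upper) blast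
    also have "... = ennreal (measure (neg_part d \<phi>) A)"
      using U.emeasure_pos_part[OF A] N.emeasure_eq_measure[of A] by (metis neg_part_def)
    finally have "- \<phi> (A - B) \<le> measure (neg_part d \<phi>) A"
      by (rule ennreal_le_iff[OF measure_nonneg, THEN iffD1])
    then show ?thesis using Diff[OF A B] by simp
  qed
  have nn: "0 \<le> measure (neg_part d \<phi>) A + \<phi> A" using *[of "{}"] A by (auto simp: borel_sets_iff)
  have "pos_var d \<phi> A \<le> ennreal (measure (neg_part d \<phi>) A + \<phi> A)"
    unfolding pos_var_def using * by (intro SUP_least ennreal_leI) auto
  then have "ennreal (measure (pos_part d \<phi>) A) \<le> ennreal (measure (neg_part d \<phi>) A + \<phi> A)"
    unfolding P.emeasure_eq_measure[symmetric] emeasure_pos_part[OF A] .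
  then show ?thesis unfolding ennreal_le_iff[OF nn] .
qed

lemma Jordan_decomposition:
  assumes A: "A \<in> borel_sets d"
  shows "\<phi> A = measure (pos_part d \<phi>) A - measure (neg_part d \<phi>) A"
proof -
  have "measure (neg_part d \<phi>) A \<le> measure (pos_part d \<phi>) A + - \<phi> A"
    using signed_measure_locale.measure_pos_part_le[OF signed_measure_locale_uminus A]
    by (simp add: neg_part_def)
  with measure_pos_part_le[OF A] show ?thesis by simp
qed

lemma total_variation_nonneg: "0 \<le> total_variation d \<phi>"
  by (simp add: total_variation_def)

abbreviation bmeas :: "(real => real) => bool" where "bmeas g \<equiv> g \<in> borel_measurable (restrict_space borel {-d..0})"

lemma bmeas_pos: "bmeas g ==> g \<in> borel_measurable (pos_part d \<phi>)"
  by (subst measurable_cong_sets[OF _ refl]) (auto simp: sets_pos_part borel_sets_def)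

lemma bmeas_neg: "bmeas g ==> g \<in> borel_measurable (neg_part d \<phi>)"
  by (subst measurable_cong_sets[OF _ refl]) (auto simp: sets_neg_part borel_sets_def)

lemma integrable_parts:
  assumes "bmeas g" "\<And>s. s \<in> {-d..0} ==> \<bar>g s\<bar> \<le> S"
  shows "integrable (pos_part d \<phi>) g" "integrable (neg_part d \<phi>) g"
proof -
  interpret P: finite_measure "pos_part d \<phi>" by (rule finite_pos_part)
  interpret N: finite_measure "neg_part d \<phi>" by (rule finite_neg_part)
  show "integrable (pos_part d \<phi>) g"
    by (rule P.integrable_const_bound[of _ S]) (auto intro!: assms bmeas_pos AE_I2)
  show "integrable (neg_part d \<phi>) g"
    by (rule N.integrable_const_bound[of _ S]) (auto intro!: assms bmeas_neg AE_I2)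
qed

lemma signed_integral_bound:
  assumes "bmeas g" "\<And>s. s \<in> {-d..0} ==> \<bar>g s\<bar> \<le> S"
  shows "\<bar>signed_integral d \<phi> g\<bar> \<le> total_variation d \<phi> * S"
proof -
  interpret P: finite_measure "pos_part d \<phi>" by (rule finite_pos_part)
  interpret N: finite_measure "neg_part d \<phi>" by (rule finite_neg_part)
  note int = integrable_parts[OF assms]
  have "\<bar>\<integral>s. g s \<partial>pos_part d \<phi>\<bar> \<le> (\<integral>s. \<bar>g s\<bar> \<partial>pos_part d \<phi>)" by (rule integral_abs_bound)
  also have "... \<le> (\<integral>s. S \<partial>pos_part d \<phi>)"
    using int(1) assms by (intro integral_mono_AE) auto
  finally have 1: "\<bar>\<integral>s. g s \<partial>pos_part d \<phi>\<bar> \<le> S * measure (pos_part d \<phi>) {-d..0}" by (simp add: mult.commute)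
  have "\<bar>\<integral>s. g s \<partial>neg_part d \<phi>\<bar> \<le> (\<integral>s. \<bar>g s\<bar> \<partial>neg_part d \<phi>)" by (rule integral_abs_bound)
  also have "... \<le> (\<integral>s. S \<partial>neg_part d \<phi>)"
    using int(2) assms by (intro integral_mono_AE) auto
  finally have 2: "\<bar>\<integral>s. g s \<partial>neg_part d \<phi>\<bar> \<le> S * measure (neg_part d \<phi>) {-d..0}" by (simp add: mult.commute)
  show ?thesis using 1 2 unfolding signed_integral_def total_variation_def
    by (simp add: algebra_simps)
qed

lemma signed_integral_cong:
  "(\<And>s. s \<in> {-d..0} ==> f s = g s) ==> signed_integral d \<phi> f = signed_integral d \<phi> g"
  unfolding signed_integral_def
  by (intro arg_cong2[where f="(-)"] Bochner_Integration.integral_cong) auto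

lemma signed_integral_lincomb:
  assumes "bmeas f" "\<And>s. s \<in> {-d..0} ==> \<bar>f s\<bar> \<le> S"
    and "bmeas g" "\<And>s. s \<in> {-d..0} ==> \<bar>g s\<bar> \<le> S'"
  shows "signed_integral d \<phi> (\<lambda>s. a * f s + b * g s) = a * signed_integral d \<phi> f + b * signed_integral d \<phi> g"
  using integrable_parts[OF assms(1,2)] integrable_parts[OF assms(3,4)]
  unfolding signed_integral_def by (simp add: algebra_simps)

text \<open>For step functions the integral involves the measure through finitely many of its values
  only. This is how measurability of a kernel set by set becomes measurability of its
  integrals.\<close>

lemma signed_integral_step:
  assumes "\<And>i. i \<in> I ==> A i \<in> borel_sets d" "finite I"
  shows "signed_integral d \<phi> (\<lambda>s. \<Sum>i\<in>I. a i * indicator (A i) s) = (\<Sum>i\<in>I. a i * \<phi> (A i))"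
proof -
  interpret P: finite_measure "pos_part d \<phi>" by (rule finite_pos_part)
  interpret N: finite_measure "neg_part d \<phi>" by (rule finite_neg_part)
  have inter: "A i \<inter> {-d..0} = A i" if "i \<in> I" for i using assms(1)[OF that] by (auto simp only: borel_sets_iff)
  have "(\<integral>s. (\<Sum>i\<in>I. a i * indicator (A i) s) \<partial>pos_part d \<phi>) = (\<Sum>i\<in>I. \<integral>s. a i * indicator (A i) s \<partial>pos_part d \<phi>)"
    using assms(1) by (intro Bochner_Integration.integral_sum integrable_mult_right integrable_real_indicator)
      (simp_all add: sets_pos_part P.emeasure_eq_measure)
  then have 1: "(\<integral>s. (\<Sum>i\<in>I. a i * indicator (A i) s) \<partial>pos_part d \<phi>) = (\<Sum>i\<in>I. a i * measure (pos_part d \<phi>) (A i))"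
    using inter by simp
  have "(\<integral>s. (\<Sum>i\<in>I. a i * indicator (A i) s) \<partial>neg_part d \<phi>) = (\<Sum>i\<in>I. \<integral>s. a i * indicator (A i) s \<partial>neg_part d \<phi>)"
    using assms(1) by (intro Bochner_Integration.integral_sum integrable_mult_right integrable_real_indicator)
      (simp_all add: sets_neg_part N.emeasure_eq_measure)
  then have 2: "(\<integral>s. (\<Sum>i\<in>I. a i * indicator (A i) s) \<partial>neg_part d \<phi>) = (\<Sum>i\<in>I. a i * measure (neg_part d \<phi>) (A i))"
    using inter by simp
  show ?thesis
    unfolding signed_integral_def 1 2 sum_subtractf[symmetric] right_diff_distrib[symmetric]
    using assms by (intro sum.cong) (simp_all add: Jordan_decomposition)
qed

end

section \<open>Square integrable functions\<close>

text \<open>The squared L^2 norm as an extended nonnegative integral. It is meaningful without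
  integrability, so that membership in \<open>L2_space\<close> becomes a finiteness condition and
  limits can be taken in \<open>ennreal\<close>.\<close>

definition N2 :: "real set => (real => real) => ennreal" where
  "N2 S f = (\<integral>\<^sup>+x. ennreal ((indicator S x * f x)\<^sup>2) \<partial>lborel)"

abbreviation sbm :: "real set => (real => real) => bool" where
  "sbm S f \<equiv> set_borel_measurable lborel S f"

lemma sbm_iff: "sbm S f \<longleftrightarrow> (\<lambda>x. indicator S x * f x) \<in> borel_measurable borel"
  by (simp add: set_borel_measurable_def)

lemma sbm_lincomb: "sbm S f ==> sbm S g ==> sbm S (\<lambda>x. a * f x + b * g x)"
proof -
  assume "sbm S f" "sbm S g"
  then have "(\<lambda>x. a * (indicator S x * f x) + b * (indicator S x * g x)) \<in> borel_measurable borel"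
    unfolding sbm_iff by measurable
  then show ?thesis unfolding sbm_iff by (simp add: algebra_simps)
qed

lemma sbm_diff: "sbm S f ==> sbm S g ==> sbm S (\<lambda>x. f x - g x)"
  using sbm_lincomb[of S f g 1 "-1"] by simp

lemma sbm_restrict_iff: "S \<in> sets borel ==> sbm S f \<longleftrightarrow> f \<in> borel_measurable (restrict_space borel S)"
  by (subst borel_measurable_restrict_space_iff) (simp_all add: set_borel_measurable_def)

lemma sbm_continuous: "S \<in> sets borel ==> continuous_on S f ==> sbm S f"
  by (simp add: sbm_restrict_iff borel_measurable_continuous_on_restrict)

lemma L2_space_iff: "f \<in> L2_space S \<longleftrightarrow> sbm S f \<and> N2 S f < \<infinity>"
proof -
  have "sbm S f ==> (\<lambda>x. (indicator S x * f x)\<^sup>2) \<in> borel_measurable borel"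
    unfolding sbm_iff by (rule borel_measurable_power)
  moreover have "(indicator S x * f x)\<^sup>2 = indicator S x * (f x)\<^sup>2" for x
    by (simp add: indicator_def)
  ultimately show ?thesis
    unfolding L2_space_def set_integrable_def by (auto simp: integrable_iff_bounded N2_def)
qed

lemma L2_norm_sq:
  assumes "f \<in> L2_space S" shows "ennreal ((L2_norm S f)\<^sup>2) = N2 S f"
proof -
  have eq: "indicator S x *\<^sub>R (f x)\<^sup>2 = (indicator S x * f x)\<^sup>2" for x
    by (simp add: indicator_def)
  have "integrable lborel (\<lambda>x. indicator S x *\<^sub>R (f x)\<^sup>2)"
    using assms by (simp add: L2_space_def set_integrable_def)
  then have "integrable lborel (\<lambda>x. (indicator S x * f x)\<^sup>2)" by (simp only: eq)
  then have "N2 S f = ennreal (\<integral>x. (indicator S x * f x)\<^sup>2 \<partial>lborel)"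
    unfolding N2_def by (subst nn_integral_eq_integral) auto
  moreover have "0 \<le> (\<integral>x. (indicator S x * f x)\<^sup>2 \<partial>lborel)" by simp
  ultimately show ?thesis by (simp add: L2_norm_def set_lebesgue_integral_def eq del: real_scaleR_def)
qed

lemma L2_norm_nonneg: "0 \<le> L2_norm S f"
  unfolding L2_norm_def set_lebesgue_integral_def by (simp add: indicator_def)

lemma N2_cong_AE:
  assumes "AE x in lborel. x \<in> S \<longrightarrow> f x = g x" shows "N2 S f = N2 S g"
  unfolding N2_def by (rule nn_integral_cong_AE) (use assms in \<open>eventually_elim, auto simp: indicator_def\<close>)

lemma N2_cong: "(\<And>x. x \<in> S ==> f x = g x) ==> N2 S f = N2 S g"
  by (rule N2_cong_AE) simp

lemma N2_commute: "N2 S (\<lambda>x. f x - g x) = N2 S (\<lambda>x. g x - f x)"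
  unfolding N2_def by (rule nn_integral_cong) (simp add: power2_commute right_diff_distrib)

lemma sq_add_le: "(a + b)\<^sup>2 \<le> 2 * a\<^sup>2 + 2 * (b::real)\<^sup>2"
proof -
  have "0 \<le> (a - b)\<^sup>2" by simp
  then show ?thesis by (simp add: power2_eq_square algebra_simps)
qed

text \<open>Rests on \<open>sq_add_le\<close>, which keeps everything in terms of squared norms; the
  factors 2 and 4 in later estimates come from here.\<close>

lemma N2_lincomb_le:
  assumes "sbm S f" "sbm S g"
  shows "N2 S (\<lambda>x. a * f x + b * g x) \<le> ennreal (2 * a\<^sup>2) * N2 S f + ennreal (2 * b\<^sup>2) * N2 S g"
proof -
  have [measurable]: "(\<lambda>x. indicator S x * f x) \<in> borel_measurable borel"
    "(\<lambda>x. indicator S x * g x) \<in> borel_measurable borel"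
    using assms by (auto simp: sbm_iff)
  have "N2 S (\<lambda>x. a * f x + b * g x) \<le> (\<integral>\<^sup>+x. ennreal (2 * a\<^sup>2) * ennreal ((indicator S x * f x)\<^sup>2) +
     ennreal (2 * b\<^sup>2) * ennreal ((indicator S x * g x)\<^sup>2) \<partial>lborel)"
    unfolding N2_def
  proof (intro nn_integral_mono)
    fix x
    have "(indicator S x * (a * f x + b * g x))\<^sup>2 = (a * (indicator S x * f x) + b * (indicator S x * g x))\<^sup>2"
      by (simp add: algebra_simps)
    also have "... \<le> (2 * a\<^sup>2) * (indicator S x * f x)\<^sup>2 + (2 * b\<^sup>2) * (indicator S x * g x)\<^sup>2"
      by (rule order_trans[OF sq_add_le]) (simp add: power_mult_distrib)
    finally show "ennreal ((indicator S x * (a * f x + b * g x))\<^sup>2) \<le>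
      ennreal (2 * a\<^sup>2) * ennreal ((indicator S x * f x)\<^sup>2) + ennreal (2 * b\<^sup>2) * ennreal ((indicator S x * g x)\<^sup>2)"
      by (simp add: ennreal_mult[symmetric] ennreal_plus[symmetric] del: ennreal_plus)
  qed
  also have "... = ennreal (2 * a\<^sup>2) * N2 S f + ennreal (2 * b\<^sup>2) * N2 S g"
    unfolding N2_def by (subst nn_integral_add) (simp_all add: nn_integral_cmult)
  finally show ?thesis .
qed

lemma N2_add_le:
  assumes "sbm S f" "sbm S g" shows "N2 S (\<lambda>x. f x + g x) \<le> 2 * N2 S f + 2 * N2 S g"
  using N2_lincomb_le[OF assms, of 1 1] by simp

lemma N2_triangle:
  assumes "sbm S f" "sbm S g" "sbm S h"
  shows "N2 S (\<lambda>x. f x - h x) \<le> 2 * N2 S (\<lambda>x. f x - g x) + 2 * N2 S (\<lambda>x. g x - h x)"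
  using N2_add_le[OF sbm_diff[OF assms(1,2)] sbm_diff[OF assms(2,3)]] by simp

lemma N2_eq_0:
  assumes "sbm S f" "N2 S f = 0" shows "AE x in lborel. x \<in> S \<longrightarrow> f x = 0"
proof -
  have [measurable]: "(\<lambda>x. indicator S x * f x) \<in> borel_measurable borel" using assms by (auto simp: sbm_iff)
  have "AE x in lborel. ennreal ((indicator S x * f x)\<^sup>2) = 0"
    using assms(2) unfolding N2_def by (subst (asm) nn_integral_0_iff_AE) auto
  then show ?thesis by eventually_elim (auto simp: indicator_def split: if_splits)
qed

lemma N2_bounded:
  assumes "\<And>x. x \<in> {a..b} ==> \<bar>f x\<bar> \<le> S" "a \<le> b" shows "N2 {a..b} f \<le> ennreal (S\<^sup>2 * (b - a))"
proof -
  have "N2 {a..b} f \<le> (\<integral>\<^sup>+x. ennreal (S\<^sup>2) * indicator {a..b} x \<partial>lborel)"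
    unfolding N2_def using assms(1)
    by (intro nn_integral_mono) (auto simp: indicator_def intro!: ennreal_leI abs_le_square_iff[THEN iffD1], force)
  also have "... = ennreal (S\<^sup>2 * (b - a))"
    using assms(2) by (subst nn_integral_cmult_indicator) (auto simp: ennreal_mult)
  finally show ?thesis .
qed

lemma continuous_on_bounded:
  fixes f :: "real => real"
  assumes "continuous_on {a..b} f" obtains S where "S \<ge> 0" "\<And>x. x \<in> {a..b} ==> \<bar>f x\<bar> \<le> S"
proof -
  have "bounded (f ` {a..b})" using assms compact_continuous_image compact_imp_bounded by blast
  then obtain S where "S > 0" "\<And>x. x \<in> {a..b} ==> \<bar>f x\<bar> \<le> S" unfolding bounded_pos by auto
  then show ?thesis using that[of S] by auto
qed

lemma L2_space_continuous:
  assumes "continuous_on {a..b} f" shows "f \<in> L2_space {a..b}"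
proof (cases "a \<le> b")
  case True
  obtain S where "\<And>x. x \<in> {a..b} ==> \<bar>f x\<bar> \<le> S" using continuous_on_bounded[OF assms] by blast
  from N2_bounded[of a b f S, OF this True] have "N2 {a..b} f < \<infinity>"
    by (metis ennreal_less_top infinity_ennreal_def order_le_less_trans)
  then show ?thesis using sbm_continuous[OF _ assms] by (simp add: L2_space_iff)
next
  case False
  then show ?thesis by (simp add: L2_space_iff N2_def sbm_iff)
qed

lemma L2_space_lincomb:
  assumes "f \<in> L2_space S" "g \<in> L2_space S" shows "(\<lambda>x. a * f x + b * g x) \<in> L2_space S"
proof -
  have "N2 S (\<lambda>x. a * f x + b * g x) \<le> ennreal (2 * a\<^sup>2) * N2 S f + ennreal (2 * b\<^sup>2) * N2 S g"
    using assms by (intro N2_lincomb_le) (auto simp: L2_space_iff)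
  also have "... < \<infinity>" using assms by (simp add: L2_space_iff ennreal_mult_less_top)
  finally show ?thesis using assms by (simp add: L2_space_iff sbm_lincomb)
qed

lemma L2_space_diff:
  assumes "f \<in> L2_space S" "g \<in> L2_space S" shows "(\<lambda>x. f x - g x) \<in> L2_space S"
  using L2_space_lincomb[OF assms, of 1 "-1"] by simp

definition clip :: "real => real => real" where "clip m x = max (- m) (min m x)"

lemma clip_abs_le: "m \<ge> 0 ==> \<bar>clip m x\<bar> \<le> m"
  by (auto simp: clip_def)

lemma clip_eq: "\<bar>x\<bar> \<le> m ==> clip m x = x"
  by (auto simp: clip_def)

lemma clip_diff: "\<bar>clip m x - clip m y\<bar> \<le> \<bar>x - y\<bar>"
  by (auto simp: clip_def max_def min_def)

lemma clip_measurable [measurable]: "clip m \<in> borel_measurable borel"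
  unfolding clip_def[abs_def] by measurable

lemma continuous_on_clip: "continuous_on S f ==> continuous_on S (\<lambda>x. clip m (f x))"
  unfolding clip_def by (intro continuous_intros)

lemma isCont_clip: "isCont (clip m) x"
  using continuous_on_clip[of UNIV "\<lambda>x. x" m] by (auto simp: continuous_on_eq_continuous_at)

lemma numeral_mult_ennreal: "0 \<le> a ==> numeral n * ennreal a = ennreal (numeral n * a)"
  by (simp add: ennreal_mult)

text \<open>Truncation by \<open>clip m\<close> leaves a bounded function. Continuous functions
  converging to it almost everywhere, clipped at the same level, are dominated by a constant on the
  bounded interval, so dominated convergence finishes.\<close>

lemma L2_dense_continuous:
  assumes z: "z \<in> L2_space {a..b}" and e: "(e::real) > 0"
  obtains g where "continuous_on UNIV g" "N2 {a..b} (\<lambda>x. z x - g x) \<le> ennreal e"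
proof -
  define F where "F x = indicator {a..b} x * z x" for x
  have F[measurable]: "F \<in> borel_measurable borel" using z by (simp add: L2_space_iff sbm_iff F_def[abs_def])
  have F2: "(\<integral>\<^sup>+x. ennreal ((F x)\<^sup>2) \<partial>lborel) < \<infinity>" using z by (simp add: L2_space_iff N2_def F_def)
  have ev: "eventually (\<lambda>m::nat. clip m y = y) sequentially" for y
  proof -
    obtain m0 :: nat where "\<bar>y\<bar> \<le> m0" using real_arch_simple by blast
    then have "clip m y = y" if "m \<ge> m0" for m using that by (intro clip_eq) (meson of_nat_mono order_trans)
    then show ?thesis by (auto simp: eventually_sequentially)
  qed
  have lim1: "(\<lambda>m. \<integral>\<^sup>+x. ennreal ((F x - clip (real m) (F x))\<^sup>2) \<partial>lborel) \<longlonglongrightarrow> (\<integral>\<^sup>+x. 0 \<partial>(lborel :: real measure))"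
  proof (rule nn_integral_dominated_convergence[where w="\<lambda>x. ennreal ((F x)\<^sup>2)" and u'="\<lambda>_. 0"])
    have "\<bar>F x - clip (real j) (F x)\<bar> \<le> \<bar>F x\<bar>" for x j by (auto simp: clip_def)
    then show "AE x in lborel. ennreal ((F x - clip (real j) (F x))\<^sup>2) \<le> ennreal ((F x)\<^sup>2)" for j
      by (auto intro!: AE_I2 ennreal_leI simp: abs_le_square_iff)
    show "AE x in lborel. (\<lambda>m. ennreal ((F x - clip (real m) (F x))\<^sup>2)) \<longlonglongrightarrow> 0"
    proof (rule AE_I2)
      fix x show "(\<lambda>m. ennreal ((F x - clip (real m) (F x))\<^sup>2)) \<longlonglongrightarrow> 0"
        by (rule tendsto_eventually) (use ev[of "F x"] in eventually_elim, simp)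
    qed
  qed (use F2 in auto)
  \<comment> \<open>Both errors are held below \<open>e / 4\<close> because
    \<open>N2_triangle\<close> doubles each of them.\<close>
  have "\<exists>m. (\<integral>\<^sup>+x. ennreal ((F x - clip (real m) (F x))\<^sup>2) \<partial>lborel) < ennreal (e / 4)"
  proof -
    have "0 < ennreal (e / 4)" using e by (auto simp: ennreal_zero_less_divide)
    then have "eventually (\<lambda>m. (\<integral>\<^sup>+x. ennreal ((F x - clip (real m) (F x))\<^sup>2) \<partial>lborel) < ennreal (e / 4)) sequentially"
      using lim1 by (auto intro: order_tendstoD)
    then show ?thesis by (auto simp: eventually_sequentially)
  qed
  then obtain m where m: "(\<integral>\<^sup>+x. ennreal ((F x - clip (real m) (F x))\<^sup>2) \<partial>lborel) < ennreal (e / 4)" by blast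
  have "F \<in> borel_measurable lebesgue" using F by (simp add: measurable_completion)
  then have "F measurable_on UNIV" by (rule lebesgue_measurable_imp_measurable_on_real) auto
  then obtain N g where N: "negligible N" and g: "\<And>n. continuous_on UNIV (g n)"
    and lim: "\<And>x. x \<notin> N ==> (\<lambda>n. g n x) \<longlonglongrightarrow> F x" unfolding measurable_on_def by auto
  have [measurable]: "g n \<in> borel_measurable borel" for n using g by (rule borel_measurable_continuous_onI)
  have AE: "AE x in lborel. x \<notin> N"
    using N AE_not_in[of N lebesgue] by (auto simp: negligible_iff_null_sets AE_completion_iff)
  have lim2: "(\<lambda>n. \<integral>\<^sup>+x. ennreal ((indicator {a..b} x * (clip m (F x) - clip m (g n x)))\<^sup>2) \<partial>lborel) \<longlonglongrightarrow> (\<integral>\<^sup>+x. 0 \<partial>(lborel :: real measure))"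
  proof (rule nn_integral_dominated_convergence[where w="\<lambda>x. ennreal ((2 * real m)\<^sup>2) * indicator {a..b} x" and u'="\<lambda>_. 0"])
    show "AE x in lborel. ennreal ((indicator {a..b} x * (clip m (F x) - clip m (g j x)))\<^sup>2) \<le> ennreal ((2 * real m)\<^sup>2) * indicator {a..b} x" for j
    proof (rule AE_I2)
      fix x
      have "\<bar>clip m (F x) - clip m (g j x)\<bar> \<le> \<bar>2 * real m\<bar>"
        using clip_abs_le[of m "F x"] clip_abs_le[of m "g j x"] by auto
      then have "(clip m (F x) - clip m (g j x))\<^sup>2 \<le> (2 * real m)\<^sup>2" by (simp only: abs_le_square_iff)
      then show "ennreal ((indicator {a..b} x * (clip m (F x) - clip m (g j x)))\<^sup>2) \<le> ennreal ((2 * real m)\<^sup>2) * indicator {a..b} x"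
        by (auto simp: indicator_def intro!: ennreal_leI)
    qed
    show "AE x in lborel. (\<lambda>n. ennreal ((indicator {a..b} x * (clip m (F x) - clip m (g n x)))\<^sup>2)) \<longlonglongrightarrow> 0"
      using AE
    proof eventually_elim
      fix x assume "x \<notin> N"
      then have "(\<lambda>n. g n x) \<longlonglongrightarrow> F x" by (rule lim)
      then have "(\<lambda>n. (indicator {a..b} x * (clip m (F x) - clip m (g n x)))\<^sup>2) \<longlonglongrightarrow> (indicator {a..b} x * (clip m (F x) - clip m (F x)))\<^sup>2"
        by (intro tendsto_intros isCont_tendsto_compose[OF isCont_clip])
      then show "(\<lambda>n. ennreal ((indicator {a..b} x * (clip m (F x) - clip m (g n x)))\<^sup>2)) \<longlonglongrightarrow> 0"
        using tendsto_ennrealI by fastforce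
    qed
    show "(\<integral>\<^sup>+x. ennreal ((2 * real m)\<^sup>2) * indicator {a..b} x \<partial>lborel) < \<infinity>"
      by (subst nn_integral_cmult_indicator) (auto simp: ennreal_mult_less_top emeasure_lborel_Icc_eq)
  qed auto
  have "\<exists>n. (\<integral>\<^sup>+x. ennreal ((indicator {a..b} x * (clip m (F x) - clip m (g n x)))\<^sup>2) \<partial>lborel) < ennreal (e / 4)"
  proof -
    have "0 < ennreal (e / 4)" using e by (auto simp: ennreal_zero_less_divide)
    then have "eventually (\<lambda>n. (\<integral>\<^sup>+x. ennreal ((indicator {a..b} x * (clip m (F x) - clip m (g n x)))\<^sup>2) \<partial>lborel) < ennreal (e / 4)) sequentially"
      using lim2 by (auto intro: order_tendstoD)
    then show ?thesis by (auto simp: eventually_sequentially)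
  qed
  then obtain n where n: "(\<integral>\<^sup>+x. ennreal ((indicator {a..b} x * (clip m (F x) - clip m (g n x)))\<^sup>2) \<partial>lborel) < ennreal (e / 4)" by blast
  show ?thesis
  proof (rule that[of "\<lambda>x. clip m (g n x)"])
    show "continuous_on UNIV (\<lambda>x. clip m (g n x))" by (rule continuous_on_clip[OF g])
    have "N2 {a..b} (\<lambda>x. z x - clip m (g n x)) \<le>
      2 * N2 {a..b} (\<lambda>x. z x - clip m (F x)) + 2 * N2 {a..b} (\<lambda>x. clip m (F x) - clip m (g n x))"
      using z by (intro N2_triangle) (auto simp: L2_space_iff sbm_iff)
    also have "N2 {a..b} (\<lambda>x. z x - clip m (F x)) = (\<integral>\<^sup>+x. ennreal ((F x - clip (real m) (F x))\<^sup>2) \<partial>lborel)"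
      unfolding N2_def F_def by (intro nn_integral_cong) (auto simp: indicator_def clip_def)
    also have "2 * (\<integral>\<^sup>+x. ennreal ((F x - clip (real m) (F x))\<^sup>2) \<partial>lborel) + 2 * N2 {a..b} (\<lambda>x. clip m (F x) - clip m (g n x))
      \<le> 2 * ennreal (e / 4) + 2 * ennreal (e / 4)"
      using m n unfolding N2_def by (intro add_mono mult_left_mono) auto
    also have "... = ennreal (2 * (e / 4) + 2 * (e / 4))"
      using e by (simp add: numeral_mult_ennreal ennreal_plus[symmetric] del: ennreal_plus)
    finally show "N2 {a..b} (\<lambda>x. z x - clip m (g n x)) \<le> ennreal e" by simp
  qed
qed

lemma ennreal_null_sandwich:
  fixes a b c :: "nat => ennreal"
  assumes "\<And>n. a n \<le> K * b n + L * c n" "K < top" "L < top" "b \<longlonglongrightarrow> 0" "c \<longlonglongrightarrow> 0"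
  shows "a \<longlonglongrightarrow> 0"
proof (rule tendsto_sandwich[of "\<lambda>_. 0" _ _ "\<lambda>n. K * b n + L * c n"])
  have "(\<lambda>n. K * b n + L * c n) \<longlonglongrightarrow> K * 0 + L * 0"
    using assms by (intro tendsto_add ennreal_tendsto_cmult) auto
  then show "(\<lambda>n. K * b n + L * c n) \<longlonglongrightarrow> 0" by simp
qed (use assms(1) in auto)

lemma ennreal_not_infinityE:
  assumes "s \<noteq> \<infinity>" obtains K where "s = ennreal K" "K \<ge> 0"
  using assms by (cases s) auto

lemma le_suminf_ennreal: "h n \<le> suminf (h :: nat => ennreal)"
  using sum_le_suminf[of h "{n}"] by simp

text \<open>Riesz-Fischer for geometrically decreasing steps. With weights \<open>2^n\<close> the
  series of squared increments still has finite integral, as 1/8 becomes 1/4, and its finiteness at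
  a point bounds the increments there geometrically. Fatou's lemma then carries the rate over to the
  limit.\<close>

lemma L2_complete:
  assumes S: "S \<in> sets borel" and f: "\<And>n. f n \<in> L2_space S" and C: "C \<ge> 0"
    and cauchy: "\<And>n. N2 S (\<lambda>x. f n x - f (Suc n) x) \<le> ennreal (C * (1/8)^n)"
  shows "\<exists>f'\<in>L2_space S. (\<lambda>n. N2 S (\<lambda>x. f n x - f' x)) \<longlonglongrightarrow> 0"
proof -
  define F where "F n x = indicator S x * f n x" for n x
  have F[measurable]: "F n \<in> borel_measurable borel" for n
    using f[of n] by (simp add: F_def[abs_def] L2_space_iff sbm_iff)
  have sb: "sbm S (f n)" for n using f by (simp add: L2_space_iff)
  have N2F: "N2 S (\<lambda>x. f n x - f m x) = (\<integral>\<^sup>+x. ennreal ((F n x - F m x)\<^sup>2) \<partial>lborel)" for n m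
    unfolding N2_def F_def by (simp add: right_diff_distrib)
  define f' where "f' x = lim (\<lambda>n. F n x)" for x
  have f'[measurable]: "f' \<in> borel_measurable borel" unfolding f'_def by measurable
  have f'0: "f' x = 0" if "x \<notin> S" for x using that by (simp add: f'_def F_def lim_def LIMSEQ_const_iff)
  have N2f': "N2 S (\<lambda>x. f n x - f' x) = (\<integral>\<^sup>+x. ennreal ((F n x - f' x)\<^sup>2) \<partial>lborel)" for n
    unfolding N2_def by (intro nn_integral_cong) (auto simp: indicator_def F_def f'0)
  have sbf': "sbm S f'" using f'0 unfolding sbm_iff
    by (subst measurable_cong[of _ _ f']) (auto simp: indicator_def)
  have "(\<integral>\<^sup>+x. (\<Sum>n. ennreal (2^n * (F n x - F (Suc n) x)\<^sup>2)) \<partial>lborel) = (\<Sum>n. (\<integral>\<^sup>+x. ennreal (2^n * (F n x - F (Suc n) x)\<^sup>2) \<partial>lborel))"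
    by (rule nn_integral_suminf) measurable
  also have "... = (\<Sum>n. ennreal (2^n) * N2 S (\<lambda>x. f n x - f (Suc n) x))"
    unfolding N2F by (intro suminf_cong) (simp add: ennreal_mult nn_integral_cmult)
  also have "... \<le> (\<Sum>n. ennreal (C * (1/4)^n))"
  proof (intro suminf_le)
    fix n
    have "ennreal (2^n) * N2 S (\<lambda>x. f n x - f (Suc n) x) \<le> ennreal (2^n) * ennreal (C * (1/8)^n)"
      by (intro mult_left_mono cauchy) auto
    also have "... = ennreal (C * (1/4)^n)" using C
      by (simp add: ennreal_mult[symmetric] power_mult_distrib[symmetric] mult.left_commute)
    finally show "ennreal (2^n) * N2 S (\<lambda>x. f n x - f (Suc n) x) \<le> ennreal (C * (1/4)^n)" .
  qed auto
  also have "... < \<infinity>"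
  proof -
    have "summable (\<lambda>n. C * (1/4::real)^n)" by (intro summable_mult summable_geometric) simp
    then have "(\<Sum>n. ennreal (C * (1/4)^n)) \<noteq> top" using C by (intro ennreal_suminf_neq_top) auto
    then show ?thesis unfolding infinity_ennreal_def top.not_eq_extremum .
  qed
  finally have "(\<integral>\<^sup>+x. (\<Sum>n. ennreal (2^n * (F n x - F (Suc n) x)\<^sup>2)) \<partial>lborel) \<noteq> \<infinity>" by simp
  then have "AE x in lborel. (\<Sum>n. ennreal (2^n * (F n x - F (Suc n) x)\<^sup>2)) \<noteq> \<infinity>"
    by (rule nn_integral_PInf_AE[rotated]) measurable
  then have conv: "AE x in lborel. (\<lambda>n. F n x) \<longlonglongrightarrow> f' x"
  proof eventually_elim
    fix x assume fin: "(\<Sum>n. ennreal (2^n * (F n x - F (Suc n) x)\<^sup>2)) \<noteq> \<infinity>"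
    obtain K where K: "(\<Sum>n. ennreal (2^n * (F n x - F (Suc n) x)\<^sup>2)) = ennreal K" "K \<ge> 0"
      by (rule ennreal_not_infinityE[OF fin])
    have b: "norm (F (Suc n) x - F n x) \<le> sqrt K * (1 / sqrt 2)^n" for n
    proof -
      have "ennreal (2^n * (F n x - F (Suc n) x)\<^sup>2) \<le> ennreal K"
        unfolding K(1)[symmetric] by (rule le_suminf_ennreal)
      then have "2^n * (F n x - F (Suc n) x)\<^sup>2 \<le> K" by (rule ennreal_le_iff[OF K(2), THEN iffD1])
      then have "(F n x - F (Suc n) x)\<^sup>2 \<le> K * (1/2)^n" by (simp add: field_simps)
      then have "sqrt ((F n x - F (Suc n) x)\<^sup>2) \<le> sqrt (K * (1/2)^n)" by (rule real_sqrt_le_mono)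
      then show ?thesis unfolding real_sqrt_abs
        by (simp add: real_sqrt_mult real_sqrt_power real_sqrt_divide abs_minus_commute)
    qed
    have "summable (\<lambda>n. F (Suc n) x - F n x)"
      by (rule summable_comparison_test'[where N=0 and g="\<lambda>n. sqrt K * (1 / sqrt 2)^n"])
         (use b in \<open>auto intro!: summable_mult summable_geometric\<close>)
    then have "(\<lambda>n. \<Sum>i<n. F (Suc i) x - F i x) \<longlonglongrightarrow> (\<Sum>n. F (Suc n) x - F n x)" by (rule summable_LIMSEQ)
    then have "(\<lambda>n. F n x - F 0 x) \<longlonglongrightarrow> (\<Sum>n. F (Suc n) x - F n x)" by (simp only: sum_lessThan_telescope[of "\<lambda>n. F n x"])
    then have "(\<lambda>n. (F n x - F 0 x) + F 0 x) \<longlonglongrightarrow> (\<Sum>n. F (Suc n) x - F n x) + F 0 x" by (intro tendsto_intros)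
    then have "convergent (\<lambda>n. F n x)" by (auto simp: convergent_def)
    then show "(\<lambda>n. F n x) \<longlonglongrightarrow> f' x" by (simp add: f'_def convergent_LIMSEQ_iff)
  qed
  \<comment> \<open>The ratio 1/8 outweighs the factor 2 of the triangle inequality, and the
    constant 4 reproduces itself: \<open>2 * C + 2 * (4 * C) / 8\<close> is at most
    \<open>4 * C\<close>.\<close>
  have step: "N2 S (\<lambda>x. f n x - f (n + j) x) \<le> ennreal (4 * C * (1/8)^n)" for n j
  proof (induction j arbitrary: n)
    case 0 then show ?case by (simp add: N2_def)
  next
    case (Suc j)
    have "N2 S (\<lambda>x. f n x - f (n + Suc j) x) \<le> 2 * N2 S (\<lambda>x. f n x - f (Suc n) x) + 2 * N2 S (\<lambda>x. f (Suc n) x - f (Suc n + j) x)"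
      using N2_triangle[OF sb[of n] sb[of "Suc n"] sb[of "n + Suc j"]] by simp
    also have "... \<le> 2 * ennreal (C * (1/8)^n) + 2 * ennreal (4 * C * (1/8)^Suc n)"
      by (intro add_mono mult_left_mono cauchy Suc) auto
    also have "... = ennreal (2 * (C * (1/8)^n) + 2 * (4 * C * (1/8)^Suc n))"
      using C by (simp add: numeral_mult_ennreal ennreal_plus[symmetric] del: ennreal_plus)
    also have "... \<le> ennreal (4 * C * (1/8)^n)"
      using C by (intro ennreal_leI) (simp add: mult_nonneg_nonneg)
    finally show ?case .
  qed
  have bound: "N2 S (\<lambda>x. f n x - f' x) \<le> ennreal (4 * C * (1/8)^n)" for n
  proof -
    have "N2 S (\<lambda>x. f n x - f' x) = (\<integral>\<^sup>+x. liminf (\<lambda>m. ennreal ((F n x - F m x)\<^sup>2)) \<partial>lborel)"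
      unfolding N2f'
    proof (rule nn_integral_cong_AE, use conv in eventually_elim)
      fix x assume "(\<lambda>m. F m x) \<longlonglongrightarrow> f' x"
      then have "(\<lambda>m. ennreal ((F n x - F m x)\<^sup>2)) \<longlonglongrightarrow> ennreal ((F n x - f' x)\<^sup>2)"
        by (intro tendsto_ennrealI tendsto_intros)
      then show "ennreal ((F n x - f' x)\<^sup>2) = liminf (\<lambda>m. ennreal ((F n x - F m x)\<^sup>2))"
        by (rule lim_imp_Liminf[OF trivial_limit_sequentially, symmetric])
    qed
    also have "... \<le> liminf (\<lambda>m. \<integral>\<^sup>+x. ennreal ((F n x - F m x)\<^sup>2) \<partial>lborel)"
      by (rule nn_integral_liminf) measurable
    also have "... \<le> liminf (\<lambda>m::nat. ennreal (4 * C * (1/8)^n))"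
    proof (rule Liminf_mono)
      have "(\<integral>\<^sup>+x. ennreal ((F n x - F m x)\<^sup>2) \<partial>lborel) \<le> ennreal (4 * C * (1/8)^n)" if "n \<le> m" for m
        using step[of n "m - n"] that by (simp add: N2F)
      then show "\<forall>\<^sub>F m in sequentially. (\<integral>\<^sup>+x. ennreal ((F n x - F m x)\<^sup>2) \<partial>lborel) \<le> ennreal (4 * C * (1/8)^n)"
        by (auto simp: eventually_sequentially)
    qed
    also have "... = ennreal (4 * C * (1/8)^n)" by (simp add: Liminf_const)
    finally show ?thesis .
  qed
  have "N2 S f' \<le> 2 * N2 S (\<lambda>x. f' x - f 0 x) + 2 * N2 S (f 0)"
    using N2_add_le[OF sbm_diff[OF sbf' sb[of 0]] sb[of 0]] by simp
  also have "... < \<infinity>"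
    using bound[of 0] f[of 0] unfolding N2_commute[of S f']
    by (auto simp: L2_space_iff ennreal_mult_less_top intro: order_le_less_trans)
  finally have "f' \<in> L2_space S" using sbf' by (simp add: L2_space_iff)
  moreover have "(\<lambda>n. N2 S (\<lambda>x. f n x - f' x)) \<longlonglongrightarrow> 0"
  proof (rule tendsto_sandwich[of "\<lambda>_. 0" _ _ "\<lambda>n. ennreal (4 * C * (1/8)^n)"])
    have "(\<lambda>n. 4 * C * (1/8::real)^n) \<longlonglongrightarrow> 4 * C * 0" by (intro tendsto_intros LIMSEQ_power_zero) simp
    then show "(\<lambda>n. ennreal (4 * C * (1/8)^n)) \<longlonglongrightarrow> 0" using tendsto_ennrealI by fastforce
  qed (use bound in auto)
  ultimately show ?thesis by blast
qed

section \<open>The delay operator\<close>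

lemma M0_signed: "\<psi> \<in> M0 d ==> signed_measure_locale d \<psi>"
  by (simp add: M0_def signed_measure_locale_def)

text \<open>The integrand is continuous in \<open>r\<close>, so the integral is the limit of Riemann
  sums over a fixed partition of [-d,0], and each sum is a finite combination of measurable
  functions. The parameter space is arbitrary: it is a time interval in one use and a product with
  the sample space in another.\<close>

lemma signed_integral_measurable:
  fixes \<kappa> :: "'q => real set => real"
  assumes d: "d > 0"
    and M0: "\<And>q. q \<in> space Q ==> \<kappa> q \<in> M0 d"
    and meas: "\<And>A. A \<in> sets borel ==> A \<subseteq> {-d..<0} ==> (\<lambda>q. \<kappa> q A) \<in> borel_measurable Q"
    and X: "\<And>r. r \<in> {-d..0} ==> X r \<in> borel_measurable Q"
    and cont: "\<And>q. q \<in> space Q ==> continuous_on {-d..0} (\<lambda>r. X r q)"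
  shows "(\<lambda>q. signed_integral d (\<kappa> q) (\<lambda>r. X r q)) \<in> borel_measurable Q"
proof -
  define A where "A n i = {s\<in>{-d..0}. \<lfloor>(s + d) * real (Suc n) / d\<rfloor> = int i}" for n i
  define r where "r n i = - d + d / real (Suc n) * real i" for n i
  define S where "S n q = (\<Sum>i\<le>Suc n. X (r n i) q * \<kappa> q (A n i))" for n q
  have A_borel: "A n i \<in> sets borel" for n i unfolding A_def by measurable
  have Ab: "A n i \<in> borel_sets d" for n i using A_borel by (auto simp: borel_sets_iff A_def)
  have floor_range: "0 \<le> \<lfloor>(s + d) * real (Suc n) / d\<rfloor>" "\<lfloor>(s + d) * real (Suc n) / d\<rfloor> \<le> int (Suc n)"
    if "s \<in> {-d..0}" for s n
  proof -
    show "0 \<le> \<lfloor>(s + d) * real (Suc n) / d\<rfloor>" using that d by simp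
    have "(s + d) * real (Suc n) / d \<le> d * real (Suc n) / d"
      using that d by (intro divide_right_mono mult_right_mono) auto
    then show "\<lfloor>(s + d) * real (Suc n) / d\<rfloor> \<le> int (Suc n)" using d
      by (simp add: floor_le_iff del: of_nat_Suc)
  qed
  have rr: "r n i \<in> {-d..0}" if "i \<le> Suc n" for n i
  proof -
    have "d / real (Suc n) * real i \<le> d / real (Suc n) * real (Suc n)" using that d by (intro mult_left_mono) auto
    then show ?thesis using d by (simp add: r_def)
  qed
  \<comment> \<open>The last index collects only the endpoint 0, which carries no mass in
    \<open>M0\<close>. All other cells lie in [-d,0), where the kernel is assumed to be
    measurable.\<close>
  have last: "A n (Suc n) = {0}" for n
  proof -
    have "s = 0" if "s \<in> A n (Suc n)" for s
    proof -
      have "real (Suc n) \<le> (s + d) * real (Suc n) / d"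
        using that unfolding A_def by (metis (mono_tags, lifting) le_floor_iff mem_Collect_eq of_int_of_nat_eq order_refl)
      then have "d * real (Suc n) \<le> (s + d) * real (Suc n)" using d by (simp add: pos_le_divide_eq mult.commute del: of_nat_Suc)
      then have "d \<le> s + d" by (rule mult_right_le_imp_le) simp
      then show "s = 0" using that by (simp add: A_def)
    qed
    moreover have "0 \<in> A n (Suc n)" using d by (simp add: A_def del: of_nat_Suc)
    ultimately show ?thesis by blast
  qed
  have S_alt: "S n q = (\<Sum>i\<le>n. X (r n i) q * \<kappa> q (A n i))" if "q \<in> space Q" for n q
    using M0[OF that] by (simp add: S_def last M0_def)
  have meas_lim: "(\<lambda>q. \<Sum>i\<le>n. X (r n i) q * \<kappa> q (A n i)) \<in> borel_measurable Q" for n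
  proof (intro borel_measurable_sum borel_measurable_times)
    fix i assume "i \<in> {..n}"
    then show "X (r n i) \<in> borel_measurable Q" by (intro X rr) auto
    have "A n i \<subseteq> {-d..<0}" using \<open>i \<in> {..n}\<close> d by (auto simp: A_def order_le_less)
    then show "(\<lambda>q. \<kappa> q (A n i)) \<in> borel_measurable Q" by (intro meas A_borel)
  qed
  have "(\<lambda>n. S n q) \<longlonglongrightarrow> signed_integral d (\<kappa> q) (\<lambda>r. X r q)" if q: "q \<in> space Q" for q
  proof (rule LIMSEQ_I)
    fix e :: real assume e: "e > 0"
    interpret sm: signed_measure_locale d "\<kappa> q" by (rule M0_signed[OF M0[OF q]])
    define V where "V = total_variation d (\<kappa> q)"
    have V: "V \<ge> 0" by (simp add: V_def sm.total_variation_nonneg)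
    have "uniformly_continuous_on {-d..0} (\<lambda>r. X r q)"
      by (rule compact_uniformly_continuous[OF cont[OF q]]) auto
    moreover have "e / (V + 1) > 0" using e V by simp
    ultimately obtain \<delta> where \<delta>: "\<delta> > 0"
      "\<And>x x'. x \<in> {-d..0} ==> x' \<in> {-d..0} ==> dist x' x < \<delta> ==> dist (X x' q) (X x q) < e / (V + 1)"
      unfolding uniformly_continuous_on_def by metis
    obtain N :: nat where N: "d / \<delta> < N" using reals_Archimedean2 by blast
    obtain B where B: "\<And>x. x \<in> {-d..0} ==> \<bar>X x q\<bar> \<le> B" using continuous_on_bounded[OF cont[OF q]] by metis
    have bm: "sm.bmeas (\<lambda>r. X r q)" by (rule borel_measurable_continuous_on_restrict[OF cont[OF q]])
    show "\<exists>no. \<forall>n\<ge>no. norm (S n q - signed_integral d (\<kappa> q) (\<lambda>r. X r q)) < e"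
    proof (intro exI allI impI)
      fix n assume n: "n \<ge> N"
      have "d < \<delta> * real N" using N \<delta>(1) by (simp add: field_simps)
      also have "... \<le> \<delta> * real (Suc n)" using n \<delta>(1) by (intro mult_left_mono) auto
      finally have dn: "d / real (Suc n) < \<delta>" by (simp add: field_simps del: of_nat_Suc)
      define st where "st s = (\<Sum>i\<le>Suc n. X (r n i) q * indicator (A n i) s)" for s
      have st: "\<exists>i\<le>Suc n. st s = X (r n i) q \<and> \<bar>r n i - s\<bar> < \<delta>" if s: "s \<in> {-d..0}" for s
      proof -
        define i where "i = nat \<lfloor>(s + d) * real (Suc n) / d\<rfloor>"
        have i: "int i = \<lfloor>(s + d) * real (Suc n) / d\<rfloor>" "i \<le> Suc n"
          using floor_range[OF s, of n] by (auto simp: i_def)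
        have "st s = (\<Sum>j\<le>Suc n. if j = i then X (r n j) q else 0)"
          unfolding st_def using s i(1) by (intro sum.cong) (auto simp: A_def)
        also have "... = X (r n i) q" using i(2) by simp
        finally have 1: "st s = X (r n i) q" .
        have "real i \<le> (s + d) * real (Suc n) / d" "(s + d) * real (Suc n) / d < real i + 1"
          using i(1) by linarith+
        then have "d / real (Suc n) * real i \<le> s + d" "s + d < d / real (Suc n) * real i + d / real (Suc n)"
          using d by (simp_all add: field_simps del: of_nat_Suc)
        then have "\<bar>r n i - s\<bar> \<le> d / real (Suc n)" unfolding r_def by linarith
        with dn 1 i(2) show ?thesis by force
      qed
      have st_bd: "\<bar>st s\<bar> \<le> B" if "s \<in> {-d..0}" for s using st[OF that] B rr by metis
      have st_m: "sm.bmeas st" unfolding st_def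
        by (intro borel_measurable_sum borel_measurable_times borel_measurable_const borel_measurable_indicator)
           (use Ab in \<open>simp add: borel_sets_def\<close>)
      have "S n q = signed_integral d (\<kappa> q) st"
        unfolding S_def st_def by (rule sm.signed_integral_step[symmetric]) (auto simp: Ab)
      then have "S n q - signed_integral d (\<kappa> q) (\<lambda>r. X r q) = signed_integral d (\<kappa> q) (\<lambda>s. 1 * st s + (-1) * X s q)"
        using sm.signed_integral_lincomb[OF st_m st_bd bm B, of 1 "-1"] by simp
      also have "\<bar>...\<bar> \<le> total_variation d (\<kappa> q) * (e / (V + 1))"
      proof (rule sm.signed_integral_bound)
        show "sm.bmeas (\<lambda>s. 1 * st s + (-1) * X s q)" using st_m bm by measurable
        fix s assume s: "s \<in> {-d..0}"
        then obtain i where "i \<le> Suc n" "st s = X (r n i) q" "\<bar>r n i - s\<bar> < \<delta>" using st by blast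
        with \<delta>(2)[of s "r n i"] rr[of i n] s show "\<bar>1 * st s + (-1) * X s q\<bar> \<le> e / (V + 1)"
          by (simp add: dist_real_def)
      qed
      also have "... < e" unfolding V_def[symmetric] using e V by (simp add: field_simps)
      finally show "norm (S n q - signed_integral d (\<kappa> q) (\<lambda>r. X r q)) < e" by simp
    qed
  qed
  then have "(\<lambda>n. \<Sum>i\<le>n. X (r n i) q * \<kappa> q (A n i)) \<longlonglongrightarrow> signed_integral d (\<kappa> q) (\<lambda>r. X r q)" if "q \<in> space Q" for q
    using that S_alt by simp
  then show ?thesis using meas_lim by (rule borel_measurable_LIMSEQ_real)
qed

text \<open>One sample path of the kernel. The constants are uniform in time, and later also in the
  sample point.\<close>

locale delay_kernel =
  fixes d T c cL :: real and k :: "real => real set => real"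
  assumes d: "0 < d" and T: "0 < T" and c0: "0 \<le> c" and cL0: "0 \<le> cL"
    and kM0: "\<And>t. t \<in> {0..T} ==> k t \<in> M0 d"
    and tv: "\<And>t. t \<in> {0..T} ==> total_variation d (k t) \<le> c"
    and kmeas: "\<And>A. A \<in> sets borel ==> A \<subseteq> {-d..<0} ==>
      (\<lambda>t. k t A) \<in> borel_measurable (restrict_space borel {0..T})"
    and kL2: "\<And>z. continuous_on {-d..T} z ==>
      L2_norm {0..T} (delay_op d k z) \<le> cL * L2_norm {-d..T} z"
begin

abbreviation "dop \<equiv> delay_op d k"

lemma continuous_on_shift:
  assumes "continuous_on {-d..T} z" "t \<in> {0..T}" shows "continuous_on {-d..0} (\<lambda>s. z (t + s))"
  by (rule continuous_on_compose2[OF assms(1)]) (use assms(2) in \<open>auto intro!: continuous_intros\<close>)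

lemma bmeas_shift:
  assumes "continuous_on {-d..T} z" "t \<in> {0..T}"
  shows "(\<lambda>s. z (t + s)) \<in> borel_measurable (restrict_space borel {-d..0})"
  by (rule borel_measurable_continuous_on_restrict[OF continuous_on_shift[OF assms]])

lemma dop_bound:
  assumes z: "continuous_on {-d..T} z" and t: "t \<in> {0..T}" and S: "\<And>s. s \<in> {-d..t} ==> \<bar>z s\<bar> \<le> S"
  shows "\<bar>dop z t\<bar> \<le> c * S"
proof -
  interpret signed_measure_locale d "k t" by (rule M0_signed[OF kM0[OF t]])
  have "\<bar>dop z t\<bar> \<le> total_variation d (k t) * S"
    unfolding delay_op_def by (rule signed_integral_bound[OF bmeas_shift[OF z t]]) (use t S in auto)
  also have "... \<le> c * S" using tv[OF t] S[of t] t d by (intro mult_right_mono) auto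
  finally show ?thesis .
qed

lemma dop_cong:
  assumes "t \<in> {0..T}" "\<And>s. s \<in> {-d..t} ==> z s = w s" shows "dop z t = dop w t"
proof -
  interpret signed_measure_locale d "k t" by (rule M0_signed[OF kM0[OF assms(1)]])
  show ?thesis unfolding delay_op_def by (rule signed_integral_cong) (use assms in auto)
qed

lemma dop_lincomb:
  assumes z: "continuous_on {-d..T} z" and w: "continuous_on {-d..T} w" and t: "t \<in> {0..T}"
  shows "dop (\<lambda>s. a * z s + b * w s) t = a * dop z t + b * dop w t"
proof -
  interpret signed_measure_locale d "k t" by (rule M0_signed[OF kM0[OF t]])
  obtain S where "\<And>s. s \<in> {-d..0} ==> \<bar>z (t + s)\<bar> \<le> S"
    using continuous_on_bounded[OF continuous_on_shift[OF z t]] by metis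
  moreover obtain S' where "\<And>s. s \<in> {-d..0} ==> \<bar>w (t + s)\<bar> \<le> S'"
    using continuous_on_bounded[OF continuous_on_shift[OF w t]] by metis
  ultimately show ?thesis unfolding delay_op_def
    by (intro signed_integral_lincomb bmeas_shift z w t)
qed

lemma dop_diff:
  assumes "continuous_on {-d..T} z" "continuous_on {-d..T} w" "t \<in> {0..T}"
  shows "dop (\<lambda>s. z s - w s) t = dop z t - dop w t"
  using dop_lincomb[OF assms, of 1 "-1"] by simp

lemma dop_measurable:
  assumes z: "continuous_on {-d..T} z" shows "dop z \<in> borel_measurable (restrict_space borel {0..T})"
proof -
  have "(\<lambda>t. signed_integral d (k t) (\<lambda>r. z (t + r))) \<in> borel_measurable (restrict_space borel {0..T})"
  proof (rule signed_integral_measurable[OF d _ kmeas])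
    show "(\<lambda>t. z (t + r)) \<in> borel_measurable (restrict_space borel {0..T})" if "r \<in> {-d..0}" for r
      by (rule borel_measurable_continuous_on_restrict, rule continuous_on_compose2[OF z])
         (use that in \<open>auto intro!: continuous_intros\<close>)
  qed (use z in \<open>auto simp: space_restrict_space intro!: continuous_on_shift kM0\<close>)
  then show ?thesis by (simp add: delay_op_def[abs_def])
qed

lemma sbm_dop: "continuous_on {-d..T} z ==> sbm {0..T} (dop z)"
  by (simp add: sbm_restrict_iff dop_measurable)

lemma dop_L2:
  assumes z: "continuous_on {-d..T} z" shows "dop z \<in> L2_space {0..T}"
proof -
  obtain S where "\<And>s. s \<in> {-d..T} ==> \<bar>z s\<bar> \<le> S" using continuous_on_bounded[OF z] by metis
  then have "\<bar>dop z t\<bar> \<le> c * S" if "t \<in> {0..T}" for t using that by (intro dop_bound[OF z that]) auto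
  then have "N2 {0..T} (dop z) \<le> ennreal ((c * S)\<^sup>2 * (T - 0))" using T by (intro N2_bounded) auto
  then have "N2 {0..T} (dop z) < \<infinity>" by (rule order_le_less_trans) simp
  then show ?thesis using sbm_dop[OF z] by (simp add: L2_space_iff)
qed

lemma dop_N2:
  assumes z: "continuous_on {-d..T} z"
  shows "N2 {0..T} (dop z) \<le> ennreal (cL\<^sup>2) * N2 {-d..T} z"
proof -
  have "N2 {0..T} (dop z) = ennreal ((L2_norm {0..T} (dop z))\<^sup>2)" by (rule L2_norm_sq[OF dop_L2[OF z], symmetric])
  also have "... \<le> ennreal ((cL * L2_norm {-d..T} z)\<^sup>2)"
    by (intro ennreal_leI power_mono kL2 z L2_norm_nonneg)
  also have "... = ennreal (cL\<^sup>2) * ennreal ((L2_norm {-d..T} z)\<^sup>2)"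
    by (simp add: power_mult_distrib ennreal_mult)
  also have "... = ennreal (cL\<^sup>2) * N2 {-d..T} z"
    by (simp add: L2_norm_sq[OF L2_space_continuous[OF z]])
  finally show ?thesis .
qed

lemma dop_N2_diff:
  assumes z: "continuous_on {-d..T} z" and w: "continuous_on {-d..T} w"
  shows "N2 {0..T} (\<lambda>t. dop z t - dop w t) \<le> ennreal (cL\<^sup>2) * N2 {-d..T} (\<lambda>t. z t - w t)"
proof -
  have "N2 {0..T} (\<lambda>t. dop z t - dop w t) = N2 {0..T} (dop (\<lambda>t. z t - w t))"
    by (rule N2_cong) (simp add: dop_diff[OF z w])
  also have "... \<le> ennreal (cL\<^sup>2) * N2 {-d..T} (\<lambda>t. z t - w t)"
    by (rule dop_N2) (intro continuous_intros z w)
  finally show ?thesis .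
qed

section \<open>Extension of the delay operator to square integrable paths\<close>

definition approximates :: "(nat => real => real) => (real => real) => bool" where
  "approximates g z \<longleftrightarrow> (\<forall>n. continuous_on {-d..T} (g n)) \<and> (\<lambda>n. N2 {-d..T} (\<lambda>x. z x - g n x)) \<longlonglongrightarrow> 0"

text \<open>The rate \<open>(1/8)^n\<close> is the one that \<open>L2_complete\<close> asks
  for.\<close>

lemma ex_fast_approximation:
  assumes z: "z \<in> L2_space {-d..T}"
  obtains g where "\<And>n. continuous_on UNIV (g n)" "\<And>n. N2 {-d..T} (\<lambda>x. z x - g n x) \<le> ennreal ((1/8)^n)"
proof -
  have "\<forall>n. \<exists>g. continuous_on UNIV g \<and> N2 {-d..T} (\<lambda>x. z x - g x) \<le> ennreal ((1/8)^n)"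
  proof
    fix n :: nat
    have "(1/8::real)^n > 0" by simp
    from L2_dense_continuous[OF z this] show "\<exists>g. continuous_on UNIV g \<and> N2 {-d..T} (\<lambda>x. z x - g x) \<le> ennreal ((1/8)^n)"
      by blast
  qed
  then show ?thesis using that by metis
qed

lemma fast_approximates:
  assumes "\<And>n. continuous_on UNIV (g n)" "\<And>n. N2 {-d..T} (\<lambda>x. z x - g n x) \<le> ennreal ((1/8)^n)"
  shows "approximates g z"
  unfolding approximates_def
proof (intro conjI allI)
  show "continuous_on {-d..T} (g n)" for n using assms(1) continuous_on_subset by blast
  show "(\<lambda>n. N2 {-d..T} (\<lambda>x. z x - g n x)) \<longlonglongrightarrow> 0"
  proof (rule tendsto_sandwich[of "\<lambda>_. 0" _ _ "\<lambda>n. ennreal ((1/8)^n)"])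
    have "(\<lambda>n. (1/8::real)^n) \<longlonglongrightarrow> 0" by (intro LIMSEQ_power_zero) simp
    then show "(\<lambda>n. ennreal ((1/8)^n)) \<longlonglongrightarrow> 0" using tendsto_ennrealI by fastforce
  qed (use assms in auto)
qed

lemma sbm_cont: "continuous_on {-d..T} z ==> sbm {-d..T} z"
  by (rule sbm_continuous) auto

text \<open>Two approximations of the same path differ by a null sequence in L^2, which the L^2
  bound carries over to their images. Hence the extension does not depend on the approximation
  through which it is defined.\<close>

lemma dop_limits_unique:
  assumes z: "z \<in> L2_space {-d..T}" and g: "approximates g z" and h: "approximates h z" and f: "f \<in> L2_space {0..T}"
    and lim: "(\<lambda>n. N2 {0..T} (\<lambda>t. dop (g n) t - f t)) \<longlonglongrightarrow> 0"
  shows "(\<lambda>n. N2 {0..T} (\<lambda>t. dop (h n) t - f t)) \<longlonglongrightarrow> 0"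
proof -
  have gc: "continuous_on {-d..T} (g n)" and hc: "continuous_on {-d..T} (h n)" for n
    using g h by (auto simp: approximates_def)
  have zs: "sbm {-d..T} z" and fs: "sbm {0..T} f" using z f by (auto simp: L2_space_iff)
  have hg: "(\<lambda>n. N2 {-d..T} (\<lambda>t. h n t - g n t)) \<longlonglongrightarrow> 0"
  proof (rule ennreal_null_sandwich)
    show "N2 {-d..T} (\<lambda>t. h n t - g n t) \<le> 2 * N2 {-d..T} (\<lambda>t. z t - h n t) + 2 * N2 {-d..T} (\<lambda>t. z t - g n t)" for n
      using N2_triangle[OF sbm_cont[OF hc[of n]] zs sbm_cont[OF gc[of n]]]
      by (simp only: N2_commute[of "{-d..T}" z "h n"])
  qed (use g h in \<open>auto simp: approximates_def\<close>)
  show ?thesis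
  proof (rule ennreal_null_sandwich)
    show "N2 {0..T} (\<lambda>t. dop (h n) t - f t) \<le> (2 * ennreal (cL\<^sup>2)) * N2 {-d..T} (\<lambda>t. h n t - g n t) + 2 * N2 {0..T} (\<lambda>t. dop (g n) t - f t)" for n
    proof -
      have "N2 {0..T} (\<lambda>t. dop (h n) t - f t) \<le> 2 * N2 {0..T} (\<lambda>t. dop (h n) t - dop (g n) t) + 2 * N2 {0..T} (\<lambda>t. dop (g n) t - f t)"
        by (rule N2_triangle[OF sbm_dop[OF hc] sbm_dop[OF gc] fs])
      also have "... \<le> 2 * (ennreal (cL\<^sup>2) * N2 {-d..T} (\<lambda>t. h n t - g n t)) + 2 * N2 {0..T} (\<lambda>t. dop (g n) t - f t)"
        by (intro add_right_mono mult_left_mono dop_N2_diff hc gc) auto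
      finally show ?thesis by (simp only: mult.assoc)
    qed
  qed (use hg lim in \<open>auto simp: ennreal_mult_less_top\<close>)
qed

lemma ex_extension_value:
  assumes z: "z \<in> L2_space {-d..T}"
  shows "\<exists>f\<in>L2_space {0..T}. \<forall>g. approximates g z \<longrightarrow> (\<lambda>n. N2 {0..T} (\<lambda>t. dop (g n) t - f t)) \<longlonglongrightarrow> 0"
proof -
  obtain g where g: "\<And>n. continuous_on UNIV (g n)" "\<And>n. N2 {-d..T} (\<lambda>x. z x - g n x) \<le> ennreal ((1/8)^n)"
    using ex_fast_approximation[OF z] by metis
  have gc: "continuous_on {-d..T} (g n)" for n using g(1) continuous_on_subset by blast
  have zs: "sbm {-d..T} z" using z by (auto simp: L2_space_iff)
  have "\<exists>f\<in>L2_space {0..T}. (\<lambda>n. N2 {0..T} (\<lambda>t. dop (g n) t - f t)) \<longlonglongrightarrow> 0"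
  proof (rule L2_complete)
    \<comment> \<open>The 4 is an upper bound for \<open>2 + 2 / 8\<close>, which arises from
      comparing consecutive approximations through \<open>z\<close>.\<close>
    show "0 \<le> cL\<^sup>2 * 4" by simp
    fix n
    have "N2 {0..T} (\<lambda>x. dop (g n) x - dop (g (Suc n)) x) \<le> ennreal (cL\<^sup>2) * N2 {-d..T} (\<lambda>t. g n t - g (Suc n) t)"
      by (rule dop_N2_diff[OF gc gc])
    also have "N2 {-d..T} (\<lambda>t. g n t - g (Suc n) t) \<le> 2 * N2 {-d..T} (\<lambda>t. z t - g n t) + 2 * N2 {-d..T} (\<lambda>t. z t - g (Suc n) t)"
      using N2_triangle[OF sbm_cont[OF gc[of n]] zs sbm_cont[OF gc[of "Suc n"]]]
      by (simp only: N2_commute[of "{-d..T}" z "g n"])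
    also have "... \<le> 2 * ennreal ((1/8)^n) + 2 * ennreal ((1/8)^Suc n)"
      by (intro add_mono mult_left_mono g) auto
    also have "... = ennreal (2 * (1/8)^n + 2 * (1/8)^Suc n)"
      by (simp add: numeral_mult_ennreal ennreal_plus[symmetric] del: ennreal_plus)
    also have "... \<le> ennreal (4 * (1/8)^n)" by (intro ennreal_leI) simp
    also have "ennreal (cL\<^sup>2) * ennreal (4 * (1/8)^n) = ennreal (cL\<^sup>2 * 4 * (1/8)^n)"
      by (simp add: ennreal_mult[symmetric] mult.assoc)
    finally show "N2 {0..T} (\<lambda>x. dop (g n) x - dop (g (Suc n)) x) \<le> ennreal (cL\<^sup>2 * 4 * (1/8)^n)"
      by (simp add: mult_left_mono)
  qed (use dop_L2[OF gc] in auto)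
  then show ?thesis using dop_limits_unique[OF z fast_approximates[OF g]] by blast
qed

lemma approximates_lincomb:
  assumes z: "z \<in> L2_space {-d..T}" "approximates g z" and w: "w \<in> L2_space {-d..T}" "approximates h w"
  shows "approximates (\<lambda>n s. a * g n s + b * h n s) (\<lambda>s. a * z s + b * w s)"
  unfolding approximates_def
proof (intro conjI allI)
  have gc: "continuous_on {-d..T} (g n)" and hc: "continuous_on {-d..T} (h n)" for n
    using z w by (auto simp: approximates_def)
  then show "continuous_on {-d..T} (\<lambda>s. a * g n s + b * h n s)" for n by (intro continuous_intros)
  show "(\<lambda>n. N2 {-d..T} (\<lambda>x. a * z x + b * w x - (a * g n x + b * h n x))) \<longlonglongrightarrow> 0"
  proof (rule ennreal_null_sandwich)
    show "N2 {-d..T} (\<lambda>x. a * z x + b * w x - (a * g n x + b * h n x)) \<le>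
      ennreal (2 * a\<^sup>2) * N2 {-d..T} (\<lambda>x. z x - g n x) + ennreal (2 * b\<^sup>2) * N2 {-d..T} (\<lambda>x. w x - h n x)" for n
      using N2_lincomb_le[of "{-d..T}" "\<lambda>x. z x - g n x" "\<lambda>x. w x - h n x" a b] z w
        sbm_diff[OF _ sbm_cont[OF gc]] sbm_diff[OF _ sbm_cont[OF hc]]
      by (simp add: L2_space_iff algebra_simps)
  qed (use z w in \<open>auto simp: approximates_def\<close>)
qed

lemma approximates_const: "continuous_on {-d..T} z ==> approximates (\<lambda>_. z) z"
  by (simp add: approximates_def N2_def)

lemma tendsto_const_ennreal_0: "(\<lambda>n::nat. a :: ennreal) \<longlonglongrightarrow> 0 ==> a = 0"
  by (simp add: LIMSEQ_const_iff)

text \<open>Stated for an arbitrary limit \<open>f\<close>, so that it serves the operator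
  constructed here as well as the one picked by \<open>delay_ext\<close>. The 4 comes from two uses
  of \<open>N2_add_le\<close>.\<close>

lemma N2_limit_le:
  assumes z: "z \<in> L2_space {-d..T}" and g: "approximates g z" and f: "f \<in> L2_space {0..T}"
    and lim: "(\<lambda>n. N2 {0..T} (\<lambda>t. dop (g n) t - f t)) \<longlonglongrightarrow> 0"
  shows "N2 {0..T} f \<le> ennreal (4 * cL\<^sup>2) * N2 {-d..T} z"
proof -
  have gc: "continuous_on {-d..T} (g n)" for n using g by (auto simp: approximates_def)
  have zs: "sbm {-d..T} z" and sf: "sbm {0..T} f" using z f by (auto simp: L2_space_iff)
  define K where "K = ennreal (cL\<^sup>2)"
  have K: "K < top" by (simp add: K_def)
  have four: "2 * (2 * x) = 4 * (x::ennreal)" for x by (simp only: mult.assoc[symmetric]) simp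
  have "N2 {0..T} f \<le> 2 * N2 {0..T} (\<lambda>t. dop (g n) t - f t) + 4 * K * N2 {-d..T} (\<lambda>t. z t - g n t) + 4 * K * N2 {-d..T} z" for n
  proof -
    have "N2 {0..T} f \<le> 2 * N2 {0..T} (\<lambda>t. dop (g n) t - f t) + 2 * N2 {0..T} (dop (g n))"
      using N2_add_le[OF sbm_diff[OF sf sbm_dop[OF gc[of n]]] sbm_dop[OF gc[of n]]]
      by (simp add: N2_commute[of "{0..T}" f])
    also have "... \<le> 2 * N2 {0..T} (\<lambda>t. dop (g n) t - f t) + 2 * (K * N2 {-d..T} (g n))"
      unfolding K_def by (intro add_left_mono mult_left_mono dop_N2 gc) auto
    also have "... \<le> 2 * N2 {0..T} (\<lambda>t. dop (g n) t - f t) + 2 * (K * (2 * N2 {-d..T} (\<lambda>t. z t - g n t) + 2 * N2 {-d..T} z))"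
    proof (intro add_left_mono mult_left_mono)
      have "N2 {-d..T} (g n) = N2 {-d..T} (\<lambda>t. (g n t - z t) + z t)" by (rule N2_cong) simp
      also have "... \<le> 2 * N2 {-d..T} (\<lambda>t. g n t - z t) + 2 * N2 {-d..T} z"
        by (intro N2_add_le sbm_diff sbm_cont gc zs)
      finally show "N2 {-d..T} (g n) \<le> 2 * N2 {-d..T} (\<lambda>t. z t - g n t) + 2 * N2 {-d..T} z"
        by (simp only: N2_commute[of "{-d..T}" z "g n"])
    qed auto
    also have "... = 2 * N2 {0..T} (\<lambda>t. dop (g n) t - f t) + 4 * K * N2 {-d..T} (\<lambda>t. z t - g n t) + 4 * K * N2 {-d..T} z"
      by (simp only: distrib_left four[symmetric] add.assoc mult.assoc mult.left_commute[of K])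
    finally show ?thesis .
  qed
  moreover have "(\<lambda>n. 2 * N2 {0..T} (\<lambda>t. dop (g n) t - f t) + 4 * K * N2 {-d..T} (\<lambda>t. z t - g n t) + 4 * K * N2 {-d..T} z)
     \<longlonglongrightarrow> 2 * 0 + 4 * K * 0 + 4 * K * N2 {-d..T} z"
    using g K by (intro tendsto_add ennreal_tendsto_cmult lim tendsto_const) (auto simp: approximates_def ennreal_mult_less_top)
  ultimately have "N2 {0..T} f \<le> 2 * 0 + 4 * K * 0 + 4 * K * N2 {-d..T} z"
    by (intro LIMSEQ_le_const[where a="N2 {0..T} f"]) auto
  then show ?thesis by (simp add: ennreal_mult K_def)
qed

text \<open>Values are chosen as L^2 limits, so they are determined only up to null sets. Linearity
  holds almost everywhere because both sides are limits of one and the same sequence.\<close>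

lemma extension_exists: "\<exists>L. is_delay_extension d T k L"
proof -
  obtain L where L: "\<And>z. z \<in> L2_space {-d..T} ==> L z \<in> L2_space {0..T}"
    and lim: "\<And>z g. z \<in> L2_space {-d..T} ==> approximates g z ==> (\<lambda>n. N2 {0..T} (\<lambda>t. dop (g n) t - L z t)) \<longlonglongrightarrow> 0"
    using ex_extension_value by metis
  have ex: "\<exists>g. approximates g z" if z: "z \<in> L2_space {-d..T}" for z
  proof -
    obtain g where "\<And>n. continuous_on UNIV (g n)" "\<And>n. N2 {-d..T} (\<lambda>x. z x - g n x) \<le> ennreal ((1/8)^n)"
      using ex_fast_approximation[OF z] by metis
    from fast_approximates[OF this] show ?thesis by blast
  qed
  have sL: "sbm {0..T} (L z)" if "z \<in> L2_space {-d..T}" for z using L[OF that] by (simp add: L2_space_iff)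
  have "AE t in lborel. t \<in> {0..T} \<longrightarrow> L (\<lambda>s. a * z s + b * w s) t = a * L z t + b * L w t"
    if z: "z \<in> L2_space {-d..T}" and w: "w \<in> L2_space {-d..T}" for z w a b
  proof -
    obtain g h where g: "approximates g z" and h: "approximates h w" using ex[OF z] ex[OF w] by blast
    have gc: "continuous_on {-d..T} (g n)" and hc: "continuous_on {-d..T} (h n)" for n
      using g h by (auto simp: approximates_def)
    let ?u = "\<lambda>s. a * z s + b * w s" and ?p = "\<lambda>n s. a * g n s + b * h n s"
    have u: "?u \<in> L2_space {-d..T}" by (rule L2_space_lincomb[OF z w])
    have p: "approximates ?p ?u" by (rule approximates_lincomb[OF z g w h])
    have pc: "continuous_on {-d..T} (?p n)" for n using p by (auto simp: approximates_def)
    have s1: "sbm {0..T} (\<lambda>t. a * L z t + b * L w t)" by (intro sbm_lincomb sL z w)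
    have lim2: "(\<lambda>n. N2 {0..T} (\<lambda>t. dop (?p n) t - (a * L z t + b * L w t))) \<longlonglongrightarrow> 0"
    proof (rule ennreal_null_sandwich)
      fix n
      have "N2 {0..T} (\<lambda>t. dop (?p n) t - (a * L z t + b * L w t)) =
        N2 {0..T} (\<lambda>t. a * (dop (g n) t - L z t) + b * (dop (h n) t - L w t))"
        by (rule N2_cong) (simp add: dop_lincomb[OF gc hc] algebra_simps)
      also have "... \<le> ennreal (2 * a\<^sup>2) * N2 {0..T} (\<lambda>t. dop (g n) t - L z t) + ennreal (2 * b\<^sup>2) * N2 {0..T} (\<lambda>t. dop (h n) t - L w t)"
        by (intro N2_lincomb_le sbm_diff sbm_dop gc hc sL z w)
      finally show "N2 {0..T} (\<lambda>t. dop (?p n) t - (a * L z t + b * L w t)) \<le>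
        ennreal (2 * a\<^sup>2) * N2 {0..T} (\<lambda>t. dop (g n) t - L z t) + ennreal (2 * b\<^sup>2) * N2 {0..T} (\<lambda>t. dop (h n) t - L w t)" .
    qed (use lim[OF z g] lim[OF w h] in auto)
    have "(\<lambda>n. N2 {0..T} (\<lambda>t. L ?u t - (a * L z t + b * L w t))) \<longlonglongrightarrow> 0"
    proof (rule ennreal_null_sandwich)
      show "N2 {0..T} (\<lambda>t. L ?u t - (a * L z t + b * L w t)) \<le> 2 * N2 {0..T} (\<lambda>t. dop (?p n) t - L ?u t) +
         2 * N2 {0..T} (\<lambda>t. dop (?p n) t - (a * L z t + b * L w t))" for n
        using N2_triangle[OF sL[OF u] sbm_dop[OF pc[of n]] s1]
        by (simp only: N2_commute[of "{0..T}" "L ?u"])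
    qed (use lim[OF u p] lim2 in auto)
    then have "N2 {0..T} (\<lambda>t. L ?u t - (a * L z t + b * L w t)) = 0" by (rule tendsto_const_ennreal_0)
    from N2_eq_0[OF sbm_diff[OF sL[OF u] s1] this] show ?thesis by simp
  qed
  moreover have "L2_norm {0..T} (L z) \<le> (2 * cL) * L2_norm {-d..T} z" if z: "z \<in> L2_space {-d..T}" for z
  proof -
    obtain g where g: "approximates g z" using ex[OF z] by blast
    have "N2 {0..T} (L z) \<le> ennreal (4 * cL\<^sup>2) * N2 {-d..T} z"
      by (rule N2_limit_le[OF z g L[OF z] lim[OF z g]])
    then have "ennreal ((L2_norm {0..T} (L z))\<^sup>2) \<le> ennreal (4 * cL\<^sup>2) * ennreal ((L2_norm {-d..T} z)\<^sup>2)"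
      by (simp only: L2_norm_sq[OF z] L2_norm_sq[OF L[OF z]])
    also have "... = ennreal ((2 * cL * L2_norm {-d..T} z)\<^sup>2)"
      by (simp add: numeral_mult_ennreal ennreal_mult[symmetric] power_mult_distrib)
    finally have "(L2_norm {0..T} (L z))\<^sup>2 \<le> (2 * cL * L2_norm {-d..T} z)\<^sup>2"
      by (rule ennreal_le_iff[OF zero_le_power2, THEN iffD1])
    then show ?thesis by (rule power2_le_imp_le) (simp add: cL0 L2_norm_nonneg)
  qed
  moreover have "AE t in lborel. t \<in> {0..T} \<longrightarrow> L z t = dop z t" if z: "continuous_on {-d..T} z" for z
  proof -
    note zL = L2_space_continuous[OF z]
    have "N2 {0..T} (\<lambda>t. dop z t - L z t) = 0"
      by (rule tendsto_const_ennreal_0, rule lim[OF zL approximates_const[OF z]])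
    from N2_eq_0[OF sbm_diff[OF sbm_dop[OF z] sL[OF zL]] this] show ?thesis by eventually_elim auto
  qed
  ultimately show ?thesis unfolding is_delay_extension_def using L by blast
qed

abbreviation "Lx \<equiv> delay_ext d T k"

lemma is_delay_extension_Lx: "is_delay_extension d T k Lx"
  unfolding delay_ext_def by (rule someI_ex[OF extension_exists])

lemma Lx_L2: "z \<in> L2_space {-d..T} ==> Lx z \<in> L2_space {0..T}"
  using is_delay_extension_Lx by (simp add: is_delay_extension_def)

lemma Lx_lincomb: "z \<in> L2_space {-d..T} ==> w \<in> L2_space {-d..T} ==>
    AE t in lborel. t \<in> {0..T} \<longrightarrow> Lx (\<lambda>s. a * z s + b * w s) t = a * Lx z t + b * Lx w t"
  using is_delay_extension_Lx by (simp add: is_delay_extension_def)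

lemma Lx_continuous: "continuous_on {-d..T} z ==> AE t in lborel. t \<in> {0..T} \<longrightarrow> Lx z t = dop z t"
  using is_delay_extension_Lx by (simp add: is_delay_extension_def)

text \<open>The operator picked by \<open>delay_ext\<close> is known only through its defining
  properties, with some constant \<open>C\<close> that may vary with the kernel path. Any such
  constant gives convergence along approximations, hence agreement with the limits above.\<close>

lemma Lx_limit:
  assumes z: "z \<in> L2_space {-d..T}" and g: "approximates g z"
  shows "(\<lambda>n. N2 {0..T} (\<lambda>t. dop (g n) t - Lx z t)) \<longlonglongrightarrow> 0"
proof -
  obtain C where C: "\<And>z. z \<in> L2_space {-d..T} ==> L2_norm {0..T} (Lx z) \<le> C * L2_norm {-d..T} z"
    using is_delay_extension_Lx unfolding is_delay_extension_def by blast
  have CN: "N2 {0..T} (Lx z) \<le> ennreal (C\<^sup>2) * N2 {-d..T} z" if "z \<in> L2_space {-d..T}" for z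
  proof -
    have "N2 {0..T} (Lx z) = ennreal ((L2_norm {0..T} (Lx z))\<^sup>2)" by (rule L2_norm_sq[OF Lx_L2[OF that], symmetric])
    also have "... \<le> ennreal ((C * L2_norm {-d..T} z)\<^sup>2)"
      by (intro ennreal_leI power_mono C that L2_norm_nonneg)
    also have "... = ennreal (C\<^sup>2) * N2 {-d..T} z"
      by (simp add: power_mult_distrib ennreal_mult L2_norm_sq[OF that])
    finally show ?thesis .
  qed
  have gc: "continuous_on {-d..T} (g n)" for n using g by (auto simp: approximates_def)
  note gL = L2_space_continuous[OF gc]
  show ?thesis
  proof (rule ennreal_null_sandwich)
    fix n
    have "AE t in lborel. t \<in> {0..T} \<longrightarrow> dop (g n) t - Lx z t = - Lx (\<lambda>s. 1 * z s + (-1) * g n s) t"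
      using Lx_lincomb[OF z gL[of n], of 1 "-1"] Lx_continuous[OF gc[of n]] by eventually_elim auto
    then have "N2 {0..T} (\<lambda>t. dop (g n) t - Lx z t) = N2 {0..T} (\<lambda>t. - Lx (\<lambda>s. 1 * z s + (-1) * g n s) t)"
      by (rule N2_cong_AE)
    also have "... = N2 {0..T} (Lx (\<lambda>s. 1 * z s + (-1) * g n s))" by (simp add: N2_def)
    also have "... \<le> ennreal (C\<^sup>2) * N2 {-d..T} (\<lambda>s. 1 * z s + (-1) * g n s)"
      by (rule CN[OF L2_space_lincomb[OF z gL]])
    \<comment> \<open>The summand \<open>0 * 0\<close> gives the bound the two-term shape of
      \<open>ennreal_null_sandwich\<close>.\<close>
    finally show "N2 {0..T} (\<lambda>t. dop (g n) t - Lx z t) \<le> ennreal (C\<^sup>2) * N2 {-d..T} (\<lambda>s. z s - g n s) + 0 * 0" by simp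
  qed (use g in \<open>auto simp: approximates_def\<close>)
qed

text \<open>Recovers an explicit constant in place of the unspecified one in
  \<open>is_delay_extension\<close>. This makes the bound uniform over the sample points.\<close>

lemma Lx_N2:
  assumes z: "z \<in> L2_space {-d..T}"
  shows "N2 {0..T} (Lx z) \<le> ennreal (4 * cL\<^sup>2) * N2 {-d..T} z"
proof -
  obtain g where "\<And>n. continuous_on UNIV (g n)" "\<And>n. N2 {-d..T} (\<lambda>x. z x - g n x) \<le> ennreal ((1/8)^n)"
    using ex_fast_approximation[OF z] by metis
  from fast_approximates[OF this] have g: "approximates g z" .
  show ?thesis by (rule N2_limit_le[OF z g Lx_L2[OF z] Lx_limit[OF z g]])
qed

end

section \<open>Indefinite integrals\<close>

abbreviation Lint :: "(real => real) => real => real => real" where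
  "Lint g a b \<equiv> LINT s:{a..b}|lborel. g s"

text \<open>The bridge to the gauge integral, from which additivity over intervals, continuity of
  the indefinite integral and the fundamental theorem of calculus are taken.\<close>

lemma Lint_eq_integral:
  assumes "set_integrable lborel {a..b} (g :: real => real)"
  shows "Lint g a b = integral {a..b} g" "g integrable_on {a..b}"
  using set_borel_integral_eq_integral[OF assms] by auto

lemma set_integrable_sub:
  "set_integrable lborel {a..b} (g :: real => real) ==> a \<le> a' ==> b' \<le> b ==> set_integrable lborel {a'..b'} g"
  by (rule set_integrable_subset) auto

lemma Lint_split:
  assumes "set_integrable lborel {a..c} (g :: real => real)" "a \<le> b" "b \<le> c"
  shows "Lint g a c = Lint g a b + Lint g b c"
proof -
  have "set_integrable lborel {a..b} g" "set_integrable lborel {b..c} g"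
    using assms by (auto intro: set_integrable_sub)
  then show ?thesis
    using assms Henstock_Kurzweil_Integration.integral_combine[OF assms(2,3), of g] by (simp add: Lint_eq_integral)
qed

lemma continuous_on_Lint:
  assumes "set_integrable lborel {a..b} (g :: real => real)"
  shows "continuous_on {a..b} (\<lambda>t. Lint g a t)"
proof -
  have "continuous_on {a..b} (\<lambda>t. integral {a..t} g)"
    by (rule indefinite_integral_continuous_1) (rule Lint_eq_integral[OF assms])
  then show ?thesis
  proof (rule continuous_on_eq)
    show "integral {a..t} g = Lint g a t" if "t \<in> {a..b}" for t
      using that Lint_eq_integral(1)[OF set_integrable_sub[OF assms, of a t]] by auto
  qed
qed

lemma Lint_diff:
  fixes f g :: "real => real"
  assumes "set_integrable lborel {a..b} f" "set_integrable lborel {a..b} g"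
  shows "Lint (\<lambda>s. f s - g s) a b = Lint f a b - Lint g a b"
  by (rule set_integral_diff[OF assms])

lemma set_integrable_bounded:
  fixes g :: "real => real"
  assumes "sbm {a..b} g" "\<And>s. s \<in> {a..b} ==> \<bar>g s\<bar> \<le> B"
  shows "set_integrable lborel {a..b} g"
  unfolding set_integrable_def
proof (rule Bochner_Integration.integrable_bound)
  show "integrable lborel (\<lambda>s. indicator {a..b} s *\<^sub>R B)"
    using emeasure_lborel_cbox_finite by (intro integrable_scaleR_left integrable_real_indicator) (auto simp: emeasure_lborel_Icc_eq)
  show "(\<lambda>x. indicator {a..b} x *\<^sub>R g x) \<in> borel_measurable lborel"
    using assms(1) by (simp add: set_borel_measurable_def)
  show "AE x in lborel. norm (indicator {a..b} x *\<^sub>R g x) \<le> norm (indicator {a..b} x *\<^sub>R B)"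
    using assms(2) by (intro AE_I2) (force simp: indicator_def)
qed

lemma set_integrable_continuous_mult:
  fixes g h :: "real => real"
  assumes g: "set_integrable lborel {a..b} g" and h: "continuous_on {a..b} h"
  shows "set_integrable lborel {a..b} (\<lambda>s. h s * g s)"
proof -
  obtain S where S: "S \<ge> 0" "\<And>x. x \<in> {a..b} ==> \<bar>h x\<bar> \<le> S" using continuous_on_bounded[OF h] by blast
  have hm: "(\<lambda>x. indicator {a..b} x * h x) \<in> borel_measurable lborel"
    using sbm_continuous[OF _ h] by (simp add: sbm_iff)
  have gm: "(\<lambda>x. indicator {a..b} x *\<^sub>R g x) \<in> borel_measurable lborel" using g by (auto simp: set_integrable_def)
  show ?thesis unfolding set_integrable_def
  proof (rule Bochner_Integration.integrable_bound)
    show "integrable lborel (\<lambda>s. S * (indicator {a..b} s *\<^sub>R g s))"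
      using g unfolding set_integrable_def by (intro integrable_mult_right)
    have "(\<lambda>x. (indicator {a..b} x * h x) * (indicator {a..b} x *\<^sub>R g x)) \<in> borel_measurable lborel"
      by (rule borel_measurable_times[OF hm gm])
    also have "(\<lambda>x. (indicator {a..b} x * h x) * (indicator {a..b} x *\<^sub>R g x)) = (\<lambda>x. indicator {a..b} x *\<^sub>R (h x * g x))"
      by (auto simp: indicator_def)
    finally show "(\<lambda>x. indicator {a..b} x *\<^sub>R (h x * g x)) \<in> borel_measurable lborel" .
    show "AE x in lborel. norm (indicator {a..b} x *\<^sub>R (h x * g x)) \<le> norm (S * (indicator {a..b} x *\<^sub>R g x))"
      using S by (intro AE_I2) (auto simp: indicator_def abs_mult intro!: mult_right_mono)
  qed
qed

lemma Lint_abs_le: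
  fixes g h :: "real => real"
  assumes "set_integrable lborel {a..b} g" "set_integrable lborel {a..b} h" "\<And>s. s \<in> {a..b} ==> \<bar>g s\<bar> \<le> h s"
  shows "\<bar>Lint g a b\<bar> \<le> Lint h a b"
proof -
  have "norm (Lint g a b) \<le> Lint h a b"
    unfolding set_lebesgue_integral_def
  proof (rule Bochner_Integration.integral_norm_bound_integral)
    show "norm (indicator {a..b} x *\<^sub>R g x) \<le> indicator {a..b} x *\<^sub>R h x" for x
      using assms(3) by (simp add: indicator_def)
  qed (use assms(1,2) in \<open>simp_all add: set_integrable_def\<close>)
  then show ?thesis by simp
qed

lemma Lint_mono:
  fixes g h :: "real => real"
  assumes "set_integrable lborel {a..b} g" "set_integrable lborel {a..b} h" "\<And>s. s \<in> {a..b} ==> g s \<le> h s"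
  shows "Lint g a b \<le> Lint h a b"
  using assms by (rule set_integral_mono)

lemma Lint_nonneg: "(\<And>s. 0 \<le> g s) ==> 0 \<le> Lint g a b"
  unfolding set_lebesgue_integral_def by (intro integral_nonneg_AE AE_I2) (auto simp: indicator_def)

lemma Lint_subset_mono:
  assumes g: "set_integrable lborel {a..b} (g :: real => real)" and nn: "\<And>s. 0 \<le> g s"
    and le: "a \<le> a'" "a' \<le> b'" "b' \<le> b"
  shows "Lint g a' b' \<le> Lint g a b"
proof -
  have "Lint g a b = Lint g a b' + Lint g b' b" using le by (intro Lint_split g) auto
  moreover have "Lint g a b' = Lint g a a' + Lint g a' b'" using le by (intro Lint_split set_integrable_sub[OF g]) auto
  moreover have "Lint g a a' \<ge> 0" "Lint g b' b \<ge> 0" by (rule Lint_nonneg[OF nn])+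
  ultimately show ?thesis by simp
qed

text \<open>Also covers constants, in the form \<open>C * exp (0 * s)\<close> that appears in
  several proofs below.\<close>

lemma set_integrable_exp: "set_integrable lborel {a..b} (\<lambda>s. C * exp (l * s) :: real)"
  by (rule borel_integrable_atLeastAtMost') (intro continuous_intros)

text \<open>The gain \<open>1 / l\<close> turns a Volterra inequality into a contraction in an
  exponentially weighted norm, both for the Picard map and in the Gronwall argument.\<close>

lemma Lint_exp_le:
  assumes "l > 0" "t \<ge> 0" "C \<ge> 0" shows "Lint (\<lambda>s. C * exp (l * s)) 0 t \<le> C * exp (l * t) / l"
proof -
  have "((\<lambda>s. C * exp (l * s) / l) has_real_derivative C * exp (l * s)) (at s within {0..t})" for s
    using assms(1) by (auto intro!: derivative_eq_intros)
  then have "((\<lambda>s. C * exp (l * s)) has_integral (C * exp (l * t) / l - C * exp (l * 0) / l)) {0..t}"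
    using assms(2) by (intro fundamental_theorem_of_calculus)
      (simp_all only: has_real_derivative_iff_has_vector_derivative)
  from integral_unique[OF this] have "Lint (\<lambda>s. C * exp (l * s)) 0 t = C * exp (l * t) / l - C / l"
    by (simp only: Lint_eq_integral(1)[OF set_integrable_exp]) simp
  then show ?thesis using assms by simp
qed

section \<open>The pathwise equation\<close>

definition ext0 :: "(real => real) => real => real" where "ext0 w s = (if s < 0 then 0 else w s)"

lemma continuous_on_ext0:
  assumes "continuous_on {0..T} w" "w 0 = 0" shows "continuous_on {-d..T} (ext0 w)"
proof -
  have "continuous_on ({-d..0} \<union> {0..T}) (\<lambda>s. if s \<le> 0 then 0 else w s)"
    using assms by (intro continuous_on_cases) auto
  then show ?thesis
  proof (rule continuous_on_eq[OF continuous_on_subset])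
    fix s assume "s \<in> {-d..T}" then show "(if s \<le> 0 then 0 else w s) = ext0 w s"
      using assms(2) by (cases "s = 0") (auto simp: ext0_def)
  qed auto
qed

text \<open>\<open>E\<close> stands for one path of the stochastic exponential; solving the equation
  uses of it the three properties listed here.\<close>

locale pathwise_equation = delay_kernel +
  fixes \<mu> :: real and E :: "real => real"
  assumes E_cont: "continuous_on {0..T} E" and E_pos: "\<And>t. t \<in> {0..T} ==> E t > 0" and E_0: "E 0 = 1"
begin

text \<open>The part of the drift that depends on the unknown \<open>w\<close>, the solution minus
  its initial value. The part coming from the datum is collected in the forcing
  \<open>f\<close>.\<close>

definition drift :: "(real => real) => real => real" where
  "drift w t = \<mu> * w t + dop (ext0 w) t"

definition path :: "(real => real) => bool" where
  "path w \<longleftrightarrow> continuous_on {0..T} w \<and> w 0 = 0"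

lemma path_ext0: "path w ==> continuous_on {-d..T} (ext0 w)"
  by (simp add: path_def continuous_on_ext0)

lemma drift_bound:
  assumes w: "path w" and t: "t \<in> {0..T}" and S: "\<And>s. s \<in> {0..t} ==> \<bar>w s\<bar> \<le> S"
  shows "\<bar>drift w t\<bar> \<le> (\<bar>\<mu>\<bar> + c) * S"
proof -
  have "S \<ge> 0" using S[of t] t by auto
  then have "\<bar>dop (ext0 w) t\<bar> \<le> c * S" using S by (intro dop_bound[OF path_ext0[OF w] t]) (auto simp: ext0_def)
  moreover have "\<bar>\<mu> * w t\<bar> \<le> \<bar>\<mu>\<bar> * S" using S[of t] t by (simp add: abs_mult mult_left_mono)
  ultimately show ?thesis unfolding drift_def distrib_right by linarith
qed

lemma path_diff: "path v ==> path w ==> path (\<lambda>s. v s - w s)"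
  by (auto simp: path_def intro!: continuous_intros)

lemma drift_diff:
  assumes "path v" "path w" "t \<in> {0..T}"
  shows "drift (\<lambda>s. v s - w s) t = drift v t - drift w t"
proof -
  have "dop (ext0 (\<lambda>s. v s - w s)) t = dop (\<lambda>s. ext0 v s - ext0 w s) t"
    by (rule dop_cong[OF assms(3)]) (simp add: ext0_def)
  then show ?thesis
    using dop_diff[OF path_ext0[OF assms(1)] path_ext0[OF assms(2)] assms(3)]
    by (simp add: drift_def algebra_simps)
qed

lemma drift_integrable: assumes w: "path w" shows "set_integrable lborel {0..T} (drift w)"
proof -
  have wc: "continuous_on {0..T} w" using w by (simp add: path_def)
  obtain S where S: "\<And>s. s \<in> {0..T} ==> \<bar>w s\<bar> \<le> S" using continuous_on_bounded[OF wc] by blast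
  show ?thesis
  proof (rule set_integrable_bounded)
    have "drift w = (\<lambda>t. \<mu> * w t + 1 * dop (ext0 w) t)" by (simp add: fun_eq_iff drift_def)
    then show "sbm {0..T} (drift w)"
      using sbm_lincomb[OF sbm_continuous[OF _ wc] sbm_dop[OF path_ext0[OF w]], of \<mu> 1] by simp
    show "\<bar>drift w s\<bar> \<le> (\<bar>\<mu>\<bar> + c) * S" if "s \<in> {0..T}" for s
      by (rule drift_bound[OF w that]) (use S that in auto)
  qed
qed

lemma div_E_integrable:
  assumes "set_integrable lborel {0..T} f" shows "set_integrable lborel {0..T} (\<lambda>s. f s / E s)"
proof -
  have "continuous_on {0..T} (\<lambda>s. 1 / E s)" using E_pos by (intro continuous_intros E_cont) force
  from set_integrable_continuous_mult[OF assms this] show ?thesis by simp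
qed

lemma integrand_integrable:
  assumes f: "set_integrable lborel {0..T} f" and w: "path w"
  shows "set_integrable lborel {0..T} (\<lambda>s. (f s + drift w s) / E s)"
  by (intro div_E_integrable set_integral_add f drift_integrable w)

text \<open>Variation of constants: the integral is \<open>u - x0\<close> for the path
  \<open>u\<close> with initial value \<open>x0\<close> and derivative
  \<open>(f + drift w) / E\<close>, and the formula is \<open>E * u - x0\<close>.\<close>

definition Picard :: "real => (real => real) => (real => real) => real => real" where
  "Picard x0 f w t = E t * (x0 + Lint (\<lambda>s. (f s + drift w s) / E s) 0 t) - x0"

definition solves :: "real => (real => real) => (real => real) => bool" where
  "solves x0 f w \<longleftrightarrow> path w \<and> (\<forall>t\<in>{0..T}. w t = Picard x0 f w t)"

lemma path_Picard:
  assumes f: "set_integrable lborel {0..T} f" and w: "path w" shows "path (Picard x0 f w)"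
  unfolding path_def Picard_def
proof (intro conjI continuous_intros E_cont continuous_on_Lint integrand_integrable f w)
  have "Lint (\<lambda>s. (f s + drift w s) / E s) 0 0 = integral {0..0} (\<lambda>s. (f s + drift w s) / E s)"
    using T by (intro Lint_eq_integral set_integrable_sub[OF integrand_integrable[OF f w]]) auto
  then show "E 0 * (x0 + Lint (\<lambda>s. (f s + drift w s) / E s) 0 0) - x0 = 0" by (simp add: E_0)
qed

lemma E_bounds: obtains Emax Emin where "Emin > 0" "\<And>t. t \<in> {0..T} ==> E t \<le> Emax" "\<And>t. t \<in> {0..T} ==> Emin \<le> E t"
proof -
  obtain t1 where "t1 \<in> {0..T}" "\<And>t. t \<in> {0..T} ==> E t \<le> E t1"
    using continuous_attains_sup[of "{0..T}" E] E_cont T by auto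
  moreover obtain t2 where "t2 \<in> {0..T}" "\<And>t. t \<in> {0..T} ==> E t2 \<le> E t"
    using continuous_attains_inf[of "{0..T}" E] E_cont T by auto
  ultimately show ?thesis using that E_pos by blast
qed

text \<open>The bound \<open>h s\<close> is required to dominate the difference on all of [0,s],
  since the delay term looks back. The constant \<open>K\<close> is chosen before the data, so that
  one constant serves every iteration step.\<close>

lemma Picard_diff_le:
  obtains K where "K \<ge> 0"
    "\<And>x0 (f::real=>real) v w t (h::real=>real). set_integrable lborel {0..T} f ==> path v ==> path w ==> t \<in> {0..T} ==>
       set_integrable lborel {0..T} h ==>
       (\<And>s r. s \<in> {0..t} ==> r \<in> {0..s} ==> \<bar>v r - w r\<bar> \<le> h s) ==>
       \<bar>Picard x0 f v t - Picard x0 f w t\<bar> \<le> K * Lint h 0 t"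
proof -
  obtain Emax Emin where E: "Emin > 0" "\<And>t. t \<in> {0..T} ==> E t \<le> Emax" "\<And>t. t \<in> {0..T} ==> Emin \<le> E t"
    by (rule E_bounds) blast
  have Em: "Emax > 0" using E(2)[of 0] E_0 T by auto
  let ?a = "(\<bar>\<mu>\<bar> + c) / Emin"
  have a0: "?a \<ge> 0" using E(1) c0 by simp
  show ?thesis
  proof (rule that[of "Emax * ?a"])
    show "0 \<le> Emax * ?a" using Em a0 by (intro mult_nonneg_nonneg) auto
    fix x0 t and f v w h :: "real => real"
    assume f: "set_integrable lborel {0..T} (f::real=>real)" and v: "path v" and w: "path w" and t: "t \<in> {0..T}"
      and h: "set_integrable lborel {0..T} h" and vw: "\<And>s r. s \<in> {0..t} ==> r \<in> {0..s} ==> \<bar>v r - w r\<bar> \<le> h s"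
    have iv: "set_integrable lborel {0..t} (\<lambda>s. (f s + drift v s) / E s)"
      and iw: "set_integrable lborel {0..t} (\<lambda>s. (f s + drift w s) / E s)"
      and ih: "set_integrable lborel {0..t} h"
      using t by (auto intro!: set_integrable_sub[OF integrand_integrable] set_integrable_sub[OF h] f v w)
    have "\<bar>Lint (\<lambda>s. (f s + drift v s) / E s - (f s + drift w s) / E s) 0 t\<bar> \<le> Lint (\<lambda>s. ?a * h s) 0 t"
    proof (rule Lint_abs_le)
      fix s assume s: "s \<in> {0..t}"
      then have sT: "s \<in> {0..T}" using t by auto
      have "(f s + drift v s) / E s - (f s + drift w s) / E s = drift (\<lambda>s. v s - w s) s / E s"
        by (simp add: drift_diff[OF v w sT] diff_divide_distrib add_divide_distrib)
      also have "\<bar>...\<bar> = \<bar>drift (\<lambda>s. v s - w s) s\<bar> / E s" using E_pos[OF sT] by simp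
      also have "... \<le> ((\<bar>\<mu>\<bar> + c) * h s) / E s"
        using E_pos[OF sT] vw[OF s] by (intro divide_right_mono drift_bound[OF path_diff[OF v w] sT]) auto
      also have "... \<le> ((\<bar>\<mu>\<bar> + c) * h s) / Emin"
        using E(1) E(3)[OF sT] c0 vw[OF s, of s] s by (intro divide_left_mono mult_nonneg_nonneg mult_pos_pos E_pos[OF sT]) auto
      finally show "\<bar>(f s + drift v s) / E s - (f s + drift w s) / E s\<bar> \<le> ?a * h s" by simp
    qed (intro set_integral_diff iv iw set_integrable_mult_right ih)+
    also have "... = ?a * Lint h 0 t" by (rule set_integral_mult_right)
    finally have 1: "\<bar>Lint (\<lambda>s. (f s + drift v s) / E s) 0 t - Lint (\<lambda>s. (f s + drift w s) / E s) 0 t\<bar> \<le> ?a * Lint h 0 t"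
      by (simp add: Lint_diff[OF iv iw])
    have "\<bar>Picard x0 f v t - Picard x0 f w t\<bar> = E t * \<bar>Lint (\<lambda>s. (f s + drift v s) / E s) 0 t - Lint (\<lambda>s. (f s + drift w s) / E s) 0 t\<bar>"
      using E_pos[OF t] by (simp add: Picard_def abs_mult right_diff_distrib[symmetric] distrib_left)
    also have "... \<le> Emax * (?a * Lint h 0 t)"
      using 1 E(2)[OF t] Em by (intro mult_mono) auto
    finally show "\<bar>Picard x0 f v t - Picard x0 f w t\<bar> \<le> Emax * ?a * Lint h 0 t" by (simp only: mult.assoc)
  qed
qed

primrec iter :: "real => (real => real) => nat => real => real" where
  "iter x0 f 0 = (\<lambda>_. 0)"
| "iter x0 f (Suc n) = Picard x0 f (iter x0 f n)"

text \<open>A limit of explicit iterates rather than a choice among solutions: this is what lets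
  adaptedness pass from the iterates to the solution.\<close>

definition sol :: "real => (real => real) => real => real" where
  "sol x0 f t = lim (\<lambda>n. iter x0 f n t)"

lemma path_iter: "set_integrable lborel {0..T} f ==> path (iter x0 f n)"
  by (induction n) (auto simp: path_Picard, simp add: path_def)

lemma iter_converges:
  assumes f: "set_integrable lborel {0..T} f"
  shows "uniform_limit {0..T} (iter x0 f) (sol x0 f) sequentially" and "solves x0 f (sol x0 f)"
proof -
  obtain K where K: "K \<ge> 0"
    "\<And>x0 (f::real=>real) v w t (h::real=>real). set_integrable lborel {0..T} f ==> path v ==> path w ==> t \<in> {0..T} ==>
       set_integrable lborel {0..T} h ==>
       (\<And>s r. s \<in> {0..t} ==> r \<in> {0..s} ==> \<bar>v r - w r\<bar> \<le> h s) ==>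
       \<bar>Picard x0 f v t - Picard x0 f w t\<bar> \<le> K * Lint h 0 t"
    by (rule Picard_diff_le) blast
  \<comment> \<open>Then \<open>K / l\<close> is at most 1/2, so each step halves the distance in
    the norm weighted by \<open>exp (- l * t)\<close>; the summand 1 keeps \<open>l\<close> positive
    when \<open>K\<close> is 0.\<close>
  define l where "l = 2 * K + 1"
  have l: "l > 0" "K / l \<le> 1/2" using K(1) by (auto simp: l_def field_simps)
  have ip: "path (iter x0 f n)" for n by (rule path_iter[OF f])
  have "continuous_on {0..T} (iter x0 f 1)" using ip[of 1] by (simp add: path_def)
  then obtain D where D: "D \<ge> 0" "\<And>t. t \<in> {0..T} ==> \<bar>iter x0 f 1 t\<bar> \<le> D" using continuous_on_bounded by blast
  have step: "\<bar>iter x0 f (Suc n) t - iter x0 f n t\<bar> \<le> D * (1/2)^n * exp (l * t)" if "t \<in> {0..T}" for n t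
    using that
  proof (induction n arbitrary: t)
    case 0
    have "\<bar>iter x0 f (Suc 0) t - iter x0 f 0 t\<bar> \<le> D * 1" using D(2)[OF 0] by simp
    also have "... \<le> D * exp (l * t)" using D(1) l 0 by (intro mult_left_mono) auto
    finally show ?case by simp
  next
    case (Suc n)
    have "\<bar>Picard x0 f (iter x0 f (Suc n)) t - Picard x0 f (iter x0 f n) t\<bar> \<le> K * Lint (\<lambda>s. D * (1/2)^n * exp (l * s)) 0 t"
    proof (rule K(2)[OF f ip ip Suc.prems set_integrable_exp])
      fix s r assume sr: "s \<in> {0..t}" "r \<in> {0..s}"
      have "\<bar>iter x0 f (Suc n) r - iter x0 f n r\<bar> \<le> D * (1/2)^n * exp (l * r)" using sr Suc.prems by (intro Suc.IH) auto
      also have "... \<le> D * (1/2)^n * exp (l * s)" using sr D l by (intro mult_left_mono) auto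
      finally show "\<bar>iter x0 f (Suc n) r - iter x0 f n r\<bar> \<le> D * (1/2)^n * exp (l * s)" .
    qed
    also have "... \<le> K * (D * (1/2)^n * exp (l * t) / l)"
      using Suc.prems l D K(1) by (intro mult_left_mono Lint_exp_le) auto
    also have "... = (K / l) * (D * (1/2)^n * exp (l * t))" by simp
    also have "... \<le> (1/2) * (D * (1/2)^n * exp (l * t))" using l(2) D by (intro mult_right_mono) auto
    finally show ?case by simp
  qed
  define B where "B = D * exp (l * T)"
  have B: "B \<ge> 0" using D by (simp add: B_def)
  have stepB: "\<bar>iter x0 f (Suc n) t - iter x0 f n t\<bar> \<le> B * (1/2)^n" if t: "t \<in> {0..T}" for n t
  proof -
    have "D * (1/2)^n * exp (l * t) \<le> D * (1/2)^n * exp (l * T)" using t D l by (intro mult_left_mono) auto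
    then show ?thesis using step[OF t, of n] by (simp add: B_def mult_ac)
  qed
  have far: "\<bar>iter x0 f (n + j) t - iter x0 f n t\<bar> \<le> 2 * B * (1/2)^n" if t: "t \<in> {0..T}" for n j t
  proof -
    \<comment> \<open>Subtracting the remaining tail of the geometric series makes the bound
      inductive in \<open>j\<close>.\<close>
    have "\<bar>iter x0 f (n + j) t - iter x0 f n t\<bar> \<le> 2 * B * (1/2)^n - 2 * B * (1/2)^(n + j)"
    proof (induction j)
      case (Suc j)
      then show ?case using stepB[OF t, of "n + j"] by simp
    qed simp
    moreover have "0 \<le> 2 * B * (1/2)^(n + j)" using B by simp
    ultimately show ?thesis by linarith
  qed
  have conv: "(\<lambda>n. iter x0 f n t) \<longlonglongrightarrow> sol x0 f t" if t: "t \<in> {0..T}" for t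
  proof -
    have "summable (\<lambda>n. iter x0 f (Suc n) t - iter x0 f n t)"
      by (rule summable_comparison_test'[where N=0 and g="\<lambda>n. B * (1/2)^n"])
         (use stepB[OF t] in \<open>auto intro!: summable_mult summable_geometric\<close>)
    from summable_LIMSEQ[OF this] have "convergent (\<lambda>n. iter x0 f n t - iter x0 f 0 t)"
      unfolding sum_lessThan_telescope[of "\<lambda>n. iter x0 f n t"] by (auto simp: convergent_def)
    then have "convergent (\<lambda>n. iter x0 f n t)" by simp
    then show ?thesis by (simp add: sol_def convergent_LIMSEQ_iff)
  qed
  have near: "\<bar>sol x0 f t - iter x0 f n t\<bar> \<le> 2 * B * (1/2)^n" if t: "t \<in> {0..T}" for n t
  proof (rule LIMSEQ_le_const2)
    show "(\<lambda>m. \<bar>iter x0 f m t - iter x0 f n t\<bar>) \<longlonglongrightarrow> \<bar>sol x0 f t - iter x0 f n t\<bar>"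
      by (intro tendsto_intros conv t)
    show "\<exists>N. \<forall>m\<ge>N. \<bar>iter x0 f m t - iter x0 f n t\<bar> \<le> 2 * B * (1/2)^n"
      using far[OF t, of n] by (metis le_add_diff_inverse)
  qed
  have small: "(\<lambda>n. 2 * B * (1/2::real)^n) \<longlonglongrightarrow> 0"
    by (intro tendsto_mult_right_zero LIMSEQ_power_zero) simp
  show ul: "uniform_limit {0..T} (iter x0 f) (sol x0 f) sequentially"
  proof (rule uniform_limitI)
    fix e :: real assume "e > 0"
    with small have "\<forall>\<^sub>F n in sequentially. 2 * B * (1/2::real)^n < e" by (auto intro: order_tendstoD)
    then show "\<forall>\<^sub>F n in sequentially. \<forall>t\<in>{0..T}. dist (iter x0 f n t) (sol x0 f t) < e"
    proof eventually_elim
      case (elim n)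
      show ?case using near[of _ n] elim by (fastforce simp: dist_real_def abs_minus_commute)
    qed
  qed
  have "continuous_on {0..T} (sol x0 f)"
    by (rule uniform_limit_theorem[OF _ ul]) (use ip in \<open>auto simp: path_def\<close>)
  moreover have "(\<lambda>n. iter x0 f n 0) \<longlonglongrightarrow> sol x0 f 0" using T by (intro conv) auto
  then have "sol x0 f 0 = 0" using ip by (simp add: path_def LIMSEQ_const_iff)
  ultimately have sp: "path (sol x0 f)" by (simp add: path_def)
  show "solves x0 f (sol x0 f)" unfolding solves_def
  proof (intro conjI ballI sp)
    fix t assume t: "t \<in> {0..T}"
    have "\<bar>Picard x0 f (sol x0 f) t - iter x0 f (Suc n) t\<bar> \<le> K * T * (2 * B * (1/2)^n)" for n
    proof -
      have "\<bar>Picard x0 f (sol x0 f) t - Picard x0 f (iter x0 f n) t\<bar> \<le> K * Lint (\<lambda>s. 2 * B * (1/2)^n * exp (0 * s)) 0 t"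
        by (rule K(2)[OF f sp ip t set_integrable_exp]) (use near t in auto)
      also have "... = K * (t * (2 * B * (1/2)^n))"
        using t by (subst Lint_eq_integral(1)[OF set_integrable_exp]) simp
      also have "... \<le> K * (T * (2 * B * (1/2)^n))" using t K(1) B by (intro mult_left_mono mult_right_mono) auto
      finally show ?thesis by simp
    qed
    then have bnd: "\<forall>\<^sub>F n in sequentially. norm (Picard x0 f (sol x0 f) t - iter x0 f (Suc n) t) \<le> K * T * (2 * B * (1/2)^n)"
      by (intro always_eventually allI) (simp only: real_norm_def)
    have "(\<lambda>n. Picard x0 f (sol x0 f) t - iter x0 f (Suc n) t) \<longlonglongrightarrow> 0"
      by (rule Lim_null_comparison[OF bnd tendsto_mult_right_zero[OF small]])
    moreover have "(\<lambda>n. Picard x0 f (sol x0 f) t - iter x0 f (Suc n) t) \<longlonglongrightarrow> Picard x0 f (sol x0 f) t - sol x0 f t"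
      using conv[OF t] by (intro tendsto_intros LIMSEQ_Suc)
    ultimately show "sol x0 f t = Picard x0 f (sol x0 f) t" using LIMSEQ_unique by fastforce
  qed
qed

text \<open>Linearity of the equation. It reduces the dependence on the data to the growth estimate
  that follows.\<close>

lemma solves_diff:
  assumes f: "set_integrable lborel {0..T} f" and g: "set_integrable lborel {0..T} g"
    and v: "solves x0 f v" and w: "solves y0 g w"
  shows "solves (x0 - y0) (\<lambda>s. f s - g s) (\<lambda>s. v s - w s)"
  unfolding solves_def
proof (intro conjI ballI)
  have pv: "path v" and pw: "path w" using v w by (auto simp: solves_def)
  show "path (\<lambda>s. v s - w s)" by (rule path_diff[OF pv pw])
  fix t assume t: "t \<in> {0..T}"
  have iv: "set_integrable lborel {0..t} (\<lambda>s. (f s + drift v s) / E s)"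
    and iw: "set_integrable lborel {0..t} (\<lambda>s. (g s + drift w s) / E s)"
    using t by (auto intro!: set_integrable_sub[OF integrand_integrable] f g pv pw)
  have "Lint (\<lambda>s. (f s - g s + drift (\<lambda>s. v s - w s) s) / E s) 0 t =
    Lint (\<lambda>s. (f s + drift v s) / E s - (g s + drift w s) / E s) 0 t"
    using t by (intro set_lebesgue_integral_cong) (auto simp: drift_diff[OF pv pw] field_simps diff_divide_distrib)
  then have L: "Lint (\<lambda>s. (f s - g s + drift (\<lambda>s. v s - w s) s) / E s) 0 t =
    Lint (\<lambda>s. (f s + drift v s) / E s) 0 t - Lint (\<lambda>s. (g s + drift w s) / E s) 0 t"
    by (simp only: Lint_diff[OF iv iw])
  have eq: "v t = Picard x0 f v t" "w t = Picard y0 g w t" using v w t by (auto simp: solves_def)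
  show "v t - w t = Picard (x0 - y0) (\<lambda>s. f s - g s) (\<lambda>s. v s - w s) t"
    unfolding eq Picard_def L by (simp add: right_diff_distrib distrib_left)
qed

text \<open>On a single cell \<open>E\<close> grows at most by the factor \<open>R\<close>, and the
  cell is so short that the drift contributes at most half of the running maximum, which can be
  absorbed on the left. The resulting factor per cell is then multiplied over the \<open>N\<close>
  cells.\<close>

lemma solves_growth:
  assumes f: "set_integrable lborel {0..T} f" and w: "solves x0 f w" and N: "N > 0" and R: "R \<ge> 1"
    and osc: "\<And>(i::nat) s t. i < N ==> s \<in> {T / N * i..T / N * (i + 1)} ==> t \<in> {s..T / N * (i + 1)} ==> E t \<le> R * E s"
    and fine: "R * (T / N) * (\<bar>\<mu>\<bar> + c) \<le> 1/2"
    and t: "t \<in> {0..T}"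
  shows "\<bar>w t\<bar> \<le> (5 * R)^N * (\<bar>x0\<bar> + Lint (\<lambda>s. \<bar>f s\<bar>) 0 T)"
proof -
  have pw: "path w" using w by (auto simp: solves_def)
  have eq: "w t = Picard x0 f w t" if "t \<in> {0..T}" for t using w that by (auto simp: solves_def)
  define h where "h = T / N"
  have h: "h > 0" "h * N = T" using T N by (auto simp: h_def)
  have af: "set_integrable lborel {0..T} (\<lambda>s. \<bar>f s\<bar>)" using set_integrable_abs[OF f] .
  define X where "X = \<bar>x0\<bar> + Lint (\<lambda>s. \<bar>f s\<bar>) 0 T"
  have F0: "Lint (\<lambda>s. \<bar>f s\<bar>) 0 T \<ge> 0" by (rule Lint_nonneg) simp
  have X: "X \<ge> 0" "\<bar>x0\<bar> \<le> X" "Lint (\<lambda>s. \<bar>f s\<bar>) 0 T \<le> X - \<bar>x0\<bar>" using F0 by (auto simp: X_def)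
  \<comment> \<open>What is multiplied by \<open>5 * R\<close> is the running maximum plus
    \<open>X\<close>, hence the subtracted \<open>X\<close>. Absorption gives
    \<open>4 * R * (X + S0)\<close> for the maximum, and the added \<open>X\<close> is at most
    \<open>R * (X + S0)\<close>.\<close>
  have main: "\<forall>t\<in>{0..h * real i}. \<bar>w t\<bar> \<le> (5 * R)^i * X - X" if "i \<le> N" for i
    using that
  proof (induction i)
    case 0
    then show ?case using pw by (auto simp: path_def)
  next
    case (Suc i)
    define a b where "a = h * real i" and "b = h * real (Suc i)"
    have IH: "\<And>t. t \<in> {0..a} ==> \<bar>w t\<bar> \<le> (5 * R)^i * X - X" using Suc by (auto simp: a_def)
    have ab: "0 \<le> a" "a \<le> b" "b - a = h" using h by (auto simp: a_def b_def algebra_simps)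
    have bT: "b \<le> T" using Suc.prems h unfolding b_def by (metis mult_le_cancel_left_pos of_nat_le_iff)
    define S0 where "S0 = (5 * R)^i * X - X"
    have "continuous_on {0..b} (\<lambda>t. \<bar>w t\<bar>)" using pw bT unfolding path_def
      by (intro continuous_intros) (auto elim: continuous_on_subset)
    \<comment> \<open>The maximum is taken over [0,b] and not only over the new cell, because the
      drift in the cell depends on the whole past. If it is attained before \<open>a\<close>, the
      induction hypothesis suffices.\<close>
    then obtain r where r: "r \<in> {0..b}" and max: "\<And>t. t \<in> {0..b} ==> \<bar>w t\<bar> \<le> \<bar>w r\<bar>"
      using continuous_attains_sup[of "{0..b}" "\<lambda>t. \<bar>w t\<bar>"] ab by auto
    have S0: "S0 \<ge> 0" using order_trans[OF abs_ge_zero IH[of 0]] ab by (simp add: S0_def)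
    have "\<bar>w r\<bar> \<le> 4 * R * (X + S0)"
    proof (cases "r \<le> a")
      case True
      then have "\<bar>w r\<bar> \<le> S0" using IH[of r] r by (auto simp: S0_def)
      also have "S0 \<le> X + S0" using X by simp
      also have "... \<le> 4 * R * (X + S0)" using R X S0 by (intro mult_le_cancel_right1[THEN iffD2]) auto
      finally show ?thesis .
    next
      case False
      have rT: "r \<in> {0..T}" and aT: "a \<in> {0..T}" and rab: "r \<in> {a..b}" using r bT ab False by auto
      let ?g = "\<lambda>s. (f s + drift w s) / E s"
      have ig: "set_integrable lborel {0..T} ?g" by (rule integrand_integrable[OF f pw])
      have split: "Lint ?g 0 r = Lint ?g 0 a + Lint ?g a r"
        using ig rT False ab by (intro Lint_split set_integrable_sub[OF ig]) auto
      have E1: "E r \<le> R * E s" if "s \<in> {a..r}" for s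
        using osc[of i s r] that rab Suc.prems by (auto simp: a_def b_def h_def algebra_simps)
      have Ea: "E a > 0" "E r > 0" using E_pos aT rT by auto
      have wa: "x0 + Lint ?g 0 a = (w a + x0) / E a" using eq[OF aT] Ea by (simp add: Picard_def)
      have "w r + x0 = E r * ((w a + x0) / E a + Lint ?g a r)"
        using eq[OF rT] wa split by (simp add: Picard_def)
      then have wr: "w r = E r / E a * (w a + x0) + E r * Lint ?g a r - x0" by (simp add: algebra_simps)
      have 1: "\<bar>E r / E a * (w a + x0)\<bar> \<le> R * (S0 + \<bar>x0\<bar>)"
      proof -
        have "E r / E a \<le> R" using E1[of a] False Ea by (simp add: field_simps)
        moreover have "\<bar>w a + x0\<bar> \<le> S0 + \<bar>x0\<bar>" using IH[of a] ab by (auto simp: S0_def)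
        ultimately show ?thesis using Ea R by (simp only: abs_mult) (intro mult_mono, auto)
      qed
      have 2: "\<bar>E r * Lint ?g a r\<bar> \<le> R * (X - \<bar>x0\<bar>) + 1/2 * \<bar>w r\<bar>"
      proof -
        have sub: "set_integrable lborel {a..r} q" if "set_integrable lborel {0..T} q" for q :: "real => real"
          using set_integrable_sub[OF that] ab rT by auto
        have q1: "set_integrable lborel {a..r} (\<lambda>s. R * \<bar>f s\<bar>)" by (rule set_integrable_mult_right[OF sub[OF af]])
        have q2: "set_integrable lborel {a..r} (\<lambda>s. R * (\<bar>\<mu>\<bar> + c) * \<bar>w r\<bar> * exp (0 * s))" by (rule set_integrable_exp)
        have A1: "E r * Lint ?g a r = Lint (\<lambda>s. E r * ?g s) a r" by (rule set_integral_mult_right[symmetric])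
        have A2: "\<bar>Lint (\<lambda>s. E r * ?g s) a r\<bar> \<le> Lint (\<lambda>s. R * \<bar>f s\<bar> + R * (\<bar>\<mu>\<bar> + c) * \<bar>w r\<bar> * exp (0 * s)) a r"
        proof (rule Lint_abs_le)
          show "set_integrable lborel {a..r} (\<lambda>s. E r * ?g s)" by (rule set_integrable_mult_right[OF sub[OF ig]])
          show "set_integrable lborel {a..r} (\<lambda>s. R * \<bar>f s\<bar> + R * (\<bar>\<mu>\<bar> + c) * \<bar>w r\<bar> * exp (0 * s))"
            by (rule set_integral_add(1)[OF q1 q2])
          fix s assume s: "s \<in> {a..r}"
          then have sT: "s \<in> {0..T}" using ab rT by auto
          have Es: "E r / E s \<le> R" "E s > 0" using E1[OF s] E_pos[OF sT] by (auto simp: field_simps)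
          have "\<bar>drift w s\<bar> \<le> (\<bar>\<mu>\<bar> + c) * \<bar>w r\<bar>"
            using s ab rab by (intro drift_bound[OF pw sT] max) auto
          then have "\<bar>f s + drift w s\<bar> \<le> \<bar>f s\<bar> + (\<bar>\<mu>\<bar> + c) * \<bar>w r\<bar>" by linarith
          then have "E r / E s * \<bar>f s + drift w s\<bar> \<le> R * (\<bar>f s\<bar> + (\<bar>\<mu>\<bar> + c) * \<bar>w r\<bar>)"
            using Es Ea R by (intro mult_mono) auto
          moreover have "\<bar>E r * ?g s\<bar> = E r / E s * \<bar>f s + drift w s\<bar>" using Ea Es by (simp add: abs_mult)
          ultimately show "\<bar>E r * ?g s\<bar> \<le> R * \<bar>f s\<bar> + R * (\<bar>\<mu>\<bar> + c) * \<bar>w r\<bar> * exp (0 * s)"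
            by (simp add: algebra_simps)
        qed
        have A3: "Lint (\<lambda>s. R * \<bar>f s\<bar> + R * (\<bar>\<mu>\<bar> + c) * \<bar>w r\<bar> * exp (0 * s)) a r
            = R * Lint (\<lambda>s. \<bar>f s\<bar>) a r + Lint (\<lambda>s. R * (\<bar>\<mu>\<bar> + c) * \<bar>w r\<bar> * exp (0 * s)) a r"
          unfolding set_integral_add(2)[OF q1 q2] by (simp only: set_integral_mult_right)
        have "Lint (\<lambda>s. R * (\<bar>\<mu>\<bar> + c) * \<bar>w r\<bar> * exp (0 * s)) a r = (r - a) * (R * (\<bar>\<mu>\<bar> + c) * \<bar>w r\<bar>)"
          using False by (subst Lint_eq_integral(1)[OF set_integrable_exp]) simp
        also have "... \<le> h * (R * (\<bar>\<mu>\<bar> + c) * \<bar>w r\<bar>)" using rab ab R c0 by (intro mult_right_mono) auto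
        also have "... = (R * (T / N) * (\<bar>\<mu>\<bar> + c)) * \<bar>w r\<bar>" by (simp add: h_def)
        also have "... \<le> 1/2 * \<bar>w r\<bar>" by (rule mult_right_mono[OF fine]) simp
        finally have A4: "Lint (\<lambda>s. R * (\<bar>\<mu>\<bar> + c) * \<bar>w r\<bar> * exp (0 * s)) a r \<le> 1/2 * \<bar>w r\<bar>" .
        have "Lint (\<lambda>s. \<bar>f s\<bar>) a r \<le> Lint (\<lambda>s. \<bar>f s\<bar>) 0 T"
          using ab rT False by (intro Lint_subset_mono[OF af]) auto
        also have "... \<le> X - \<bar>x0\<bar>" by (rule X)
        finally have "R * Lint (\<lambda>s. \<bar>f s\<bar>) a r \<le> R * (X - \<bar>x0\<bar>)" using R by (intro mult_left_mono) auto
        then show ?thesis unfolding A1 using A2 A3 A4 by linarith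
      qed
      have "\<bar>w r\<bar> \<le> R * (S0 + \<bar>x0\<bar>) + (R * (X - \<bar>x0\<bar>) + 1/2 * \<bar>w r\<bar>) + \<bar>x0\<bar>"
        using 1 2 wr by linarith
      then have "1/2 * \<bar>w r\<bar> \<le> R * S0 + R * X + \<bar>x0\<bar>" by (simp add: algebra_simps)
      also have "... \<le> R * S0 + R * X + 1 * X" using X by simp
      also have "... \<le> R * S0 + R * X + R * X" using R X by (intro add_left_mono mult_right_mono) auto
      finally have "1/2 * \<bar>w r\<bar> \<le> R * S0 + R * X + R * X" .
      moreover have "0 \<le> R * S0" using R S0 by simp
      moreover have "4 * R * (X + S0) = 4 * (R * X) + 4 * (R * S0)" by (simp add: algebra_simps)
      ultimately show ?thesis by linarith
    qed
    then have "\<bar>w r\<bar> + X \<le> 4 * R * (X + S0) + X" by simp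
    also have "... \<le> 4 * R * (X + S0) + R * (X + S0)"
      using mult_right_mono[OF R, of "X + S0"] X S0 by simp
    also have "... = (5 * R)^Suc i * X" by (simp add: S0_def)
    finally show ?case using max unfolding b_def[symmetric] by fastforce
  qed
  have "t \<in> {0..h * real N}" using t h by simp
  then have "\<bar>w t\<bar> \<le> (5 * R)^N * X - X" using main[of N] by blast
  then show ?thesis using X(1) by (simp add: X_def)
qed

end

section \<open>Pathwise Ito formula along dyadic partitions\<close>

definition grid :: "real => nat => nat => real" where "grid T m j = T * real j / 2 ^ m"

text \<open>Cells beyond \<open>t\<close> contribute 0 and the cell containing \<open>t\<close> is
  cut there. So sums over all \<open>2^m\<close> cells depend on \<open>t\<close> without a variable
  range of summation.\<close>

definition incr :: "(real => real) => real => nat => real => nat => real" where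
  "incr b T m t j = b (min t (grid T m (Suc j))) - b (min t (grid T m j))"

definition QV :: "(real => real) => real => nat => real => real" where
  "QV b T m t = (\<Sum>j<2^m. (incr b T m t j)\<^sup>2)"

lemma Lint_singleton: "Lint g a a = 0"
proof -
  have "AE x in lborel. indicator {a..a} x *\<^sub>R g x = 0"
    using AE_lborel_singleton[of a] by eventually_elim simp
  then show ?thesis unfolding set_lebesgue_integral_def by (rule integral_eq_zero_AE)
qed

lemma grid_0 [simp]: "grid T m 0 = 0" by (simp add: grid_def)

lemma grid_last [simp]: "grid T m (2^m) = T" by (simp add: grid_def)

lemma grid_Suc: "grid T m (Suc j) = grid T m j + T / 2^m"
  by (simp add: grid_def add_divide_distrib distrib_left)

lemma grid_mono: "T > 0 ==> i \<le> j ==> grid T m i \<le> grid T m j"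
  by (simp add: grid_def divide_right_mono)

lemma grid_nonneg: "T > 0 ==> 0 \<le> grid T m j"
  by (simp add: grid_def)

lemma grid_le_T: "T > 0 ==> j \<le> 2^m ==> grid T m j \<le> T"
  using grid_mono[of T j "2^m" m] by simp

lemma grid_refine: "l \<le> m ==> grid T l i = grid T m (i * 2^(m - l))"
  by (simp add: grid_def field_simps power_add[symmetric])

lemma grid_cell:
  assumes "T > 0" "t \<in> {0..<T}"
  obtains i where "i < 2^m" "grid T m i \<le> t" "t < grid T m (Suc i)"
proof
  define i where "i = nat \<lfloor>t * 2^m / T\<rfloor>"
  have nn: "0 \<le> t * 2^m / T" using assms by simp
  have i: "real i \<le> t * 2^m / T" "t * 2^m / T < real i + 1"
    unfolding i_def using nn by linarith+
  show "grid T m i \<le> t" using i(1) assms by (simp add: grid_def field_simps)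
  show "t < grid T m (Suc i)" using i(2) assms by (simp add: grid_def field_simps)
  have "t * 2^m / T < 2^m" using assms by (simp add: field_simps)
  then have "real i < 2^m" using i(1) by linarith
  then show "i < 2^m" by (metis of_nat_less_iff of_nat_numeral of_nat_power)
qed

lemma ex_near_grid:
  assumes T: "T > 0" and t: "t \<in> {0..T}" shows "\<exists>j<2^k. \<bar>grid T k j - t\<bar> \<le> T / 2^k"
proof (cases "t = T")
  case True
  \<comment> \<open>At the right end the largest admissible index is \<open>2^k - 1\<close>, exactly
    one mesh width away from \<open>T\<close>.\<close>
  have "grid T k (Suc (2^k - 1)) = T" by simp
  moreover define h where "h = T / 2^k"
  moreover have "h > 0" using T by (simp add: h_def)
  ultimately have "\<bar>grid T k (2^k - 1) - t\<bar> = T / 2^k" using True unfolding grid_Suc by linarith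
  then show ?thesis by (intro exI[of _ "2^k - 1"]) simp
next
  case False
  then obtain i where "i < 2^k" "grid T k i \<le> t" "t < grid T k (Suc i)" using grid_cell[OF T, of t k] t by auto
  then have "\<bar>grid T k i - t\<bar> \<le> T / 2^k" unfolding grid_Suc by simp
  with \<open>i < 2^k\<close> show ?thesis by blast
qed

lemma eventually_uniform_grid:
  fixes f :: "real => real"
  assumes "continuous_on {0..T} f" "T > 0" "e > 0"
  shows "\<forall>\<^sub>F m in sequentially. \<forall>s\<in>{0..T}. \<forall>t\<in>{0..T}. \<bar>s - t\<bar> \<le> T / 2^m \<longrightarrow> \<bar>f s - f t\<bar> < e"
proof -
  have "uniformly_continuous_on {0..T} f" by (rule compact_uniformly_continuous[OF assms(1)]) auto
  then obtain r where r: "r > 0" "\<And>s t. s \<in> {0..T} ==> t \<in> {0..T} ==> dist t s < r ==> dist (f t) (f s) < e"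
    unfolding uniformly_continuous_on_def using assms(3) by metis
  have "(\<lambda>m. T * (1/2)^m) \<longlonglongrightarrow> T * 0" by (intro tendsto_intros LIMSEQ_power_zero) simp
  then have "\<forall>\<^sub>F m in sequentially. T * (1/2)^m < r" using r(1) by (auto intro: order_tendstoD)
  then show ?thesis
  proof eventually_elim
    case (elim m)
    then have "T / 2^m < r" by (simp add: power_one_over divide_simps)
    then show ?case using r(2) by (auto simp: dist_real_def abs_minus_commute)
  qed
qed

lemma sum_telescope_min:
  fixes f :: "real => real"
  assumes "T > 0" "t \<in> {0..T}"
  shows "(\<Sum>j<2^m. f (min t (grid T m (Suc j))) - f (min t (grid T m j))) = f t - f 0"
proof -
  have "min t T = t" "min t 0 = 0" using assms by auto
  then show ?thesis
    using sum_lessThan_telescope[of "\<lambda>j. f (min t (grid T m j))" "2^m"] by (simp only: grid_last grid_0)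
qed

lemma min_grid_bounds:
  assumes "T > 0" "t \<in> {0..T}"
  shows "min t (grid T m j) \<in> {0..T}" "min t (grid T m j) \<le> min t (grid T m (Suc j))"
    "min t (grid T m (Suc j)) - min t (grid T m j) \<le> T / 2^m"
    "0 \<le> min t (grid T m (Suc j)) - min t (grid T m j)"
proof -
  define h where "h = T / 2^m"
  have "0 < h" using assms by (simp add: h_def)
  then show "min t (grid T m j) \<in> {0..T}" "min t (grid T m j) \<le> min t (grid T m (Suc j))"
    "min t (grid T m (Suc j)) - min t (grid T m j) \<le> T / 2^m"
    "0 \<le> min t (grid T m (Suc j)) - min t (grid T m j)"
    using assms grid_nonneg[of T m j] unfolding grid_Suc h_def[symmetric] by (auto simp: min_def)
qed

text \<open>At a grid time every cell is either full or empty, so a later time can only add squares.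
  Between grid times the square of the cut increment may well decrease.\<close>

lemma QV_mono_grid:
  assumes T: "T > 0" and le: "grid T m K \<le> t" shows "QV b T m (grid T m K) \<le> QV b T m t"
  unfolding QV_def
proof (rule sum_mono)
  fix j
  show "(incr b T m (grid T m K) j)\<^sup>2 \<le> (incr b T m t j)\<^sup>2"
  proof (cases "j < K")
    case True
    then have "grid T m (Suc j) \<le> grid T m K" "grid T m j \<le> grid T m K" using T by (auto intro!: grid_mono)
    then have "min (grid T m K) (grid T m (Suc j)) = min t (grid T m (Suc j))" "min (grid T m K) (grid T m j) = min t (grid T m j)"
      using le by auto
    then have "incr b T m (grid T m K) j = incr b T m t j" by (simp only: incr_def)
    then show ?thesis by simp
  next
    case False
    then have "grid T m K \<le> grid T m j" "grid T m K \<le> grid T m (Suc j)" using T by (auto intro!: grid_mono)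
    then show ?thesis by (simp add: incr_def min_def)
  qed
qed

text \<open>The time \<open>t\<close> cuts at most one cell, that of index \<open>j0\<close>; all
  other cells are full or empty. The cut cell is paid for by \<open>B\<close>.\<close>

lemma QV_le_grid:
  assumes T: "T > 0" and le: "t \<le> grid T m K" and t: "t \<in> {0..T}" and B: "\<And>j. (incr b T m t j)\<^sup>2 \<le> B"
  shows "QV b T m t \<le> QV b T m (grid T m K) + B"
proof -
  have B0: "B \<ge> 0" using B[of 0] zero_le_power2 order_trans by blast
  define j0 where "j0 = nat \<lfloor>t * 2^m / T\<rfloor>"
  have "(incr b T m t j)\<^sup>2 \<le> (incr b T m (grid T m K) j)\<^sup>2 + (if j = j0 then B else 0)" for j
  proof -
    consider "grid T m (Suc j) \<le> t" | "t \<le> grid T m j" | "grid T m j < t" "t < grid T m (Suc j)" by linarith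
    then show ?thesis
    proof cases
      case 1
      moreover have "grid T m j \<le> grid T m (Suc j)" using T by (intro grid_mono) auto
      ultimately have "min t (grid T m (Suc j)) = min (grid T m K) (grid T m (Suc j))" "min t (grid T m j) = min (grid T m K) (grid T m j)"
        using le by auto
      then have "incr b T m t j = incr b T m (grid T m K) j" by (simp only: incr_def)
      then show ?thesis using B0 by simp
    next
      case 2
      moreover have "grid T m j \<le> grid T m (Suc j)" using T by (intro grid_mono) auto
      ultimately have "incr b T m t j = 0" by (simp add: incr_def min_def)
      then show ?thesis using B0 by simp
    next
      case 3
      have "real j \<le> t * 2^m / T" "t * 2^m / T < real j + 1" using 3 T by (simp_all add: grid_def field_simps)
      then have "\<lfloor>t * 2^m / T\<rfloor> = int j" by (intro floor_unique) auto
      then show ?thesis using B[of j] by (simp add: j0_def add_increasing)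
    qed
  qed
  then have "QV b T m t \<le> (\<Sum>j<2^m. (incr b T m (grid T m K) j)\<^sup>2 + (if j = j0 then B else 0))"
    unfolding QV_def by (intro sum_mono)
  also have "... \<le> QV b T m (grid T m K) + B" unfolding QV_def sum.distrib using B0 by (simp add: sum.delta)
  finally show ?thesis .
qed

text \<open>Applied to coefficients frozen on a coarser grid: the sum then sees the fine increments
  only through their partial sums at the coarse indices.\<close>

lemma sum_div_blocks:
  fixes a :: "nat => real"
  assumes "p > 0"
  shows "(\<Sum>j<n * p. f (j div p) * a j) = (\<Sum>i<n. f i * ((\<Sum>j<Suc i * p. a j) - (\<Sum>j<i * p. a j)))"
proof (induction n)
  case (Suc n)
  have split: "(\<Sum>j<Suc n * p. g j) = (\<Sum>j<n * p. g j) + (\<Sum>j=n * p..<n * p + p. g j)" for g :: "nat => real"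
    using sum.atLeastLessThan_concat[of 0 "n * p" "n * p + p" g] by (simp add: lessThan_atLeast0 add.commute)
  have "(\<Sum>j=n * p..<n * p + p. f (j div p) * a j) = f n * (\<Sum>j=n * p..<n * p + p. a j)"
    unfolding sum_distrib_left
  proof (rule sum.cong)
    fix j assume "j \<in> {n * p..<n * p + p}"
    then have "j div p = n" by (intro div_nat_eqI) (auto simp: mult.commute)
    then show "f (j div p) * a j = f n * a j" by simp
  qed simp
  moreover have "(\<Sum>j=n * p..<n * p + p. a j) = (\<Sum>j<Suc n * p. a j) - (\<Sum>j<n * p. a j)" using split[of a] by simp
  ultimately show ?case using Suc split[of "\<lambda>j. f (j div p) * a j"] by simp
qed simp

lemma exp_Taylor2:
  fixes x :: real assumes "\<bar>x\<bar> \<le> 1" shows "\<bar>exp x - 1 - x - x\<^sup>2 / 2\<bar> \<le> \<bar>x\<bar>^3"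
proof -
  obtain t where t: "\<bar>t\<bar> \<le> \<bar>x\<bar>" "exp x = (\<Sum>m<3. x ^ m / fact m) + exp t / fact 3 * x ^ 3"
    using Maclaurin_exp_le[of x 3] by blast
  have "exp x - 1 - x - x\<^sup>2 / 2 = exp t / 6 * x^3"
    using t(2) by (simp add: eval_nat_numeral)
  then have "\<bar>exp x - 1 - x - x\<^sup>2 / 2\<bar> = exp t / 6 * \<bar>x\<bar>^3" by (simp only: abs_mult power_abs) simp
  also have "exp t \<le> exp 1" using t(1) assms by auto
  then have "exp t / 6 \<le> 1" using exp_le by linarith
  then have "exp t / 6 * \<bar>x\<bar>^3 \<le> 1 * \<bar>x\<bar>^3" by (intro mult_right_mono) auto
  finally show ?thesis by simp
qed

text \<open>Convergence is demanded at the countably many dyadic times only, which is what an almost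
  sure statement can provide simultaneously.\<close>

locale quadratic_variation_path =
  fixes T s2 :: real and b :: "real => real"
  assumes T: "T > 0" and s2: "s2 \<ge> 0" and b_cont: "continuous_on {0..T} b"
    and QV_lim: "\<And>l i. i \<le> 2^l ==> (\<lambda>m. QV b T m (grid T l i)) \<longlonglongrightarrow> s2 * grid T l i"
begin

abbreviation "step m t j \<equiv> min t (grid T m (Suc j)) - min t (grid T m j)"

lemma eventually_incr_small:
  assumes "e > 0" shows "\<forall>\<^sub>F m in sequentially. \<forall>t\<in>{0..T}. \<forall>j. \<bar>incr b T m t j\<bar> < e"
  using eventually_uniform_grid[OF b_cont T assms]
proof eventually_elim
  case (elim m)
  show ?case
  proof (intro ballI allI)
    fix t j assume t: "t \<in> {0..T}"
    have "\<bar>min t (grid T m (Suc j)) - min t (grid T m j)\<bar> \<le> T / 2^m"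
      using min_grid_bounds(3,4)[OF T t, of m j] by linarith
    then show "\<bar>incr b T m t j\<bar> < e" unfolding incr_def
      using elim min_grid_bounds(1)[OF T t] by blast
  qed
qed

lemma eventually_step_small:
  assumes "e > 0" shows "\<forall>\<^sub>F m in sequentially. T / 2^m < e"
proof -
  have "(\<lambda>m. T * (1/2)^m) \<longlonglongrightarrow> T * 0" by (intro tendsto_intros LIMSEQ_power_zero) simp
  then have "\<forall>\<^sub>F m in sequentially. T * (1/2)^m < e" using assms by (auto intro: order_tendstoD)
  then show ?thesis by eventually_elim (simp add: power_one_over divide_simps)
qed

text \<open>A Dini-type argument: the functions are monotone up to the square of one small increment
  and their limit is continuous, so they are squeezed between the values at two neighbouring points
  of a fixed coarse grid.\<close>

lemma QV_uniform:
  assumes e: "e > 0" shows "\<forall>\<^sub>F m in sequentially. \<forall>t\<in>{0..T}. \<bar>QV b T m t - s2 * t\<bar> < e"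
proof -
  have "e / 3 / (s2 + 1) > 0" using e s2 by simp
  then obtain l where l: "T / 2^l < e / 3 / (s2 + 1)"
    using eventually_happens[OF eventually_step_small] by auto
  have "s2 * (T / 2^l) \<le> (s2 + 1) * (T / 2^l)" using T by (intro mult_right_mono) auto
  also have "... < e / 3" using l s2 by (simp add: field_simps)
  finally have l': "s2 * (T / 2^l) < e / 3" .
  have "\<forall>\<^sub>F m in sequentially. \<bar>QV b T m (grid T l i) - s2 * grid T l i\<bar> < e / 3" if "i \<le> 2^l" for i
    using tendstoD[OF QV_lim[OF that], of "e / 3"] e by (simp add: dist_real_def)
  then have "\<forall>\<^sub>F m in sequentially. \<forall>i\<in>{..2^l}. \<bar>QV b T m (grid T l i) - s2 * grid T l i\<bar> < e / 3"
    by (intro eventually_ball_finite) auto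
  moreover have "\<forall>\<^sub>F m in sequentially. \<forall>t\<in>{0..T}. \<forall>j. \<bar>incr b T m t j\<bar> < min 1 (e / 3)"
    using e by (intro eventually_incr_small) auto
  moreover have "\<forall>\<^sub>F m in sequentially. l \<le> m" by (rule eventually_ge_at_top)
  ultimately show ?thesis
  proof eventually_elim
    case (elim m)
    have G: "\<bar>QV b T m (grid T l i) - s2 * grid T l i\<bar> < e / 3" if "i \<le> 2^l" for i using elim(1) that by auto
    show ?case
    proof
      fix t assume t: "t \<in> {0..T}"
      show "\<bar>QV b T m t - s2 * t\<bar> < e"
      proof (cases "t = T")
        case True
        then show ?thesis using G[of "2^l"] e by simp
      next
        case False
        then obtain i where i: "i < 2^l" "grid T l i \<le> t" "t < grid T l (Suc i)" using grid_cell[OF T, of t l] t by auto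
        have B: "(incr b T m t j)\<^sup>2 \<le> e / 3" for j
        proof -
          have "\<bar>incr b T m t j\<bar> < min 1 (e / 3)" using elim(2) t by blast
          then have "\<bar>incr b T m t j\<bar> * \<bar>incr b T m t j\<bar> \<le> 1 * (e / 3)" by (intro mult_mono) auto
          then show ?thesis by (simp add: power2_eq_square abs_mult[symmetric])
        qed
        have "QV b T m (grid T l i) \<le> QV b T m t"
          using QV_mono_grid[OF T, of m "i * 2^(m-l)" t] i(2) by (simp add: grid_refine[OF elim(3)])
        moreover have "QV b T m t \<le> QV b T m (grid T l (Suc i)) + e / 3"
          using QV_le_grid[OF T _ t B, of "Suc i * 2^(m-l)"] i(3) by (simp only: grid_refine[OF elim(3)])
        moreover have "\<bar>QV b T m (grid T l i) - s2 * grid T l i\<bar> < e / 3"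
          "\<bar>QV b T m (grid T l (Suc i)) - s2 * grid T l (Suc i)\<bar> < e / 3" using G i by auto
        moreover have "s2 * grid T l (Suc i) = s2 * grid T l i + s2 * (T / 2^l)" by (simp add: grid_Suc distrib_left)
        moreover have "s2 * grid T l i \<le> s2 * t" "s2 * t \<le> s2 * grid T l (Suc i)" using s2 i by (auto intro: mult_left_mono)
        ultimately show ?thesis using l' by linarith
      qed
    qed
  qed
qed

lemma QV_bounded: "\<forall>\<^sub>F m in sequentially. \<forall>t\<in>{0..T}. QV b T m t \<le> s2 * T + 1"
  using QV_uniform[of 1, simplified]
proof eventually_elim
  case (elim m)
  show ?case
  proof
    fix t assume t: "t \<in> {0..T}"
    have "s2 * t \<le> s2 * T" using t s2 by (intro mult_left_mono) auto
    then show "QV b T m t \<le> s2 * T + 1" using bspec[OF elim t] by linarith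
  qed
qed

lemma sum_step: "t \<in> {0..T} ==> (\<Sum>j<2^m. step m t j) = t"
  using sum_telescope_min[OF T, of t "\<lambda>x. x" m] by simp

lemma weighted_QV:
  assumes y: "continuous_on {0..T} y" and e: "e > 0"
  shows "\<forall>\<^sub>F m in sequentially. \<forall>t\<in>{0..T}. \<bar>\<Sum>j<2^m. y (grid T m j) * ((incr b T m t j)\<^sup>2 - s2 * step m t j)\<bar> < e"
proof -
  obtain Y where Y: "Y \<ge> 0" "\<And>t. t \<in> {0..T} ==> \<bar>y t\<bar> \<le> Y" using continuous_on_bounded[OF y] by blast
  \<comment> \<open>Bounds the sum of \<open>\<bar>a j\<bar>\<close> below: at most
    \<open>s2 * T + 1\<close> from the squares and \<open>s2 * T\<close> from their
    compensators.\<close>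
  define C where "C = 2 * s2 * T + 1"
  have C: "C > 0" using s2 T by (simp add: C_def add_nonneg_pos)
  have "e / 2 / C > 0" using e C by simp
  then obtain l where l: "\<And>s t. s \<in> {0..T} ==> t \<in> {0..T} ==> \<bar>s - t\<bar> \<le> T / 2^l ==> \<bar>y s - y t\<bar> < e / 2 / C"
    using eventually_happens[OF eventually_uniform_grid[OF y T]] by (metis sequentially_bot)
  \<comment> \<open>There are \<open>2^l\<close> frozen terms, each at most
    \<open>Y * (2 * n)\<close>; with \<open>Y + 1\<close> in place of \<open>Y\<close> the
    denominator is positive and the final inequality strict.\<close>
  define n where "n = e / 2 / (2^l * (Y + 1) * 2)"
  have n: "n > 0" using e Y by (simp add: n_def)
  have "\<forall>\<^sub>F m in sequentially. l \<le> m" by (rule eventually_ge_at_top)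
  with QV_uniform[OF n] QV_bounded show ?thesis
  proof eventually_elim
    case (elim m)
    show ?case
    proof
      fix t assume t: "t \<in> {0..T}"
      define a where "a j = (incr b T m t j)\<^sup>2 - s2 * step m t j" for j
      define p where "p = (2::nat)^(m - l)"
      have p: "p > 0" "2^l * p = 2^m" using elim(3) by (simp_all add: p_def power_add[symmetric])
      \<comment> \<open>A partial sum of the \<open>a j\<close> equals the full compensated sum with
        time stopped at the \<open>K\<close>-th grid point, so uniformity in time bounds all partial
        sums at once.\<close>
      have part: "(\<Sum>j<K. a j) = QV b T m (min t (grid T m K)) - s2 * min t (grid T m K)" if K: "K \<le> 2^m" for K
      proof -
        let ?r = "min t (grid T m K)"
        have r: "?r \<in> {0..T}" using min_grid_bounds(1)[OF T t] .
        have below: "incr b T m ?r j = incr b T m t j" "step m ?r j = step m t j" if "j < K" for j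
        proof -
          have "grid T m (Suc j) \<le> grid T m K" "grid T m j \<le> grid T m K" using that T by (auto intro!: grid_mono)
          then have "min ?r (grid T m (Suc j)) = min t (grid T m (Suc j))" "min ?r (grid T m j) = min t (grid T m j)" by (auto simp: min_def)
          then show "incr b T m ?r j = incr b T m t j" "step m ?r j = step m t j" by (simp_all only: incr_def)
        qed
        have above: "incr b T m ?r j = 0" "step m ?r j = 0" if "\<not> j < K" for j
        proof -
          have "grid T m K \<le> grid T m (Suc j)" "grid T m K \<le> grid T m j" using that T by (auto intro!: grid_mono)
          then have "min ?r (grid T m (Suc j)) = ?r" "min ?r (grid T m j) = ?r" by (auto simp: min_def)
          then show "incr b T m ?r j = 0" "step m ?r j = 0" by (simp_all only: incr_def)
        qed
        have "QV b T m ?r - s2 * ?r = (\<Sum>j<2^m. (incr b T m ?r j)\<^sup>2 - s2 * step m ?r j)"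
        proof -
          have "QV b T m ?r - s2 * ?r = QV b T m ?r - s2 * (\<Sum>j<2^m. step m ?r j)" by (simp only: sum_step[OF r])
          also have "... = (\<Sum>j<2^m. (incr b T m ?r j)\<^sup>2 - s2 * step m ?r j)"
            by (simp only: QV_def sum_subtractf sum_distrib_left right_diff_distrib)
          finally show ?thesis .
        qed
        also have "... = (\<Sum>j<2^m. if j < K then a j else 0)"
          by (intro sum.cong) (auto simp: below above a_def simp del: min.absorb1 min.absorb2)
        also have "... = (\<Sum>j<K. a j)" using K by (subst sum.inter_filter[symmetric]) (auto intro!: sum.cong)
        finally show ?thesis by simp
      qed
      have small: "\<bar>\<Sum>j<K. a j\<bar> < n" if "K \<le> 2^m" for K
        using elim(1) min_grid_bounds(1)[OF T t, of m K] part[OF that] by auto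
      have yb: "\<bar>y (grid T m j) - y (grid T l (j div p))\<bar> \<le> e / 2 / C" if j: "j < 2^m" for j
      proof -
        have 1: "grid T l (j div p) = grid T m (j div p * p)" using grid_refine[OF elim(3)] by (simp add: p_def)
        have "j div p * p \<le> j" by simp
        then have le: "grid T m (j div p * p) \<le> grid T m j" using T by (intro grid_mono) auto
        have "real j \<le> real (j div p * p) + real p" using p by (metis div_mult_mod_eq less_imp_le mod_less_divisor nat_add_left_cancel_le of_nat_add of_nat_le_iff)
        then have "T * real j / 2^m \<le> T * (real (j div p * p) + real p) / 2^m" using T by (intro divide_right_mono mult_left_mono) auto
        also have "... = grid T m (j div p * p) + T * real p / 2^m" by (simp add: grid_def distrib_left add_divide_distrib)
        also have "T * real p / 2^m = T / 2^l" using arg_cong[OF p(2), of real] by (simp add: field_simps)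
        finally have "grid T m j \<le> grid T m (j div p * p) + T / 2^l" by (simp add: grid_def)
        then have "\<bar>grid T m j - grid T l (j div p)\<bar> \<le> T / 2^l" using le 1 by simp
        moreover have "grid T m j \<in> {0..T}" "grid T l (j div p) \<in> {0..T}"
          using le j T 1 order_trans[OF div_times_less_eq_dividend less_imp_le[OF j]] by (auto intro!: grid_nonneg grid_le_T)
        ultimately show ?thesis by (intro less_imp_le[OF l])
      qed
      have aabs: "(\<Sum>j<2^m. \<bar>a j\<bar>) \<le> C"
      proof -
        have "(\<Sum>j<2^m. \<bar>a j\<bar>) \<le> (\<Sum>j<2^m. (incr b T m t j)\<^sup>2 + s2 * step m t j)"
        proof (rule sum_mono)
          fix j
          have "0 \<le> s2 * step m t j" using s2 min_grid_bounds(4)[OF T t] by (rule mult_nonneg_nonneg)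
          moreover have "0 \<le> (incr b T m t j)\<^sup>2" by simp
          ultimately show "\<bar>a j\<bar> \<le> (incr b T m t j)\<^sup>2 + s2 * step m t j" unfolding a_def by linarith
        qed
        also have "... = QV b T m t + s2 * t"
        proof -
          have "QV b T m t + s2 * t = QV b T m t + s2 * (\<Sum>j<2^m. step m t j)" by (simp only: sum_step[OF t])
          then show ?thesis by (simp only: QV_def sum.distrib sum_distrib_left)
        qed
        also have "... \<le> (s2 * T + 1) + s2 * T" using elim(2) t s2 by (intro add_mono mult_left_mono) auto
        also have "... = C" unfolding C_def by simp
        finally show ?thesis .
      qed
      have "(\<Sum>j<2^m. y (grid T m j) * a j) = (\<Sum>j<2^m. (y (grid T m j) - y (grid T l (j div p))) * a j) + (\<Sum>j<2^m. y (grid T l (j div p)) * a j)"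
        unfolding sum.distrib[symmetric] by (intro sum.cong refl) (simp add: left_diff_distrib)
      also have "(\<Sum>j<2^m. y (grid T l (j div p)) * a j) = (\<Sum>i<2^l. y (grid T l i) * ((\<Sum>j<Suc i * p. a j) - (\<Sum>j<i * p. a j)))"
        using sum_div_blocks[OF p(1), where n="2^l" and f="\<lambda>i. y (grid T l i)" and a=a] by (simp add: p(2))
      finally have split: "(\<Sum>j<2^m. y (grid T m j) * a j) = (\<Sum>j<2^m. (y (grid T m j) - y (grid T l (j div p))) * a j)
          + (\<Sum>i<2^l. y (grid T l i) * ((\<Sum>j<Suc i * p. a j) - (\<Sum>j<i * p. a j)))" .
      have "\<bar>\<Sum>j<2^m. (y (grid T m j) - y (grid T l (j div p))) * a j\<bar> \<le> (\<Sum>j<2^m. e / 2 / C * \<bar>a j\<bar>)"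
      proof (intro order_trans[OF sum_abs] sum_mono)
        fix j assume "j \<in> {..<(2::nat)^m}"
        then show "\<bar>(y (grid T m j) - y (grid T l (j div p))) * a j\<bar> \<le> e / 2 / C * \<bar>a j\<bar>"
          unfolding abs_mult by (intro mult_right_mono yb) auto
      qed
      also have "... = e / 2 / C * (\<Sum>j<2^m. \<bar>a j\<bar>)" by (rule sum_distrib_left[symmetric])
      also have "... \<le> e / 2 / C * C" using aabs e C by (intro mult_left_mono) auto
      also have "... = e / 2" using C by simp
      finally have 1: "\<bar>\<Sum>j<2^m. (y (grid T m j) - y (grid T l (j div p))) * a j\<bar> \<le> e / 2" .
      have "\<bar>\<Sum>i<2^l. y (grid T l i) * ((\<Sum>j<Suc i * p. a j) - (\<Sum>j<i * p. a j))\<bar> \<le> (\<Sum>i<(2::nat)^l. Y * (2 * n))"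
      proof (intro order_trans[OF sum_abs] sum_mono)
        fix i assume "i \<in> {..<(2::nat)^l}"
        then have i: "i < 2^l" by simp
        have "Suc i * p \<le> 2^l * p" using i by (intro mult_le_mono1) auto
        then have le: "Suc i * p \<le> 2^m" "i * p \<le> 2^m" using p(2) by auto
        have "\<bar>(\<Sum>j<Suc i * p. a j) - (\<Sum>j<i * p. a j)\<bar> \<le> 2 * n" using small[OF le(1)] small[OF le(2)] by linarith
        moreover have "grid T l i \<in> {0..T}" using i T by (auto intro!: grid_nonneg grid_le_T)
        then have "\<bar>y (grid T l i)\<bar> \<le> Y" by (rule Y)
        ultimately show "\<bar>y (grid T l i) * ((\<Sum>j<Suc i * p. a j) - (\<Sum>j<i * p. a j))\<bar> \<le> Y * (2 * n)"
          unfolding abs_mult using Y by (intro mult_mono) auto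
      qed
      also have "... = (2^l * Y * 2) * n" by simp
      also have "... < (2^l * (Y + 1) * 2) * n" using n by (intro mult_strict_right_mono) auto
      also have "... = e / 2"
      proof -
        define q where "q = 2^l * (Y + 1) * 2"
        have "q \<noteq> 0" using Y(1) by (simp add: q_def)
        then show ?thesis unfolding n_def q_def[symmetric] by simp
      qed
      finally show "\<bar>\<Sum>j<2^m. y (grid T m j) * ((incr b T m t j)\<^sup>2 - s2 * step m t j)\<bar> < e"
        using 1 split unfolding a_def[symmetric] by linarith
    qed
  qed
qed

text \<open>In the Taylor expansion the correction \<open>- s2 * \<delta> / 2\<close> in the
  exponent joins \<open>db\<^sup>2 / 2\<close> from the second order to form the compensated square.
  All other terms carry an additional factor of size \<open>n\<close>.\<close>

lemma second_order_remainder: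
  assumes "0 < n" "n \<le> 1/2" "\<bar>db\<bar> \<le> n" "0 \<le> \<delta>" "s2 * \<delta> \<le> n"
  shows "\<bar>exp (db - s2 * \<delta> / 2) - 1 - db - (db\<^sup>2 - s2 * \<delta>) / 2\<bar> \<le> n * (4 * db\<^sup>2 + 3 * (s2 * \<delta>))"
proof -
  define q where "q = s2 * \<delta>"
  have q: "0 \<le> q" "q \<le> n" using assms s2 by (auto simp: q_def)
  define D where "D = db - q / 2"
  have D: "\<bar>D\<bar> \<le> 2 * n" "\<bar>D\<bar> \<le> 1" using assms q unfolding D_def by linarith+
  have "q * q \<le> n * q" using q by (intro mult_right_mono) auto
  then have q2: "q\<^sup>2 \<le> n * q" by (simp add: power2_eq_square)
  have "D\<^sup>2 \<le> 2 * db\<^sup>2 + 2 * (- q / 2)\<^sup>2" using sq_add_le[of db "- q / 2"] by (simp add: D_def)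
  also have "... = 2 * db\<^sup>2 + q\<^sup>2 / 2" by (simp add: power2_eq_square)
  also have "... \<le> 2 * db\<^sup>2 + q" using q2 q mult_right_mono[OF assms(2) q(1)] by linarith
  finally have D2: "D\<^sup>2 \<le> 2 * db\<^sup>2 + q" .
  have "\<bar>D\<bar>^3 = \<bar>D\<bar> * D\<^sup>2" by (simp add: power3_eq_cube power2_eq_square)
  also have "... \<le> 2 * n * (2 * db\<^sup>2 + q)" using D D2 by (intro mult_mono) auto
  finally have 1: "\<bar>exp D - 1 - D - D\<^sup>2 / 2\<bar> \<le> 2 * n * (2 * db\<^sup>2 + q)" using exp_Taylor2[OF D(2)] by linarith
  have "D\<^sup>2 - db\<^sup>2 = - (db * q) + q\<^sup>2 / 4" by (simp add: D_def power2_eq_square algebra_simps)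
  moreover have "\<bar>db * q\<bar> \<le> n * q" unfolding abs_mult using assms q by (intro mult_mono) auto
  ultimately have 2: "\<bar>D\<^sup>2 - db\<^sup>2\<bar> \<le> 2 * (n * q)" using q2 zero_le_power2[of q] by linarith
  have "exp (db - s2 * \<delta> / 2) - 1 - db - (db\<^sup>2 - s2 * \<delta>) / 2 = (exp D - 1 - D - D\<^sup>2 / 2) + (D\<^sup>2 - db\<^sup>2) / 2"
    by (simp add: D_def q_def field_simps)
  also have "\<bar>...\<bar> \<le> 2 * n * (2 * db\<^sup>2 + q) + n * q" by (rule order_trans[OF abs_triangle_ineq add_mono[OF 1]]) (use 2 in simp)
  also have "... = n * (4 * db\<^sup>2 + 3 * q)" by (simp add: algebra_simps)
  finally show ?thesis by (simp add: q_def)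
qed

text \<open>The increments of \<open>y\<close> are telescoped. Their deviation from
  \<open>y * db\<close> consists of compensated squares, which \<open>weighted_QV\<close> removes,
  of third order terms bounded by the quadratic variation, and of the absolutely continuous part,
  where uniform continuity of \<open>E\<close> replaces its endpoint value by its value under the
  integral.\<close>

lemma dyadic_sums_converge:
  assumes E: "\<And>t. E t = exp (b t - s2 * t / 2)"
    and \<beta>: "set_integrable lborel {0..T} \<beta>" and u: "\<And>t. t \<in> {0..T} ==> u t = x0 + Lint \<beta> 0 t"
    and y: "\<And>t. t \<in> {0..T} ==> y t = E t * u t"
  shows "uniform_limit {0..T} (\<lambda>m t. \<Sum>j<2^m. y (grid T m j) * incr b T m t j)
    (\<lambda>t. y t - y 0 - Lint (\<lambda>s. E s * \<beta> s) 0 t) sequentially"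
proof (rule uniform_limitI)
  fix e :: real assume e: "e > 0"
  have "continuous_on {0..T} (\<lambda>t. exp (b t - s2 * t / 2))" by (intro continuous_intros b_cont) auto
  then have E_cont: "continuous_on {0..T} E" by (rule continuous_on_eq) (simp add: E)
  have u_cont: "continuous_on {0..T} u"
    by (rule continuous_on_eq[of _ "\<lambda>t. x0 + Lint \<beta> 0 t"]) (auto intro!: continuous_intros continuous_on_Lint \<beta> simp: u)
  have y_cont: "continuous_on {0..T} y"
    by (rule continuous_on_eq[of _ "\<lambda>t. E t * u t"]) (auto intro!: continuous_intros E_cont u_cont simp: y)
  obtain Y where Y: "Y \<ge> 0" "\<And>t. t \<in> {0..T} ==> \<bar>y t\<bar> \<le> Y" using continuous_on_bounded[OF y_cont] by blast
  have a\<beta>: "set_integrable lborel {0..T} (\<lambda>s. \<bar>\<beta> s\<bar>)" by (rule set_integrable_abs[OF \<beta>])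
  have E\<beta>: "set_integrable lborel {0..T} (\<lambda>s. E s * \<beta> s)" by (rule set_integrable_continuous_mult[OF \<beta> E_cont])
  define I where "I = Lint (\<lambda>s. \<bar>\<beta> s\<bar>) 0 T"
  have I: "I \<ge> 0" unfolding I_def by (rule Lint_nonneg) simp
  define C where "C = 4 * (s2 * T + 1) + 3 * (s2 * T)"
  have C: "C \<ge> 0" using s2 T by (simp add: C_def)
  define n where "n = min (1/2) (e / 3 / (Y * C + 1))"
  have YC: "Y * C + 1 > 0" using Y C by (simp add: add_nonneg_pos)
  then have n: "n > 0" "n \<le> 1/2" "n \<le> e / 3 / (Y * C + 1)" using e unfolding n_def by (simp_all only: min.cobounded1 min.cobounded2) simp
  have "\<forall>\<^sub>F m in sequentially. T / 2^m < n / (s2 + 1)" using n s2 by (intro eventually_step_small) simp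
  moreover have "\<forall>\<^sub>F m in sequentially. \<forall>s\<in>{0..T}. \<forall>t\<in>{0..T}. \<bar>s - t\<bar> \<le> T / 2^m \<longrightarrow> \<bar>E s - E t\<bar> < e / 3 / (I + 1)"
    using e I by (intro eventually_uniform_grid E_cont T) simp
  moreover note eventually_incr_small[OF n(1)] QV_bounded
  moreover have "\<forall>\<^sub>F m in sequentially. \<forall>t\<in>{0..T}. \<bar>\<Sum>j<2^m. y (grid T m j) * ((incr b T m t j)\<^sup>2 - s2 * step m t j)\<bar> < e / 3"
    using e by (intro weighted_QV y_cont) simp
  ultimately show "\<forall>\<^sub>F m in sequentially. \<forall>t\<in>{0..T}.
      dist (\<Sum>j<2^m. y (grid T m j) * incr b T m t j) (y t - y 0 - Lint (\<lambda>s. E s * \<beta> s) 0 t) < e"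
  proof eventually_elim
    case (elim m)
    show ?case
    proof
      fix t assume t: "t \<in> {0..T}"
      define r where "r j = min t (grid T m j)" for j
      have r: "r j \<in> {0..T}" "r j \<le> r (Suc j)" "r (Suc j) - r j \<le> T / 2^m" for j
        using min_grid_bounds[OF T t] by (simp_all add: r_def)
      have sub: "set_integrable lborel {r j..r (Suc j)} q" if "set_integrable lborel {0..T} q" for j and q :: "real => real"
        using set_integrable_sub[OF that] r(1)[of j] r(1)[of "Suc j"] by auto
      have Lr: "Lint q 0 (r (Suc j)) - Lint q 0 (r j) = Lint q (r j) (r (Suc j))"
        if "set_integrable lborel {0..T} q" for j and q :: "real => real"
        using Lint_split[of 0 "r (Suc j)" q "r j"] set_integrable_sub[OF that, of 0 "r (Suc j)"] r(1)[of j] r(1)[of "Suc j"] r(2)[of j] by auto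
      define R where "R j = exp (incr b T m t j - s2 * step m t j / 2) - 1 - incr b T m t j" for j
      \<comment> \<open>Discrete product rule with \<open>u\<close> at the left and \<open>E\<close>
        at the right endpoint. In a cell after \<open>t\<close> the increments vanish, so
        \<open>y\<close> may be evaluated at the grid point instead of the stopped point.\<close>
      have ydiff: "y (r (Suc j)) - y (r j) = y (grid T m j) * incr b T m t j + y (grid T m j) * R j + E (r (Suc j)) * Lint \<beta> (r j) (r (Suc j))" for j
      proof -
        have "u (r (Suc j)) - u (r j) = Lint \<beta> (r j) (r (Suc j))" using Lr[OF \<beta>, of j] u r(1) by simp
        moreover have "E (r (Suc j)) = E (r j) * exp (incr b T m t j - s2 * step m t j / 2)"
          by (simp add: E exp_add[symmetric] incr_def r_def) (simp add: field_simps)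
        moreover have "y (r (Suc j)) - y (r j) = u (r j) * (E (r (Suc j)) - E (r j)) + E (r (Suc j)) * (u (r (Suc j)) - u (r j))"
          using y r(1) by (simp add: algebra_simps)
        ultimately have "y (r (Suc j)) - y (r j) = y (r j) * (exp (incr b T m t j - s2 * step m t j / 2) - 1) + E (r (Suc j)) * Lint \<beta> (r j) (r (Suc j))"
          using y[OF r(1)[of j]] by (simp add: algebra_simps)
        moreover have "y (r j) * (exp (incr b T m t j - s2 * step m t j / 2) - 1) = y (grid T m j) * (exp (incr b T m t j - s2 * step m t j / 2) - 1)"
        proof (cases "grid T m j \<le> t")
          case True then show ?thesis by (simp add: r_def min_def)
        next
          case False
          moreover have "grid T m j \<le> grid T m (Suc j)" using T by (intro grid_mono) auto
          ultimately have "incr b T m t j = 0" "step m t j = 0" by (simp_all add: incr_def min_def)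
          then show ?thesis by simp
        qed
        ultimately show ?thesis by (simp add: R_def algebra_simps)
      qed
      have "y t - y 0 = (\<Sum>j<2^m. y (r (Suc j)) - y (r j))"
        using sum_telescope_min[OF T t, of y m] by (simp add: r_def)
      moreover have "Lint (\<lambda>s. E s * \<beta> s) 0 t = (\<Sum>j<2^m. Lint (\<lambda>s. E s * \<beta> s) 0 (r (Suc j)) - Lint (\<lambda>s. E s * \<beta> s) 0 (r j))"
        using sum_telescope_min[OF T t, of "Lint (\<lambda>s. E s * \<beta> s) 0" m] T
        by (simp add: r_def Lint_singleton del: atLeastAtMost_singleton)
      ultimately have diff: "(y t - y 0 - Lint (\<lambda>s. E s * \<beta> s) 0 t) - (\<Sum>j<2^m. y (grid T m j) * incr b T m t j)
         = (\<Sum>j<2^m. y (grid T m j) * R j) + (\<Sum>j<2^m. E (r (Suc j)) * Lint \<beta> (r j) (r (Suc j)) - Lint (\<lambda>s. E s * \<beta> s) (r j) (r (Suc j)))"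
        unfolding ydiff Lr[OF E\<beta>] by (simp add: sum.distrib sum_subtractf)
      have "\<bar>\<Sum>j<2^m. E (r (Suc j)) * Lint \<beta> (r j) (r (Suc j)) - Lint (\<lambda>s. E s * \<beta> s) (r j) (r (Suc j))\<bar>
        \<le> (\<Sum>j<2^m. e / 3 / (I + 1) * Lint (\<lambda>s. \<bar>\<beta> s\<bar>) (r j) (r (Suc j)))"
      proof (intro order_trans[OF sum_abs] sum_mono)
        fix j
        have "E (r (Suc j)) * Lint \<beta> (r j) (r (Suc j)) = Lint (\<lambda>s. E (r (Suc j)) * \<beta> s) (r j) (r (Suc j))"
          by (rule set_integral_mult_right[symmetric])
        then have "E (r (Suc j)) * Lint \<beta> (r j) (r (Suc j)) - Lint (\<lambda>s. E s * \<beta> s) (r j) (r (Suc j)) =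
          Lint (\<lambda>s. E (r (Suc j)) * \<beta> s - E s * \<beta> s) (r j) (r (Suc j))"
          by (simp only: Lint_diff[OF set_integrable_mult_right[OF sub[OF \<beta>]] sub[OF E\<beta>]])
        also have "\<bar>...\<bar> \<le> Lint (\<lambda>s. e / 3 / (I + 1) * \<bar>\<beta> s\<bar>) (r j) (r (Suc j))"
        proof (rule Lint_abs_le)
          fix s assume s: "s \<in> {r j..r (Suc j)}"
          then have "s \<in> {0..T}" "\<bar>r (Suc j) - s\<bar> \<le> T / 2^m" using r(1)[of j] r(1)[of "Suc j"] r(3)[of j] by auto
          then have "\<bar>E (r (Suc j)) - E s\<bar> \<le> e / 3 / (I + 1)" using elim(2)[rule_format, of "r (Suc j)" s] r(1)[of "Suc j"] by simp
          then show "\<bar>E (r (Suc j)) * \<beta> s - E s * \<beta> s\<bar> \<le> e / 3 / (I + 1) * \<bar>\<beta> s\<bar>"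
            unfolding left_diff_distrib[symmetric] abs_mult by (intro mult_right_mono) auto
        qed (intro set_integral_diff set_integrable_mult_right sub \<beta> E\<beta> a\<beta>)+
        also have "... = e / 3 / (I + 1) * Lint (\<lambda>s. \<bar>\<beta> s\<bar>) (r j) (r (Suc j))" by (rule set_integral_mult_right)
        finally show "\<bar>E (r (Suc j)) * Lint \<beta> (r j) (r (Suc j)) - Lint (\<lambda>s. E s * \<beta> s) (r j) (r (Suc j))\<bar> \<le> e / 3 / (I + 1) * Lint (\<lambda>s. \<bar>\<beta> s\<bar>) (r j) (r (Suc j))" .
      qed
      also have "... = e / 3 / (I + 1) * (\<Sum>j<2^m. Lint (\<lambda>s. \<bar>\<beta> s\<bar>) 0 (r (Suc j)) - Lint (\<lambda>s. \<bar>\<beta> s\<bar>) 0 (r j))"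
        unfolding Lr[OF a\<beta>] sum_distrib_left ..
      also have "... \<le> e / 3 / (I + 1) * I"
      proof (rule mult_left_mono)
        have "(\<Sum>j<2^m. Lint (\<lambda>s. \<bar>\<beta> s\<bar>) 0 (r (Suc j)) - Lint (\<lambda>s. \<bar>\<beta> s\<bar>) 0 (r j)) = Lint (\<lambda>s. \<bar>\<beta> s\<bar>) 0 t - Lint (\<lambda>s. \<bar>\<beta> s\<bar>) 0 0"
          using sum_telescope_min[OF T t, of "Lint (\<lambda>s. \<bar>\<beta> s\<bar>) 0" m] by (simp add: r_def)
        also have "... \<le> I" unfolding Lint_singleton I_def using t Lint_subset_mono[OF a\<beta>, of 0 t] by simp
        finally show "(\<Sum>j<2^m. Lint (\<lambda>s. \<bar>\<beta> s\<bar>) 0 (r (Suc j)) - Lint (\<lambda>s. \<bar>\<beta> s\<bar>) 0 (r j)) \<le> I" .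
      qed (use e I in simp)
      also have "... \<le> e / 3" using e I by (simp add: field_simps)
      finally have 1: "\<bar>\<Sum>j<2^m. E (r (Suc j)) * Lint \<beta> (r j) (r (Suc j)) - Lint (\<lambda>s. E s * \<beta> s) (r j) (r (Suc j))\<bar> \<le> e / 3" .
      have "(\<Sum>j<2^m. y (grid T m j) * R j) = (\<Sum>j<2^m. y (grid T m j) * ((incr b T m t j)\<^sup>2 - s2 * step m t j)) / 2
        + (\<Sum>j<2^m. y (grid T m j) * (R j - ((incr b T m t j)\<^sup>2 - s2 * step m t j) / 2))"
        unfolding sum_divide_distrib sum.distrib[symmetric] by (intro sum.cong refl) (simp add: right_diff_distrib)
      moreover have "\<bar>\<Sum>j<2^m. y (grid T m j) * (R j - ((incr b T m t j)\<^sup>2 - s2 * step m t j) / 2)\<bar> \<le>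
        (\<Sum>j<2^m. Y * (n * (4 * (incr b T m t j)\<^sup>2 + 3 * (s2 * step m t j))))"
      proof (intro order_trans[OF sum_abs] sum_mono)
        fix j assume "j \<in> {..<(2::nat)^m}"
        then have "grid T m j \<in> {0..T}" using T by (auto intro!: grid_nonneg grid_le_T)
        then have "\<bar>y (grid T m j)\<bar> \<le> Y" by (rule Y)
        moreover have "\<bar>R j - ((incr b T m t j)\<^sup>2 - s2 * step m t j) / 2\<bar> \<le> n * (4 * (incr b T m t j)\<^sup>2 + 3 * (s2 * step m t j))"
          unfolding R_def
        proof (rule second_order_remainder[OF n(1,2)])
          show "\<bar>incr b T m t j\<bar> \<le> n" using elim(3)[rule_format, OF t, of j] by simp
          show "0 \<le> step m t j" using min_grid_bounds(4)[OF T t] .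
          have "s2 * step m t j \<le> (s2 + 1) * (T / 2^m)"
            using s2 min_grid_bounds(3,4)[OF T t, of m j] by (intro mult_mono) auto
          also have "... \<le> n" using elim(1) s2 by (simp add: field_simps)
          finally show "s2 * step m t j \<le> n" .
        qed
        ultimately show "\<bar>y (grid T m j) * (R j - ((incr b T m t j)\<^sup>2 - s2 * step m t j) / 2)\<bar> \<le> Y * (n * (4 * (incr b T m t j)\<^sup>2 + 3 * (s2 * step m t j)))"
          unfolding abs_mult using Y by (intro mult_mono) auto
      qed
      moreover have "(\<Sum>j<2^m. Y * (n * (4 * (incr b T m t j)\<^sup>2 + 3 * (s2 * step m t j)))) = Y * n * (4 * QV b T m t + 3 * (s2 * t))"
      proof -
        have "(\<Sum>j<2^m. Y * (n * (4 * (incr b T m t j)\<^sup>2 + 3 * (s2 * step m t j)))) =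
          Y * n * (4 * (\<Sum>j<2^m. (incr b T m t j)\<^sup>2) + 3 * (s2 * (\<Sum>j<2^m. step m t j)))"
          unfolding sum_distrib_left sum.distrib[symmetric] by (intro sum.cong refl) (simp add: algebra_simps)
        then show ?thesis by (simp only: QV_def sum_step[OF t])
      qed
      moreover have "Y * n * (4 * QV b T m t + 3 * (s2 * t)) \<le> Y * n * C"
        unfolding C_def using elim(4) t s2 Y n by (intro mult_left_mono add_mono) auto
      moreover have "Y * n * C \<le> e / 3"
      proof -
        have "x / q * q = x" if "q > 0" for x q :: real using that by simp
        from this[OF YC, of "e / 3"] have "n * (Y * C + 1) \<le> e / 3"
          using mult_right_mono[OF n(3), of "Y * C + 1"] YC by linarith
        then show ?thesis using n(1) by (simp add: algebra_simps)
      qed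
      moreover have "\<bar>\<Sum>j<2^m. y (grid T m j) * ((incr b T m t j)\<^sup>2 - s2 * step m t j)\<bar> < e / 3" using elim(5) t by blast
      \<comment> \<open>The compensated squares enter with the factor 1/2 and account for
        \<open>e / 6\<close>, the Taylor remainders for \<open>e / 3\<close>.\<close>
      ultimately have 2: "\<bar>\<Sum>j<2^m. y (grid T m j) * R j\<bar> < e / 6 + e / 3" by linarith
      show "dist (\<Sum>j<2^m. y (grid T m j) * incr b T m t j) (y t - y 0 - Lint (\<lambda>s. E s * \<beta> s) 0 t) < e"
        using 1 2 diff e unfolding dist_real_def by linarith
    qed
  qed
qed

end

section \<open>Brownian increments\<close>

text \<open>The product formula over \<open>Basis\<close>, reindexed by coordinates through the
  injection sending \<open>i\<close> to \<open>axis i 1\<close>.\<close>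

lemma nn_integral_lborel_vec_prod:
  fixes F :: "'n::finite => real => real"
  assumes [measurable]: "\<And>i. F i \<in> borel_measurable borel" and nn: "\<And>i x. 0 \<le> F i x"
  shows "(\<integral>\<^sup>+x. ennreal (\<Prod>i\<in>UNIV. F i (x $ i)) \<partial>(lborel :: (real^'n) measure)) = (\<Prod>i\<in>UNIV. \<integral>\<^sup>+x. ennreal (F i x) \<partial>lborel)"
proof -
  define e where "e i = (axis i 1 :: real^'n)" for i
  have inj: "inj e" by (auto simp: inj_on_def e_def axis_eq_axis)
  have B: "(Basis :: (real^'n) set) = range e" by (auto simp: Basis_vec_def e_def)
  define f where "f b = F (inv e b)" for b
  have fe: "f (e i) = F i" for i by (simp add: f_def inv_f_f[OF inj])
  have xe: "x \<bullet> e i = x $ i" for x i by (simp add: e_def inner_axis)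
  have "(\<integral>\<^sup>+x. ennreal (\<Prod>i\<in>UNIV. F i (x $ i)) \<partial>(lborel :: (real^'n) measure)) = (\<integral>\<^sup>+x. (\<Prod>b\<in>Basis. ennreal (f b (x \<bullet> b))) \<partial>lborel)"
    by (intro nn_integral_cong) (simp add: B prod.reindex[OF inj] fe xe prod_ennreal nn)
  also have "... = (\<Prod>b\<in>(Basis :: (real^'n) set). \<integral>\<^sup>+x. ennreal (f b x) \<partial>lborel)"
    by (rule nn_integral_lborel_prod) (auto simp: f_def)
  also have "... = (\<Prod>i\<in>UNIV. \<integral>\<^sup>+x. ennreal (F i x) \<partial>lborel)"
    by (simp add: B prod.reindex[OF inj] fe)
  finally show ?thesis .
qed

text \<open>The density is a product, so the probability of a box factorizes. A condition on the
  coordinates in \<open>J\<close> alone is a box with \<open>UNIV\<close> in the other directions,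
  each of which contributes the factor 1.\<close>

lemma (in prob_space) independent_normal_components:
  fixes X :: "'a => real^'n"
  assumes D: "distributed M lborel X (\<lambda>x. ennreal (\<Prod>i\<in>UNIV. normal_density 0 \<sigma> (x $ i)))" and \<sigma>: "\<sigma> > 0"
  shows "distributed M lborel (\<lambda>\<omega>. X \<omega> $ i) (normal_density 0 \<sigma>)"
    and "indep_vars (\<lambda>_. borel) (\<lambda>i \<omega>. X \<omega> $ i) UNIV"
proof -
  have X[measurable]: "X \<in> borel_measurable M" using distributed_measurable[OF D] by simp
  have [measurable]: "(\<lambda>\<omega>. X \<omega> $ i) \<in> borel_measurable M" for i
    by (rule measurable_compose[OF X borel_measurable_nth])
  define \<nu> where "\<nu> A = (\<integral>\<^sup>+x. ennreal (normal_density 0 \<sigma> x * indicator A x) \<partial>lborel)" for A :: "real set"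
  have \<nu>1: "\<nu> UNIV = 1"
    unfolding \<nu>_def using \<sigma> by (simp add: nn_integral_eq_integral)
  have joint: "emeasure M {\<omega>\<in>space M. \<forall>i. X \<omega> $ i \<in> A i} = (\<Prod>i\<in>UNIV. \<nu> (A i))"
    if A: "\<And>i. A i \<in> sets borel" for A
  proof -
    have S: "{x :: real^'n. \<forall>i. x $ i \<in> A i} \<in> sets borel"
    proof -
      have "{x :: real^'n. \<forall>i. x $ i \<in> A i} = (\<Inter>i. (\<lambda>x. x $ i) -` A i \<inter> space borel)" by auto
      also have "... \<in> sets borel"
        by (intro sets.finite_INT measurable_sets[OF borel_measurable_nth A]) auto
      finally show ?thesis .
    qed
    have "emeasure M {\<omega>\<in>space M. \<forall>i. X \<omega> $ i \<in> A i} = emeasure M (X -` {x. \<forall>i. x $ i \<in> A i} \<inter> space M)"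
      by (intro arg_cong[where f="emeasure M"]) auto
    also have "... = (\<integral>\<^sup>+x. ennreal (\<Prod>i\<in>UNIV. normal_density 0 \<sigma> (x $ i)) * indicator {x. \<forall>i. x $ i \<in> A i} x \<partial>lborel)"
      using S by (intro distributed_emeasure[OF D]) simp
    also have "... = (\<integral>\<^sup>+x. ennreal (\<Prod>i\<in>UNIV. normal_density 0 \<sigma> (x $ i) * indicator (A i) (x $ i)) \<partial>lborel)"
    proof (intro nn_integral_cong)
      fix x :: "real^'n"
      have "indicator {x. \<forall>i. x $ i \<in> A i} x = (\<Prod>i\<in>UNIV. indicator (A i) (x $ i) :: real)"
      proof (cases "\<forall>i. x $ i \<in> A i")
        case True then show ?thesis by simp
      next
        case False
        then obtain i where "x $ i \<notin> A i" by blast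
        then have "(\<Prod>i\<in>UNIV. indicator (A i) (x $ i) :: real) = 0" by (intro prod_zero bexI[of _ i]) auto
        then show ?thesis using False by simp
      qed
      then have "(\<Prod>i\<in>UNIV. normal_density 0 \<sigma> (x $ i) * indicator (A i) (x $ i)) = (\<Prod>i\<in>UNIV. normal_density 0 \<sigma> (x $ i)) * indicator {x. \<forall>i. x $ i \<in> A i} x"
        by (simp add: prod.distrib)
      then show "ennreal (\<Prod>i\<in>UNIV. normal_density 0 \<sigma> (x $ i)) * indicator {x. \<forall>i. x $ i \<in> A i} x =
        ennreal (\<Prod>i\<in>UNIV. normal_density 0 \<sigma> (x $ i) * indicator (A i) (x $ i))"
        by (simp add: indicator_def)
    qed
    also have "... = (\<Prod>i\<in>UNIV. \<nu> (A i))" unfolding \<nu>_def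
      using A by (intro nn_integral_lborel_vec_prod) auto
    finally show ?thesis .
  qed
  have marg: "emeasure M {\<omega>\<in>space M. \<forall>i\<in>J. X \<omega> $ i \<in> A i} = (\<Prod>i\<in>J. \<nu> (A i))"
    if A: "\<And>i. i \<in> J ==> A i \<in> sets borel" for A J
  proof -
    have "emeasure M {\<omega>\<in>space M. \<forall>i\<in>J. X \<omega> $ i \<in> A i} = emeasure M {\<omega>\<in>space M. \<forall>i. X \<omega> $ i \<in> (if i \<in> J then A i else UNIV)}"
      by (intro arg_cong[where f="emeasure M"]) auto
    also have "... = (\<Prod>i\<in>UNIV. \<nu> (if i \<in> J then A i else UNIV))" by (rule joint) (use A in auto)
    also have "... = (\<Prod>i\<in>UNIV. if i \<in> J then \<nu> (A i) else 1)" by (intro prod.cong) (auto simp: \<nu>1)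
    also have "... = (\<Prod>i\<in>J. \<nu> (A i))" by (simp add: prod.If_cases)
    finally show ?thesis .
  qed
  show "distributed M lborel (\<lambda>\<omega>. X \<omega> $ i) (normal_density 0 \<sigma>)" for i
    unfolding distributed_def
  proof (intro conjI)
    show "distr M lborel (\<lambda>\<omega>. X \<omega> $ i) = density lborel (\<lambda>x. ennreal (normal_density 0 \<sigma> x))"
    proof (rule measure_eqI)
      fix A assume "A \<in> sets (distr M lborel (\<lambda>\<omega>. X \<omega> $ i))"
      then have A: "A \<in> sets borel" by simp
      have "emeasure (distr M lborel (\<lambda>\<omega>. X \<omega> $ i)) A = emeasure M {\<omega>\<in>space M. \<forall>j\<in>{i}. X \<omega> $ j \<in> A}"
        using A by (subst emeasure_distr) (auto intro!: arg_cong[where f="emeasure M"])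
      also have "... = \<nu> A" using marg[of "{i}" "\<lambda>_. A"] A by simp
      also have "... = emeasure (density lborel (\<lambda>x. ennreal (normal_density 0 \<sigma> x))) A"
        unfolding \<nu>_def using A by (subst emeasure_density) (auto intro!: nn_integral_cong simp: indicator_def)
      finally show "emeasure (distr M lborel (\<lambda>\<omega>. X \<omega> $ i)) A = emeasure (density lborel (\<lambda>x. ennreal (normal_density 0 \<sigma> x))) A" .
    qed simp
  qed auto
  show "indep_vars (\<lambda>_. borel) (\<lambda>i \<omega>. X \<omega> $ i) UNIV"
    unfolding indep_vars_def2
  proof (intro conjI ballI indep_setsI)
    fix A J assume J: "J \<noteq> {}" "J \<subseteq> UNIV" "finite J" and "\<forall>j\<in>J. A j \<in> {(\<lambda>\<omega>. X \<omega> $ j) -` B \<inter> space M |B. B \<in> sets borel}"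
    then obtain B where B: "\<And>j. j \<in> J ==> B j \<in> sets borel" "\<And>j. j \<in> J ==> A j = (\<lambda>\<omega>. X \<omega> $ j) -` B j \<inter> space M"
      by (simp only: mem_Collect_eq) metis
    have "(\<Inter>j\<in>J. A j) = {\<omega>\<in>space M. \<forall>j\<in>J. X \<omega> $ j \<in> B j}" using B(2) J(1) by auto
    then have "emeasure M (\<Inter>j\<in>J. A j) = (\<Prod>j\<in>J. \<nu> (B j))" using marg[of J B] B(1) by simp
    also have "... = (\<Prod>j\<in>J. emeasure M (A j))"
    proof (rule prod.cong)
      fix j assume j: "j \<in> J"
      have "A j = {\<omega>\<in>space M. \<forall>i\<in>{j}. X \<omega> $ i \<in> B i}" using B(2)[OF j] by auto
      then show "\<nu> (B j) = emeasure M (A j)" using marg[of "{j}" B] B(1)[OF j] by simp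
    qed simp
    finally show "prob (\<Inter>j\<in>J. A j) = (\<Prod>j\<in>J. prob (A j))"
      by (simp add: emeasure_eq_measure prod_ennreal prod_nonneg)
  qed auto
qed

lemma (in prob_space) normal_inner:
  fixes X :: "'a => real^'n"
  assumes D: "distributed M lborel X (\<lambda>x. ennreal (\<Prod>i\<in>UNIV. normal_density 0 \<sigma> (x $ i)))" and \<sigma>: "\<sigma> > 0" and a: "a \<noteq> 0"
  shows "distributed M lborel (\<lambda>\<omega>. a \<bullet> X \<omega>) (normal_density 0 (norm a * \<sigma>))"
proof -
  note ind = independent_normal_components[OF D \<sigma>]
  \<comment> \<open>\<open>sum_indep_normal\<close> requires a nonempty index set and positive
    standard deviations, so the coordinates with coefficient 0 are left out.\<close>
  define I where "I = {i. a $ i \<noteq> 0}"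
  have I: "I \<noteq> {}" using a by (auto simp: I_def vec_eq_iff)
  have "distributed M lborel (\<lambda>\<omega>. \<Sum>i\<in>I. a $ i * X \<omega> $ i) (normal_density (\<Sum>i\<in>I. 0) (sqrt (\<Sum>i\<in>I. (\<bar>a $ i\<bar> * \<sigma>)\<^sup>2)))"
  proof (rule sum_indep_normal)
    show "indep_vars (\<lambda>i. borel) (\<lambda>i \<omega>. a $ i * X \<omega> $ i) I"
      by (rule indep_vars_compose2[OF indep_vars_subset[OF ind(2)]]) auto
    show "distributed M lborel (\<lambda>\<omega>. a $ i * X \<omega> $ i) (normal_density 0 (\<bar>a $ i\<bar> * \<sigma>))" if "i \<in> I" for i
      using normal_density_affine[OF ind(1)[of i] \<sigma>, of "a $ i" 0] that by (simp add: I_def)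
  qed (use I \<sigma> in \<open>auto simp: I_def\<close>)
  moreover have "(\<lambda>\<omega>. \<Sum>i\<in>I. a $ i * X \<omega> $ i) = (\<lambda>\<omega>. a \<bullet> X \<omega>)"
    unfolding inner_vec_def inner_real_def I_def by (intro ext sum.mono_neutral_left) auto
  moreover have "sqrt (\<Sum>i\<in>I. (\<bar>a $ i\<bar> * \<sigma>)\<^sup>2) = norm a * \<sigma>"
  proof -
    have "(\<Sum>i\<in>I. (\<bar>a $ i\<bar> * \<sigma>)\<^sup>2) = (\<Sum>i\<in>UNIV. (\<bar>a $ i\<bar> * \<sigma>)\<^sup>2)"
      unfolding I_def by (intro sum.mono_neutral_left) auto
    also have "... = (\<Sum>i\<in>UNIV. (a $ i)\<^sup>2) * \<sigma>\<^sup>2" by (simp add: power_mult_distrib sum_distrib_right)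
    also have "(\<Sum>i\<in>UNIV. (a $ i)\<^sup>2) = (norm a)\<^sup>2"
      unfolding power2_norm_eq_inner inner_vec_def by (simp add: power2_eq_square)
    finally show ?thesis using \<sigma> by (simp add: real_sqrt_mult)
  qed
  ultimately show ?thesis by simp
qed

lemma (in prob_space) normal_moments:
  assumes D: "distributed M lborel X (normal_density 0 \<sigma>)" and \<sigma>: "\<sigma> > 0"
  shows "integrable M (\<lambda>\<omega>. X \<omega> ^ k)" "expectation X = 0" "expectation (\<lambda>\<omega>. X \<omega> ^ 2) = \<sigma>^2"
    "expectation (\<lambda>\<omega>. X \<omega> ^ 4) = 3 * \<sigma>^4"
    "(\<integral>\<^sup>+\<omega>. ennreal (exp (\<theta> * X \<omega>)) \<partial>M) = ennreal (exp (\<theta>\<^sup>2 * \<sigma>\<^sup>2 / 2))"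
proof -
  have int: "integrable lborel (\<lambda>x. normal_density 0 \<sigma> x * x ^ k)" for k
    using integrable_normal_moment[OF \<sigma>, of 0 k] by simp
  show "integrable M (\<lambda>\<omega>. X \<omega> ^ k)"
    using distributed_integrable[OF D, of "\<lambda>x. x ^ k"] int[of k] by simp
  show "expectation X = 0" by (rule normal_distributed_expectation[OF \<sigma> D])
  have E: "expectation (\<lambda>\<omega>. X \<omega> ^ (2 * k)) = fact (2 * k) / ((2 / \<sigma>\<^sup>2)^k * fact k)" for k
    using distributed_integral[OF D, of "\<lambda>x. x ^ (2 * k)"] integral_normal_moment_even[OF \<sigma>, of 0 k] by simp
  show "expectation (\<lambda>\<omega>. X \<omega> ^ 2) = \<sigma>^2" using E[of 1] by simp
  have f4: "fact 4 = (24::real)" by (simp add: fact_numeral)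
  show "expectation (\<lambda>\<omega>. X \<omega> ^ 4) = 3 * \<sigma>^4" using E[of 2] \<sigma> by (simp add: f4 power_divide power_mult[symmetric])
  have "(\<integral>\<^sup>+\<omega>. ennreal (exp (\<theta> * X \<omega>)) \<partial>M) = (\<integral>\<^sup>+x. ennreal (normal_density 0 \<sigma> x) * ennreal (exp (\<theta> * x)) \<partial>lborel)"
    by (rule distributed_nn_integral[OF D, symmetric]) auto
  also have "... = (\<integral>\<^sup>+x. ennreal (exp (\<theta>\<^sup>2 * \<sigma>\<^sup>2 / 2)) * ennreal (normal_density (\<theta> * \<sigma>\<^sup>2) \<sigma> x) \<partial>lborel)"
  proof (intro nn_integral_cong)
    fix x
    \<comment> \<open>Completing the square: the exponential factor shifts the mean to
      \<open>\<theta> * \<sigma>\<^sup>2\<close> and leaves a constant in front.\<close>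
    have "- (x\<^sup>2) / (2 * \<sigma>\<^sup>2) + \<theta> * x = \<theta>\<^sup>2 * \<sigma>\<^sup>2 / 2 + - ((x - \<theta> * \<sigma>\<^sup>2)\<^sup>2) / (2 * \<sigma>\<^sup>2)"
      using \<sigma> by (simp add: field_simps power2_eq_square)
    then have "exp (- (x\<^sup>2) / (2 * \<sigma>\<^sup>2)) * exp (\<theta> * x) = exp (\<theta>\<^sup>2 * \<sigma>\<^sup>2 / 2) * exp (- ((x - \<theta> * \<sigma>\<^sup>2)\<^sup>2) / (2 * \<sigma>\<^sup>2))"
      by (simp only: exp_add[symmetric])
    then have "normal_density 0 \<sigma> x * exp (\<theta> * x) = exp (\<theta>\<^sup>2 * \<sigma>\<^sup>2 / 2) * normal_density (\<theta> * \<sigma>\<^sup>2) \<sigma> x"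
      by (simp add: normal_density_def)
    then show "ennreal (normal_density 0 \<sigma> x) * ennreal (exp (\<theta> * x)) = ennreal (exp (\<theta>\<^sup>2 * \<sigma>\<^sup>2 / 2)) * ennreal (normal_density (\<theta> * \<sigma>\<^sup>2) \<sigma> x)"
      by (simp add: ennreal_mult[symmetric])
  qed
  also have "... = ennreal (exp (\<theta>\<^sup>2 * \<sigma>\<^sup>2 / 2))"
    using \<sigma> by (simp add: nn_integral_cmult nn_integral_eq_integral)
  finally show "(\<integral>\<^sup>+\<omega>. ennreal (exp (\<theta> * X \<omega>)) \<partial>M) = ennreal (exp (\<theta>\<^sup>2 * \<sigma>\<^sup>2 / 2))" .
qed

section \<open>The augmented filtration\<close>

lemma measurable_filtration_mono:
  assumes "f \<in> measurable A N" "space A = space B" "sets A \<subseteq> sets B" shows "f \<in> measurable B N"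
  using assms by (auto simp: measurable_def)

locale brownian = prob_space M for M :: "'a measure" +
  fixes Z :: "real => 'a => real^'n"
  assumes BM: "brownian_motion M Z"
begin

abbreviation "F \<equiv> augmented_filtration M Z"
abbreviation "NF \<equiv> natural_filtration M Z"

lemma Z_measurable: "t \<ge> 0 ==> Z t \<in> borel_measurable M"
  using BM by (simp add: brownian_motion_def)

lemma space_NF: "space (NF t) = space M"
  unfolding natural_filtration_def by (rule space_measure_of) auto

lemma sets_NF: "sets (NF t) = sigma_sets (space M) {Z s -` B \<inter> space M | s B. s \<in> {0..t} \<and> B \<in> sets borel}"
  unfolding natural_filtration_def by (rule sets_measure_of) auto

lemma sets_Nat_subset: "sets (NF t) \<subseteq> sets M"
  unfolding sets_NF using Z_measurable by (intro sets.sigma_sets_subset) (auto intro: measurable_sets)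

lemma gen_F: "sets (NF t) \<union> null_sets M \<subseteq> Pow (space M)"
  using sets_Nat_subset[of t] sets.sets_into_space[of _ M] by auto

lemma space_F [simp]: "space (F t) = space M"
  unfolding augmented_filtration_def by (rule space_measure_of[OF gen_F])

lemma sets_F: "sets (F t) = sigma_sets (space M) (sets (NF t) \<union> null_sets M)"
  unfolding augmented_filtration_def by (rule sets_measure_of[OF gen_F])

lemma sets_F_subset: "sets (F t) \<subseteq> sets M"
  unfolding sets_F using sets_Nat_subset by (intro sets.sigma_sets_subset) auto

lemma null_sets_F: "N \<in> null_sets M ==> N \<in> sets (F t)"
  unfolding sets_F by (intro sigma_sets.Basic) auto

lemma NF_mono: assumes "s \<le> t" shows "sets (NF s) \<subseteq> sets (NF t)"
  unfolding sets_NF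
proof (rule sigma_sets_subseteq, rule subsetI)
  fix x assume "x \<in> {Z r -` B \<inter> space M |r B. r \<in> {0..s} \<and> B \<in> sets borel}"
  then obtain r B where "x = Z r -` B \<inter> space M" "r \<in> {0..s}" "B \<in> sets borel" by blast
  moreover from this have "r \<in> {0..t}" using assms by auto
  ultimately show "x \<in> {Z r -` B \<inter> space M |r B. r \<in> {0..t} \<and> B \<in> sets borel}" by blast
qed

lemma F_mono: "s \<le> t ==> sets (F s) \<subseteq> sets (F t)"
  unfolding sets_F using NF_mono by (intro sigma_sets_subseteq) auto

lemma measurable_F_mono: "X \<in> measurable (F s) N ==> s \<le> t ==> X \<in> measurable (F t) N"
  by (rule measurable_filtration_mono[OF _ _ F_mono]) auto

lemma measurable_F_M: "X \<in> measurable (F s) N ==> X \<in> measurable M N"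
  by (rule measurable_filtration_mono[OF _ _ sets_F_subset]) auto

lemma Z_F_measurable: assumes "0 \<le> s" "s \<le> t" shows "Z s \<in> borel_measurable (F t)"
proof (rule measurableI)
  fix B assume "B \<in> sets (borel :: (real^'n) measure)"
  then have "Z s -` B \<inter> space M \<in> sets (NF t)" unfolding sets_NF using assms by (intro sigma_sets.Basic) auto
  then show "Z s -` B \<inter> space (F t) \<in> sets (F t)" unfolding sets_F space_F by (intro sigma_sets.Basic) auto
qed auto

text \<open>Augmentation changes events only by null sets. This transfers the independence of
  increments, given for the natural filtration, to the augmented one.\<close>

lemma F_approx:
  assumes "A \<in> sets (F t)" shows "\<exists>B\<in>sets (NF t). AE \<omega> in M. \<omega> \<in> A \<longleftrightarrow> \<omega> \<in> B"
  using assms unfolding sets_F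
proof (induction rule: sigma_sets.induct)
  case (Basic a)
  show ?case
  proof (cases "a \<in> sets (NF t)")
    case False
    with Basic have "a \<in> null_sets M" by auto
    then have "AE \<omega> in M. \<omega> \<in> a \<longleftrightarrow> \<omega> \<in> {}" using AE_not_in[of a M] by auto
    then show ?thesis by (intro bexI[of _ "{}"]) auto
  qed auto
next
  case Empty show ?case by (intro bexI[of _ "{}"]) auto
next
  case (Compl a)
  then obtain B where B: "B \<in> sets (NF t)" "AE \<omega> in M. \<omega> \<in> a \<longleftrightarrow> \<omega> \<in> B" by blast
  have "space M - B \<in> sets (NF t)" using B(1) sets.compl_sets[of B "NF t"] by (simp add: space_NF)
  moreover have "AE \<omega> in M. \<omega> \<in> space M - a \<longleftrightarrow> \<omega> \<in> space M - B" using B(2) by eventually_elim auto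
  ultimately show ?case by blast
next
  case (Union a)
  then obtain B where B: "\<And>i. B i \<in> sets (NF t)" "\<And>i. AE \<omega> in M. \<omega> \<in> a i \<longleftrightarrow> \<omega> \<in> B i" by metis
  have "AE \<omega> in M. \<forall>i. \<omega> \<in> a i \<longleftrightarrow> \<omega> \<in> B i" using B(2) by (simp add: AE_all_countable)
  then have "AE \<omega> in M. \<omega> \<in> (\<Union>i. a i) \<longleftrightarrow> \<omega> \<in> (\<Union>i. B i)" by eventually_elim auto
  moreover have "(\<Union>i. B i) \<in> sets (NF t)" using B(1) by auto
  ultimately show ?case by blast
qed

lemma increment_independent:
  assumes st: "0 \<le> s" "s < t" and A: "A \<in> sets (F s)" and D: "D \<in> sets borel"
  shows "prob (A \<inter> ((\<lambda>\<omega>. Z t \<omega> - Z s \<omega>) -` D \<inter> space M)) = prob A * prob ((\<lambda>\<omega>. Z t \<omega> - Z s \<omega>) -` D \<inter> space M)"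
proof -
  let ?D = "(\<lambda>\<omega>. Z t \<omega> - Z s \<omega>) -` D \<inter> space M"
  obtain B where B: "B \<in> sets (NF s)" "AE \<omega> in M. \<omega> \<in> A \<longleftrightarrow> \<omega> \<in> B" using F_approx[OF A] by blast
  have [measurable]: "Z s \<in> borel_measurable M" "Z t \<in> borel_measurable M" using st by (auto intro: Z_measurable)
  have Ds: "?D \<in> sets M" using D by (intro measurable_sets[of _ M borel]) auto
  have As: "A \<in> sets M" "B \<in> sets M" using A sets_F_subset B sets_Nat_subset by auto
  have "prob (A \<inter> ?D) = prob (B \<inter> ?D)"
    using B(2) As Ds by (intro finite_measure_eq_AE) auto
  also have "... = prob B * prob ?D"
    using BM st B(1) D unfolding brownian_motion_def by (intro indep_setD) auto
  also have "prob B = prob A" using B(2) As by (intro finite_measure_eq_AE) auto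
  finally show ?thesis .
qed

lemma indep_var_increment:
  fixes W :: "'a => real" and g :: "real^'n => real"
  assumes st: "0 \<le> s" "s < t" and W: "W \<in> borel_measurable (F s)" and g: "g \<in> borel_measurable borel"
  shows "indep_var borel W borel (\<lambda>\<omega>. g (Z t \<omega> - Z s \<omega>))"
  unfolding indep_var_eq
proof (intro conjI)
  let ?I = "\<lambda>\<omega>. Z t \<omega> - Z s \<omega>"
  have [measurable]: "Z s \<in> borel_measurable M" "Z t \<in> borel_measurable M" using st by (auto intro: Z_measurable)
  have [measurable]: "W \<in> borel_measurable M" by (rule measurable_F_M[OF W])
  note g[measurable]
  show "random_variable borel W" "random_variable borel (\<lambda>\<omega>. g (?I \<omega>))" by measurable
  have 1: "sigma_sets (space M) {W -` A \<inter> space M |A. A \<in> sets borel} \<subseteq> sets (F s)"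
  proof -
    have "{W -` A \<inter> space M |A. A \<in> sets borel} \<subseteq> sets (F s)" using measurable_sets[OF W] by auto
    from sets.sigma_sets_subset[OF this] show ?thesis by simp
  qed
  have 2: "sigma_sets (space M) {(\<lambda>\<omega>. g (?I \<omega>)) -` A \<inter> space M |A. A \<in> sets borel} \<subseteq> sets (vimage_algebra (space M) ?I borel)"
  proof -
    have "(\<lambda>\<omega>. g (?I \<omega>)) -` A \<inter> space M \<in> sets (vimage_algebra (space M) ?I borel)" if "A \<in> sets borel" for A
    proof -
      have "g -` A \<in> sets borel" using measurable_sets[OF g that] by simp
      then have "?I -` (g -` A) \<inter> space M \<in> sets (vimage_algebra (space M) ?I borel)" by (rule in_vimage_algebra)
      then show ?thesis by (simp add: vimage_def)
    qed
    then show ?thesis using sets.sigma_sets_subset[of "{(\<lambda>\<omega>. g (?I \<omega>)) -` A \<inter> space M |A. A \<in> sets borel}" "vimage_algebra (space M) ?I borel"]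
      by auto
  qed
  have 3: "sets (vimage_algebra (space M) ?I borel) = {?I -` D \<inter> space M |D. D \<in> sets borel}"
    by (rule sets_vimage_algebra2) auto
  show "indep_set (sigma_sets (space M) {W -` A \<inter> space M |A. A \<in> sets borel})
     (sigma_sets (space M) {(\<lambda>\<omega>. g (?I \<omega>)) -` A \<inter> space M |A. A \<in> sets borel})"
  proof (rule indep_setI)
    show "sigma_sets (space M) {W -` A \<inter> space M |A. A \<in> sets borel} \<subseteq> events" using 1 sets_F_subset by auto
    show "sigma_sets (space M) {(\<lambda>\<omega>. g (?I \<omega>)) -` A \<inter> space M |A. A \<in> sets borel} \<subseteq> events"
      by (intro sets.sigma_sets_subset) (auto intro: measurable_sets)
    fix a b assume "a \<in> sigma_sets (space M) {W -` A \<inter> space M |A. A \<in> sets borel}"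
      and "b \<in> sigma_sets (space M) {(\<lambda>\<omega>. g (?I \<omega>)) -` A \<inter> space M |A. A \<in> sets borel}"
    then have "a \<in> sets (F s)" "b \<in> {?I -` D \<inter> space M |D. D \<in> sets borel}" using 1 2 3 by auto
    then show "prob (a \<inter> b) = prob a * prob b" using increment_independent[OF st] by auto
  qed
qed

lemma expectation_increment:
  fixes W :: "'a => real" and g :: "real^'n => real"
  assumes st: "0 \<le> s" "s < t" and W: "W \<in> borel_measurable (F s)" and g: "g \<in> borel_measurable borel"
    and iW: "integrable M W" and ig: "integrable M (\<lambda>\<omega>. g (Z t \<omega> - Z s \<omega>))"
  shows "integrable M (\<lambda>\<omega>. W \<omega> * g (Z t \<omega> - Z s \<omega>))"
    "expectation (\<lambda>\<omega>. W \<omega> * g (Z t \<omega> - Z s \<omega>)) = expectation W * expectation (\<lambda>\<omega>. g (Z t \<omega> - Z s \<omega>))"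
  using indep_var_integrable[OF indep_var_increment[OF st W g] iW ig]
    indep_var_lebesgue_integral[OF indep_var_increment[OF st W g] iW ig] by auto

lemma inner_increment_moments:
  fixes a :: "real^'n"
  assumes st: "0 \<le> s" "s < t"
  defines "X \<equiv> \<lambda>\<omega>. a \<bullet> (Z t \<omega> - Z s \<omega>)"
  shows "integrable M (\<lambda>\<omega>. X \<omega> ^ k)" "expectation X = 0" "expectation (\<lambda>\<omega>. X \<omega> ^ 2) = (norm a)\<^sup>2 * (t - s)"
    "expectation (\<lambda>\<omega>. X \<omega> ^ 4) = 3 * ((norm a)\<^sup>2 * (t - s))\<^sup>2"
    "(\<integral>\<^sup>+\<omega>. ennreal (exp (\<theta> * X \<omega>)) \<partial>M) = ennreal (exp (\<theta>\<^sup>2 * ((norm a)\<^sup>2 * (t - s)) / 2))"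
proof -
  have D: "distributed M lborel (\<lambda>\<omega>. Z t \<omega> - Z s \<omega>) (\<lambda>x. ennreal (\<Prod>i\<in>UNIV. normal_density 0 (sqrt (t - s)) (x $ i)))"
    using BM st by (simp add: brownian_motion_def)
  have "integrable M (\<lambda>\<omega>. X \<omega> ^ k) \<and> expectation X = 0 \<and> expectation (\<lambda>\<omega>. X \<omega> ^ 2) = (norm a)\<^sup>2 * (t - s)
    \<and> expectation (\<lambda>\<omega>. X \<omega> ^ 4) = 3 * ((norm a)\<^sup>2 * (t - s))\<^sup>2
    \<and> (\<integral>\<^sup>+\<omega>. ennreal (exp (\<theta> * X \<omega>)) \<partial>M) = ennreal (exp (\<theta>\<^sup>2 * ((norm a)\<^sup>2 * (t - s)) / 2))"
  \<comment> \<open>For \<open>a = 0\<close> the inner product has no density, and the formulas are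
    checked directly; \<open>k = 0\<close> is separate because \<open>0 ^ 0 = 1\<close>.\<close>
  proof (cases "a = 0")
    case True
    have "(\<integral>\<^sup>+\<omega>. 1 \<partial>M) = 1" using emeasure_space_1 by simp
    then show ?thesis using True unfolding X_def by (cases "k = 0") (auto simp: prob_space)
  next
    case False
    have \<sigma>: "sqrt (t - s) > 0" "norm a * sqrt (t - s) > 0" using st False by auto
    have DX: "distributed M lborel X (normal_density 0 (norm a * sqrt (t - s)))"
      unfolding X_def by (rule normal_inner[OF D \<sigma>(1) False])
    have sq: "(norm a * sqrt (t - s))\<^sup>2 = (norm a)\<^sup>2 * (t - s)" using st by (simp add: power_mult_distrib)
    have "(norm a * sqrt (t - s))^4 = ((norm a * sqrt (t - s))\<^sup>2)\<^sup>2" by (simp add: power_mult[symmetric])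
    then show ?thesis using normal_moments[OF DX \<sigma>(2)] by (simp only: sq)
  qed
  then show "integrable M (\<lambda>\<omega>. X \<omega> ^ k)" "expectation X = 0" "expectation (\<lambda>\<omega>. X \<omega> ^ 2) = (norm a)\<^sup>2 * (t - s)"
    "expectation (\<lambda>\<omega>. X \<omega> ^ 4) = 3 * ((norm a)\<^sup>2 * (t - s))\<^sup>2"
    "(\<integral>\<^sup>+\<omega>. ennreal (exp (\<theta> * X \<omega>)) \<partial>M) = ennreal (exp (\<theta>\<^sup>2 * ((norm a)\<^sup>2 * (t - s)) / 2))" by auto
qed

text \<open>The exponential Markov inequality with parameter \<open>l / q\<close>, applied to
  \<open>a\<close> and to \<open>- a\<close>. A positive upper bound \<open>S\<close> for the
  squared norm is used so that \<open>a = 0\<close> is included.\<close>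

lemma increment_tail:
  assumes st: "0 \<le> s" "s < t" and S: "(norm a)\<^sup>2 \<le> S" "S > 0" and l: "l > 0"
  shows "prob {\<omega>\<in>space M. \<bar>a \<bullet> (Z t \<omega> - Z s \<omega>)\<bar> > l} \<le> 2 * exp (- l\<^sup>2 / (2 * S * (t - s)))"
proof -
  let ?X = "\<lambda>\<omega>. a \<bullet> (Z t \<omega> - Z s \<omega>)"
  have [measurable]: "Z s \<in> borel_measurable M" "Z t \<in> borel_measurable M" using st by (auto intro: Z_measurable)
  define q where "q = S * (t - s)"
  have q: "q > 0" using S st by (simp add: q_def)
  have one: "prob {\<omega>\<in>space M. b \<bullet> (Z t \<omega> - Z s \<omega>) > l} \<le> exp (- l\<^sup>2 / (2 * q))" if b: "norm b = norm a" for b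
  proof -
    let ?Y = "\<lambda>\<omega>. b \<bullet> (Z t \<omega> - Z s \<omega>)"
    have "emeasure M {\<omega>\<in>space M. ?Y \<omega> > l} \<le> (\<integral>\<^sup>+\<omega>. ennreal (exp (- l\<^sup>2 / q)) * ennreal (exp (l / q * ?Y \<omega>)) \<partial>M)"
    proof -
      have "emeasure M {\<omega>\<in>space M. ?Y \<omega> > l} = (\<integral>\<^sup>+\<omega>. indicator {\<omega>\<in>space M. ?Y \<omega> > l} \<omega> \<partial>M)" by simp
      also have "... \<le> (\<integral>\<^sup>+\<omega>. ennreal (exp (- l\<^sup>2 / q)) * ennreal (exp (l / q * ?Y \<omega>)) \<partial>M)"
      proof (intro nn_integral_mono)
        fix \<omega>
        show "indicator {\<omega>\<in>space M. ?Y \<omega> > l} \<omega> \<le> ennreal (exp (- l\<^sup>2 / q)) * ennreal (exp (l / q * ?Y \<omega>))"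
        proof (cases "?Y \<omega> > l")
          case True
          have "l / q * l \<le> l / q * ?Y \<omega>" using True l q by (intro mult_left_mono) auto
          then have "0 \<le> - l\<^sup>2 / q + l / q * ?Y \<omega>" by (simp add: power2_eq_square)
          then have "1 \<le> exp (- l\<^sup>2 / q) * exp (l / q * ?Y \<omega>)" by (simp add: exp_add[symmetric])
          then have "ennreal 1 \<le> ennreal (exp (- l\<^sup>2 / q) * exp (l / q * ?Y \<omega>))" by (rule ennreal_leI)
          then show ?thesis by (simp add: ennreal_mult indicator_def)
        qed (simp add: indicator_def)
      qed
      finally show ?thesis .
    qed
    also have "... = ennreal (exp (- l\<^sup>2 / q)) * ennreal (exp ((l / q)\<^sup>2 * ((norm b)\<^sup>2 * (t - s)) / 2))"
    proof -
      have "(\<lambda>\<omega>. ennreal (exp (l / q * ?Y \<omega>))) \<in> borel_measurable M" by measurable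
      then show ?thesis by (simp only: nn_integral_cmult inner_increment_moments(5)[OF st])
    qed
    also have "... = ennreal (exp (- l\<^sup>2 / q + (l / q)\<^sup>2 * ((norm b)\<^sup>2 * (t - s)) / 2))"
      by (simp add: ennreal_mult[symmetric] mult_exp_exp)
    also have "... \<le> ennreal (exp (- l\<^sup>2 / (2 * q)))"
    proof (intro ennreal_leI exp_le_cancel_iff[THEN iffD2])
      have "(norm b)\<^sup>2 * (t - s) \<le> q" unfolding q_def b using S st by (intro mult_right_mono) auto
      then have "(l / q)\<^sup>2 * ((norm b)\<^sup>2 * (t - s)) / 2 \<le> (l / q)\<^sup>2 * q / 2" by (intro divide_right_mono mult_left_mono) auto
      also have "... = l\<^sup>2 / (2 * q)" using q by (simp add: power2_eq_square field_simps)
      finally have "(l / q)\<^sup>2 * ((norm b)\<^sup>2 * (t - s)) / 2 \<le> l\<^sup>2 / (2 * q)" .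
      moreover have "- l\<^sup>2 / q = - (l\<^sup>2 / (2 * q)) - l\<^sup>2 / (2 * q)" using q by (simp add: field_simps)
      ultimately show "- l\<^sup>2 / q + (l / q)\<^sup>2 * ((norm b)\<^sup>2 * (t - s)) / 2 \<le> - l\<^sup>2 / (2 * q)"
        by simp
    qed
    finally show ?thesis by (simp add: emeasure_eq_measure)
  qed
  have "prob {\<omega>\<in>space M. \<bar>?X \<omega>\<bar> > l} \<le> prob ({\<omega>\<in>space M. ?X \<omega> > l} \<union> {\<omega>\<in>space M. (- a) \<bullet> (Z t \<omega> - Z s \<omega>) > l})"
    by (intro finite_measure_mono) auto
  also have "... \<le> prob {\<omega>\<in>space M. ?X \<omega> > l} + prob {\<omega>\<in>space M. (- a) \<bullet> (Z t \<omega> - Z s \<omega>) > l}"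
    by (intro measure_Un_le) auto
  also have "... \<le> exp (- l\<^sup>2 / (2 * q)) + exp (- l\<^sup>2 / (2 * q))" by (intro add_mono one) auto
  finally show ?thesis by (simp add: q_def mult.assoc)
qed

end

section \<open>Stochastic integrals of simple processes\<close>

context brownian
begin

text \<open>One step of the Ito isometry. In its use \<open>W\<close> is the integral accumulated
  before time \<open>s\<close>, so the vanishing second expectation removes the cross term from the
  square of the sum.\<close>

lemma weighted_increment:
  fixes W V :: "'a => real" and \<xi> :: "'a => real^'n"
  assumes st: "0 \<le> s" "s \<le> t" and \<xi>: "\<xi> \<in> borel_measurable (F s)" and bd: "\<And>\<omega>. \<omega> \<in> space M ==> norm (\<xi> \<omega>) \<le> C"
    and W: "W \<in> borel_measurable (F s)" "integrable M (\<lambda>\<omega>. (W \<omega>)\<^sup>2)"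
  defines "Y \<equiv> \<lambda>\<omega>. \<xi> \<omega> \<bullet> (Z t \<omega> - Z s \<omega>)"
  shows "integrable M (\<lambda>\<omega>. W \<omega> * Y \<omega>)" "expectation (\<lambda>\<omega>. W \<omega> * Y \<omega>) = 0"
    "integrable M (\<lambda>\<omega>. (Y \<omega>)\<^sup>2)" "expectation (\<lambda>\<omega>. (Y \<omega>)\<^sup>2) = expectation (\<lambda>\<omega>. (norm (\<xi> \<omega>))\<^sup>2 * (t - s))"
proof -
  let ?D = "\<lambda>\<omega>. Z t \<omega> - Z s \<omega>"
  have "integrable M (\<lambda>\<omega>. W \<omega> * Y \<omega>) \<and> expectation (\<lambda>\<omega>. W \<omega> * Y \<omega>) = 0 \<and>
    integrable M (\<lambda>\<omega>. (Y \<omega>)\<^sup>2) \<and> expectation (\<lambda>\<omega>. (Y \<omega>)\<^sup>2) = expectation (\<lambda>\<omega>. (norm (\<xi> \<omega>))\<^sup>2 * (t - s))"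
  proof (cases "s = t")
    case True
    then show ?thesis by (simp add: Y_def)
  next
    case False
    then have st': "0 \<le> s" "s < t" using st by auto
    have C: "C \<ge> 0" using bd not_empty order_trans[OF norm_ge_zero] by blast
    have \<xi>i: "(\<lambda>\<omega>. \<xi> \<omega> $ i) \<in> borel_measurable (F s)" for i by (rule measurable_compose[OF \<xi> borel_measurable_nth])
    have \<xi>b: "\<bar>\<xi> \<omega> $ i\<bar> \<le> C" if "\<omega> \<in> space M" for i \<omega> using component_le_norm_cart[of "\<xi> \<omega>" i] bd[OF that] by linarith
    have [measurable]: "W \<in> borel_measurable M" "\<And>i. (\<lambda>\<omega>. \<xi> \<omega> $ i) \<in> borel_measurable M"
      by (auto intro: measurable_F_M[OF W(1)] measurable_F_M[OF \<xi>i])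
    have mom: "integrable M (\<lambda>\<omega>. (?D \<omega> $ i) ^ k)" "expectation (\<lambda>\<omega>. ?D \<omega> $ i) = 0" for i k
      using inner_increment_moments(1,2)[OF st', of "axis i 1"] by (simp_all add: inner_axis')
    have e1: "integrable M (\<lambda>\<omega>. ?D \<omega> $ i)" for i using mom(1)[of i 1] by simp
    have sq: "expectation (\<lambda>\<omega>. (a \<bullet> ?D \<omega>)\<^sup>2) = (norm a)\<^sup>2 * (t - s)" "integrable M (\<lambda>\<omega>. (a \<bullet> ?D \<omega>)\<^sup>2)" for a
      using inner_increment_moments(1,3)[OF st', where a=a] by auto
    define e where "e i = (axis i 1 :: real^'n)" for i
    \<comment> \<open>Polarization: mixed moments of the components follow from the one-dimensional
      laws along \<open>e i + e j\<close> and \<open>e i - e j\<close>.\<close>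
    have prodform: "?D \<omega> $ i * ?D \<omega> $ j = (((e i + e j) \<bullet> ?D \<omega>)\<^sup>2 - ((e i - e j) \<bullet> ?D \<omega>)\<^sup>2) / 4" for i j \<omega>
      by (simp add: e_def inner_axis' inner_add_left inner_diff_left power2_eq_square algebra_simps)
    have cov_int: "integrable M (\<lambda>\<omega>. ?D \<omega> $ i * ?D \<omega> $ j)" for i j
      unfolding prodform by (intro integrable_divide Bochner_Integration.integrable_diff sq)
    have cov: "expectation (\<lambda>\<omega>. ?D \<omega> $ i * ?D \<omega> $ j) = (if i = j then t - s else 0)" for i j
    proof -
      have "expectation (\<lambda>\<omega>. ?D \<omega> $ i * ?D \<omega> $ j) = ((norm (e i + e j))\<^sup>2 - (norm (e i - e j))\<^sup>2) / 4 * (t - s)"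
        unfolding prodform by (simp add: sq left_diff_distrib diff_divide_distrib)
      also have "(norm (e i + e j))\<^sup>2 - (norm (e i - e j))\<^sup>2 = 4 * (e i \<bullet> e j)"
        by (simp add: power2_norm_eq_inner inner_add_left inner_add_right inner_diff_left inner_diff_right inner_commute)
      also have "e i \<bullet> e j = (if i = j then 1 else 0)" by (simp add: e_def inner_axis_axis)
      finally show ?thesis by simp
    qed
    have Yi: "Y \<omega> = (\<Sum>i\<in>UNIV. \<xi> \<omega> $ i * ?D \<omega> $ i)" for \<omega> by (simp add: Y_def inner_vec_def)
    have W1: "integrable M W" by (rule square_integrable_imp_integrable) (use W(2) in auto)
    have Wx: "integrable M (\<lambda>\<omega>. W \<omega> * \<xi> \<omega> $ i)" for i
    proof (rule Bochner_Integration.integrable_bound[of M "\<lambda>\<omega>. C * W \<omega>"])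
      show "AE \<omega> in M. norm (W \<omega> * \<xi> \<omega> $ i) \<le> norm (C * W \<omega>)"
      proof (rule AE_I2)
        fix \<omega> assume "\<omega> \<in> space M"
        then have "\<bar>W \<omega>\<bar> * \<bar>\<xi> \<omega> $ i\<bar> \<le> \<bar>W \<omega>\<bar> * C" by (intro mult_left_mono \<xi>b) auto
        then show "norm (W \<omega> * \<xi> \<omega> $ i) \<le> norm (C * W \<omega>)" using C by (simp add: abs_mult mult.commute)
      qed
    qed (use W1 in auto)
    have Wterm: "integrable M (\<lambda>\<omega>. W \<omega> * \<xi> \<omega> $ i * ?D \<omega> $ i)" "expectation (\<lambda>\<omega>. W \<omega> * \<xi> \<omega> $ i * ?D \<omega> $ i) = 0" for i
      using expectation_increment[OF st', of "\<lambda>\<omega>. W \<omega> * \<xi> \<omega> $ i" "\<lambda>x. x $ i"] W(1) \<xi>i[of i] Wx[of i] e1[of i] mom(2)[of i]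
      by (auto intro!: borel_measurable_times)
    have WY: "W \<omega> * Y \<omega> = (\<Sum>i\<in>UNIV. W \<omega> * \<xi> \<omega> $ i * ?D \<omega> $ i)" for \<omega> by (simp add: Yi sum_distrib_left mult.assoc)
    have xx: "integrable M (\<lambda>\<omega>. \<xi> \<omega> $ i * \<xi> \<omega> $ j)" for i j
    proof (rule integrable_const_bound[where B="C * C"])
      show "AE \<omega> in M. norm (\<xi> \<omega> $ i * \<xi> \<omega> $ j) \<le> C * C"
        using \<xi>b C by (intro AE_I2) (auto simp: abs_mult intro!: mult_mono)
    qed auto
    have xiterm: "integrable M (\<lambda>\<omega>. \<xi> \<omega> $ i * \<xi> \<omega> $ j * (?D \<omega> $ i * ?D \<omega> $ j))"
      "expectation (\<lambda>\<omega>. \<xi> \<omega> $ i * \<xi> \<omega> $ j * (?D \<omega> $ i * ?D \<omega> $ j)) = expectation (\<lambda>\<omega>. \<xi> \<omega> $ i * \<xi> \<omega> $ j) * (if i = j then t - s else 0)" for i j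
      using expectation_increment[OF st', of "\<lambda>\<omega>. \<xi> \<omega> $ i * \<xi> \<omega> $ j" "\<lambda>x. x $ i * x $ j"] \<xi>i xx[of i j] cov_int[of i j] cov[of i j]
      by (auto intro!: borel_measurable_times)
    have Y2: "(Y \<omega>)\<^sup>2 = (\<Sum>i\<in>UNIV. \<Sum>j\<in>UNIV. \<xi> \<omega> $ i * \<xi> \<omega> $ j * (?D \<omega> $ i * ?D \<omega> $ j))" for \<omega>
      unfolding power2_eq_square Yi sum_product by (intro sum.cong refl) (simp add: mult_ac)
    have "expectation (\<lambda>\<omega>. (Y \<omega>)\<^sup>2) = (\<Sum>i\<in>UNIV. \<Sum>j\<in>UNIV. expectation (\<lambda>\<omega>. \<xi> \<omega> $ i * \<xi> \<omega> $ j) * (if i = j then t - s else 0))"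
      unfolding Y2 using xiterm by (simp add: Bochner_Integration.integral_sum)
    also have "... = (\<Sum>i\<in>UNIV. expectation (\<lambda>\<omega>. \<xi> \<omega> $ i * \<xi> \<omega> $ i) * (t - s))"
      by (intro sum.cong refl) (simp add: if_distrib[of "\<lambda>x. _ * x"] cong: if_cong)
    also have "... = expectation (\<lambda>\<omega>. (\<Sum>i\<in>UNIV. \<xi> \<omega> $ i * \<xi> \<omega> $ i) * (t - s))"
      using xx by (simp add: sum_distrib_right[symmetric] Bochner_Integration.integral_sum)
    also have "... = expectation (\<lambda>\<omega>. (norm (\<xi> \<omega>))\<^sup>2 * (t - s))"
      by (simp add: power2_norm_eq_inner inner_vec_def)
    finally have E: "expectation (\<lambda>\<omega>. (Y \<omega>)\<^sup>2) = expectation (\<lambda>\<omega>. (norm (\<xi> \<omega>))\<^sup>2 * (t - s))" .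
    have "integrable M (\<lambda>\<omega>. W \<omega> * Y \<omega>)" "expectation (\<lambda>\<omega>. W \<omega> * Y \<omega>) = 0"
      unfolding WY using Wterm by (simp_all add: Bochner_Integration.integral_sum)
    moreover have "integrable M (\<lambda>\<omega>. (Y \<omega>)\<^sup>2)" unfolding Y2 using xiterm(1) by (intro Bochner_Integration.integrable_sum)
    ultimately show ?thesis using E by blast
  qed
  then show "integrable M (\<lambda>\<omega>. W \<omega> * Y \<omega>)" "expectation (\<lambda>\<omega>. W \<omega> * Y \<omega>) = 0"
    "integrable M (\<lambda>\<omega>. (Y \<omega>)\<^sup>2)" "expectation (\<lambda>\<omega>. (Y \<omega>)\<^sup>2) = expectation (\<lambda>\<omega>. (norm (\<xi> \<omega>))\<^sup>2 * (t - s))" by auto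
qed

lemma simple_integrandD:
  assumes "simple_integrand M F T m \<tau> \<xi>"
  shows "i \<le> j ==> j \<le> m ==> \<tau> i \<le> \<tau> j" "j \<le> m ==> 0 \<le> \<tau> j" "j \<le> m ==> \<tau> j \<le> T"
    "j < m ==> \<xi> j \<in> borel_measurable (F (\<tau> j))"
proof -
  show mono: "\<tau> i \<le> \<tau> j" if "i \<le> j" "j \<le> m" for i j
    using that
  proof (induction j)
    case (Suc j)
    then show ?case using assms unfolding simple_integrand_def
      by (cases "i = Suc j") (auto intro: order_trans[of _ "\<tau> j"])
  qed auto
  show "j \<le> m ==> 0 \<le> \<tau> j" using mono[of 0 j] assms unfolding simple_integrand_def by auto
  show "j \<le> m ==> \<tau> j \<le> T" using mono[of j m] assms unfolding simple_integrand_def by auto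
  show "j < m ==> \<xi> j \<in> borel_measurable (F (\<tau> j))" using assms unfolding simple_integrand_def by auto
qed

text \<open>Induction on the number of steps. The third claim feeds it: the sum of the first
  \<open>k\<close> terms is measurable at \<open>\<tau> k\<close>, where the next coefficient is
  known, also when \<open>t\<close> lies before that time.\<close>

lemma simple_ito_isometry:
  assumes "simple_integrand M F T m \<tau> \<xi>" "0 \<le> t"
  shows "integrable M (\<lambda>\<omega>. (simple_ito Z m \<tau> \<xi> t \<omega>)\<^sup>2)"
    "expectation (\<lambda>\<omega>. (simple_ito Z m \<tau> \<xi> t \<omega>)\<^sup>2) =
      expectation (\<lambda>\<omega>. \<Sum>j<m. (norm (\<xi> j \<omega>))\<^sup>2 * (min t (\<tau> (Suc j)) - min t (\<tau> j)))"
    "\<And>u. \<tau> m \<le> u ==> simple_ito Z m \<tau> \<xi> t \<in> borel_measurable (F u)"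
proof -
  note D = simple_integrandD[OF assms(1)]
  have bd: "\<exists>C. \<forall>\<omega>\<in>space M. norm (\<xi> j \<omega>) \<le> C" if "j < m" for j using assms(1) that unfolding simple_integrand_def by auto
  have eint: "integrable M (\<lambda>\<omega>. (norm (\<xi> j \<omega>))\<^sup>2 * (min t (\<tau> (Suc j)) - min t (\<tau> j)))" if j: "j < m" for j
  proof -
    obtain C where C: "\<forall>\<omega>\<in>space M. norm (\<xi> j \<omega>) \<le> C" using bd[OF j] by blast
    have [measurable]: "\<xi> j \<in> borel_measurable M" by (rule measurable_F_M[OF D(4)[OF j]])
    have "integrable M (\<lambda>\<omega>. (norm (\<xi> j \<omega>))\<^sup>2)"
      by (rule integrable_const_bound[where B="C\<^sup>2"]) (use C in \<open>auto intro!: AE_I2 power_mono\<close>)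
    then show ?thesis by simp
  qed
  have main: "(\<forall>u\<ge>\<tau> k. simple_ito Z k \<tau> \<xi> t \<in> borel_measurable (F u)) \<and> integrable M (\<lambda>\<omega>. (simple_ito Z k \<tau> \<xi> t \<omega>)\<^sup>2) \<and>
    expectation (\<lambda>\<omega>. (simple_ito Z k \<tau> \<xi> t \<omega>)\<^sup>2) =
      expectation (\<lambda>\<omega>. \<Sum>j<k. (norm (\<xi> j \<omega>))\<^sup>2 * (min t (\<tau> (Suc j)) - min t (\<tau> j)))" if "k \<le> m" for k
    using that
  proof (induction k)
    case 0
    then show ?case by (simp add: simple_ito_def)
  next
    case (Suc k)
    let ?S = "simple_ito Z k \<tau> \<xi> t"
    let ?Y = "\<lambda>\<omega>. \<xi> k \<omega> \<bullet> (Z (min t (\<tau> (Suc k))) \<omega> - Z (min t (\<tau> k)) \<omega>)"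
    have k: "k < m" using Suc by simp
    have IH: "\<And>u. \<tau> k \<le> u ==> ?S \<in> borel_measurable (F u)" "integrable M (\<lambda>\<omega>. (?S \<omega>)\<^sup>2)"
      "expectation (\<lambda>\<omega>. (?S \<omega>)\<^sup>2) = expectation (\<lambda>\<omega>. \<Sum>j<k. (norm (\<xi> j \<omega>))\<^sup>2 * (min t (\<tau> (Suc j)) - min t (\<tau> j)))"
      using Suc by auto
    have \<tau>: "0 \<le> \<tau> k" "\<tau> k \<le> \<tau> (Suc k)" using D(1)[of k "Suc k"] D(2)[of k] k by auto
    obtain C where C: "\<And>\<omega>. \<omega> \<in> space M ==> norm (\<xi> k \<omega>) \<le> C" using bd[OF k] by blast
    have Y: "integrable M (\<lambda>\<omega>. ?S \<omega> * ?Y \<omega>)" "expectation (\<lambda>\<omega>. ?S \<omega> * ?Y \<omega>) = 0"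
      "integrable M (\<lambda>\<omega>. (?Y \<omega>)\<^sup>2)" "expectation (\<lambda>\<omega>. (?Y \<omega>)\<^sup>2) = expectation (\<lambda>\<omega>. (norm (\<xi> k \<omega>))\<^sup>2 * (min t (\<tau> (Suc k)) - min t (\<tau> k)))"
    proof (atomize (full), cases "\<tau> k \<le> t")
      case True
      then have m: "min t (\<tau> k) = \<tau> k" by simp
      have le: "\<tau> k \<le> min t (\<tau> (Suc k))" using True \<tau> by simp
      show "(integrable M (\<lambda>\<omega>. ?S \<omega> * ?Y \<omega>) \<and> expectation (\<lambda>\<omega>. ?S \<omega> * ?Y \<omega>) = 0) \<and>
        integrable M (\<lambda>\<omega>. (?Y \<omega>)\<^sup>2) \<and> expectation (\<lambda>\<omega>. (?Y \<omega>)\<^sup>2) = expectation (\<lambda>\<omega>. (norm (\<xi> k \<omega>))\<^sup>2 * (min t (\<tau> (Suc k)) - min t (\<tau> k)))"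
        unfolding m using weighted_increment[OF \<tau>(1) le D(4)[OF k] C IH(1)[OF order_refl] IH(2)] by blast
    next
      case False
      then have "min t (\<tau> k) = t" "min t (\<tau> (Suc k)) = t" using \<tau> by auto
      then show "(integrable M (\<lambda>\<omega>. ?S \<omega> * ?Y \<omega>) \<and> expectation (\<lambda>\<omega>. ?S \<omega> * ?Y \<omega>) = 0) \<and>
        integrable M (\<lambda>\<omega>. (?Y \<omega>)\<^sup>2) \<and> expectation (\<lambda>\<omega>. (?Y \<omega>)\<^sup>2) = expectation (\<lambda>\<omega>. (norm (\<xi> k \<omega>))\<^sup>2 * (min t (\<tau> (Suc k)) - min t (\<tau> k)))"
        by simp
    qed
    have S': "simple_ito Z (Suc k) \<tau> \<xi> t \<omega> = ?S \<omega> + ?Y \<omega>" for \<omega> by (simp add: simple_ito_def)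
    have sq: "(simple_ito Z (Suc k) \<tau> \<xi> t \<omega>)\<^sup>2 = (?S \<omega>)\<^sup>2 + 2 * (?S \<omega> * ?Y \<omega>) + (?Y \<omega>)\<^sup>2" for \<omega>
      unfolding S' by (simp add: power2_eq_square algebra_simps)
    have meas: "simple_ito Z (Suc k) \<tau> \<xi> t \<in> borel_measurable (F u)" if "u \<ge> \<tau> (Suc k)" for u
    proof -
      have "?S \<in> borel_measurable (F u)" "\<xi> k \<in> borel_measurable (F u)"
        "Z (min t (\<tau> (Suc k))) \<in> borel_measurable (F u)" "Z (min t (\<tau> k)) \<in> borel_measurable (F u)"
        using that \<tau> assms(2) by (auto intro!: IH(1) measurable_F_mono[OF D(4)[OF k]] Z_F_measurable)
      then show ?thesis unfolding S'[abs_def] by measurable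
    qed
    have int: "integrable M (\<lambda>\<omega>. (simple_ito Z (Suc k) \<tau> \<xi> t \<omega>)\<^sup>2)"
      unfolding sq using IH(2) Y(1,3) by (intro Bochner_Integration.integrable_add integrable_mult_right)
    have "expectation (\<lambda>\<omega>. (simple_ito Z (Suc k) \<tau> \<xi> t \<omega>)\<^sup>2) = expectation (\<lambda>\<omega>. (?S \<omega>)\<^sup>2) + 2 * expectation (\<lambda>\<omega>. ?S \<omega> * ?Y \<omega>) + expectation (\<lambda>\<omega>. (?Y \<omega>)\<^sup>2)"
      unfolding sq using IH(2) Y(1,3) by simp
    also have "... = expectation (\<lambda>\<omega>. \<Sum>j<k. (norm (\<xi> j \<omega>))\<^sup>2 * (min t (\<tau> (Suc j)) - min t (\<tau> j))) +
       expectation (\<lambda>\<omega>. (norm (\<xi> k \<omega>))\<^sup>2 * (min t (\<tau> (Suc k)) - min t (\<tau> k)))" unfolding Y IH(3) by simp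
    also have "... = expectation (\<lambda>\<omega>. \<Sum>j<Suc k. (norm (\<xi> j \<omega>))\<^sup>2 * (min t (\<tau> (Suc j)) - min t (\<tau> j)))"
      unfolding sum.lessThan_Suc using k
      by (intro Bochner_Integration.integral_add[symmetric] Bochner_Integration.integrable_sum eint) auto
    finally show ?case using meas int by blast
  qed
  from main[of m] show "integrable M (\<lambda>\<omega>. (simple_ito Z m \<tau> \<xi> t \<omega>)\<^sup>2)"
    "expectation (\<lambda>\<omega>. (simple_ito Z m \<tau> \<xi> t \<omega>)\<^sup>2) =
      expectation (\<lambda>\<omega>. \<Sum>j<m. (norm (\<xi> j \<omega>))\<^sup>2 * (min t (\<tau> (Suc j)) - min t (\<tau> j)))"
    "\<And>u. \<tau> m \<le> u ==> simple_ito Z m \<tau> \<xi> t \<in> borel_measurable (F u)" by auto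
qed

text \<open>The sum of the squares has finite expectation, hence is finite almost surely, and its
  terms tend to 0.\<close>

lemma AE_tendsto_0_if_summable:
  fixes X :: "nat => 'a => real"
  assumes int: "\<And>m. integrable M (\<lambda>\<omega>. (X m \<omega>)\<^sup>2)" and le: "\<And>m. expectation (\<lambda>\<omega>. (X m \<omega>)\<^sup>2) \<le> c m" and c: "summable c"
  shows "AE \<omega> in M. (\<lambda>m. X m \<omega>) \<longlonglongrightarrow> 0"
proof -
  have "(\<integral>\<^sup>+\<omega>. (\<Sum>m. ennreal ((X m \<omega>)\<^sup>2)) \<partial>M) = (\<Sum>m. \<integral>\<^sup>+\<omega>. ennreal ((X m \<omega>)\<^sup>2) \<partial>M)"
    by (rule nn_integral_suminf) (use int in auto)
  also have "... = (\<Sum>m. ennreal (expectation (\<lambda>\<omega>. (X m \<omega>)\<^sup>2)))"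
    by (intro suminf_cong nn_integral_eq_integral int) auto
  also have "... \<noteq> top"
  proof (rule ennreal_suminf_neq_top)
    show "summable (\<lambda>m. expectation (\<lambda>\<omega>. (X m \<omega>)\<^sup>2))"
      by (rule summable_comparison_test'[OF c, of 0]) (use le in auto)
  qed auto
  finally have "(\<integral>\<^sup>+\<omega>. (\<Sum>m. ennreal ((X m \<omega>)\<^sup>2)) \<partial>M) \<noteq> \<infinity>" by simp
  then have "AE \<omega> in M. (\<Sum>m. ennreal ((X m \<omega>)\<^sup>2)) \<noteq> \<infinity>"
    by (rule nn_integral_PInf_AE[rotated]) (use int in auto)
  then show ?thesis
  proof eventually_elim
    fix \<omega> assume "(\<Sum>m. ennreal ((X m \<omega>)\<^sup>2)) \<noteq> \<infinity>"
    then have "summable (\<lambda>m. (X m \<omega>)\<^sup>2)" by (intro summable_suminf_not_top) auto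
    then have "(\<lambda>m. (X m \<omega>)\<^sup>2) \<longlonglongrightarrow> 0" by (rule summable_LIMSEQ_zero)
    then have "(\<lambda>m. sqrt ((X m \<omega>)\<^sup>2)) \<longlonglongrightarrow> sqrt 0" by (rule tendsto_real_sqrt)
    then show "(\<lambda>m. X m \<omega>) \<longlonglongrightarrow> 0" by (simp add: tendsto_rabs_zero_iff)
  qed
qed

text \<open>The compensated squares are orthogonal with variance quadratic in the step length, so
  the second moment of their sum is of the order of the mesh. Along dyadic partitions this is
  summable, which gives almost sure convergence without passing to a subsequence.\<close>

lemma quadratic_variation_AE:
  assumes T: "T > 0" and t: "t \<in> {0..T}"
  shows "AE \<omega> in M. (\<lambda>m. QV (\<lambda>s. a \<bullet> Z s \<omega>) T m t) \<longlonglongrightarrow> (norm a)\<^sup>2 * t"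
proof -
  let ?v = "(norm a)\<^sup>2"
  define st where "st m j = min t (grid T m (Suc j)) - min t (grid T m j)" for m j
  define D where "D m j \<omega> = (incr (\<lambda>s. a \<bullet> Z s \<omega>) T m t j)\<^sup>2 - ?v * st m j" for m j \<omega>
  have g: "0 \<le> min t (grid T m j)" "min t (grid T m j) \<le> min t (grid T m (Suc j))" "0 \<le> st m j" "st m j \<le> T / 2^m" for m j
    using min_grid_bounds[OF T t, of m j] by (auto simp: st_def)
  have Dm: "D m j \<in> borel_measurable (F (min t (grid T m (Suc j))))" for m j
  proof -
    have "Z (min t (grid T m (Suc j))) \<in> borel_measurable (F (min t (grid T m (Suc j))))"
      "Z (min t (grid T m j)) \<in> borel_measurable (F (min t (grid T m (Suc j))))"
      using g[of m j] g(1)[of m "Suc j"] by (auto intro!: Z_F_measurable simp del: min.bounded_iff min_le_iff_disj)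
    then show ?thesis unfolding D_def[abs_def] incr_def by measurable
  qed
  have D: "integrable M (\<lambda>\<omega>. W \<omega> * D m j \<omega>)" "expectation (\<lambda>\<omega>. W \<omega> * D m j \<omega>) = 0"
    "integrable M (\<lambda>\<omega>. (D m j \<omega>)\<^sup>2)" "expectation (\<lambda>\<omega>. (D m j \<omega>)\<^sup>2) = 2 * ?v\<^sup>2 * (st m j)\<^sup>2"
    if W: "W \<in> borel_measurable (F (min t (grid T m j)))" "integrable M W" for W m j
  proof (atomize (full), cases "st m j = 0")
    case True
    then have "D m j = (\<lambda>_. 0)" by (auto simp: D_def incr_def st_def)
    then show "(integrable M (\<lambda>\<omega>. W \<omega> * D m j \<omega>) \<and> expectation (\<lambda>\<omega>. W \<omega> * D m j \<omega>) = 0) \<and>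
      integrable M (\<lambda>\<omega>. (D m j \<omega>)\<^sup>2) \<and> expectation (\<lambda>\<omega>. (D m j \<omega>)\<^sup>2) = 2 * ?v\<^sup>2 * (st m j)\<^sup>2" using True by simp
  next
    case False
    let ?s = "min t (grid T m j)" and ?u = "min t (grid T m (Suc j))"
    have su: "0 \<le> ?s" "?s < ?u" using False g[of m j] unfolding st_def by linarith+
    note mom = inner_increment_moments[OF su, where a=a]
    define X where "X \<omega> = a \<bullet> (Z ?u \<omega> - Z ?s \<omega>)" for \<omega>
    have DX: "D m j \<omega> = (X \<omega>)\<^sup>2 - ?v * st m j" for \<omega> by (simp add: D_def incr_def X_def inner_diff_right)
    have i2: "integrable M (\<lambda>\<omega>. (X \<omega>)\<^sup>2)" and i4: "integrable M (\<lambda>\<omega>. (X \<omega>)^4)" using mom(1) by (auto simp: X_def)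
    have EX: "expectation (\<lambda>\<omega>. (X \<omega>)\<^sup>2) = ?v * st m j" "expectation (\<lambda>\<omega>. (X \<omega>)^4) = 3 * (?v * st m j)\<^sup>2"
      using mom(3,4) by (simp_all only: X_def st_def)
    have iD: "integrable M (D m j)" unfolding DX[abs_def] using i2 by simp
    have ED: "expectation (D m j) = 0" unfolding DX[abs_def] using i2 EX(1) by (simp add: prob_space)
    have "(\<lambda>x. (a \<bullet> x)\<^sup>2 - ?v * st m j) \<in> borel_measurable borel" by measurable
    moreover have "(a \<bullet> (Z ?u \<omega> - Z ?s \<omega>))\<^sup>2 - ?v * st m j = D m j \<omega>" for \<omega> by (simp add: DX X_def)
    ultimately have WD: "integrable M (\<lambda>\<omega>. W \<omega> * D m j \<omega>)" "expectation (\<lambda>\<omega>. W \<omega> * D m j \<omega>) = 0"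
      using expectation_increment[OF su W(1), of "\<lambda>x. (a \<bullet> x)\<^sup>2 - ?v * st m j"] W(2) iD ED by simp_all
    have D2: "(D m j \<omega>)\<^sup>2 = (X \<omega>)^4 - 2 * (?v * st m j) * (X \<omega>)\<^sup>2 + (?v * st m j)\<^sup>2" for \<omega>
      unfolding DX by (simp add: power2_eq_square power4_eq_xxxx algebra_simps)
    have "expectation (\<lambda>\<omega>. (D m j \<omega>)\<^sup>2) = expectation (\<lambda>\<omega>. (X \<omega>)^4) - 2 * (?v * st m j) * expectation (\<lambda>\<omega>. (X \<omega>)\<^sup>2) + (?v * st m j)\<^sup>2"
      unfolding D2 using i2 i4 by (simp add: prob_space)
    also have "... = 2 * ?v\<^sup>2 * (st m j)\<^sup>2" unfolding EX by (simp add: power2_eq_square algebra_simps)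
    finally show "(integrable M (\<lambda>\<omega>. W \<omega> * D m j \<omega>) \<and> expectation (\<lambda>\<omega>. W \<omega> * D m j \<omega>) = 0) \<and>
      integrable M (\<lambda>\<omega>. (D m j \<omega>)\<^sup>2) \<and> expectation (\<lambda>\<omega>. (D m j \<omega>)\<^sup>2) = 2 * ?v\<^sup>2 * (st m j)\<^sup>2"
      using WD i2 i4 unfolding D2 by simp
  qed
  define S where "S m k \<omega> = (\<Sum>j<k. D m j \<omega>)" for m k \<omega>
  have S: "S m k \<in> borel_measurable (F (min t (grid T m k))) \<and> integrable M (\<lambda>\<omega>. (S m k \<omega>)\<^sup>2) \<and>
    expectation (\<lambda>\<omega>. (S m k \<omega>)\<^sup>2) \<le> 2 * ?v\<^sup>2 * (T / 2^m) * (\<Sum>j<k. st m j)" for m k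
  proof (induction k)
    case 0 show ?case by (simp add: S_def)
  next
    case (Suc k)
    have sq: "(S m (Suc k) \<omega>)\<^sup>2 = (S m k \<omega>)\<^sup>2 + 2 * (S m k \<omega> * D m k \<omega>) + (D m k \<omega>)\<^sup>2" for \<omega>
      by (simp add: S_def power2_eq_square algebra_simps)
    have mk: "S m k \<in> borel_measurable (F (min t (grid T m k)))" and ik: "integrable M (\<lambda>\<omega>. (S m k \<omega>)\<^sup>2)" using Suc by auto
    have "integrable M (S m k)" by (rule square_integrable_imp_integrable[OF measurable_F_M[OF mk] ik])
    note Dk = D[OF mk this]
    have "S m (Suc k) = (\<lambda>\<omega>. S m k \<omega> + D m k \<omega>)" by (simp add: S_def fun_eq_iff)
    then have "S m (Suc k) \<in> borel_measurable (F (min t (grid T m (Suc k))))"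
      using Dm[of m k] measurable_F_mono[OF mk g(2)] by simp
    moreover have "expectation (\<lambda>\<omega>. (S m (Suc k) \<omega>)\<^sup>2) = expectation (\<lambda>\<omega>. (S m k \<omega>)\<^sup>2) + 2 * ?v\<^sup>2 * (st m k)\<^sup>2"
      unfolding sq using Dk ik by simp
    moreover have "2 * ?v\<^sup>2 * (st m k)\<^sup>2 \<le> 2 * ?v\<^sup>2 * (T / 2^m * st m k)"
      unfolding power2_eq_square[of "st m k"] using g[of m k] by (intro mult_left_mono mult_right_mono) auto
    moreover have "integrable M (\<lambda>\<omega>. (S m (Suc k) \<omega>)\<^sup>2)" unfolding sq using Dk ik by simp
    ultimately show ?case using Suc by (simp add: distrib_left mult.assoc)
  qed
  have QVS: "QV (\<lambda>s. a \<bullet> Z s \<omega>) T m t - ?v * t = S m (2^m) \<omega>" for m \<omega>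
  proof -
    have "(\<Sum>j<2^m. st m j) = t" using sum_telescope_min[OF T t, of "\<lambda>x. x" m] by (simp add: st_def)
    then have "?v * t = (\<Sum>j<2^m. ?v * st m j)" by (simp add: sum_distrib_left[symmetric])
    then show ?thesis by (simp add: QV_def S_def D_def sum_subtractf)
  qed
  have "AE \<omega> in M. (\<lambda>m. QV (\<lambda>s. a \<bullet> Z s \<omega>) T m t - ?v * t) \<longlonglongrightarrow> 0"
  proof (rule AE_tendsto_0_if_summable)
    show "integrable M (\<lambda>\<omega>. (QV (\<lambda>s. a \<bullet> Z s \<omega>) T m t - ?v * t)\<^sup>2)" for m unfolding QVS using S by blast
    show "expectation (\<lambda>\<omega>. (QV (\<lambda>s. a \<bullet> Z s \<omega>) T m t - ?v * t)\<^sup>2) \<le> (2 * ?v\<^sup>2 * T * t) * (1/2)^m" for m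
    proof -
      have "(\<Sum>j<2^m. st m j) = t" using sum_telescope_min[OF T t, of "\<lambda>x. x" m] by (simp add: st_def)
      then show ?thesis unfolding QVS using S[of m "2^m"] by (simp add: power_one_over field_simps)
    qed
    show "summable (\<lambda>m. (2 * ?v\<^sup>2 * T * t) * (1/2)^m)" by (intro summable_mult summable_geometric) simp
  qed
  then show ?thesis
    by eventually_elim (simp add: LIM_zero_iff)
qed

lemma quadratic_variation_path_AE:
  assumes T: "T > 0"
  shows "AE \<omega> in M. quadratic_variation_path T ((norm a)\<^sup>2) (\<lambda>s. a \<bullet> Z s \<omega>)"
proof -
  have "AE \<omega> in M. \<forall>l i. i \<le> 2^l \<longrightarrow> (\<lambda>m. QV (\<lambda>s. a \<bullet> Z s \<omega>) T m (grid T l i)) \<longlonglongrightarrow> (norm a)\<^sup>2 * grid T l i"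
    unfolding AE_all_countable
  proof (intro allI)
    fix l i
    show "AE \<omega> in M. i \<le> 2^l \<longrightarrow> (\<lambda>m. QV (\<lambda>s. a \<bullet> Z s \<omega>) T m (grid T l i)) \<longlonglongrightarrow> (norm a)\<^sup>2 * grid T l i"
    proof (cases "i \<le> 2^l")
      case True
      then have "grid T l i \<in> {0..T}" using T by (auto intro!: grid_nonneg grid_le_T)
      from quadratic_variation_AE[OF T this] show ?thesis by eventually_elim auto
    qed simp
  qed
  moreover have "AE \<omega> in M. continuous_on {0..} (\<lambda>t. Z t \<omega>)" using BM by (simp add: brownian_motion_def)
  ultimately show ?thesis
  proof eventually_elim
    case (elim \<omega>)
    have "continuous_on {0..T} (\<lambda>t. Z t \<omega>)" using elim(2) by (rule continuous_on_subset) auto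
    then have "continuous_on {0..T} (\<lambda>s. a \<bullet> Z s \<omega>)" by (intro continuous_intros)
    with elim T show ?case by unfold_locales auto
  qed
qed

end

section \<open>Common refinements of simple processes\<close>

lemma grid_indicator_sum:
  fixes f :: "nat => 'b::real_vector"
  assumes mono: "\<And>i j. i \<le> j ==> j \<le> n ==> \<rho> i \<le> (\<rho> j :: real)" and i: "i < n" and t: "t \<in> {\<rho> i<..\<rho> (Suc i)}"
  shows "(\<Sum>j<n. indicator {\<rho> j<..\<rho> (Suc j)} t *\<^sub>R f j) = f i"
proof -
  have "indicator {\<rho> j<..\<rho> (Suc j)} t = (if j = i then 1 else 0 :: real)" if j: "j < n" for j
  proof -
    consider "j = i" | "j < i" | "i < j" by linarith
    then show ?thesis
    proof cases
      case 2 then show ?thesis using mono[of "Suc j" i] i t by auto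
    next
      case 3 then show ?thesis using mono[of "Suc i" j] j t by auto
    qed (use t in auto)
  qed
  then have "(\<Sum>j<n. indicator {\<rho> j<..\<rho> (Suc j)} t *\<^sub>R f j) = (\<Sum>j<n. if j = i then f j else 0)"
    by (intro sum.cong) auto
  then show ?thesis using i by simp
qed

text \<open>Polymorphic in the values of \<open>g\<close>, since it is applied to real indicator
  differences as well as to the vector-valued path of \<open>Z\<close>.\<close>

lemma refine_telescope:
  fixes g :: "real => 'b::real_vector"
  assumes strict: "\<And>i j. i < j ==> j \<le> n ==> \<rho> i < (\<rho> j :: real)" and ab: "a \<le> b" "b \<le> n"
  shows "(\<Sum>i<n. indicator {\<rho> a<..\<rho> b} (\<rho> (Suc i)) *\<^sub>R (g (\<rho> (Suc i)) - g (\<rho> i))) = g (\<rho> b) - g (\<rho> a)"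
proof -
  have iff: "\<rho> i < \<rho> j \<longleftrightarrow> i < j" if "i \<le> n" "j \<le> n" for i j
    using strict[of i j] strict[of j i] that by (metis less_irrefl less_trans not_less_iff_gr_or_eq)
  have "(\<Sum>i<n. indicator {\<rho> a<..\<rho> b} (\<rho> (Suc i)) *\<^sub>R (g (\<rho> (Suc i)) - g (\<rho> i))) = (\<Sum>i<n. if i \<in> {a..<b} then g (\<rho> (Suc i)) - g (\<rho> i) else 0)"
  proof (rule sum.cong)
    fix i assume "i \<in> {..<n}"
    then have "\<rho> a < \<rho> (Suc i) \<longleftrightarrow> a \<le> i" "\<rho> (Suc i) \<le> \<rho> b \<longleftrightarrow> i < b"
      using iff[of a "Suc i"] iff[of b "Suc i"] ab by (auto simp: not_less[symmetric])
    then show "indicator {\<rho> a<..\<rho> b} (\<rho> (Suc i)) *\<^sub>R (g (\<rho> (Suc i)) - g (\<rho> i)) = (if i \<in> {a..<b} then g (\<rho> (Suc i)) - g (\<rho> i) else 0)"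
      by (simp add: indicator_def)
  qed simp
  also have "... = (\<Sum>i\<in>{a..<b}. g (\<rho> (Suc i)) - g (\<rho> i))"
    using ab by (subst sum.inter_restrict[symmetric]) (auto intro!: sum.cong)
  also have "... = g (\<rho> b) - g (\<rho> a)" using ab(1) by (rule sum_Suc_diff')
  finally show ?thesis .
qed

context brownian
begin

text \<open>A simple process is constant on each cell of a finer partition, so its value may be read
  at the right endpoint \<open>\<rho> (Suc i)\<close>. That value is already known at
  \<open>\<rho> i\<close>: a term contributes only if \<open>\<tau> j < \<rho> (Suc i)\<close>, and
  as \<open>\<tau> j\<close> is itself a point of the finer partition, this means
  \<open>\<tau> j \<le> \<rho> i\<close>.\<close>

lemma refine_simple:
  assumes s: "simple_integrand M F T m \<tau> \<xi>"
    and strict: "\<And>i j. i < j ==> j \<le> n ==> \<rho> i < \<rho> j" and range: "\<tau> ` {..m} \<subseteq> \<rho> ` {..n}"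
    and \<rho>: "0 \<le> \<rho> 0" "\<rho> n \<le> T"
  defines "\<zeta> \<equiv> \<lambda>i \<omega>. simple_process m \<tau> \<xi> (\<rho> (Suc i)) \<omega>"
  shows "simple_integrand M F T n \<rho> \<zeta>" "simple_process n \<rho> \<zeta> t \<omega> = simple_process m \<tau> \<xi> t \<omega>"
    "simple_ito Z n \<rho> \<zeta> t \<omega> = simple_ito Z m \<tau> \<xi> t \<omega>"
proof -
  note D = simple_integrandD[OF s]
  have le: "\<rho> i \<le> \<rho> j" if "i \<le> j" "j \<le> n" for i j using strict[of i j] that by (cases "i = j") auto
  have idx: "\<exists>a b. a \<le> b \<and> b \<le> n \<and> \<tau> j = \<rho> a \<and> \<tau> (Suc j) = \<rho> b" if j: "j < m" for j
  proof -
    have "\<tau> j \<in> \<rho> ` {..n}" "\<tau> (Suc j) \<in> \<rho> ` {..n}" using range j by auto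
    then obtain a b where ab: "a \<le> n" "b \<le> n" "\<tau> j = \<rho> a" "\<tau> (Suc j) = \<rho> b" by auto
    have "\<rho> a \<le> \<rho> b" using D(1)[of j "Suc j"] j ab by simp
    then have "a \<le> b" using strict[of b a] ab(1) by (intro leI notI) simp
    then show ?thesis using ab by blast
  qed
  have tele: "(\<Sum>i<n. indicator {\<tau> j<..\<tau> (Suc j)} (\<rho> (Suc i)) *\<^sub>R (g (\<rho> (Suc i)) - g (\<rho> i))) = g (\<tau> (Suc j)) - g (\<tau> j)"
    if j: "j < m" for j and g :: "real => real"
  proof -
    obtain a b where ab: "a \<le> b" "b \<le> n" "\<tau> j = \<rho> a" "\<tau> (Suc j) = \<rho> b" using idx[OF j] by blast
    show ?thesis unfolding ab(3,4) by (rule refine_telescope[OF strict ab(1,2)])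
  qed
  have tele_vec: "(\<Sum>i<n. indicator {\<tau> j<..\<tau> (Suc j)} (\<rho> (Suc i)) *\<^sub>R (g (\<rho> (Suc i)) - g (\<rho> i))) = g (\<tau> (Suc j)) - g (\<tau> j)"
    if j: "j < m" for j and g :: "real => real^'n"
  proof -
    obtain a b where ab: "a \<le> b" "b \<le> n" "\<tau> j = \<rho> a" "\<tau> (Suc j) = \<rho> b" using idx[OF j] by blast
    show ?thesis unfolding ab(3,4) by (rule refine_telescope[OF strict ab(1,2)])
  qed
  show "simple_process n \<rho> \<zeta> t \<omega> = simple_process m \<tau> \<xi> t \<omega>"
  proof -
    \<comment> \<open>Membership in a half-open cell is a difference of indicators at its endpoints,
      so the refinement of the process becomes another telescoping sum.\<close>
    have ind: "indicator {\<rho> i<..\<rho> (Suc i)} t = (indicator {t..} (\<rho> (Suc i)) - indicator {t..} (\<rho> i) :: real)" if "i < n" for i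
      using le[of i "Suc i"] that by (auto simp: indicator_def)
    have ind\<tau>: "(indicator {t..} (\<tau> (Suc j)) - indicator {t..} (\<tau> j) :: real) = indicator {\<tau> j<..\<tau> (Suc j)} t" if "j < m" for j
      using D(1)[of j "Suc j"] that by (auto simp: indicator_def)
    have "simple_process n \<rho> \<zeta> t \<omega> = (\<Sum>i<n. (\<Sum>j<m. (indicator {\<tau> j<..\<tau> (Suc j)} (\<rho> (Suc i)) * (indicator {t..} (\<rho> (Suc i)) - indicator {t..} (\<rho> i))) *\<^sub>R \<xi> j \<omega>))"
      unfolding simple_process_def \<zeta>_def scaleR_sum_right by (intro sum.cong refl) (simp add: ind mult.commute)
    also have "... = (\<Sum>j<m. (\<Sum>i<n. indicator {\<tau> j<..\<tau> (Suc j)} (\<rho> (Suc i)) *\<^sub>R (indicator {t..} (\<rho> (Suc i)) - indicator {t..} (\<rho> i) :: real)) *\<^sub>R \<xi> j \<omega>)"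
      unfolding scaleR_sum_left by (subst sum.swap) simp
    also have "... = simple_process m \<tau> \<xi> t \<omega>"
      unfolding simple_process_def by (intro sum.cong refl) (simp only: tele lessThan_iff ind\<tau>)
    finally show ?thesis .
  qed
  show "simple_ito Z n \<rho> \<zeta> t \<omega> = simple_ito Z m \<tau> \<xi> t \<omega>"
  proof -
    have "simple_ito Z n \<rho> \<zeta> t \<omega> = (\<Sum>i<n. (\<Sum>j<m. \<xi> j \<omega> \<bullet> (indicator {\<tau> j<..\<tau> (Suc j)} (\<rho> (Suc i)) *\<^sub>R (Z (min t (\<rho> (Suc i))) \<omega> - Z (min t (\<rho> i)) \<omega>))))"
      unfolding simple_ito_def simple_process_def \<zeta>_def inner_sum_left by (intro sum.cong refl) simp
    also have "... = (\<Sum>j<m. \<xi> j \<omega> \<bullet> (\<Sum>i<n. indicator {\<tau> j<..\<tau> (Suc j)} (\<rho> (Suc i)) *\<^sub>R (Z (min t (\<rho> (Suc i))) \<omega> - Z (min t (\<rho> i)) \<omega>)))"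
      unfolding inner_sum_right by (rule sum.swap)
    also have "... = simple_ito Z m \<tau> \<xi> t \<omega>"
      unfolding simple_ito_def using tele_vec[of _ "\<lambda>s. Z (min t s) \<omega>"] by (intro sum.cong refl) simp
    finally show ?thesis .
  qed
  show "simple_integrand M F T n \<rho> \<zeta>"
    unfolding simple_integrand_def
  proof (intro conjI allI impI)
    fix i assume i: "i < n"
    show "\<rho> i \<le> \<rho> (Suc i)" using le[of i "Suc i"] i by simp
    show "\<zeta> i \<in> borel_measurable (F (\<rho> i))"
      unfolding \<zeta>_def simple_process_def
    proof (rule borel_measurable_sum)
      fix j assume "j \<in> {..<m}"
      then have j: "j < m" by simp
      show "(\<lambda>\<omega>. indicator {\<tau> j<..\<tau> (Suc j)} (\<rho> (Suc i)) *\<^sub>R \<xi> j \<omega>) \<in> borel_measurable (F (\<rho> i))"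
      proof (cases "\<tau> j < \<rho> (Suc i)")
        case True
        have "\<tau> j \<in> \<rho> ` {..n}" using range j by auto
        then obtain a where a: "a \<le> n" "\<tau> j = \<rho> a" by auto
        have "a \<le> i"
        proof (rule ccontr)
          assume "\<not> a \<le> i"
          then have "\<rho> (Suc i) \<le> \<rho> a" using a by (intro le) auto
          then show False using True a by simp
        qed
        then have "\<tau> j \<le> \<rho> i" using le[of a i] a i by simp
        then have "\<xi> j \<in> borel_measurable (F (\<rho> i))" by (rule measurable_F_mono[OF D(4)[OF j]])
        then show ?thesis by simp
      qed simp
    qed
    have "\<forall>j. \<exists>C. j < m \<longrightarrow> (\<forall>\<omega>\<in>space M. norm (\<xi> j \<omega>) \<le> C)" using s unfolding simple_integrand_def by blast
    then obtain C where C: "\<And>j \<omega>. j < m ==> \<omega> \<in> space M ==> norm (\<xi> j \<omega>) \<le> C j" by metis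
    have "norm (\<zeta> i \<omega>) \<le> (\<Sum>j<m. C j)" if "\<omega> \<in> space M" for \<omega>
      unfolding \<zeta>_def simple_process_def
    proof (intro order_trans[OF norm_sum] sum_mono)
      fix j assume "j \<in> {..<m}"
      then have "norm (\<xi> j \<omega>) \<le> C j" using C that by simp
      moreover from this have "0 \<le> C j" using norm_ge_zero order_trans by blast
      ultimately show "norm (indicator {\<tau> j<..\<tau> (Suc j)} (\<rho> (Suc i)) *\<^sub>R \<xi> j \<omega>) \<le> C j" by (simp add: indicator_def)
    qed
    then show "\<exists>C. \<forall>\<omega>\<in>space M. norm (\<zeta> i \<omega>) \<le> C" by blast
  qed (use \<rho> in auto)
qed

lemma simple_integrand_diff:
  assumes "simple_integrand M F T n \<rho> \<zeta>" "simple_integrand M F T n \<rho> \<zeta>'"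
  shows "simple_integrand M F T n \<rho> (\<lambda>i \<omega>. \<zeta> i \<omega> - \<zeta>' i \<omega>)"
    "simple_process n \<rho> (\<lambda>i \<omega>. \<zeta> i \<omega> - \<zeta>' i \<omega>) t \<omega> = simple_process n \<rho> \<zeta> t \<omega> - simple_process n \<rho> \<zeta>' t \<omega>"
    "simple_ito Z n \<rho> (\<lambda>i \<omega>. \<zeta> i \<omega> - \<zeta>' i \<omega>) t \<omega> = simple_ito Z n \<rho> \<zeta> t \<omega> - simple_ito Z n \<rho> \<zeta>' t \<omega>"
proof -
  have "\<exists>C. \<forall>\<omega>\<in>space M. norm (\<zeta> j \<omega> - \<zeta>' j \<omega>) \<le> C" if j: "j < n" for j
  proof -
    obtain C C' where "\<forall>\<omega>\<in>space M. norm (\<zeta> j \<omega>) \<le> C" "\<forall>\<omega>\<in>space M. norm (\<zeta>' j \<omega>) \<le> C'"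
      using assms j unfolding simple_integrand_def by blast
    then have "\<forall>\<omega>\<in>space M. norm (\<zeta> j \<omega> - \<zeta>' j \<omega>) \<le> C + C'"
      by (intro ballI order_trans[OF norm_triangle_ineq4] add_mono) auto
    then show ?thesis by blast
  qed
  then show "simple_integrand M F T n \<rho> (\<lambda>i \<omega>. \<zeta> i \<omega> - \<zeta>' i \<omega>)"
    using assms unfolding simple_integrand_def by (auto intro!: borel_measurable_diff)
qed (simp_all add: simple_process_def simple_ito_def sum_subtractf scaleR_right_diff_distrib inner_diff_left)

text \<open>Approximating sequences come with unrelated partitions, whereas the isometry concerns a
  single simple process. The new partition is the sorted list of all points, without repetitions and
  hence strictly increasing.\<close>

lemma ex_common_refinement:
  assumes s: "simple_integrand M F T m \<tau> \<xi>" and s': "simple_integrand M F T m' \<tau>' \<xi>'"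
  shows "\<exists>n \<rho> \<zeta>. simple_integrand M F T n \<rho> \<zeta> \<and>
    (\<forall>t \<omega>. simple_process n \<rho> \<zeta> t \<omega> = simple_process m \<tau> \<xi> t \<omega> - simple_process m' \<tau>' \<xi>' t \<omega>) \<and>
    (\<forall>t \<omega>. simple_ito Z n \<rho> \<zeta> t \<omega> = simple_ito Z m \<tau> \<xi> t \<omega> - simple_ito Z m' \<tau>' \<xi>' t \<omega>)"
proof -
  define S where "S = \<tau> ` {..m} \<union> \<tau>' ` {..m'}"
  define n where "n = card S - 1"
  define \<rho> where "\<rho> i = sorted_list_of_set S ! i" for i
  have S: "finite S" "S \<noteq> {}" by (auto simp: S_def)
  then have cS: "card S = Suc n" by (auto simp: n_def card_gt_0_iff)
  have strict: "\<rho> i < \<rho> j" if "i < j" "j \<le> n" for i j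
    unfolding \<rho>_def using that cS
    by (intro sorted_wrt_nth_less[OF strict_sorted_list_of_set]) auto
  have "\<rho> ` {..n} = set (sorted_list_of_set S)"
    unfolding \<rho>_def set_conv_nth using cS by (auto simp: less_Suc_eq_le)
  then have range: "\<rho> ` {..n} = S" using S by simp
  have "S \<subseteq> {0..T}" unfolding S_def using simple_integrandD(2,3)[OF s] simple_integrandD(2,3)[OF s'] by auto
  then have \<rho>0: "0 \<le> \<rho> 0" "\<rho> n \<le> T" using range by auto
  note R = refine_simple[OF s strict _ \<rho>0] and R' = refine_simple[OF s' strict _ \<rho>0]
  have sub: "\<tau> ` {..m} \<subseteq> \<rho> ` {..n}" "\<tau>' ` {..m'} \<subseteq> \<rho> ` {..n}" unfolding range by (auto simp: S_def)
  note Df = simple_integrand_diff[OF R(1)[OF _ _ sub(1)] R'(1)[OF _ _ sub(2)]]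
  show ?thesis
    by (intro exI conjI allI, rule Df(1)) (simp_all only: Df(2,3) R(2,3)[OF _ _ sub(1)] R'(2,3)[OF _ _ sub(2)])
qed

section \<open>Convergence in probability of integrals of simple processes\<close>

lemma truncated_sum_le:
  fixes c :: "nat => real"
  assumes "\<And>i. c i \<ge> 0" "\<delta> \<ge> 0"
  shows "(\<Sum>i<n. if (\<Sum>l\<le>i. c l) \<le> \<delta> then c i else 0) \<le> \<delta>"
proof (induction n)
  case (Suc n)
  show ?case
  \<comment> \<open>If the last term is kept, even the full sum is at most \<open>\<delta>\<close>;
    otherwise nothing is added to the previous sum.\<close>
  proof (cases "(\<Sum>l\<le>n. c l) \<le> \<delta>")
    case True
    have "(\<Sum>i<Suc n. if (\<Sum>l\<le>i. c l) \<le> \<delta> then c i else 0) \<le> (\<Sum>i<Suc n. c i)"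
      using assms by (intro sum_mono) auto
    then show ?thesis using True by (simp only: lessThan_Suc_atMost)
  qed (use Suc in simp)
qed (use assms in simp)

definition bracket :: "nat => (nat => real) => (nat => 'a => real^'n) => 'a => real" where
  "bracket n \<rho> \<zeta> \<omega> = (\<Sum>i<n. (norm (\<zeta> i \<omega>))\<^sup>2 * (\<rho> (Suc i) - \<rho> i))"

text \<open>Stop the integrand before its bracket exceeds \<open>\<delta>\<close>.\<close>

lemma Lenglart:
  assumes s: "simple_integrand M F T n \<rho> \<zeta>" and t: "0 \<le> t" and \<delta>: "\<delta> \<ge> 0"
  shows "expectation (\<lambda>\<omega>. min 1 ((simple_ito Z n \<rho> \<zeta> t \<omega>)\<^sup>2)) \<le> \<delta> + prob {\<omega>\<in>space M. bracket n \<rho> \<zeta> \<omega> > \<delta>}"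
proof -
  note D = simple_integrandD[OF s]
  have \<rho>: "\<rho> i \<le> \<rho> (Suc i)" if "i < n" for i using D(1)[of i "Suc i"] that by simp
  define c where "c i \<omega> = (if i < n then (norm (\<zeta> i \<omega>))\<^sup>2 * (\<rho> (Suc i) - \<rho> i) else 0)" for i \<omega>
  have c0: "c i \<omega> \<ge> 0" for i \<omega> using \<rho> by (simp add: c_def)
  \<comment> \<open>The sum includes the index \<open>i\<close> itself, whose coefficient is known
    at \<open>\<rho> i\<close>. So the truncated process is still adapted, and its bracket stays
    below \<open>\<delta>\<close> with no overshoot.\<close>
  define \<zeta>' where "\<zeta>' i \<omega> = (if (\<Sum>l\<le>i. c l \<omega>) \<le> \<delta> then \<zeta> i \<omega> else 0)" for i \<omega>
  have s': "simple_integrand M F T n \<rho> \<zeta>'"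
    unfolding simple_integrand_def
  proof (intro conjI allI impI)
    fix i assume i: "i < n"
    have zl: "\<zeta> l \<in> borel_measurable (F (\<rho> i))" if "l \<le> i" for l
      using that i by (intro measurable_F_mono[OF D(4)] D(1)) auto
    have "c l \<in> borel_measurable (F (\<rho> i))" if "l \<le> i" for l
      unfolding c_def[abs_def] using zl[OF that] by measurable
    then have "(\<lambda>\<omega>. \<Sum>l\<le>i. c l \<omega>) \<in> borel_measurable (F (\<rho> i))" by (intro borel_measurable_sum) auto
    then show "\<zeta>' i \<in> borel_measurable (F (\<rho> i))" unfolding \<zeta>'_def[abs_def] using zl[of i] by measurable
    obtain C where "\<forall>\<omega>\<in>space M. norm (\<zeta> i \<omega>) \<le> C" using s i unfolding simple_integrand_def by blast
    then have "\<forall>\<omega>\<in>space M. norm (\<zeta>' i \<omega>) \<le> max C 0" by (auto simp: \<zeta>'_def)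
    then show "\<exists>C. \<forall>\<omega>\<in>space M. norm (\<zeta>' i \<omega>) \<le> C" by blast
  qed (use s in \<open>auto simp: simple_integrand_def\<close>)
  note I = simple_ito_isometry[OF s' t]
  have meas: "simple_ito Z n \<rho> \<zeta> t \<in> borel_measurable M" by (rule measurable_F_M[OF simple_ito_isometry(3)[OF s t order_refl]])
  have "\<zeta> i \<in> borel_measurable M" if "i < n" for i by (rule measurable_F_M[OF D(4)[OF that]])
  then have brm: "bracket n \<rho> \<zeta> \<in> borel_measurable M" unfolding bracket_def[abs_def] by (intro borel_measurable_sum) auto
  then have A: "{\<omega>\<in>space M. bracket n \<rho> \<zeta> \<omega> > \<delta>} \<in> sets M" by measurable
  have bracket': "(\<Sum>i<n. (norm (\<zeta>' i \<omega>))\<^sup>2 * (min t (\<rho> (Suc i)) - min t (\<rho> i))) \<le> \<delta>" for \<omega>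
  proof -
    have "(\<Sum>i<n. (norm (\<zeta>' i \<omega>))\<^sup>2 * (min t (\<rho> (Suc i)) - min t (\<rho> i))) \<le> (\<Sum>i<n. if (\<Sum>l\<le>i. c l \<omega>) \<le> \<delta> then c i \<omega> else 0)"
    proof (rule sum_mono)
      fix i assume "i \<in> {..<n}"
      then have i: "i < n" by simp
      have "min t (\<rho> (Suc i)) - min t (\<rho> i) \<le> \<rho> (Suc i) - \<rho> i" using \<rho>[OF i] by linarith
      then show "(norm (\<zeta>' i \<omega>))\<^sup>2 * (min t (\<rho> (Suc i)) - min t (\<rho> i)) \<le> (if (\<Sum>l\<le>i. c l \<omega>) \<le> \<delta> then c i \<omega> else 0)"
        using i by (auto simp: \<zeta>'_def c_def intro!: mult_left_mono)
    qed
    then show ?thesis using truncated_sum_le[of "\<lambda>i. c i \<omega>" \<delta> n] c0 \<delta> by simp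
  qed
  have "expectation (\<lambda>\<omega>. min 1 ((simple_ito Z n \<rho> \<zeta> t \<omega>)\<^sup>2)) \<le>
    expectation (\<lambda>\<omega>. (simple_ito Z n \<rho> \<zeta>' t \<omega>)\<^sup>2 + indicator {\<omega>\<in>space M. bracket n \<rho> \<zeta> \<omega> > \<delta>} \<omega>)"
  proof (rule integral_mono)
    show "integrable M (\<lambda>\<omega>. min 1 ((simple_ito Z n \<rho> \<zeta> t \<omega>)\<^sup>2))"
      by (rule integrable_const_bound[where B=1]) (use meas in \<open>auto intro!: AE_I2\<close>)
    show "integrable M (\<lambda>\<omega>. (simple_ito Z n \<rho> \<zeta>' t \<omega>)\<^sup>2 + indicator {\<omega>\<in>space M. bracket n \<rho> \<zeta> \<omega> > \<delta>} \<omega>)"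
      using I(1) A by (intro Bochner_Integration.integrable_add integrable_real_indicator) (auto simp: emeasure_eq_measure)
    fix \<omega> assume w: "\<omega> \<in> space M"
    show "min 1 ((simple_ito Z n \<rho> \<zeta> t \<omega>)\<^sup>2) \<le> (simple_ito Z n \<rho> \<zeta>' t \<omega>)\<^sup>2 + indicator {\<omega>\<in>space M. bracket n \<rho> \<zeta> \<omega> > \<delta>} \<omega>"
    proof (cases "bracket n \<rho> \<zeta> \<omega> > \<delta>")
      case False
      have "\<zeta>' i \<omega> = \<zeta> i \<omega>" if i: "i < n" for i
      proof -
        have "(\<Sum>l\<le>i. c l \<omega>) \<le> (\<Sum>l<n. c l \<omega>)" using i c0 by (intro sum_mono2) auto
        also have "... = bracket n \<rho> \<zeta> \<omega>" by (simp add: bracket_def c_def)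
        finally show ?thesis using False by (simp add: \<zeta>'_def)
      qed
      then have "simple_ito Z n \<rho> \<zeta>' t \<omega> = simple_ito Z n \<rho> \<zeta> t \<omega>" by (simp add: simple_ito_def)
      then show ?thesis using False by simp
    qed (use w in \<open>simp add: min.coboundedI1\<close>)
  qed
  also have "... = expectation (\<lambda>\<omega>. (simple_ito Z n \<rho> \<zeta>' t \<omega>)\<^sup>2) + prob {\<omega>\<in>space M. bracket n \<rho> \<zeta> \<omega> > \<delta>}"
    using I(1) A by (subst Bochner_Integration.integral_add) (auto simp: emeasure_eq_measure Int_absorb2 intro!: arg_cong[where f=prob])
  also have "expectation (\<lambda>\<omega>. (simple_ito Z n \<rho> \<zeta>' t \<omega>)\<^sup>2) \<le> \<delta>"
    unfolding I(2)
  \<comment> \<open>If the sum were not integrable, its Bochner integral would be 0 by default and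
    the bound would still hold.\<close>
  proof (cases "integrable M (\<lambda>\<omega>. \<Sum>j<n. (norm (\<zeta>' j \<omega>))\<^sup>2 * (min t (\<rho> (Suc j)) - min t (\<rho> j)))")
    case True
    then show "expectation (\<lambda>\<omega>. \<Sum>j<n. (norm (\<zeta>' j \<omega>))\<^sup>2 * (min t (\<rho> (Suc j)) - min t (\<rho> j))) \<le> \<delta>"
      by (rule integral_le_const) (use bracket' in auto)
  qed (use \<delta> in \<open>simp add: not_integrable_integral_eq\<close>)
  finally show ?thesis by simp
qed

lemma bracket_le:
  assumes s: "simple_integrand M F T n \<rho> \<zeta>"
  shows "ennreal (bracket n \<rho> \<zeta> \<omega>) \<le> (\<integral>\<^sup>+t\<in>{0..T}. ennreal ((norm (simple_process n \<rho> \<zeta> t \<omega>))\<^sup>2) \<partial>lborel)"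
proof -
  note D = simple_integrandD[OF s]
  have \<rho>: "\<rho> i \<le> \<rho> (Suc i)" if "i < n" for i using D(1)[of i "Suc i"] that by simp
  have "ennreal (bracket n \<rho> \<zeta> \<omega>) = (\<Sum>i<n. ennreal ((norm (\<zeta> i \<omega>))\<^sup>2) * emeasure lborel {\<rho> i<..\<rho> (Suc i)})"
    unfolding bracket_def using \<rho> by (subst sum_ennreal[symmetric]) (auto simp: ennreal_mult intro!: sum.cong)
  also have "... = (\<integral>\<^sup>+t. (\<Sum>i<n. ennreal ((norm (\<zeta> i \<omega>))\<^sup>2) * indicator {\<rho> i<..\<rho> (Suc i)} t) \<partial>lborel)"
    by (subst nn_integral_sum) (auto simp: nn_integral_cmult_indicator)
  also have "... \<le> (\<integral>\<^sup>+t\<in>{0..T}. ennreal ((norm (simple_process n \<rho> \<zeta> t \<omega>))\<^sup>2) \<partial>lborel)"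
  proof (rule nn_integral_mono)
    fix t
    show "(\<Sum>i<n. ennreal ((norm (\<zeta> i \<omega>))\<^sup>2) * indicator {\<rho> i<..\<rho> (Suc i)} t) \<le> ennreal ((norm (simple_process n \<rho> \<zeta> t \<omega>))\<^sup>2) * indicator {0..T} t"
    proof (cases "\<exists>i<n. t \<in> {\<rho> i<..\<rho> (Suc i)}")
      case True
      then obtain i where i: "i < n" "t \<in> {\<rho> i<..\<rho> (Suc i)}" by blast
      have "(\<Sum>j<n. ennreal ((norm (\<zeta> j \<omega>))\<^sup>2) * indicator {\<rho> j<..\<rho> (Suc j)} t) = ennreal (\<Sum>j<n. indicator {\<rho> j<..\<rho> (Suc j)} t *\<^sub>R (norm (\<zeta> j \<omega>))\<^sup>2)"
        by (subst sum_ennreal[symmetric]) (auto simp: indicator_def intro!: sum.cong)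
      also have "... = ennreal ((norm (\<zeta> i \<omega>))\<^sup>2)" using grid_indicator_sum[where f="\<lambda>j. (norm (\<zeta> j \<omega>))\<^sup>2", OF D(1) i] by simp
      also have "\<zeta> i \<omega> = simple_process n \<rho> \<zeta> t \<omega>" unfolding simple_process_def using grid_indicator_sum[where f="\<lambda>j. \<zeta> j \<omega>", OF D(1) i] by simp
      finally show ?thesis using i D(2)[of i] D(3)[of "Suc i"] by (auto simp: indicator_def)
    next
      case False
      then have "(\<Sum>i<n. ennreal ((norm (\<zeta> i \<omega>))\<^sup>2) * indicator {\<rho> i<..\<rho> (Suc i)} t) = 0" by (intro sum.neutral) (auto simp: indicator_def)
      then show ?thesis by (simp only: zero_le)
    qed
  qed
  finally show ?thesis .
qed

text \<open>The expectation of the truncated square measures convergence in probability. Half of the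
  error is the level \<open>\<delta>\<close> of Lenglart's inequality, the other half the
  probability that the bracket exceeds it.\<close>

lemma simple_ito_tendsto_0:
  assumes s: "\<And>k. simple_integrand M F T (n k) (\<rho> k) (\<zeta> k)" and t: "0 \<le> t"
    and lim: "AE \<omega> in M. (\<lambda>k. \<integral>\<^sup>+t\<in>{0..T}. ennreal ((norm (simple_process (n k) (\<rho> k) (\<zeta> k) t \<omega>))\<^sup>2) \<partial>lborel) \<longlonglongrightarrow> 0"
  shows "(\<lambda>k. expectation (\<lambda>\<omega>. min 1 ((simple_ito Z (n k) (\<rho> k) (\<zeta> k) t \<omega>)\<^sup>2))) \<longlonglongrightarrow> 0"
proof (rule LIMSEQ_I)
  fix e :: real assume e: "e > 0"
  define A where "A k = {\<omega>\<in>space M. bracket (n k) (\<rho> k) (\<zeta> k) \<omega> > e / 2}" for k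
  have A[measurable]: "A k \<in> sets M" for k
  proof -
    have "\<zeta> k i \<in> borel_measurable M" if "i < n k" for i by (rule measurable_F_M[OF simple_integrandD(4)[OF s that]])
    then have "bracket (n k) (\<rho> k) (\<zeta> k) \<in> borel_measurable M" unfolding bracket_def[abs_def] by (intro borel_measurable_sum) auto
    then show ?thesis unfolding A_def by measurable
  qed
  have "(\<lambda>k. \<integral>\<omega>. indicator (A k) \<omega> \<partial>M) \<longlonglongrightarrow> (\<integral>\<omega>. (0::real) \<partial>M)"
  proof (rule integral_dominated_convergence[where w="\<lambda>_. 1"])
    show "AE \<omega> in M. (\<lambda>k. indicator (A k) \<omega> :: real) \<longlonglongrightarrow> 0"
      using lim
    proof eventually_elim
      case (elim \<omega>)
      have "0 < ennreal (e / 2)" using e by simp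
      with elim have "\<forall>\<^sub>F k in sequentially. (\<integral>\<^sup>+t\<in>{0..T}. ennreal ((norm (simple_process (n k) (\<rho> k) (\<zeta> k) t \<omega>))\<^sup>2) \<partial>lborel) < ennreal (e / 2)"
        by (auto intro: order_tendstoD)
      then have "\<forall>\<^sub>F k in sequentially. indicator (A k) \<omega> = (0::real)"
      proof eventually_elim
        case (elim k)
        then have "ennreal (bracket (n k) (\<rho> k) (\<zeta> k) \<omega>) \<le> ennreal (e / 2)" using bracket_le[OF s, of k \<omega>] by (meson less_imp_le order_trans)
        then have "bracket (n k) (\<rho> k) (\<zeta> k) \<omega> \<le> e / 2" by (rule ennreal_le_iff[THEN iffD1, rotated]) (use e in simp)
        then show ?case by (simp add: A_def)
      qed
      then show ?case by (rule tendsto_eventually)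
    qed
  qed auto
  then have "(\<lambda>k. prob (A k)) \<longlonglongrightarrow> 0" by simp
  from order_tendstoD(2)[OF this, of "e / 2"] have "\<forall>\<^sub>F k in sequentially. prob (A k) < e / 2" using e by simp
  then obtain K where K: "\<And>k. k \<ge> K ==> prob (A k) < e / 2" by (auto simp: eventually_sequentially)
  show "\<exists>K. \<forall>k\<ge>K. norm (expectation (\<lambda>\<omega>. min 1 ((simple_ito Z (n k) (\<rho> k) (\<zeta> k) t \<omega>)\<^sup>2)) - 0) < e"
  proof (intro exI allI impI)
    fix k assume "k \<ge> K"
    have "expectation (\<lambda>\<omega>. min 1 ((simple_ito Z (n k) (\<rho> k) (\<zeta> k) t \<omega>)\<^sup>2)) \<le> e / 2 + prob (A k)"
      unfolding A_def using e by (intro Lenglart[OF s t]) simp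
    also have "... < e" using K[OF \<open>k \<ge> K\<close>] by simp
    finally have "expectation (\<lambda>\<omega>. min 1 ((simple_ito Z (n k) (\<rho> k) (\<zeta> k) t \<omega>)\<^sup>2)) < e" .
    moreover have "0 \<le> expectation (\<lambda>\<omega>. min 1 ((simple_ito Z (n k) (\<rho> k) (\<zeta> k) t \<omega>)\<^sup>2))" by (rule integral_nonneg_AE) auto
    ultimately show "norm (expectation (\<lambda>\<omega>. min 1 ((simple_ito Z (n k) (\<rho> k) (\<zeta> k) t \<omega>)\<^sup>2)) - 0) < e" by simp
  qed
qed

end

text \<open>Time is rounded to a multiple of \<open>1 / Suc n\<close>, which leaves countably many
  measurable pieces. Rounding up is harmless, because all times of [a,b] are measurable for the
  single sigma-algebra \<open>N\<close>.\<close>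

lemma continuous_process_jointly_measurable:
  fixes X :: "real => 'a => real"
  assumes ab: "a \<le> b" and meas: "\<And>s. s \<in> {a..b} ==> X s \<in> borel_measurable N"
    and cont: "\<And>\<omega>. \<omega> \<in> space N ==> continuous_on {a..b} (\<lambda>s. X s \<omega>)"
  shows "(\<lambda>(s, \<omega>). X s \<omega>) \<in> borel_measurable (restrict_space borel {a..b} \<Otimes>\<^sub>M N)"
proof -
  define q where "q n (i::int) = max a (min b (real_of_int i / real (Suc n)))" for n i
  have q: "q n i \<in> {a..b}" for n i using ab by (auto simp: q_def)
  define Y where "Y n p = X (q n \<lceil>real (Suc n) * fst p\<rceil>) (snd p)" for n and p :: "real \<times> 'a"
  have Y: "Y n \<in> borel_measurable (restrict_space borel {a..b} \<Otimes>\<^sub>M N)" for n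
    unfolding Y_def
  proof (rule measurable_compose_countable[where f="\<lambda>i p. X (q n i) (snd p)"])
    show "(\<lambda>p. X (q n i) (snd p)) \<in> borel_measurable (restrict_space borel {a..b} \<Otimes>\<^sub>M N)" for i
      by (rule measurable_compose[OF measurable_snd meas[OF q]])
    have "fst \<in> borel_measurable (restrict_space borel {a..b} \<Otimes>\<^sub>M N)"
      by (rule measurable_compose[OF measurable_fst]) (auto intro: measurable_restrict_space1)
    then show "(\<lambda>p. \<lceil>real (Suc n) * fst p\<rceil>) \<in> measurable (restrict_space borel {a..b} \<Otimes>\<^sub>M N) (count_space UNIV)"
      by measurable
  qed
  have "(\<lambda>n. Y n p) \<longlonglongrightarrow> (case p of (s, \<omega>) => X s \<omega>)" if p: "p \<in> space (restrict_space borel {a..b} \<Otimes>\<^sub>M N)" for p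
  proof -
    obtain s \<omega> where p': "p = (s, \<omega>)" "s \<in> {a..b}" "\<omega> \<in> space N"
      using p by (auto simp: space_pair_measure space_restrict_space)
    have "(\<lambda>n. q n \<lceil>real (Suc n) * s\<rceil>) \<longlonglongrightarrow> max a (min b s)"
    proof -
      have "(\<lambda>n. real_of_int \<lceil>real (Suc n) * s\<rceil> / real (Suc n)) \<longlonglongrightarrow> s"
      proof (rule tendsto_sandwich)
        show "\<forall>\<^sub>F n in sequentially. s \<le> real_of_int \<lceil>real (Suc n) * s\<rceil> / real (Suc n)"
          by (intro always_eventually allI) (simp add: pos_le_divide_eq mult.commute del: of_nat_Suc)
        show "\<forall>\<^sub>F n in sequentially. real_of_int \<lceil>real (Suc n) * s\<rceil> / real (Suc n) \<le> s + 1 / real (Suc n)"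
        proof (intro always_eventually allI)
          fix n
          have "real_of_int \<lceil>real (Suc n) * s\<rceil> \<le> real (Suc n) * s + 1" by linarith
          then have "real_of_int \<lceil>real (Suc n) * s\<rceil> / real (Suc n) \<le> (real (Suc n) * s + 1) / real (Suc n)" by (intro divide_right_mono) auto
          then show "real_of_int \<lceil>real (Suc n) * s\<rceil> / real (Suc n) \<le> s + 1 / real (Suc n)" by (simp add: add_divide_distrib del: of_nat_Suc)
        qed
        have "(\<lambda>n. s + 1 / real (Suc n)) \<longlonglongrightarrow> s + 0"
          by (intro tendsto_intros LIMSEQ_Suc[OF lim_1_over_n])
        then show "(\<lambda>n. s + 1 / real (Suc n)) \<longlonglongrightarrow> s" by simp
      qed auto
      then show ?thesis unfolding q_def by (intro tendsto_intros)
    qed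
    then have "(\<lambda>n. q n \<lceil>real (Suc n) * s\<rceil>) \<longlonglongrightarrow> s" using p'(2) by simp
    then have "(\<lambda>n. X (q n \<lceil>real (Suc n) * s\<rceil>) \<omega>) \<longlonglongrightarrow> X s \<omega>"
      by (rule continuous_on_tendsto_compose[OF cont[OF p'(3)] _ p'(2)]) (use q in auto)
    then show ?thesis by (simp add: p' Y_def)
  qed
  then show ?thesis by (rule borel_measurable_LIMSEQ_real[OF _ Y])
qed

lemma nn_integral_two_two:
  fixes a b :: "'c => ennreal"
  assumes "a \<in> borel_measurable N" "b \<in> borel_measurable N"
  shows "(\<integral>\<^sup>+x. 2 * a x + 2 * b x \<partial>N) = 2 * (\<integral>\<^sup>+x. a x \<partial>N) + 2 * (\<integral>\<^sup>+x. b x \<partial>N)"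
  using assms by (simp add: nn_integral_add nn_integral_cmult)

lemma Riemann_sums_converge:
  fixes f :: "real => real"
  assumes f: "continuous_on {0..T} f" and T: "T > 0" and t: "t \<in> {0..T}"
  shows "(\<lambda>m. \<Sum>j<2^m. f (grid T m j) * (min t (grid T m (Suc j)) - min t (grid T m j))) \<longlonglongrightarrow> Lint f 0 t"
proof (rule LIMSEQ_I)
  fix e :: real assume e: "e > 0"
  have fi: "set_integrable lborel {0..T} f" by (rule borel_integrable_atLeastAtMost'[OF f])
  have "e / (T + 1) > 0" using e T by simp
  from eventually_uniform_grid[OF f T this] obtain N where
    N: "\<And>m s t. m \<ge> N ==> s \<in> {0..T} ==> t \<in> {0..T} ==> \<bar>s - t\<bar> \<le> T / 2^m ==> \<bar>f s - f t\<bar> < e / (T + 1)"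
    unfolding eventually_sequentially by blast
  show "\<exists>N. \<forall>m\<ge>N. norm ((\<Sum>j<2^m. f (grid T m j) * (min t (grid T m (Suc j)) - min t (grid T m j))) - Lint f 0 t) < e"
  proof (intro exI allI impI)
    fix m assume m: "m \<ge> N"
    define r where "r j = min t (grid T m j)" for j
    have r: "r j \<in> {0..T}" "r j \<le> r (Suc j)" "r (Suc j) - r j \<le> T / 2^m" for j
      using min_grid_bounds[OF T t] by (simp_all add: r_def)
    have sub: "set_integrable lborel {r j..r (Suc j)} f" for j
      using set_integrable_sub[OF fi] r(1)[of j] r(1)[of "Suc j"] by auto
    have Lr: "Lint f 0 (r (Suc j)) - Lint f 0 (r j) = Lint f (r j) (r (Suc j))" for j
      using Lint_split[of 0 "r (Suc j)" f "r j"] set_integrable_sub[OF fi, of 0 "r (Suc j)"] r(1)[of j] r(1)[of "Suc j"] r(2)[of j] by auto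
    have "(\<Sum>j<2^m. Lint f 0 (r (Suc j)) - Lint f 0 (r j)) = Lint f 0 t - Lint f 0 0"
      unfolding r_def by (rule sum_telescope_min[OF T t])
    then have "Lint f 0 t = (\<Sum>j<2^m. Lint f (r j) (r (Suc j)))" unfolding Lr Lint_singleton by simp
    then have "\<bar>(\<Sum>j<2^m. f (grid T m j) * (r (Suc j) - r j)) - Lint f 0 t\<bar> = \<bar>\<Sum>j<2^m. f (grid T m j) * (r (Suc j) - r j) - Lint f (r j) (r (Suc j))\<bar>"
      by (simp add: sum_subtractf)
    also have "... \<le> (\<Sum>j<2^m. e / (T + 1) * (r (Suc j) - r j))"
    proof (intro order_trans[OF sum_abs] sum_mono)
      fix j assume "j \<in> {..<(2::nat)^m}"
      then have j: "j < 2^m" by simp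
      show "\<bar>f (grid T m j) * (r (Suc j) - r j) - Lint f (r j) (r (Suc j))\<bar> \<le> e / (T + 1) * (r (Suc j) - r j)"
      proof (cases "grid T m j \<le> t")
        case False
        then have "r j = t" "r (Suc j) = t" using grid_mono[OF T, of j "Suc j" m] by (auto simp: r_def)
        then show ?thesis by (simp add: Lint_singleton del: atLeastAtMost_singleton)
      next
        case True
        then have gr: "grid T m j = r j" by (simp add: r_def)
        have c: "set_integrable lborel {r j..r (Suc j)} (\<lambda>s. C * exp (0 * s))" "Lint (\<lambda>s. C * exp (0 * s)) (r j) (r (Suc j)) = C * (r (Suc j) - r j)" for C
          by (rule set_integrable_exp) (use r(2)[of j] in \<open>subst Lint_eq_integral(1)[OF set_integrable_exp], simp\<close>)
        have "f (r j) * (r (Suc j) - r j) - Lint f (r j) (r (Suc j)) = Lint (\<lambda>s. f (r j) * exp (0 * s) - f s) (r j) (r (Suc j))"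
          by (simp only: Lint_diff[OF c(1) sub] c(2))
        also have "\<bar>...\<bar> \<le> Lint (\<lambda>s. e / (T + 1) * exp (0 * s)) (r j) (r (Suc j))"
        proof (rule Lint_abs_le[OF set_integral_diff(1)[OF c(1) sub] c(1)])
          fix s assume s: "s \<in> {r j..r (Suc j)}"
          then have "s \<in> {0..T}" "\<bar>r j - s\<bar> \<le> T / 2^m" using r(1)[of j] r(1)[of "Suc j"] r(3)[of j] by auto
          then have "\<bar>f (r j) - f s\<bar> < e / (T + 1)" by (intro N[OF m r(1)])
          then show "\<bar>f (r j) * exp (0 * s) - f s\<bar> \<le> e / (T + 1) * exp (0 * s)" by simp
        qed
        finally show ?thesis unfolding gr c(2) .
      qed
    qed
    also have "... = e / (T + 1) * t"
      unfolding sum_distrib_left[symmetric] r_def using sum_telescope_min[OF T t, of "\<lambda>x. x" m] by (simp only: diff_zero)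
    also have "... \<le> e / (T + 1) * T" using t e T by (intro mult_left_mono) auto
    also have "... < e" using e T by (simp add: field_simps)
    finally show "norm ((\<Sum>j<2^m. f (grid T m j) * (min t (grid T m (Suc j)) - min t (grid T m j))) - Lint f 0 t) < e"
      by (simp only: r_def real_norm_def)
  qed
qed

section \<open>Dyadic approximation of the integral of a continuous adapted process\<close>

context brownian
begin

text \<open>Clipping at level \<open>k\<close> makes the coefficients bounded, as
  \<open>simple_integrand\<close> demands; on a continuous path it is inactive for all large
  \<open>k\<close>.\<close>

definition dyadic_int :: "(real => 'a => real) => real => real^'n => nat => nat => 'a => real^'n" where
  "dyadic_int y T s k j \<omega> = clip (real k) (y (grid T k j) \<omega>) *\<^sub>R s"

lemma dyadic_simple:
  assumes y: "adapted_on F T y" and T: "T > 0"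
  shows "simple_integrand M F T (2^k) (grid T k) (dyadic_int y T s k)"
  unfolding simple_integrand_def
proof (intro conjI allI impI)
  fix j :: nat assume j: "j < 2^k"
  show "grid T k j \<le> grid T k (Suc j)" using T by (intro grid_mono) auto
  have "grid T k j \<in> {0..T}" using j T by (auto intro!: grid_nonneg grid_le_T)
  then have "y (grid T k j) \<in> borel_measurable (F (grid T k j))" using y by (simp add: adapted_on_def)
  then show "dyadic_int y T s k j \<in> borel_measurable (F (grid T k j))" unfolding dyadic_int_def by measurable
  have "norm (dyadic_int y T s k j \<omega>) \<le> real k * norm s" for \<omega>
    unfolding dyadic_int_def norm_scaleR by (intro mult_right_mono) (simp_all add: clip_abs_le)
  then show "\<exists>C. \<forall>\<omega>\<in>space M. norm (dyadic_int y T s k j \<omega>) \<le> C" by blast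
qed auto

lemma eventually_clip_path:
  fixes f :: "real => real"
  assumes "continuous_on {0..T} f"
  shows "\<forall>\<^sub>F k in sequentially. \<forall>t\<in>{0..T}. clip (real k) (f t) = f t"
proof -
  obtain S where S: "\<And>t. t \<in> {0..T} ==> \<bar>f t\<bar> \<le> S" using continuous_on_bounded[OF assms] by blast
  obtain k0 :: nat where k0: "S \<le> real k0" using real_arch_simple by blast
  show ?thesis
    using eventually_ge_at_top[of k0]
  proof eventually_elim
    case (elim k)
    show ?case
    proof
      fix t assume "t \<in> {0..T}"
      then have "\<bar>f t\<bar> \<le> real k" using S[of t] k0 elim by (meson of_nat_le_iff order_trans)
      then show "clip (real k) (f t) = f t" by (rule clip_eq)
    qed
  qed
qed

lemma dyadic_process_converges:
  assumes c: "continuous_on {0..T} (\<lambda>t. y t \<omega>)" and T: "T > 0"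
  shows "(\<lambda>k. \<integral>\<^sup>+t\<in>{0..T}. ennreal ((norm (simple_process (2^k) (grid T k) (dyadic_int y T s k) t \<omega> - y t \<omega> *\<^sub>R s))\<^sup>2) \<partial>lborel) \<longlonglongrightarrow> 0"
proof (rule tendsto_zero_ennreal)
  fix e :: real assume e: "e > 0"
  \<comment> \<open>The minimum with 1 gives \<open>q\<^sup>2 \<le> q\<close>, so that a bound
    linear in \<open>q\<close> suffices.\<close>
  define q where "q = min 1 (e / 2 / ((norm s)\<^sup>2 * T + 1))"
  have nn: "(norm s)\<^sup>2 * T + 1 > 0" using T by (simp add: add_nonneg_pos)
  have q: "q > 0" "q \<le> 1" "q \<le> e / 2 / ((norm s)\<^sup>2 * T + 1)" using e nn by (auto simp: q_def)
  show "\<forall>\<^sub>F k in sequentially. (\<integral>\<^sup>+t\<in>{0..T}. ennreal ((norm (simple_process (2^k) (grid T k) (dyadic_int y T s k) t \<omega> - y t \<omega> *\<^sub>R s))\<^sup>2) \<partial>lborel) < ennreal e"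
    using eventually_uniform_grid[OF c T q(1)] eventually_clip_path[OF c]
  proof eventually_elim
    case (elim k)
    have close: "norm (simple_process (2^k) (grid T k) (dyadic_int y T s k) t \<omega> - y t \<omega> *\<^sub>R s) \<le> q * norm s" if t: "t \<in> {0<..T}" for t
    proof -
      have "\<exists>j<2^k. t \<in> {grid T k j<..grid T k (Suc j)}"
      proof -
        \<comment> \<open>Cells are open on the left, hence the ceiling minus one. The time 0
          belongs to no cell and is discarded below as a null set.\<close>
        define i where "i = nat (\<lceil>t * 2^k / T\<rceil> - 1)"
        have pos: "0 < t * 2^k / T" using t T by simp
        then have "int i = \<lceil>t * 2^k / T\<rceil> - 1" unfolding i_def by (simp add: zero_less_ceiling less_imp_le)
        then have i: "real i < t * 2^k / T" "t * 2^k / T \<le> real i + 1" by linarith+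
        have "t * 2^k / T \<le> 2^k" using t T by (simp add: field_simps)
        then have "real i < 2^k" using i(1) by linarith
        then have "i < 2^k" by (metis of_nat_less_iff of_nat_numeral of_nat_power)
        moreover have "grid T k i < t" "t \<le> grid T k (Suc i)" using i T by (simp_all add: grid_def field_simps)
        ultimately show ?thesis by auto
      qed
      then obtain j where j: "j < 2^k" "t \<in> {grid T k j<..grid T k (Suc j)}" by blast
      have gj: "grid T k j \<in> {0..T}" using j(1) T by (auto intro!: grid_nonneg grid_le_T)
      have "simple_process (2^k) (grid T k) (dyadic_int y T s k) t \<omega> = dyadic_int y T s k j \<omega>"
        unfolding simple_process_def using T
        by (intro grid_indicator_sum[where f="\<lambda>j. dyadic_int y T s k j \<omega>", OF _ j] grid_mono) auto
      also have "... = y (grid T k j) \<omega> *\<^sub>R s" using elim(2) gj by (simp add: dyadic_int_def)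
      finally have "norm (simple_process (2^k) (grid T k) (dyadic_int y T s k) t \<omega> - y t \<omega> *\<^sub>R s) = \<bar>y (grid T k j) \<omega> - y t \<omega>\<bar> * norm s"
        by (simp add: scaleR_left_diff_distrib[symmetric])
      also have "... \<le> q * norm s"
      proof (intro mult_right_mono less_imp_le[OF elim(1)[rule_format]])
        show "\<bar>grid T k j - t\<bar> \<le> T / 2^k" using j(2) by (auto simp: grid_Suc)
      qed (use gj t in auto)
      finally show ?thesis .
    qed
    have "(\<integral>\<^sup>+t\<in>{0..T}. ennreal ((norm (simple_process (2^k) (grid T k) (dyadic_int y T s k) t \<omega> - y t \<omega> *\<^sub>R s))\<^sup>2) \<partial>lborel)
      \<le> (\<integral>\<^sup>+t. ennreal ((q * norm s)\<^sup>2) * indicator {0..T} t \<partial>lborel)"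
    proof (rule nn_integral_mono_AE)
      show "AE t in lborel. ennreal ((norm (simple_process (2^k) (grid T k) (dyadic_int y T s k) t \<omega> - y t \<omega> *\<^sub>R s))\<^sup>2) * indicator {0..T} t
        \<le> ennreal ((q * norm s)\<^sup>2) * indicator {0..T} t"
        using AE_lborel_singleton[of 0]
      proof eventually_elim
        case (elim t)
        then show ?case using close[of t] by (auto simp: indicator_def intro!: ennreal_leI power_mono)
      qed
    qed
    also have "... = ennreal ((q * norm s)\<^sup>2 * T)"
      using T by (subst nn_integral_cmult_indicator) (auto simp: ennreal_mult)
    also have "... < ennreal e"
    proof (rule ennreal_lessI[OF e])
      have "q * q \<le> q * 1" using q by (intro mult_left_mono) auto
      then have "q\<^sup>2 * ((norm s)\<^sup>2 * T) \<le> q * ((norm s)\<^sup>2 * T)" using T by (intro mult_right_mono) (auto simp: power2_eq_square)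
      also have "... \<le> q * ((norm s)\<^sup>2 * T + 1)" using q by simp
      also have "... \<le> e / 2 / ((norm s)\<^sup>2 * T + 1) * ((norm s)\<^sup>2 * T + 1)" using q nn by (intro mult_right_mono) auto
      also have "... = e / 2"
      proof -
        have "x / q * q = x" if "q > 0" for x q :: real using that by simp
        from this[OF nn] show ?thesis .
      qed
      also have "... < e" using e by simp
      finally show "(q * norm s)\<^sup>2 * T < e" by (simp add: power_mult_distrib mult.assoc)
    qed
    finally show ?case .
  qed
qed

text \<open>The unspecified simple processes and the dyadic ones converge to the same integrand,
  almost surely in L^2 of time. Lenglart's inequality for their difference on a common refinement
  makes the two integrals close in probability.\<close>

lemma ito_vs_dyadic:
  assumes I: "ito_integral M F Z T (\<lambda>t \<omega>. y t \<omega> *\<^sub>R s) I" and y: "adapted_on F T y" "continuous_paths_on M T y"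
    and T: "T > 0" and t: "t \<in> {0..T}"
  obtains m \<tau> \<xi> where "\<And>k. simple_integrand M F T (m k) (\<tau> k) (\<xi> k)"
    "AE \<omega> in M. (\<lambda>k. simple_ito Z (m k) (\<tau> k) (\<xi> k) t \<omega>) \<longlonglongrightarrow> I t \<omega>"
    "(\<lambda>k. expectation (\<lambda>\<omega>. min 1 ((simple_ito Z (m k) (\<tau> k) (\<xi> k) t \<omega> - simple_ito Z (2^k) (grid T k) (dyadic_int y T s k) t \<omega>)\<^sup>2))) \<longlonglongrightarrow> 0"
proof -
  obtain m \<tau> \<xi> where s: "\<And>k. simple_integrand M F T (m k) (\<tau> k) (\<xi> k)"
    and conv: "AE \<omega> in M. (\<lambda>k. \<integral>\<^sup>+t\<in>{0..T}. ennreal ((norm (simple_process (m k) (\<tau> k) (\<xi> k) t \<omega> - y t \<omega> *\<^sub>R s))\<^sup>2) \<partial>lborel) \<longlonglongrightarrow> 0 \<and>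
           uniform_limit {0..T} (\<lambda>k t. simple_ito Z (m k) (\<tau> k) (\<xi> k) t \<omega>) (\<lambda>t. I t \<omega>) sequentially"
    using I unfolding ito_integral_def by blast
  have d: "simple_integrand M F T (2^k) (grid T k) (dyadic_int y T s k)" for k by (rule dyadic_simple[OF y(1) T])
  have "\<forall>k. \<exists>n \<rho> \<zeta>. simple_integrand M F T n \<rho> \<zeta> \<and>
    (\<forall>t \<omega>. simple_process n \<rho> \<zeta> t \<omega> = simple_process (m k) (\<tau> k) (\<xi> k) t \<omega> - simple_process (2^k) (grid T k) (dyadic_int y T s k) t \<omega>) \<and>
    (\<forall>t \<omega>. simple_ito Z n \<rho> \<zeta> t \<omega> = simple_ito Z (m k) (\<tau> k) (\<xi> k) t \<omega> - simple_ito Z (2^k) (grid T k) (dyadic_int y T s k) t \<omega>)"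
    using ex_common_refinement[OF s d] by blast
  then obtain n \<rho> \<zeta> where R: "\<And>k. simple_integrand M F T (n k) (\<rho> k) (\<zeta> k)"
    "\<And>k t \<omega>. simple_process (n k) (\<rho> k) (\<zeta> k) t \<omega> = simple_process (m k) (\<tau> k) (\<xi> k) t \<omega> - simple_process (2^k) (grid T k) (dyadic_int y T s k) t \<omega>"
    "\<And>k t \<omega>. simple_ito Z (n k) (\<rho> k) (\<zeta> k) t \<omega> = simple_ito Z (m k) (\<tau> k) (\<xi> k) t \<omega> - simple_ito Z (2^k) (grid T k) (dyadic_int y T s k) t \<omega>"
    by metis
  have "(\<lambda>k. expectation (\<lambda>\<omega>. min 1 ((simple_ito Z (n k) (\<rho> k) (\<zeta> k) t \<omega>)\<^sup>2))) \<longlonglongrightarrow> 0"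
  proof (rule simple_ito_tendsto_0[OF R(1)])
    show "0 \<le> t" using t by simp
    show "AE \<omega> in M. (\<lambda>k. \<integral>\<^sup>+t\<in>{0..T}. ennreal ((norm (simple_process (n k) (\<rho> k) (\<zeta> k) t \<omega>))\<^sup>2) \<partial>lborel) \<longlonglongrightarrow> 0"
      using conv AE_space
    proof eventually_elim
      case (elim \<omega>)
      have c: "continuous_on {0..T} (\<lambda>t. y t \<omega>)" using y(2) elim by (simp add: continuous_paths_on_def)
      have [measurable]: "(\<lambda>t. indicator {0..T} t *\<^sub>R y t \<omega>) \<in> borel_measurable borel"
        using sbm_continuous[OF _ c] by (simp add: set_borel_measurable_def)
      let ?H = "\<lambda>k t. simple_process (m k) (\<tau> k) (\<xi> k) t \<omega>" and ?D = "\<lambda>k t. simple_process (2^k) (grid T k) (dyadic_int y T s k) t \<omega>"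
      \<comment> \<open>Outside [0,T] nothing is known about \<open>y\<close>, so it is cut off to
        obtain a function measurable on the whole line.\<close>
      let ?ym = "\<lambda>t. (indicator {0..T} t *\<^sub>R y t \<omega>) *\<^sub>R s"
      have pm: "(\<lambda>t. simple_process a b c t \<omega>) \<in> borel_measurable borel" for a b and c :: "nat => 'a => real^'n"
        unfolding simple_process_def by (intro borel_measurable_sum borel_measurable_scaleR) auto
      have yeq: "(\<integral>\<^sup>+t\<in>{0..T}. ennreal ((norm (f t - y t \<omega> *\<^sub>R s))\<^sup>2) \<partial>lborel) = (\<integral>\<^sup>+t. ennreal ((norm (f t - ?ym t))\<^sup>2) * indicator {0..T} t \<partial>lborel)" for f
        by (intro nn_integral_cong) (simp add: indicator_def)
      show ?case
      proof (rule ennreal_null_sandwich)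
        fix k
        have [measurable]: "?H k \<in> borel_measurable borel" "?D k \<in> borel_measurable borel" by (rule pm)+
        have "(\<integral>\<^sup>+t\<in>{0..T}. ennreal ((norm (simple_process (n k) (\<rho> k) (\<zeta> k) t \<omega>))\<^sup>2) \<partial>lborel)
          \<le> (\<integral>\<^sup>+t. 2 * (ennreal ((norm (?H k t - ?ym t))\<^sup>2) * indicator {0..T} t) + 2 * (ennreal ((norm (?D k t - ?ym t))\<^sup>2) * indicator {0..T} t) \<partial>lborel)"
        proof (rule nn_integral_mono)
          fix t
          have "norm (?H k t - ?D k t) \<le> norm (?H k t - ?ym t) + norm (?D k t - ?ym t)"
            using norm_triangle_ineq4[of "?H k t - ?ym t" "?D k t - ?ym t"] by simp
          then have "(norm (?H k t - ?D k t))\<^sup>2 \<le> (norm (?H k t - ?ym t) + norm (?D k t - ?ym t))\<^sup>2" by (intro power_mono) auto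
          also have "... \<le> 2 * (norm (?H k t - ?ym t))\<^sup>2 + 2 * (norm (?D k t - ?ym t))\<^sup>2" by (rule sq_add_le)
          finally have "ennreal ((norm (?H k t - ?D k t))\<^sup>2) \<le> ennreal (2 * (norm (?H k t - ?ym t))\<^sup>2 + 2 * (norm (?D k t - ?ym t))\<^sup>2)" by (rule ennreal_leI)
          then have "ennreal ((norm (?H k t - ?D k t))\<^sup>2) \<le> 2 * ennreal ((norm (?H k t - ?ym t))\<^sup>2) + 2 * ennreal ((norm (?D k t - ?ym t))\<^sup>2)"
            by (simp add: ennreal_mult)
          then show "ennreal ((norm (simple_process (n k) (\<rho> k) (\<zeta> k) t \<omega>))\<^sup>2) * indicator {0..T} t \<le>
            2 * (ennreal ((norm (?H k t - ?ym t))\<^sup>2) * indicator {0..T} t) + 2 * (ennreal ((norm (?D k t - ?ym t))\<^sup>2) * indicator {0..T} t)"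
            unfolding R(2) by (cases "t \<in> {0..T}") auto
        qed
        also have "... = 2 * (\<integral>\<^sup>+t. ennreal ((norm (?H k t - ?ym t))\<^sup>2) * indicator {0..T} t \<partial>lborel) + 2 * (\<integral>\<^sup>+t. ennreal ((norm (?D k t - ?ym t))\<^sup>2) * indicator {0..T} t \<partial>lborel)"
          by (rule nn_integral_two_two) measurable
        finally show "(\<integral>\<^sup>+t\<in>{0..T}. ennreal ((norm (simple_process (n k) (\<rho> k) (\<zeta> k) t \<omega>))\<^sup>2) \<partial>lborel) \<le>
          2 * (\<integral>\<^sup>+t\<in>{0..T}. ennreal ((norm (?H k t - y t \<omega> *\<^sub>R s))\<^sup>2) \<partial>lborel) + 2 * (\<integral>\<^sup>+t\<in>{0..T}. ennreal ((norm (?D k t - y t \<omega> *\<^sub>R s))\<^sup>2) \<partial>lborel)"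
          unfolding yeq .
      qed (use elim dyadic_process_converges[where y=y and \<omega>=\<omega>, OF c T] in auto)
    qed
  qed
  then have 3: "(\<lambda>k. expectation (\<lambda>\<omega>. min 1 ((simple_ito Z (m k) (\<tau> k) (\<xi> k) t \<omega> - simple_ito Z (2^k) (grid T k) (dyadic_int y T s k) t \<omega>)\<^sup>2))) \<longlonglongrightarrow> 0"
    unfolding R(3) .
  have 2: "AE \<omega> in M. (\<lambda>k. simple_ito Z (m k) (\<tau> k) (\<xi> k) t \<omega>) \<longlonglongrightarrow> I t \<omega>"
    using conv by eventually_elim (use t in \<open>auto intro: tendsto_uniform_limitI\<close>)
  show ?thesis by (rule that[OF s 2 3])
qed

end

lemma min_1_sq_tendsto_0:
  fixes a :: "nat => real"
  assumes "(\<lambda>k. min 1 ((a k)\<^sup>2)) \<longlonglongrightarrow> 0" shows "a \<longlonglongrightarrow> 0"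
proof -
  have "\<forall>\<^sub>F k in sequentially. min 1 ((a k)\<^sup>2) < 1" using assms by (rule order_tendstoD) simp
  then have "\<forall>\<^sub>F k in sequentially. min 1 ((a k)\<^sup>2) = (a k)\<^sup>2" by eventually_elim (simp add: min_def split: if_splits)
  then have "(\<lambda>k. (a k)\<^sup>2) \<longlonglongrightarrow> 0" using assms by (rule Lim_transform_eventually[rotated])
  then have "(\<lambda>k. sqrt ((a k)\<^sup>2)) \<longlonglongrightarrow> sqrt 0" by (rule tendsto_real_sqrt)
  then show ?thesis by (simp add: tendsto_rabs_zero_iff)
qed

lemma nn_integral_Icc_eq_Lint:
  assumes "set_integrable lborel {a..b} g" "\<And>s. 0 \<le> (g s :: real)"
  shows "(\<integral>\<^sup>+s. indicator {a..b} s * ennreal (g s) \<partial>lborel) = ennreal (Lint g a b)"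
proof -
  have "(\<integral>\<^sup>+s. indicator {a..b} s * ennreal (g s) \<partial>lborel) = (\<integral>\<^sup>+s. ennreal (indicator {a..b} s *\<^sub>R g s) \<partial>lborel)"
    by (intro nn_integral_cong) (simp add: indicator_def)
  also have "... = ennreal (Lint g a b)"
    unfolding set_lebesgue_integral_def
    by (rule nn_integral_eq_integral) (use assms in \<open>auto simp: set_integrable_def\<close>)
  finally show ?thesis .
qed

section \<open>Second moment estimates for uniqueness\<close>

context brownian
begin

lemma Lint_sq_measurable:
  assumes v: "\<And>s. s \<in> {0..T} ==> v s \<in> borel_measurable M" "continuous_paths_on M T v" and T: "T > 0" and t: "t \<in> {0..T}"
  shows "(\<lambda>\<omega>. Lint (\<lambda>s. (v s \<omega>)\<^sup>2) 0 t) \<in> borel_measurable M"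
proof (rule borel_measurable_LIMSEQ_real)
  show "(\<lambda>m. \<Sum>j<2^m. (v (grid T m j) \<omega>)\<^sup>2 * (min t (grid T m (Suc j)) - min t (grid T m j))) \<longlonglongrightarrow> Lint (\<lambda>s. (v s \<omega>)\<^sup>2) 0 t"
    if "\<omega> \<in> space M" for \<omega>
    using v(2) that by (intro Riemann_sums_converge T t continuous_intros) (simp add: continuous_paths_on_def)
  show "(\<lambda>\<omega>. \<Sum>j<2^m. (v (grid T m j) \<omega>)\<^sup>2 * (min t (grid T m (Suc j)) - min t (grid T m j))) \<in> borel_measurable M" for m
    using T by (intro borel_measurable_sum borel_measurable_times borel_measurable_power v(1) borel_measurable_const)
      (auto intro!: grid_nonneg grid_le_T)
qed

text \<open>The isometry is available for the dyadic integrals and is passed to the limit along an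
  almost surely convergent subsequence: by Fatou's lemma on the left and by dominated convergence
  with majorant \<open>T * g\<close> on the right.\<close>

lemma ito_diff_bound:
  assumes I1: "ito_integral M F Z T (\<lambda>t \<omega>. y1 t \<omega> *\<^sub>R s) I1" and y1: "adapted_on F T y1" "continuous_paths_on M T y1"
    and I2: "ito_integral M F Z T (\<lambda>t \<omega>. y2 t \<omega> *\<^sub>R s) I2" and y2: "adapted_on F T y2" "continuous_paths_on M T y2"
    and T: "T > 0" and t: "t \<in> {0..T}"
    and g: "integrable M g" "\<And>\<omega> u. \<omega> \<in> space M ==> u \<in> {0..T} ==> (y1 u \<omega> - y2 u \<omega>)\<^sup>2 \<le> g \<omega>"
  shows "(\<integral>\<^sup>+\<omega>. ennreal ((I1 t \<omega> - I2 t \<omega>)\<^sup>2) \<partial>M) \<le> ennreal ((norm s)\<^sup>2) * (\<integral>\<^sup>+\<omega>. ennreal (Lint (\<lambda>u. (y1 u \<omega> - y2 u \<omega>)\<^sup>2) 0 t) \<partial>M)"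
proof -
  define v where "v u \<omega> = y1 u \<omega> - y2 u \<omega>" for u \<omega>
  let ?D1 = "\<lambda>k. simple_ito Z (2^k) (grid T k) (dyadic_int y1 T s k) t"
  let ?D2 = "\<lambda>k. simple_ito Z (2^k) (grid T k) (dyadic_int y2 T s k) t"
  have t0: "0 \<le> t" using t by simp
  have ym: "y1 u \<in> borel_measurable M" "y2 u \<in> borel_measurable M" if "u \<in> {0..T}" for u
    using y1(1) y2(1) that by (auto simp: adapted_on_def intro: measurable_F_M)
  then have vm: "v u \<in> borel_measurable M" if "u \<in> {0..T}" for u unfolding v_def using that by auto
  have vc: "continuous_paths_on M T v" using y1(2) y2(2) unfolding continuous_paths_on_def v_def by (auto intro!: continuous_intros)
  obtain m1 \<tau>1 \<xi>1 where 1: "\<And>k. simple_integrand M F T (m1 k) (\<tau>1 k) (\<xi>1 k)"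
    "AE \<omega> in M. (\<lambda>k. simple_ito Z (m1 k) (\<tau>1 k) (\<xi>1 k) t \<omega>) \<longlonglongrightarrow> I1 t \<omega>"
    "(\<lambda>k. expectation (\<lambda>\<omega>. min 1 ((simple_ito Z (m1 k) (\<tau>1 k) (\<xi>1 k) t \<omega> - ?D1 k \<omega>)\<^sup>2))) \<longlonglongrightarrow> 0"
    by (rule ito_vs_dyadic[OF I1 y1 T t]) blast
  obtain m2 \<tau>2 \<xi>2 where 2: "\<And>k. simple_integrand M F T (m2 k) (\<tau>2 k) (\<xi>2 k)"
    "AE \<omega> in M. (\<lambda>k. simple_ito Z (m2 k) (\<tau>2 k) (\<xi>2 k) t \<omega>) \<longlonglongrightarrow> I2 t \<omega>"
    "(\<lambda>k. expectation (\<lambda>\<omega>. min 1 ((simple_ito Z (m2 k) (\<tau>2 k) (\<xi>2 k) t \<omega> - ?D2 k \<omega>)\<^sup>2))) \<longlonglongrightarrow> 0"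
    by (rule ito_vs_dyadic[OF I2 y2 T t]) blast
  let ?H1 = "\<lambda>k. simple_ito Z (m1 k) (\<tau>1 k) (\<xi>1 k) t" and ?H2 = "\<lambda>k. simple_ito Z (m2 k) (\<tau>2 k) (\<xi>2 k) t"
  note d1 = dyadic_simple[OF y1(1) T, of _ s] and d2 = dyadic_simple[OF y2(1) T, of _ s]
  have sm: "simple_ito Z n \<rho> \<zeta> t \<in> borel_measurable M" if "simple_integrand M F T n \<rho> \<zeta>" for n \<rho> \<zeta>
    by (rule measurable_F_M[OF simple_ito_isometry(3)[OF that t0 order_refl]])
  note [measurable] = sm[OF 1(1)] sm[OF 2(1)] sm[OF d1] sm[OF d2]
  \<comment> \<open>The two errors are added so that a single subsequence makes both tend to 0
    almost surely.\<close>
  define U where "U k \<omega> = min 1 ((?H1 k \<omega> - ?D1 k \<omega>)\<^sup>2) + min 1 ((?H2 k \<omega> - ?D2 k \<omega>)\<^sup>2)" for k \<omega>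
  have i1: "integrable M (\<lambda>\<omega>. min 1 ((?H1 k \<omega> - ?D1 k \<omega>)\<^sup>2))" and i2: "integrable M (\<lambda>\<omega>. min 1 ((?H2 k \<omega> - ?D2 k \<omega>)\<^sup>2))" for k
    by (rule integrable_const_bound[where B=1], auto)+
  have "\<exists>r::nat=>nat. strict_mono r \<and> (AE \<omega> in M. (\<lambda>k. U (r k) \<omega>) \<longlonglongrightarrow> 0)"
  proof (rule tendsto_L1_AE_subseq)
    show "integrable M (U k)" for k unfolding U_def using i1 i2 by simp
    have "(\<lambda>k. expectation (\<lambda>\<omega>. min 1 ((?H1 k \<omega> - ?D1 k \<omega>)\<^sup>2)) + expectation (\<lambda>\<omega>. min 1 ((?H2 k \<omega> - ?D2 k \<omega>)\<^sup>2))) \<longlonglongrightarrow> 0 + 0"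
      by (intro tendsto_add 1(3) 2(3))
    moreover have "expectation (\<lambda>\<omega>. norm (U k \<omega>)) = expectation (\<lambda>\<omega>. min 1 ((?H1 k \<omega> - ?D1 k \<omega>)\<^sup>2)) + expectation (\<lambda>\<omega>. min 1 ((?H2 k \<omega> - ?D2 k \<omega>)\<^sup>2))" for k
    proof -
      have "norm (U k \<omega>) = U k \<omega>" for \<omega> by (simp add: U_def)
      then show ?thesis using i1[of k] i2[of k] by (simp only: U_def Bochner_Integration.integral_add)
    qed
    ultimately show "(\<lambda>k. expectation (\<lambda>\<omega>. norm (U k \<omega>))) \<longlonglongrightarrow> 0" by (simp only: add_0)
  qed
  then obtain r where r: "strict_mono r" "AE \<omega> in M. (\<lambda>k. U (r k) \<omega>) \<longlonglongrightarrow> 0" by blast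
  define X where "X k \<omega> = ?D1 (r k) \<omega> - ?D2 (r k) \<omega>" for k \<omega>
  have Xlim: "AE \<omega> in M. (\<lambda>k. X k \<omega>) \<longlonglongrightarrow> I1 t \<omega> - I2 t \<omega>"
    using r(2) 1(2) 2(2)
  proof eventually_elim
    case (elim \<omega>)
    have a: "(\<lambda>k. min 1 ((?H1 (r k) \<omega> - ?D1 (r k) \<omega>)\<^sup>2)) \<longlonglongrightarrow> 0" "(\<lambda>k. min 1 ((?H2 (r k) \<omega> - ?D2 (r k) \<omega>)\<^sup>2)) \<longlonglongrightarrow> 0"
      by (rule tendsto_sandwich[OF _ _ tendsto_const elim(1)], simp_all add: U_def)+
    have "(\<lambda>k. (?H1 (r k) \<omega> - (?H1 (r k) \<omega> - ?D1 (r k) \<omega>)) - (?H2 (r k) \<omega> - (?H2 (r k) \<omega> - ?D2 (r k) \<omega>))) \<longlonglongrightarrow> (I1 t \<omega> - 0) - (I2 t \<omega> - 0)"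
      using LIMSEQ_subseq_LIMSEQ[OF elim(2) r(1)] LIMSEQ_subseq_LIMSEQ[OF elim(3) r(1)] min_1_sq_tendsto_0[OF a(1)] min_1_sq_tendsto_0[OF a(2)]
      by (intro tendsto_diff) (simp_all add: comp_def)
    then show ?case by (simp add: X_def)
  qed
  define S where "S m \<omega> = (\<Sum>j<2^m. (v (grid T m j) \<omega>)\<^sup>2 * (min t (grid T m (Suc j)) - min t (grid T m j)))" for m \<omega>
  have gT: "grid T m j \<in> {0..T}" if "j < 2^m" for m j using that T by (auto intro!: grid_nonneg grid_le_T)
  have S0: "0 \<le> S m \<omega>" for m \<omega> unfolding S_def using min_grid_bounds(4)[OF T t] by (intro sum_nonneg mult_nonneg_nonneg) auto
  have Sm[measurable]: "S m \<in> borel_measurable M" for m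
    unfolding S_def[abs_def] using gT by (intro borel_measurable_sum borel_measurable_times borel_measurable_power vm borel_measurable_const) auto
  have SG: "S m \<omega> \<le> T * g \<omega>" if w: "\<omega> \<in> space M" for m \<omega>
  proof -
    have g0: "0 \<le> g \<omega>" using g(2)[OF w, of 0] T order_trans[OF zero_le_power2] by fastforce
    have "S m \<omega> \<le> (\<Sum>j<2^m. g \<omega> * (min t (grid T m (Suc j)) - min t (grid T m j)))"
      unfolding S_def using gT g(2)[OF w] min_grid_bounds(4)[OF T t] by (intro sum_mono mult_right_mono) (auto simp: v_def)
    also have "... = g \<omega> * t" using sum_telescope_min[OF T t, of "\<lambda>x. x" m] by (simp add: sum_distrib_left[symmetric])
    also have "... \<le> T * g \<omega>" using mult_right_mono[of t T "g \<omega>"] t g0 by (simp add: mult.commute)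
    finally show ?thesis .
  qed
  have Slim: "(\<lambda>m. \<integral>\<^sup>+\<omega>. ennreal (S m \<omega>) \<partial>M) \<longlonglongrightarrow> (\<integral>\<^sup>+\<omega>. ennreal (Lint (\<lambda>u. (v u \<omega>)\<^sup>2) 0 t) \<partial>M)"
  proof (rule nn_integral_dominated_convergence[where w="\<lambda>\<omega>. ennreal (T * g \<omega>)"])
    show "(\<lambda>\<omega>. ennreal (Lint (\<lambda>u. (v u \<omega>)\<^sup>2) 0 t)) \<in> borel_measurable M"
      using Lint_sq_measurable[OF vm vc T t] by measurable
    show "AE \<omega> in M. ennreal (S j \<omega>) \<le> ennreal (T * g \<omega>)" for j using SG by (intro AE_I2 ennreal_leI)
    show "(\<integral>\<^sup>+\<omega>. ennreal (T * g \<omega>) \<partial>M) < \<infinity>"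
    proof -
      have "integrable M (\<lambda>\<omega>. T * g \<omega>)" using g(1) by simp
      then have "(\<integral>\<^sup>+\<omega>. ennreal (norm (T * g \<omega>)) \<partial>M) < \<infinity>" by (rule integrable_iff_bounded[THEN iffD1, THEN conjunct2])
      moreover have "(\<integral>\<^sup>+\<omega>. ennreal (T * g \<omega>) \<partial>M) \<le> (\<integral>\<^sup>+\<omega>. ennreal (norm (T * g \<omega>)) \<partial>M)"
        by (intro nn_integral_mono ennreal_leI) simp
      ultimately show ?thesis by (rule order_le_less_trans[rotated])
    qed
    show "AE \<omega> in M. (\<lambda>m. ennreal (S m \<omega>)) \<longlonglongrightarrow> ennreal (Lint (\<lambda>u. (v u \<omega>)\<^sup>2) 0 t)"
      unfolding S_def using vc
      by (intro AE_I2 tendsto_ennrealI Riemann_sums_converge T t continuous_intros) (simp add: continuous_paths_on_def)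
  qed (use g(1) in auto)
  have XE: "(\<integral>\<^sup>+\<omega>. ennreal ((X k \<omega>)\<^sup>2) \<partial>M) \<le> ennreal ((norm s)\<^sup>2) * (\<integral>\<^sup>+\<omega>. ennreal (S (r k) \<omega>) \<partial>M)" for k
  proof -
    let ?n = "(2::nat)^(r k)" and ?\<rho> = "grid T (r k)"
    let ?z = "\<lambda>j \<omega>. dyadic_int y1 T s (r k) j \<omega> - dyadic_int y2 T s (r k) j \<omega>"
    note df = simple_integrand_diff[OF d1[of "r k"] d2[of "r k"]]
    note iso = simple_ito_isometry[OF df(1) t0]
    have X: "X k \<omega> = simple_ito Z ?n ?\<rho> ?z t \<omega>" for \<omega> by (simp only: X_def df(3))
    have "(\<integral>\<^sup>+\<omega>. ennreal ((X k \<omega>)\<^sup>2) \<partial>M) = ennreal (expectation (\<lambda>\<omega>. (X k \<omega>)\<^sup>2))"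
      unfolding X by (rule nn_integral_eq_integral[OF iso(1)]) simp
    also have "... = ennreal (expectation (\<lambda>\<omega>. \<Sum>j<?n. (norm (?z j \<omega>))\<^sup>2 * (min t (?\<rho> (Suc j)) - min t (?\<rho> j))))"
      unfolding X iso(2) ..
    also have "... \<le> (\<integral>\<^sup>+\<omega>. ennreal (\<Sum>j<?n. (norm (?z j \<omega>))\<^sup>2 * (min t (?\<rho> (Suc j)) - min t (?\<rho> j))) \<partial>M)"
    \<comment> \<open>In the other case the Bochner integral is 0 by default.\<close>
    proof (cases "integrable M (\<lambda>\<omega>. \<Sum>j<?n. (norm (?z j \<omega>))\<^sup>2 * (min t (?\<rho> (Suc j)) - min t (?\<rho> j)))")
      case True
      then show ?thesis using min_grid_bounds(4)[OF T t]
        by (subst nn_integral_eq_integral) (auto intro!: AE_I2 sum_nonneg mult_nonneg_nonneg)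
    qed (simp add: not_integrable_integral_eq)
    also have "... \<le> (\<integral>\<^sup>+\<omega>. ennreal ((norm s)\<^sup>2) * ennreal (S (r k) \<omega>) \<partial>M)"
    proof (rule nn_integral_mono)
      fix \<omega>
      have "(\<Sum>j<?n. (norm (?z j \<omega>))\<^sup>2 * (min t (?\<rho> (Suc j)) - min t (?\<rho> j))) \<le> (\<Sum>j<?n. ((norm s)\<^sup>2 * (v (?\<rho> j) \<omega>)\<^sup>2) * (min t (?\<rho> (Suc j)) - min t (?\<rho> j)))"
      proof (intro sum_mono mult_right_mono min_grid_bounds(4)[OF T t])
        fix j
        have "norm (?z j \<omega>) = \<bar>clip (real (r k)) (y1 (?\<rho> j) \<omega>) - clip (real (r k)) (y2 (?\<rho> j) \<omega>)\<bar> * norm s"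
          by (simp add: dyadic_int_def scaleR_left_diff_distrib[symmetric])
        also have "... \<le> \<bar>v (?\<rho> j) \<omega>\<bar> * norm s" unfolding v_def by (intro mult_right_mono clip_diff) auto
        finally have "(norm (?z j \<omega>))\<^sup>2 \<le> (\<bar>v (?\<rho> j) \<omega>\<bar> * norm s)\<^sup>2" by (intro power_mono) auto
        then show "(norm (?z j \<omega>))\<^sup>2 \<le> (norm s)\<^sup>2 * (v (?\<rho> j) \<omega>)\<^sup>2" by (simp add: power_mult_distrib mult.commute)
      qed
      also have "... = (norm s)\<^sup>2 * S (r k) \<omega>" by (simp add: S_def sum_distrib_left mult.assoc)
      finally show "ennreal (\<Sum>j<?n. (norm (?z j \<omega>))\<^sup>2 * (min t (?\<rho> (Suc j)) - min t (?\<rho> j))) \<le> ennreal ((norm s)\<^sup>2) * ennreal (S (r k) \<omega>)"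
        using S0 by (simp add: ennreal_mult[symmetric] ennreal_leI)
    qed
    also have "... = ennreal ((norm s)\<^sup>2) * (\<integral>\<^sup>+\<omega>. ennreal (S (r k) \<omega>) \<partial>M)" by (rule nn_integral_cmult) measurable
    finally show ?thesis .
  qed
  have Xm[measurable]: "X k \<in> borel_measurable M" for k unfolding X_def by measurable
  have "(\<integral>\<^sup>+\<omega>. ennreal ((I1 t \<omega> - I2 t \<omega>)\<^sup>2) \<partial>M) = (\<integral>\<^sup>+\<omega>. liminf (\<lambda>k. ennreal ((X k \<omega>)\<^sup>2)) \<partial>M)"
  proof (rule nn_integral_cong_AE, use Xlim in eventually_elim)
    case (elim \<omega>)
    then have "(\<lambda>k. ennreal ((X k \<omega>)\<^sup>2)) \<longlonglongrightarrow> ennreal ((I1 t \<omega> - I2 t \<omega>)\<^sup>2)" by (intro tendsto_ennrealI tendsto_intros)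
    then show ?case by (rule lim_imp_Liminf[OF trivial_limit_sequentially, symmetric])
  qed
  also have "... \<le> liminf (\<lambda>k. \<integral>\<^sup>+\<omega>. ennreal ((X k \<omega>)\<^sup>2) \<partial>M)" by (rule nn_integral_liminf) measurable
  also have "... \<le> liminf (\<lambda>k. ennreal ((norm s)\<^sup>2) * (\<integral>\<^sup>+\<omega>. ennreal (S (r k) \<omega>) \<partial>M))"
    by (rule Liminf_mono) (use XE in simp)
  also have "... = ennreal ((norm s)\<^sup>2) * (\<integral>\<^sup>+\<omega>. ennreal (Lint (\<lambda>u. (v u \<omega>)\<^sup>2) 0 t) \<partial>M)"
    by (rule lim_imp_Liminf[OF trivial_limit_sequentially], rule ennreal_tendsto_cmult)
       (use LIMSEQ_subseq_LIMSEQ[OF Slim r(1)] in \<open>simp_all add: comp_def\<close>)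
  finally show ?thesis by (simp only: v_def)
qed

text \<open>Fubini's theorem turns the hypothesis into an integral inequality for the second moment
  as a function of time, and iterating it forces this function to be 0. The common null set is found
  at the dyadic times and extended by continuity.\<close>

lemma second_moment_Gronwall:
  assumes v: "\<And>s. s \<in> {0..T} ==> v s \<in> borel_measurable M" "continuous_paths_on M T v" and T: "T > 0"
    and C: "C \<ge> 0" and Bd: "\<And>t. t \<in> {0..T} ==> (\<integral>\<^sup>+\<omega>. ennreal ((v t \<omega>)\<^sup>2) \<partial>M) \<le> ennreal Bd" "Bd \<ge> 0"
    and ineq: "\<And>t. t \<in> {0..T} ==> (\<integral>\<^sup>+\<omega>. ennreal ((v t \<omega>)\<^sup>2) \<partial>M) \<le> ennreal C * (\<integral>\<^sup>+\<omega>. ennreal (Lint (\<lambda>s. (v s \<omega>)\<^sup>2) 0 t) \<partial>M)"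
  shows "AE \<omega> in M. \<forall>t\<in>{0..T}. v t \<omega> = 0"
proof -
  define h where "h t = (\<integral>\<^sup>+\<omega>. ennreal ((v t \<omega>)\<^sup>2) \<partial>M)" for t
  have vc: "continuous_on {0..T} (\<lambda>t. v t \<omega>)" if "\<omega> \<in> space M" for \<omega> using v(2) that by (simp add: continuous_paths_on_def)
  have "(\<lambda>(s, \<omega>). v s \<omega>) \<in> borel_measurable (restrict_space borel {0..T} \<Otimes>\<^sub>M M)"
    using T by (intro continuous_process_jointly_measurable v(1) vc) auto
  \<comment> \<open>Clamping time to [0,T] gives a process over all of \<open>lborel\<close>, as
    Fubini's theorem wants it.\<close>
  define V where "V s \<omega> = v (max 0 (min T s)) \<omega>" for s \<omega>
  have clampT: "max 0 (min T s) \<in> {0..T}" for s using T by auto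
  have V_meas: "(\<lambda>(s, \<omega>). V s \<omega>) \<in> borel_measurable (lborel \<Otimes>\<^sub>M M)"
  proof -
    have "(\<lambda>p. (max 0 (min T (fst p)), snd p)) \<in> measurable (lborel \<Otimes>\<^sub>M M) (restrict_space borel {0..T} \<Otimes>\<^sub>M M)"
      by (intro measurable_Pair measurable_restrict_space2) (use clampT in auto)
    from measurable_compose[OF this \<open>(\<lambda>(s, \<omega>). v s \<omega>) \<in> _\<close>] show ?thesis by (simp add: V_def case_prod_beta)
  qed
  have swap: "(\<integral>\<^sup>+\<omega>. ennreal (Lint (\<lambda>s. (v s \<omega>)\<^sup>2) 0 t) \<partial>M) = (\<integral>\<^sup>+s. indicator {0..t} s * h s \<partial>lborel)" if t: "t \<in> {0..T}" for t
  proof -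
    have "(\<integral>\<^sup>+\<omega>. ennreal (Lint (\<lambda>s. (v s \<omega>)\<^sup>2) 0 t) \<partial>M) = (\<integral>\<^sup>+\<omega>. \<integral>\<^sup>+s. indicator {0..t} s * ennreal ((V s \<omega>)\<^sup>2) \<partial>lborel \<partial>M)"
    proof (rule nn_integral_cong)
      fix \<omega> assume "\<omega> \<in> space M"
      have "set_integrable lborel {0..T} (\<lambda>s. (v s \<omega>)\<^sup>2)" using vc[OF \<open>\<omega> \<in> space M\<close>] by (intro borel_integrable_atLeastAtMost' continuous_intros)
      then have "set_integrable lborel {0..t} (\<lambda>s. (v s \<omega>)\<^sup>2)" using t by (auto intro: set_integrable_sub)
      from nn_integral_Icc_eq_Lint[OF this] have "ennreal (Lint (\<lambda>s. (v s \<omega>)\<^sup>2) 0 t) = (\<integral>\<^sup>+s. indicator {0..t} s * ennreal ((v s \<omega>)\<^sup>2) \<partial>lborel)" by simp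
      also have "... = (\<integral>\<^sup>+s. indicator {0..t} s * ennreal ((V s \<omega>)\<^sup>2) \<partial>lborel)"
        using t by (intro nn_integral_cong) (auto simp: V_def indicator_def)
      finally show "ennreal (Lint (\<lambda>s. (v s \<omega>)\<^sup>2) 0 t) = (\<integral>\<^sup>+s. indicator {0..t} s * ennreal ((V s \<omega>)\<^sup>2) \<partial>lborel)" .
    qed
    also have "... = (\<integral>\<^sup>+s. \<integral>\<^sup>+\<omega>. indicator {0..t} s * ennreal ((V s \<omega>)\<^sup>2) \<partial>M \<partial>lborel)"
    proof -
      interpret pair_sigma_finite lborel M ..
      have "(\<lambda>(s, \<omega>). indicator {0..t} s * ennreal ((V s \<omega>)\<^sup>2)) \<in> borel_measurable (lborel \<Otimes>\<^sub>M M)"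
      proof -
        have [measurable]: "(\<lambda>p. V (fst p) (snd p)) \<in> borel_measurable (lborel \<Otimes>\<^sub>M M)" using V_meas by (simp add: case_prod_beta)
        show ?thesis unfolding case_prod_beta by measurable
      qed
      from Fubini'[OF this] show ?thesis by simp
    qed
    also have "... = (\<integral>\<^sup>+s. indicator {0..t} s * h s \<partial>lborel)"
    proof (rule nn_integral_cong)
      fix s :: real
      have [measurable]: "V s \<in> borel_measurable M" unfolding V_def by (rule v(1)[OF clampT])
      show "(\<integral>\<^sup>+\<omega>. indicator {0..t} s * ennreal ((V s \<omega>)\<^sup>2) \<partial>M) = indicator {0..t} s * h s"
      proof -
        have "(\<lambda>\<omega>. ennreal ((V s \<omega>)\<^sup>2)) \<in> borel_measurable M" by measurable
        then have "(\<integral>\<^sup>+\<omega>. indicator {0..t} s * ennreal ((V s \<omega>)\<^sup>2) \<partial>M) = indicator {0..t} s * (\<integral>\<^sup>+\<omega>. ennreal ((V s \<omega>)\<^sup>2) \<partial>M)"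
          by (rule nn_integral_cmult)
        then show ?thesis using t by (auto simp: h_def V_def indicator_def)
      qed
    qed
    finally show ?thesis .
  qed
  \<comment> \<open>As in the Picard iteration: with the weight \<open>exp (l * t)\<close> each
    application of the inequality gains a factor 1/2.\<close>
  define l where "l = 2 * C + 1"
  have l: "l > 0" "C / l \<le> 1/2" using C by (auto simp: l_def field_simps)
  have iter: "h t \<le> ennreal (Bd * (1/2)^n * exp (l * t))" if "t \<in> {0..T}" for n t
    using that
  proof (induction n arbitrary: t)
    case 0
    have "Bd * 1 \<le> Bd * exp (l * t)" using Bd(2) l 0 by (intro mult_left_mono) auto
    then show ?case using Bd(1)[OF 0] unfolding h_def[symmetric] by (auto intro: order_trans ennreal_leI)
  next
    case (Suc n)
    have "h t \<le> ennreal C * (\<integral>\<^sup>+s. indicator {0..t} s * h s \<partial>lborel)"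
      using ineq[OF Suc.prems] unfolding swap[OF Suc.prems] h_def[symmetric] .
    also have "... \<le> ennreal C * (\<integral>\<^sup>+s. indicator {0..t} s * ennreal (Bd * (1/2)^n * exp (l * s)) \<partial>lborel)"
    proof (rule mult_left_mono, rule nn_integral_mono)
      fix s show "indicator {0..t} s * h s \<le> indicator {0..t} s * ennreal (Bd * (1/2)^n * exp (l * s))"
        using Suc.IH[of s] Suc.prems by (auto simp: indicator_def)
    qed simp
    also have "... = ennreal (C * Lint (\<lambda>s. Bd * (1/2)^n * exp (l * s)) 0 t)"
      using C Bd(2) by (subst nn_integral_Icc_eq_Lint[OF set_integrable_exp]) (auto simp: ennreal_mult Lint_nonneg)
    also have "... \<le> ennreal (Bd * (1/2)^Suc n * exp (l * t))"
    proof (rule ennreal_leI)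
      have "C * Lint (\<lambda>s. Bd * (1/2)^n * exp (l * s)) 0 t \<le> C * (Bd * (1/2)^n * exp (l * t) / l)"
        using Suc.prems l Bd(2) C by (intro mult_left_mono Lint_exp_le) auto
      also have "... = (C / l) * (Bd * (1/2)^n * exp (l * t))" by simp
      also have "... \<le> (1/2) * (Bd * (1/2)^n * exp (l * t))" using l(2) Bd(2) by (intro mult_right_mono) auto
      finally show "C * Lint (\<lambda>s. Bd * (1/2)^n * exp (l * s)) 0 t \<le> Bd * (1/2)^Suc n * exp (l * t)" by simp
    qed
    finally show ?case .
  qed
  have zero: "AE \<omega> in M. v t \<omega> = 0" if t: "t \<in> {0..T}" for t
  proof -
    have "(\<lambda>n. Bd * exp (l * t) * (1/2)^n) \<longlonglongrightarrow> 0" by (intro tendsto_mult_right_zero LIMSEQ_power_zero) simp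
    then have "(\<lambda>n. Bd * (1/2)^n * exp (l * t)) \<longlonglongrightarrow> 0" by (simp add: mult_ac)
    from tendsto_ennrealI[OF this] have "(\<lambda>n. ennreal (Bd * (1/2)^n * exp (l * t))) \<longlonglongrightarrow> 0" by simp
    then have "h t \<le> 0" by (rule LIMSEQ_le_const) (use iter[OF t] in auto)
    then have "(\<integral>\<^sup>+\<omega>. ennreal ((v t \<omega>)\<^sup>2) \<partial>M) = 0" by (simp add: h_def)
    then have "AE \<omega> in M. ennreal ((v t \<omega>)\<^sup>2) = 0" using v(1)[OF t] by (subst (asm) nn_integral_0_iff_AE) auto
    then show ?thesis by eventually_elim simp
  qed
  have "AE \<omega> in M. \<forall>m j. j < 2^m \<longrightarrow> v (grid T m j) \<omega> = 0"
    unfolding AE_all_countable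
  proof (intro allI)
    fix m j :: nat
    show "AE \<omega> in M. j < 2^m \<longrightarrow> v (grid T m j) \<omega> = 0"
    proof (cases "j < 2^m")
      case True
      then have "grid T m j \<in> {0..T}" using T by (auto intro!: grid_nonneg grid_le_T)
      from zero[OF this] show ?thesis by simp
    qed simp
  qed
  then show ?thesis
    using AE_space
  proof eventually_elim
    case (elim \<omega>)
    show ?case
    proof (rule ballI, rule ccontr)
      fix t assume t: "t \<in> {0..T}" and "v t \<omega> \<noteq> 0"
      then have pos: "\<bar>v t \<omega>\<bar> > 0" by simp
      obtain k where k: "\<forall>s\<in>{0..T}. \<forall>u\<in>{0..T}. \<bar>s - u\<bar> \<le> T / 2^k \<longrightarrow> \<bar>v s \<omega> - v u \<omega>\<bar> < \<bar>v t \<omega>\<bar>"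
        using eventually_happens[OF eventually_uniform_grid[OF vc[OF elim(2)] T pos]] by auto
      obtain j where j: "j < 2^k" "\<bar>grid T k j - t\<bar> \<le> T / 2^k" using ex_near_grid[OF T t] by blast
      have "grid T k j \<in> {0..T}" using j(1) T by (auto intro!: grid_nonneg grid_le_T)
      then have "\<bar>v (grid T k j) \<omega> - v t \<omega>\<bar> < \<bar>v t \<omega>\<bar>" using k t j(2) by blast
      then show False using elim(1) j(1) by simp
    qed
  qed
qed

end

lemma L2_imp_L1:
  assumes f: "f \<in> L2_space {a..b}" and ab: "a \<le> b" and q: "N2 {a..b} f \<le> ennreal q" "q \<ge> 0"
  shows "set_integrable lborel {a..b} f" "(Lint (\<lambda>s. \<bar>f s\<bar>) a b)\<^sup>2 \<le> (b - a) * q"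
proof -
  have m[measurable]: "(\<lambda>x. indicator {a..b} x * f x) \<in> borel_measurable borel" using f by (simp add: L2_space_iff sbm_iff)
  let ?F = "\<lambda>x. ennreal \<bar>indicator {a..b} x * f x\<bar>"
  have "(\<integral>\<^sup>+x. ?F x * indicator {a..b} x \<partial>lborel)\<^sup>2 \<le> (\<integral>\<^sup>+x. ?F x ^ 2 \<partial>lborel) * (\<integral>\<^sup>+x. indicator {a..b} x ^ 2 \<partial>lborel)"
    by (rule Cauchy_Schwarz_nn_integral) measurable
  also have "(\<integral>\<^sup>+x. ?F x ^ 2 \<partial>lborel) = N2 {a..b} f"
    unfolding N2_def by (intro nn_integral_cong) (simp add: ennreal_power)
  also have "(\<integral>\<^sup>+x. indicator {a..b} x ^ 2 \<partial>lborel) = (\<integral>\<^sup>+x. indicator {a..b} x \<partial>(lborel::real measure))"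
    by (intro nn_integral_cong) (simp add: indicator_def)
  also have "... = ennreal (b - a)" using ab by simp
  also have "(\<integral>\<^sup>+x. ?F x * indicator {a..b} x \<partial>lborel) = (\<integral>\<^sup>+x. ?F x \<partial>lborel)"
    by (intro nn_integral_cong) (simp add: indicator_def)
  finally have "(\<integral>\<^sup>+x. ?F x \<partial>lborel)\<^sup>2 \<le> N2 {a..b} f * ennreal (b - a)" .
  also have "... \<le> ennreal q * ennreal (b - a)" by (intro mult_right_mono q) auto
  also have "... = ennreal ((b - a) * q)" using ab q(2) by (simp add: ennreal_mult[symmetric] mult.commute)
  finally have sq: "(\<integral>\<^sup>+x. ?F x \<partial>lborel)\<^sup>2 \<le> ennreal ((b - a) * q)" .
  then have "(\<integral>\<^sup>+x. ?F x \<partial>lborel) \<noteq> \<infinity>"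
    by (auto simp: power2_eq_square ennreal_top_mult top_unique)
  then have "integrable lborel (\<lambda>x. indicator {a..b} x * f x)"
    by (simp add: integrable_iff_bounded top.not_eq_extremum)
  then show si: "set_integrable lborel {a..b} f" by (simp add: set_integrable_def)
  have si': "set_integrable lborel {a..b} (\<lambda>s. \<bar>f s\<bar>)" by (rule set_integrable_abs[OF si])
  have "(\<integral>\<^sup>+x. ?F x \<partial>lborel) = ennreal (Lint (\<lambda>s. \<bar>f s\<bar>) a b)"
    by (subst nn_integral_Icc_eq_Lint[OF si', symmetric]) (auto intro!: nn_integral_cong simp: indicator_def)
  then have "ennreal ((Lint (\<lambda>s. \<bar>f s\<bar>) a b)\<^sup>2) \<le> ennreal ((b - a) * q)"
    using sq Lint_nonneg[of "\<lambda>s. \<bar>f s\<bar>" a b] by (simp add: ennreal_power)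
  then show "(Lint (\<lambda>s. \<bar>f s\<bar>) a b)\<^sup>2 \<le> (b - a) * q" using ab q(2) by (subst (asm) ennreal_le_iff) auto
qed

section \<open>The delay equation driven by a Brownian motion\<close>

definition xbar :: "real \<times> (real => real) => real => real" where
  "xbar x = extend_past (snd x) (\<lambda>_. fst x)"

lemma extend_past_L2:
  assumes x1: "x1 \<in> L2_space {-d..<0}" and y: "continuous_on {0..T} y" and d: "d > 0" "T > 0"
  shows "extend_past x1 y \<in> L2_space {-d..T}" "N2 {-d..T} (extend_past x1 y) = N2 {-d..<0} x1 + N2 {0..T} y"
proof -
  have [measurable]: "(\<lambda>s. indicator {-d..<0} s * x1 s) \<in> borel_measurable borel" "(\<lambda>s. indicator {0..T} s * y s) \<in> borel_measurable borel"
    using x1 sbm_continuous[OF _ y] by (auto simp: L2_space_iff sbm_iff)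
  have eq: "indicator {-d..T} s * extend_past x1 y s = indicator {-d..<0} s * x1 s + indicator {0..T} s * y s" for s
    using d by (simp add: extend_past_def indicator_def)
  have sb: "sbm {-d..T} (extend_past x1 y)" unfolding sbm_iff eq by measurable
  have "N2 {-d..T} (extend_past x1 y) = (\<integral>\<^sup>+s. ennreal ((indicator {-d..<0} s * x1 s)\<^sup>2) + ennreal ((indicator {0..T} s * y s)\<^sup>2) \<partial>lborel)"
    unfolding N2_def eq by (intro nn_integral_cong) (auto simp: indicator_def)
  also have "... = N2 {-d..<0} x1 + N2 {0..T} y" unfolding N2_def by (rule nn_integral_add) measurable
  finally show n: "N2 {-d..T} (extend_past x1 y) = N2 {-d..<0} x1 + N2 {0..T} y" .
  show "extend_past x1 y \<in> L2_space {-d..T}"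
    using sb x1 L2_space_continuous[OF y] n by (simp add: L2_space_iff)
qed

lemma xbar_L2:
  assumes x: "x \<in> M2_space d" and d: "d > 0" "T > 0"
  shows "xbar x \<in> L2_space {-d..T}" "N2 {-d..T} (xbar x) \<le> ennreal ((1 + T) * (M2_norm d x)\<^sup>2)"
proof -
  have x1: "snd x \<in> L2_space {-d..<0}" using x by (auto simp: M2_space_def)
  have c: "continuous_on {0..T} (\<lambda>_. fst x)" by simp
  show "xbar x \<in> L2_space {-d..T}" unfolding xbar_def by (rule extend_past_L2(1)[OF x1 c d])
  define a where "a = (L2_norm {-d..<0} (snd x))\<^sup>2"
  have "N2 {-d..T} (xbar x) = ennreal a + N2 {0..T} (\<lambda>_. fst x)"
    unfolding xbar_def a_def by (simp only: extend_past_L2(2)[OF x1 c d] L2_norm_sq[OF x1])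
  also have "... \<le> ennreal a + ennreal (\<bar>fst x\<bar>\<^sup>2 * (T - 0))" using d by (intro add_left_mono N2_bounded) auto
  also have "... = ennreal (a + (fst x)\<^sup>2 * T)" using d by (subst ennreal_plus[symmetric]) (auto simp: a_def)
  also have "... \<le> ennreal ((1 + T) * ((fst x)\<^sup>2 + a))"
    using d by (intro ennreal_leI) (auto simp: algebra_simps a_def)
  also have "(fst x)\<^sup>2 + a = (M2_norm d x)\<^sup>2" by (simp add: M2_norm_def a_def)
  finally show "N2 {-d..T} (xbar x) \<le> ennreal ((1 + T) * (M2_norm d x)\<^sup>2)" .
qed

text \<open>The regularized setting: all path properties hold at every sample point, while
  \<open>B\<close> agrees with the driving process only almost surely. Every path can then be
  handled by the deterministic theory.\<close>

locale delayed_sde = brownian M Z for M :: "'a measure" and Z :: "real => 'a => real^'n" +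
  fixes d T c cL \<mu> :: real and \<sigma> :: "real^'n" and \<kappa> :: "real => 'a => real set => real" and B :: "real => 'a => real"
  assumes kernel: "\<And>\<omega>. \<omega> \<in> space M ==> delay_kernel d T c cL (\<lambda>t. \<kappa> t \<omega>)"
    and \<kappa>_prog: "\<And>A t. A \<in> sets borel ==> A \<subseteq> {-d..<0} ==> t \<in> {0..T} ==>
      (\<lambda>(s, \<omega>). \<kappa> s \<omega> A) \<in> borel_measurable (restrict_space borel {0..t} \<Otimes>\<^sub>M F t)"
    and B_adapted: "\<And>t. t \<in> {0..T} ==> B t \<in> borel_measurable (F t)"
    and B_cont: "\<And>\<omega>. \<omega> \<in> space M ==> continuous_on {0..T} (\<lambda>t. B t \<omega>)"
    and B_0: "\<And>\<omega>. \<omega> \<in> space M ==> B 0 \<omega> = 0"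
    and B_Z: "AE \<omega> in M. \<forall>t\<in>{0..T}. B t \<omega> = \<sigma> \<bullet> Z t \<omega>"
begin

definition E :: "real => 'a => real" where "E t \<omega> = exp (B t \<omega> - (norm \<sigma>)\<^sup>2 * t / 2)"

lemma pathwise: "\<omega> \<in> space M ==> pathwise_equation d T c cL (\<lambda>t. \<kappa> t \<omega>) (\<lambda>t. E t \<omega>)"
  unfolding pathwise_equation_def pathwise_equation_axioms_def E_def
  using kernel B_cont B_0 by (auto intro!: continuous_intros)

lemma d_pos: "d > 0" and T_pos: "T > 0" and c_nonneg: "c \<ge> 0"
proof -
  obtain \<omega> where "\<omega> \<in> space M" using not_empty by blast
  then interpret delay_kernel d T c cL "\<lambda>t. \<kappa> t \<omega>" by (rule kernel)
  show "d > 0" "T > 0" "c \<ge> 0" by (rule d T c0)+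
qed

abbreviation "Ker \<omega> \<equiv> (\<lambda>t. \<kappa> t \<omega>)"
abbreviation "Drift \<omega> \<equiv> pathwise_equation.drift d (Ker \<omega>) \<mu>"
abbreviation "Iter \<omega> \<equiv> pathwise_equation.iter d (Ker \<omega>) \<mu> (\<lambda>t. E t \<omega>)"

text \<open>What the datum alone contributes to the drift, that is, the drift of the equation along
  \<open>xbar x\<close>.\<close>

definition forcing :: "real \<times> (real => real) => 'a => real => real" where
  "forcing x \<omega> s = \<mu> * fst x + delay_ext d T (Ker \<omega>) (xbar x) s"

definition W :: "real \<times> (real => real) => real => 'a => real" where
  "W x t \<omega> = pathwise_equation.sol d (Ker \<omega>) \<mu> (\<lambda>t. E t \<omega>) (fst x) (forcing x \<omega>) t"

definition Y :: "real \<times> (real => real) => real => 'a => real" where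
  "Y x t \<omega> = fst x + W x t \<omega>"

lemma const_integrable: "set_integrable lborel {a..b :: real} (\<lambda>_. C :: real)"
  using set_integrable_exp[of a b C 0] by simp

lemma delay_ext_xbar:
  assumes x: "x \<in> M2_space d" and \<omega>: "\<omega> \<in> space M"
  shows "set_integrable lborel {0..T} (delay_ext d T (Ker \<omega>) (xbar x))"
    "(Lint (\<lambda>s. \<bar>delay_ext d T (Ker \<omega>) (xbar x) s\<bar>) 0 T)\<^sup>2 \<le> T * (4 * cL\<^sup>2 * ((1 + T) * (M2_norm d x)\<^sup>2))"
proof -
  interpret delay_kernel d T c cL "Ker \<omega>" by (rule kernel[OF \<omega>])
  note xb = xbar_L2[OF x d T]
  have "N2 {0..T} (Lx (xbar x)) \<le> ennreal (4 * cL\<^sup>2) * N2 {-d..T} (xbar x)" by (rule Lx_N2[OF xb(1)])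
  also have "... \<le> ennreal (4 * cL\<^sup>2) * ennreal ((1 + T) * (M2_norm d x)\<^sup>2)" by (intro mult_left_mono xb(2)) auto
  also have "... = ennreal (4 * cL\<^sup>2 * ((1 + T) * (M2_norm d x)\<^sup>2))" using T by (simp add: ennreal_mult)
  finally have N: "N2 {0..T} (Lx (xbar x)) \<le> ennreal (4 * cL\<^sup>2 * ((1 + T) * (M2_norm d x)\<^sup>2))" .
  have q: "0 \<le> 4 * cL\<^sup>2 * ((1 + T) * (M2_norm d x)\<^sup>2)" using T by simp
  show "set_integrable lborel {0..T} (Lx (xbar x))" "(Lint (\<lambda>s. \<bar>Lx (xbar x) s\<bar>) 0 T)\<^sup>2 \<le> T * (4 * cL\<^sup>2 * ((1 + T) * (M2_norm d x)\<^sup>2))"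
    using L2_imp_L1[OF Lx_L2[OF xb(1)] less_imp_le[OF T] N q] by simp_all
qed

lemma forcing_integrable:
  assumes x: "x \<in> M2_space d" and \<omega>: "\<omega> \<in> space M" shows "set_integrable lborel {0..T} (forcing x \<omega>)"
  unfolding forcing_def[abs_def] by (intro set_integral_add const_integrable delay_ext_xbar x \<omega>)

lemma W_solves:
  assumes x: "x \<in> M2_space d" and \<omega>: "\<omega> \<in> space M"
  shows "pathwise_equation.solves d T (Ker \<omega>) \<mu> (\<lambda>t. E t \<omega>) (fst x) (forcing x \<omega>) (\<lambda>t. W x t \<omega>)"
    "uniform_limit {0..T} (Iter \<omega> (fst x) (forcing x \<omega>)) (\<lambda>t. W x t \<omega>) sequentially"
  using pathwise_equation.iter_converges[OF pathwise[OF \<omega>] forcing_integrable[OF x \<omega>]]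
  by (simp_all add: W_def[abs_def])

lemma W_path:
  assumes x: "x \<in> M2_space d" and \<omega>: "\<omega> \<in> space M"
  shows "continuous_on {0..T} (\<lambda>t. W x t \<omega>)" "W x 0 \<omega> = 0"
proof -
  interpret pathwise_equation d T c cL "Ker \<omega>" \<mu> "\<lambda>t. E t \<omega>" by (rule pathwise[OF \<omega>])
  show "continuous_on {0..T} (\<lambda>t. W x t \<omega>)" "W x 0 \<omega> = 0"
    using W_solves(1)[OF x \<omega>] by (auto simp: solves_def path_def)
qed

abbreviation "Q t \<equiv> restrict_space borel {0..t} \<Otimes>\<^sub>M F t"

text \<open>Measurability of a parametric integral over the sigma-algebra \<open>F t\<close>; sample
  points with a non-integrable integrand are covered by the default value 0.\<close>

lemma Lint_adapted:
  assumes h: "(\<lambda>(s, \<omega>). h s \<omega>) \<in> borel_measurable (Q t)"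
  shows "(\<lambda>\<omega>. Lint (\<lambda>s. h s \<omega>) 0 t) \<in> borel_measurable (F t)"
proof -
  interpret L: sigma_finite_measure "restrict_space lborel {0..t}"
    by (rule sigma_finite_measure_restrict_space[OF sigma_finite_lborel]) simp
  have sets: "sets (F t \<Otimes>\<^sub>M restrict_space lborel {0..t}) = sets (F t \<Otimes>\<^sub>M restrict_space borel {0..t})"
    by (intro sets_pair_measure_cong refl sets_restrict_space_cong) simp
  have "(\<lambda>(\<omega>, s). h s \<omega>) \<in> borel_measurable (F t \<Otimes>\<^sub>M restrict_space borel {0..t})"
    using measurable_pair_swap[OF h] by simp
  then have "(\<lambda>(\<omega>, s). h s \<omega>) \<in> borel_measurable (F t \<Otimes>\<^sub>M restrict_space lborel {0..t})"
    using measurable_cong_sets[OF sets refl] by blast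
  from L.borel_measurable_lebesgue_integral[OF this]
  have "(\<lambda>\<omega>. \<integral>s. h s \<omega> \<partial>restrict_space lborel {0..t}) \<in> borel_measurable (F t)" .
  then show ?thesis by (simp add: integral_restrict_space set_lebesgue_integral_def)
qed

lemma jointly_measurable:
  assumes "t \<in> {0..T}" "\<And>s. s \<in> {0..t} ==> X s \<in> borel_measurable (F t)" "\<And>\<omega>. \<omega> \<in> space M ==> continuous_on {0..t} (\<lambda>s. X s \<omega>)"
  shows "(\<lambda>(s, \<omega>). (X s \<omega> :: real)) \<in> borel_measurable (Q t)"
  using assms by (intro continuous_process_jointly_measurable) auto

lemma delay_op_prog:
  assumes t: "t \<in> {0..T}" and z: "\<And>s. s \<in> {-d..t} ==> z s \<in> borel_measurable (F t)"
    and cont: "\<And>\<omega>. \<omega> \<in> space M ==> continuous_on {-d..T} (\<lambda>s. z s \<omega>)"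
  shows "(\<lambda>(s, \<omega>). delay_op d (Ker \<omega>) (\<lambda>r. z r \<omega>) s) \<in> borel_measurable (Q t)"
proof -
  have sp: "fst q \<in> {0..t}" "snd q \<in> space M" if "q \<in> space (Q t)" for q
    using that by (auto simp: space_pair_measure space_restrict_space)
  have "(\<lambda>q. signed_integral d (\<kappa> (fst q) (snd q)) (\<lambda>r. z (fst q + r) (snd q))) \<in> borel_measurable (Q t)"
  proof (rule signed_integral_measurable[OF d_pos])
    fix q assume q: "q \<in> space (Q t)"
    interpret delay_kernel d T c cL "Ker (snd q)" by (rule kernel[OF sp(2)[OF q]])
    have qT: "fst q \<in> {0..T}" using sp(1)[OF q] t by auto
    show "\<kappa> (fst q) (snd q) \<in> M0 d" by (rule kM0[OF qT])
    show "continuous_on {-d..0} (\<lambda>r. z (fst q + r) (snd q))" by (rule continuous_on_shift[OF cont[OF sp(2)[OF q]] qT])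
  next
    fix A :: "real set" assume "A \<in> sets borel" "A \<subseteq> {-d..<0}"
    from \<kappa>_prog[OF this t] show "(\<lambda>q. \<kappa> (fst q) (snd q) A) \<in> borel_measurable (Q t)" by (simp add: case_prod_beta)
  next
    fix r assume r: "r \<in> {-d..0}"
    have "(\<lambda>(s, \<omega>). z (s + r) \<omega>) \<in> borel_measurable (Q t)"
    proof (rule jointly_measurable[OF t])
      show "z (s + r) \<in> borel_measurable (F t)" if "s \<in> {0..t}" for s using that r by (intro z) auto
      show "continuous_on {0..t} (\<lambda>s. z (s + r) \<omega>)" if "\<omega> \<in> space M" for \<omega>
        by (rule continuous_on_compose2[OF cont[OF that]]) (use r t in \<open>auto intro!: continuous_intros\<close>)
    qed
    then show "(\<lambda>q. z (fst q + r) (snd q)) \<in> borel_measurable (Q t)" by (simp add: case_prod_beta)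
  qed
  then show ?thesis by (simp add: delay_op_def case_prod_beta)
qed

text \<open>The approximations \<open>g n\<close> of the datum are deterministic, hence common to
  all sample points, and transfer adaptedness from \<open>delay_op\<close> to integrals of
  \<open>delay_ext\<close>. The weight \<open>h\<close> will be \<open>1 / E\<close> in the
  iteration and 1 in the equation itself.\<close>

lemma weighted_forcing_adapted:
  assumes x: "x \<in> M2_space d" and t: "t \<in> {0..T}"
    and h: "\<And>s. s \<in> {0..t} ==> h s \<in> borel_measurable (F t)" "\<And>\<omega>. \<omega> \<in> space M ==> continuous_on {0..T} (\<lambda>s. h s \<omega>)"
  shows "(\<lambda>\<omega>. Lint (\<lambda>s. h s \<omega> * forcing x \<omega> s) 0 t) \<in> borel_measurable (F t)"
proof -
  note xb = xbar_L2[OF x d_pos T_pos]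
  \<comment> \<open>Any sample point will do: it only gives access to the approximation of
    \<open>xbar x\<close>, in which the kernel does not occur.\<close>
  obtain \<omega>0 where "\<omega>0 \<in> space M" using not_empty by blast
  then interpret K0: delay_kernel d T c cL "Ker \<omega>0" by (rule kernel)
  obtain g where g: "\<And>n. continuous_on UNIV (g n)" "\<And>n. N2 {-d..T} (\<lambda>s. xbar x s - g n s) \<le> ennreal ((1/8)^n)"
    using K0.ex_fast_approximation[OF xb(1)] by metis
  have gc: "continuous_on {-d..T} (g n)" for n using g(1) continuous_on_subset by blast
  have hc: "continuous_on {0..t} (\<lambda>s. h s \<omega>)" if "\<omega> \<in> space M" for \<omega>
    using h(2)[OF that] by (rule continuous_on_subset) (use t in auto)
  define A where "A n \<omega> = Lint (\<lambda>s. h s \<omega> * (\<mu> * fst x + delay_op d (Ker \<omega>) (g n) s)) 0 t" for n \<omega>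
  have A: "A n \<in> borel_measurable (F t)" for n
    unfolding A_def
  proof (rule Lint_adapted)
    have [measurable]: "(\<lambda>q. h (fst q) (snd q)) \<in> borel_measurable (Q t)"
      using jointly_measurable[OF t h(1) hc] by (simp add: case_prod_beta)
    have [measurable]: "(\<lambda>q. delay_op d (Ker (snd q)) (g n) (fst q)) \<in> borel_measurable (Q t)"
      using delay_op_prog[OF t, of "\<lambda>s _. g n s"] gc by (simp add: case_prod_beta)
    show "(\<lambda>(s, \<omega>). h s \<omega> * (\<mu> * fst x + delay_op d (Ker \<omega>) (g n) s)) \<in> borel_measurable (Q t)"
      unfolding case_prod_beta by measurable
  qed
  have "(\<lambda>n. A n \<omega>) \<longlonglongrightarrow> Lint (\<lambda>s. h s \<omega> * forcing x \<omega> s) 0 t" if \<omega>: "\<omega> \<in> space (F t)" for \<omega>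
  proof -
    have \<omega>M: "\<omega> \<in> space M" using \<omega> by simp
    interpret delay_kernel d T c cL "Ker \<omega>" by (rule kernel[OF \<omega>M])
    have ga: "approximates g (xbar x)" by (rule fast_approximates[OF g])
    obtain H where H: "H \<ge> 0" "\<And>s. s \<in> {0..T} ==> \<bar>h s \<omega>\<bar> \<le> H" using continuous_on_bounded[OF h(2)[OF \<omega>M]] by blast
    have lim: "(\<lambda>n. N2 {0..T} (\<lambda>s. dop (g n) s - Lx (xbar x) s)) \<longlonglongrightarrow> 0" by (rule Lx_limit[OF xb(1) ga])
    have dL2: "(\<lambda>s. dop (g n) s - Lx (xbar x) s) \<in> L2_space {0..T}" for n by (rule L2_space_diff[OF dop_L2[OF gc] Lx_L2[OF xb(1)]])
    define q where "q n = enn2real (N2 {0..T} (\<lambda>s. dop (g n) s - Lx (xbar x) s))" for n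
    have qN: "N2 {0..T} (\<lambda>s. dop (g n) s - Lx (xbar x) s) = ennreal (q n)" for n
      using dL2[of n] by (simp add: q_def L2_space_iff less_top)
    have q0: "q n \<ge> 0" for n by (simp add: q_def)
    have qlim: "q \<longlonglongrightarrow> 0" using lim unfolding qN by (subst (asm) ennreal_tendsto_0_iff) (use q0 in auto)
    note L1 = L2_imp_L1[OF dL2 less_imp_le[OF T] eq_refl[OF qN] q0]
    have sub: "set_integrable lborel {0..t} p" if "set_integrable lborel {0..T} p" for p :: "real => real"
      using set_integrable_sub[OF that, of 0 t] t by auto
    have i1: "set_integrable lborel {0..T} (\<lambda>s. h s \<omega> * (\<mu> * fst x + dop (g n) s))" for n
      using L2_imp_L1(1)[OF dop_L2[OF gc[of n]] less_imp_le[OF T], of "enn2real (N2 {0..T} (dop (g n)))"] dop_L2[OF gc[of n]]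
      by (intro set_integrable_continuous_mult[OF _ h(2)[OF \<omega>M]] set_integral_add const_integrable) (simp add: L2_space_iff less_top)
    have i2: "set_integrable lborel {0..T} (\<lambda>s. h s \<omega> * forcing x \<omega> s)"
      by (rule set_integrable_continuous_mult[OF forcing_integrable[OF x \<omega>M] h(2)[OF \<omega>M]])
    have bound: "\<bar>A n \<omega> - Lint (\<lambda>s. h s \<omega> * forcing x \<omega> s) 0 t\<bar> \<le> H * sqrt (T * q n)" for n
    proof -
      have eq: "A n \<omega> - Lint (\<lambda>s. h s \<omega> * forcing x \<omega> s) 0 t = Lint (\<lambda>s. h s \<omega> * (\<mu> * fst x + dop (g n) s) - h s \<omega> * forcing x \<omega> s) 0 t"
        unfolding A_def by (simp only: Lint_diff[OF sub[OF i1] sub[OF i2]])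
      have "\<bar>Lint (\<lambda>s. h s \<omega> * (\<mu> * fst x + dop (g n) s) - h s \<omega> * forcing x \<omega> s) 0 t\<bar> \<le> Lint (\<lambda>s. H * \<bar>dop (g n) s - Lx (xbar x) s\<bar>) 0 t"
      proof (rule Lint_abs_le)
        show "set_integrable lborel {0..t} (\<lambda>s. h s \<omega> * (\<mu> * fst x + dop (g n) s) - h s \<omega> * forcing x \<omega> s)"
          by (rule set_integral_diff(1)[OF sub[OF i1] sub[OF i2]])
        show "set_integrable lborel {0..t} (\<lambda>s. H * \<bar>dop (g n) s - Lx (xbar x) s\<bar>)"
          by (rule set_integrable_mult_right[OF sub[OF set_integrable_abs[OF L1(1)]]])
        fix s assume "s \<in> {0..t}"
        then have "\<bar>h s \<omega>\<bar> \<le> H" using H t by auto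
        then have "\<bar>h s \<omega>\<bar> * \<bar>dop (g n) s - Lx (xbar x) s\<bar> \<le> H * \<bar>dop (g n) s - Lx (xbar x) s\<bar>" by (rule mult_right_mono) simp
        moreover have "h s \<omega> * (\<mu> * fst x + dop (g n) s) - h s \<omega> * forcing x \<omega> s = h s \<omega> * (dop (g n) s - Lx (xbar x) s)"
          by (simp add: forcing_def algebra_simps)
        ultimately show "\<bar>h s \<omega> * (\<mu> * fst x + dop (g n) s) - h s \<omega> * forcing x \<omega> s\<bar> \<le> H * \<bar>dop (g n) s - Lx (xbar x) s\<bar>"
          by (simp only: abs_mult)
      qed
      also have "Lint (\<lambda>s. H * \<bar>dop (g n) s - Lx (xbar x) s\<bar>) 0 t = H * Lint (\<lambda>s. \<bar>dop (g n) s - Lx (xbar x) s\<bar>) 0 t"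
        by (rule set_integral_mult_right)
      also have "... \<le> H * Lint (\<lambda>s. \<bar>dop (g n) s - Lx (xbar x) s\<bar>) 0 T"
        using H(1) t by (intro mult_left_mono Lint_subset_mono[OF set_integrable_abs[OF L1(1)]]) auto
      also have "... \<le> H * sqrt (T * q n)"
        using H(1) L1(2)[of n] by (intro mult_left_mono real_le_rsqrt) auto
      finally show ?thesis unfolding eq .
    qed
    have "(\<lambda>n. H * sqrt (T * q n)) \<longlonglongrightarrow> H * sqrt (T * 0)" by (intro tendsto_intros qlim)
    then have "(\<lambda>n. H * sqrt (T * q n)) \<longlonglongrightarrow> 0" by simp
    moreover have "\<forall>\<^sub>F n in sequentially. norm (A n \<omega> - Lint (\<lambda>s. h s \<omega> * forcing x \<omega> s) 0 t) \<le> H * sqrt (T * q n)"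
      using bound by (intro always_eventually allI) (simp only: real_norm_def)
    ultimately have "(\<lambda>n. A n \<omega> - Lint (\<lambda>s. h s \<omega> * forcing x \<omega> s) 0 t) \<longlonglongrightarrow> 0" by (rule Lim_null_comparison[rotated])
    then show ?thesis by (rule LIM_zero_cancel)
  qed
  then show ?thesis by (rule borel_measurable_LIMSEQ_real[OF _ A])
qed

lemma E_adapted: "s \<in> {0..T} ==> E s \<in> borel_measurable (F s)"
  unfolding E_def[abs_def] using B_adapted[of s] by measurable

lemma E_cont: "\<omega> \<in> space M ==> continuous_on {0..T} (\<lambda>s. E s \<omega>)"
  using pathwise pathwise_equation.E_cont by blast

lemma E_pos: "E s \<omega> > 0"
  by (simp add: E_def)

lemma weighted_drift_adapted:
  assumes t: "t \<in> {0..T}"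
    and h: "\<And>s. s \<in> {0..t} ==> h s \<in> borel_measurable (F t)" "\<And>\<omega>. \<omega> \<in> space M ==> continuous_on {0..T} (\<lambda>s. h s \<omega>)"
    and w: "\<And>s. s \<in> {0..t} ==> w s \<in> borel_measurable (F t)" "\<And>\<omega>. \<omega> \<in> space M ==> continuous_on {0..T} (\<lambda>s. w s \<omega>)"
      "\<And>\<omega>. \<omega> \<in> space M ==> w 0 \<omega> = 0"
  shows "(\<lambda>\<omega>. Lint (\<lambda>s. h s \<omega> * Drift \<omega> (\<lambda>r. w r \<omega>) s) 0 t) \<in> borel_measurable (F t)"
proof (rule Lint_adapted)
  have sub: "continuous_on {0..t} f" if "continuous_on {0..T} f" for f :: "real => real"
    using that by (rule continuous_on_subset) (use t in auto)
  have [measurable]: "(\<lambda>q. h (fst q) (snd q)) \<in> borel_measurable (Q t)" "(\<lambda>q. w (fst q) (snd q)) \<in> borel_measurable (Q t)"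
    using jointly_measurable[OF t h(1) sub[OF h(2)]] jointly_measurable[OF t w(1) sub[OF w(2)]] by (simp_all add: case_prod_beta)
  have "(\<lambda>(s, \<omega>). delay_op d (Ker \<omega>) (\<lambda>r. ext0 (\<lambda>r. w r \<omega>) r) s) \<in> borel_measurable (Q t)"
  proof (rule delay_op_prog[OF t])
    show "(\<lambda>\<omega>. ext0 (\<lambda>r. w r \<omega>) s) \<in> borel_measurable (F t)" if "s \<in> {-d..t}" for s
      using w(1)[of s] that by (cases "s < 0") (simp_all add: ext0_def)
    show "continuous_on {-d..T} (\<lambda>s. ext0 (\<lambda>r. w r \<omega>) s)" if "\<omega> \<in> space M" for \<omega>
      using continuous_on_ext0[OF w(2)[OF that] w(3)[OF that]] by simp
  qed
  then have [measurable]: "(\<lambda>q. delay_op d (Ker (snd q)) (ext0 (\<lambda>r. w r (snd q))) (fst q)) \<in> borel_measurable (Q t)"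
    by (simp add: case_prod_beta)
  have "(\<lambda>q. h (fst q) (snd q) * (\<mu> * w (fst q) (snd q) + delay_op d (Ker (snd q)) (ext0 (\<lambda>r. w r (snd q))) (fst q))) \<in> borel_measurable (Q t)"
    by measurable
  then show "(\<lambda>(s, \<omega>). h s \<omega> * Drift \<omega> (\<lambda>r. w r \<omega>) s) \<in> borel_measurable (Q t)"
  proof (rule measurable_cong[THEN iffD1, rotated])
    fix q assume "q \<in> space (Q t)"
    then have "snd q \<in> space M" by (auto simp: space_pair_measure)
    then show "h (fst q) (snd q) * (\<mu> * w (fst q) (snd q) + delay_op d (Ker (snd q)) (ext0 (\<lambda>r. w r (snd q))) (fst q)) =
      (case q of (s, \<omega>) => h s \<omega> * Drift \<omega> (\<lambda>r. w r \<omega>) s)"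
      by (simp add: case_prod_beta pathwise_equation.drift_def[OF pathwise])
  qed
qed

lemma iter_adapted:
  assumes x: "x \<in> M2_space d" and t: "t \<in> {0..T}"
  shows "(\<lambda>\<omega>. Iter \<omega> (fst x) (forcing x \<omega>) n t) \<in> borel_measurable (F t)"
  using t
proof (induction n arbitrary: t)
  case 0
  then show ?case
    by (subst measurable_cong[of _ _ "\<lambda>_. 0"]) (auto simp: pathwise_equation.iter.simps[OF pathwise])
next
  case (Suc n)
  let ?w = "\<lambda>s \<omega>. Iter \<omega> (fst x) (forcing x \<omega>) n s"
  let ?h = "\<lambda>s \<omega>. 1 / E s \<omega>"
  have h: "?h s \<in> borel_measurable (F t)" if "s \<in> {0..t}" for s
    using measurable_F_mono[OF E_adapted[of s], of t] that Suc.prems by auto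
  have hc: "continuous_on {0..T} (\<lambda>s. ?h s \<omega>)" if "\<omega> \<in> space M" for \<omega>
    using E_pos[of _ \<omega>] by (intro continuous_intros E_cont that) (simp add: less_imp_neq[symmetric])
  have w: "?w s \<in> borel_measurable (F t)" if "s \<in> {0..t}" for s
    using measurable_F_mono[OF Suc.IH[of s], of t] that Suc.prems by auto
  have path: "pathwise_equation.path T (\<lambda>s. ?w s \<omega>)" if "\<omega> \<in> space M" for \<omega>
    by (rule pathwise_equation.path_iter[OF pathwise[OF that] forcing_integrable[OF x that]])
  have wc: "continuous_on {0..T} (\<lambda>s. ?w s \<omega>)" "?w 0 \<omega> = 0" if "\<omega> \<in> space M" for \<omega>
    using path[OF that] pathwise_equation.path_def[OF pathwise[OF that]] by auto
  have "(\<lambda>\<omega>. E t \<omega> * (fst x + (Lint (\<lambda>s. ?h s \<omega> * forcing x \<omega> s) 0 t + Lint (\<lambda>s. ?h s \<omega> * Drift \<omega> (\<lambda>r. ?w r \<omega>) s) 0 t)) - fst x) \<in> borel_measurable (F t)"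
    using E_adapted[OF Suc.prems] weighted_forcing_adapted[OF x Suc.prems h hc] weighted_drift_adapted[OF Suc.prems h hc w wc]
    by measurable
  then show ?case
  proof (rule measurable_cong[THEN iffD1, rotated])
    fix \<omega> assume "\<omega> \<in> space (F t)"
    then have \<omega>: "\<omega> \<in> space M" by simp
    interpret pathwise_equation d T c cL "Ker \<omega>" \<mu> "\<lambda>t. E t \<omega>" by (rule pathwise[OF \<omega>])
    have "set_integrable lborel {0..T} (\<lambda>s. forcing x \<omega> s / E s \<omega>)" "set_integrable lborel {0..T} (\<lambda>s. drift (\<lambda>r. ?w r \<omega>) s / E s \<omega>)"
      by (intro div_E_integrable forcing_integrable x \<omega> drift_integrable path)+
    then have i: "set_integrable lborel {0..t} (\<lambda>s. forcing x \<omega> s / E s \<omega>)" "set_integrable lborel {0..t} (\<lambda>s. drift (\<lambda>r. ?w r \<omega>) s / E s \<omega>)"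
      using Suc.prems by (auto intro: set_integrable_sub)
    \<comment> \<open>Adaptedness was obtained separately for the integrals of forcing and drift, by
      different arguments, so the integral is split.\<close>
    have "Lint (\<lambda>s. (forcing x \<omega> s + drift (\<lambda>r. ?w r \<omega>) s) / E s \<omega>) 0 t = Lint (\<lambda>s. forcing x \<omega> s / E s \<omega>) 0 t + Lint (\<lambda>s. drift (\<lambda>r. ?w r \<omega>) s / E s \<omega>) 0 t"
      unfolding add_divide_distrib by (rule set_integral_add(2)[OF i])
    then show "E t \<omega> * (fst x + (Lint (\<lambda>s. ?h s \<omega> * forcing x \<omega> s) 0 t + Lint (\<lambda>s. ?h s \<omega> * drift (\<lambda>r. ?w r \<omega>) s) 0 t)) - fst x =
      Iter \<omega> (fst x) (forcing x \<omega>) (Suc n) t"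
      by (simp add: iter.simps Picard_def)
  qed
qed

lemma W_adapted:
  assumes x: "x \<in> M2_space d" and t: "t \<in> {0..T}" shows "W x t \<in> borel_measurable (F t)"
proof (rule borel_measurable_LIMSEQ_real[OF _ iter_adapted[OF x t]])
  show "(\<lambda>n. Iter \<omega> (fst x) (forcing x \<omega>) n t) \<longlonglongrightarrow> W x t \<omega>" if "\<omega> \<in> space (F t)" for \<omega>
    using W_solves(2)[OF x, of \<omega>] that t by (auto intro: tendsto_uniform_limitI)
qed

end

section \<open>Causal L^2 estimates for the drift\<close>

lemma Lint_cong_AE:
  fixes f g :: "real => real"
  assumes "set_integrable lborel {a..b} f" "set_integrable lborel {a..b} g" "AE s in lborel. s \<in> {a..b} \<longrightarrow> f s = g s"
  shows "Lint f a b = Lint g a b"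
  unfolding set_lebesgue_integral_def
proof (rule integral_cong_AE)
  show "AE s in lborel. indicator {a..b} s *\<^sub>R f s = indicator {a..b} s *\<^sub>R g s"
    using assms(3) by eventually_elim (auto simp: indicator_def)
qed (use assms(1,2) in \<open>auto simp: set_integrable_def dest: borel_measurable_integrable\<close>)

lemma N2_eq_Lint:
  assumes "continuous_on {a..b} f" shows "N2 {a..b} f = ennreal (Lint (\<lambda>s. (f s)\<^sup>2) a b)"
proof -
  have "set_integrable lborel {a..b} (\<lambda>s. (f s)\<^sup>2)"
    using assms by (intro borel_integrable_atLeastAtMost' continuous_intros)
  then show ?thesis
    by (subst nn_integral_Icc_eq_Lint[symmetric]) (auto simp: N2_def indicator_def intro!: nn_integral_cong)
qed

context pathwise_equation
begin

text \<open>The assumed bound concerns all of [0,T]. Up to time \<open>t\<close> the operator sees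
  only the past, so \<open>w\<close> may be replaced after \<open>t\<close> by a continuous path
  that falls linearly to 0 within time \<open>\<delta>\<close>. The extra mass is at most
  \<open>(w t)\<^sup>2 * \<delta>\<close> and disappears in the limit.\<close>

lemma dop_causal_bound:
  assumes w: "path w" and t: "t \<in> {0..T}"
  shows "N2 {0..t} (dop (ext0 w)) \<le> ennreal (cL\<^sup>2 * Lint (\<lambda>s. (w s)\<^sup>2) 0 t)"
proof -
  have wc: "continuous_on {0..T} w" "w 0 = 0" using w by (auto simp: path_def)
  have wt: "continuous_on {0..t} w" by (rule continuous_on_subset[OF wc(1)]) (use t in auto)
  define a where "a = Lint (\<lambda>s. (w s)\<^sup>2) 0 t"
  have a0: "a \<ge> 0" unfolding a_def by (rule Lint_nonneg) simp
  have main: "N2 {0..t} (dop (ext0 w)) \<le> ennreal (cL\<^sup>2 * (a + (w t)\<^sup>2 * \<delta>))" if \<delta>: "\<delta> > 0" for \<delta>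
  proof -
    define v where "v s = w (min s t) * max 0 (1 - max 0 (s - t) / \<delta>)" for s
    have "continuous_on {0..T} (\<lambda>s. w (min s t))"
      by (rule continuous_on_compose2[OF wc(1)]) (use t in \<open>auto intro!: continuous_intros\<close>)
    then have v: "path v" using wc(2) t \<delta> unfolding path_def v_def by (auto intro!: continuous_intros)
    have v_eq: "ext0 v s = ext0 w s" if "s \<le> t" for s using that by (simp add: ext0_def v_def)
    have "N2 {0..t} (dop (ext0 w)) = N2 {0..t} (dop (ext0 v))"
      by (intro N2_cong dop_cong) (use t v_eq in auto)
    also have "... \<le> N2 {0..T} (dop (ext0 v))"
      unfolding N2_def by (intro nn_integral_mono ennreal_leI) (use t in \<open>auto simp: indicator_def\<close>)
    also have "... \<le> ennreal (cL\<^sup>2) * N2 {-d..T} (ext0 v)" by (rule dop_N2[OF path_ext0[OF v]])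
    also have "N2 {-d..T} (ext0 v) \<le> (\<integral>\<^sup>+s. ennreal ((indicator {0..t} s * w s)\<^sup>2) + ennreal ((w t)\<^sup>2) * indicator {t..t + \<delta>} s \<partial>lborel)"
      unfolding N2_def
    proof (intro nn_integral_mono)
      fix s
      consider "s < 0" | "0 \<le> s" "s \<le> t" | "t < s" "s \<le> t + \<delta>" | "t + \<delta> < s" using \<delta> t by fastforce
      then show "ennreal ((indicator {-d..T} s * ext0 v s)\<^sup>2) \<le> ennreal ((indicator {0..t} s * w s)\<^sup>2) + ennreal ((w t)\<^sup>2) * indicator {t..t + \<delta>} s"
      proof cases
        case 2
        then have "ext0 v s = w s" using \<delta> by (simp add: v_eq) (simp add: ext0_def)
        moreover have "ennreal ((indicator {-d..T} s * w s)\<^sup>2) \<le> ennreal ((indicator {0..t} s * w s)\<^sup>2)"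
          using 2 by (intro ennreal_leI) (simp add: indicator_def)
        ultimately show ?thesis by (metis add_increasing2 zero_le)
      next
        case 3
        have "0 \<le> max 0 (1 - (s - t) / \<delta>)" "max 0 (1 - (s - t) / \<delta>) \<le> 1" using 3 \<delta> by auto
        then have q: "(max 0 (1 - (s - t) / \<delta>))\<^sup>2 \<le> 1" by (rule power_le_one)
        have "(ext0 v s)\<^sup>2 = (w t)\<^sup>2 * (max 0 (1 - (s - t) / \<delta>))\<^sup>2"
          using 3 t by (simp add: ext0_def v_def power_mult_distrib)
        also have "... \<le> (w t)\<^sup>2 * 1" by (intro mult_left_mono q) simp
        finally have "ennreal ((indicator {-d..T} s * ext0 v s)\<^sup>2) \<le> ennreal ((w t)\<^sup>2)"
          by (intro ennreal_leI) (simp add: indicator_def)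
        then show ?thesis using 3 by simp
      next
        case 4
        then have "(s - t) / \<delta> \<ge> 1" using \<delta> by (simp add: le_divide_eq)
        then have "ext0 v s = 0" using 4 \<delta> by (simp add: ext0_def v_def)
        then show ?thesis by simp
      qed (simp add: ext0_def)
    qed
    also have "... = N2 {0..t} w + ennreal ((w t)\<^sup>2) * ennreal \<delta>"
    proof -
      have [measurable]: "(\<lambda>s. indicator {0..t} s * w s) \<in> borel_measurable borel"
        using sbm_continuous[OF _ wt] by (simp add: sbm_iff)
      show ?thesis unfolding N2_def using \<delta> by (subst nn_integral_add) (auto simp: nn_integral_cmult)
    qed
    also have "... = ennreal (a + (w t)\<^sup>2 * \<delta>)"
      using a0 \<delta> unfolding N2_eq_Lint[OF wt] a_def[symmetric] by (simp add: ennreal_mult ennreal_plus)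
    finally show ?thesis using a0 \<delta> by (simp add: ennreal_mult mult_left_mono)
  qed
  have lim: "(\<lambda>n. ennreal (cL\<^sup>2 * (a + (w t)\<^sup>2 * inverse (real (Suc n))))) \<longlonglongrightarrow> ennreal (cL\<^sup>2 * (a + (w t)\<^sup>2 * 0))"
    by (intro tendsto_ennrealI tendsto_intros LIMSEQ_inverse_real_of_nat)
  have "N2 {0..t} (dop (ext0 w)) \<le> ennreal (cL\<^sup>2 * (a + (w t)\<^sup>2 * 0))"
    by (rule LIMSEQ_le_const[OF lim]) (use main in auto)
  then show ?thesis by (simp add: a_def)
qed

text \<open>The right-hand side is a time integral of squares and not a supremum, which is the form
  that survives taking expectations at fixed times.\<close>

lemma Lint_drift_sq_le:
  assumes w: "path w" and t: "t \<in> {0..T}"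
  shows "(Lint (drift w) 0 t)\<^sup>2 \<le> T * ((2 * \<mu>\<^sup>2 + 2 * cL\<^sup>2) * Lint (\<lambda>s. (w s)\<^sup>2) 0 t)"
proof -
  have wt: "continuous_on {0..t} w" using w t unfolding path_def by (auto elim: continuous_on_subset)
  define a where "a = Lint (\<lambda>s. (w s)\<^sup>2) 0 t"
  have a0: "a \<ge> 0" unfolding a_def by (rule Lint_nonneg) simp
  have sd: "sbm {0..t} (dop (ext0 w))"
    using set_borel_measurable_subset[OF sbm_dop[OF path_ext0[OF w]], of "{0..t}"] t by auto
  have eq: "drift w = (\<lambda>s. \<mu> * w s + 1 * dop (ext0 w) s)" by (simp add: fun_eq_iff drift_def)
  have "N2 {0..t} (drift w) \<le> ennreal (2 * \<mu>\<^sup>2) * N2 {0..t} w + ennreal (2 * 1\<^sup>2) * N2 {0..t} (dop (ext0 w))"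
    unfolding eq by (rule N2_lincomb_le[OF sbm_continuous[OF _ wt] sd]) simp
  also have "... \<le> ennreal (2 * \<mu>\<^sup>2) * ennreal a + ennreal (2 * 1\<^sup>2) * ennreal (cL\<^sup>2 * a)"
    using dop_causal_bound[OF w t] unfolding N2_eq_Lint[OF wt] a_def[symmetric]
    by (intro add_left_mono mult_left_mono) auto
  also have "... = ennreal (2 * \<mu>\<^sup>2 * a + 2 * 1\<^sup>2 * (cL\<^sup>2 * a))"
    using a0 by (simp add: ennreal_mult ennreal_plus)
  also have "... = ennreal ((2 * \<mu>\<^sup>2 + 2 * cL\<^sup>2) * a)" by (simp add: algebra_simps)
  finally have N: "N2 {0..t} (drift w) \<le> ennreal ((2 * \<mu>\<^sup>2 + 2 * cL\<^sup>2) * a)" .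
  have q: "0 \<le> (2 * \<mu>\<^sup>2 + 2 * cL\<^sup>2) * a" using a0 by simp
  have i: "set_integrable lborel {0..t} (drift w)" using set_integrable_sub[OF drift_integrable[OF w], of 0 t] t by auto
  have "drift w \<in> L2_space {0..t}"
    using N i order_le_less_trans[OF N] by (auto simp: L2_space_iff sbm_iff set_integrable_def dest: borel_measurable_integrable)
  from L2_imp_L1(2)[OF this _ N q] have "(Lint (\<lambda>s. \<bar>drift w s\<bar>) 0 t)\<^sup>2 \<le> t * ((2 * \<mu>\<^sup>2 + 2 * cL\<^sup>2) * a)" using t by simp
  moreover have "\<bar>Lint (drift w) 0 t\<bar> \<le> Lint (\<lambda>s. \<bar>drift w s\<bar>) 0 t" by (rule Lint_abs_le[OF i set_integrable_abs[OF i]]) simp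
  then have "(Lint (drift w) 0 t)\<^sup>2 \<le> (Lint (\<lambda>s. \<bar>drift w s\<bar>) 0 t)\<^sup>2" by (rule power2_le_iff_abs_le[THEN iffD2, rotated]) (simp add: Lint_nonneg)
  moreover have "t * ((2 * \<mu>\<^sup>2 + 2 * cL\<^sup>2) * a) \<le> T * ((2 * \<mu>\<^sup>2 + 2 * cL\<^sup>2) * a)" using q t by (intro mult_right_mono) auto
  ultimately show ?thesis unfolding a_def by linarith
qed

text \<open>The two paths differ by one that vanishes at 0, whose prolongation by 0 is continuous;
  there the extension is the explicit operator.\<close>

lemma Lx_extend_past:
  assumes x1: "x1 \<in> L2_space {-d..<0}" and y: "continuous_on {0..T} y" and w: "path w"
  shows "AE s in lborel. s \<in> {0..T} \<longrightarrow>
    Lx (extend_past x1 (\<lambda>r. y r + w r)) s = Lx (extend_past x1 y) s + dop (ext0 w) s"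
proof -
  have eq: "extend_past x1 (\<lambda>r. y r + w r) = (\<lambda>s. 1 * extend_past x1 y s + 1 * ext0 w s)"
    by (auto simp: extend_past_def ext0_def)
  show ?thesis
    unfolding eq using Lx_lincomb[OF extend_past_L2(1)[OF x1 y d T] L2_space_continuous[OF path_ext0[OF w]], of 1 1] Lx_continuous[OF path_ext0[OF w]]
    by eventually_elim simp
qed

lemma Lx_integrable:
  assumes "z \<in> L2_space {-d..T}" shows "set_integrable lborel {0..T} (Lx z)"
proof (rule L2_imp_L1(1)[OF Lx_L2[OF assms]])
  show "N2 {0..T} (Lx z) \<le> ennreal (enn2real (N2 {0..T} (Lx z)))" using Lx_L2[OF assms] by (simp add: L2_space_iff)
qed (use T in auto)

end

lemma quadratic_variation_path_cong:
  assumes q: "quadratic_variation_path T s2 b" and c: "continuous_on {0..T} b'" and eq: "\<And>t. t \<in> {0..T} ==> b' t = b t"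
  shows "quadratic_variation_path T s2 b'"
proof -
  interpret quadratic_variation_path T s2 b by (rule q)
  have "QV b' T m (grid T l i) = QV b T m (grid T l i)" if "i \<le> 2^l" for m l i
  proof -
    have "grid T l i \<in> {0..T}" using T that by (auto intro!: grid_nonneg grid_le_T)
    from min_grid_bounds(1)[OF T this] show ?thesis by (simp add: QV_def incr_def eq)
  qed
  then show ?thesis using T s2 c QV_lim by unfold_locales simp_all
qed

section \<open>The constructed process solves the original equation\<close>

context delayed_sde
begin

text \<open>The remainder that the equation attributes to the stochastic integral. The equation thus
  becomes a rearrangement, and the work lies in showing that this remainder is the integral.\<close>

definition ito :: "real \<times> (real => real) => real => 'a => real" where
  "ito x t \<omega> = Y x t \<omega> - fst x - (Lint (forcing x \<omega>) 0 t + Lint (Drift \<omega> (\<lambda>r. W x r \<omega>)) 0 t)"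

context
  fixes x assumes x: "x \<in> M2_space d"
begin

lemma Y_adapted: "adapted_on F T (Y x)"
  unfolding adapted_on_def Y_def[abs_def] using W_adapted[OF x] by auto

lemma Y_cont: "continuous_paths_on M T (Y x)"
  unfolding continuous_paths_on_def Y_def using W_path(1)[OF x] by (auto intro!: continuous_intros)

lemma W_pathwise: "\<omega> \<in> space M ==> pathwise_equation.path T (\<lambda>r. W x r \<omega>)"
  using W_path[OF x] pathwise_equation.path_def[OF pathwise] by simp

lemma Drift_W_integrable: "\<omega> \<in> space M ==> set_integrable lborel {0..T} (Drift \<omega> (\<lambda>r. W x r \<omega>))"
  by (rule pathwise_equation.drift_integrable[OF pathwise W_pathwise])

lemma ito_adapted: "adapted_on F T (ito x)"
  unfolding adapted_on_def
proof
  fix t assume t: "t \<in> {0..T}"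
  have W': "W x s \<in> borel_measurable (F t)" if "s \<in> {0..t}" for s
    using measurable_F_mono[OF W_adapted[OF x, of s], of t] that t by auto
  have "(\<lambda>\<omega>. Lint (forcing x \<omega>) 0 t) \<in> borel_measurable (F t)"
    using weighted_forcing_adapted[OF x t, of "\<lambda>_ _. 1"] by simp
  moreover have "(\<lambda>\<omega>. Lint (Drift \<omega> (\<lambda>r. W x r \<omega>)) 0 t) \<in> borel_measurable (F t)"
    using weighted_drift_adapted[OF t, of "\<lambda>_ _. 1" "W x"] W' W_path[OF x] by simp
  moreover have "Y x t \<in> borel_measurable (F t)" using Y_adapted t by (simp add: adapted_on_def)
  ultimately show "ito x t \<in> borel_measurable (F t)" unfolding ito_def[abs_def] by measurable
qed

lemma ito_cont: "continuous_paths_on M T (ito x)"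
  unfolding continuous_paths_on_def ito_def
  using Y_cont by (auto simp: continuous_paths_on_def intro!: continuous_intros continuous_on_Lint forcing_integrable[OF x] Drift_W_integrable)

lemma Y_dyadic_sums:
  "AE \<omega> in M. uniform_limit {0..T} (\<lambda>k t. simple_ito Z (2^k) (grid T k) (dyadic_int (Y x) T \<sigma> k) t \<omega>) (\<lambda>t. ito x t \<omega>) sequentially"
  using quadratic_variation_path_AE[OF T_pos, of \<sigma>] B_Z AE_space
proof eventually_elim
  case (elim \<omega>)
  note \<omega> = elim(3) and BZ = elim(2)
  interpret pathwise_equation d T c cL "Ker \<omega>" \<mu> "\<lambda>t. E t \<omega>" by (rule pathwise[OF \<omega>])
  interpret qv: quadratic_variation_path T "(norm \<sigma>)\<^sup>2" "\<lambda>t. B t \<omega>"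
    by (rule quadratic_variation_path_cong[OF elim(1) B_cont[OF \<omega>]]) (use elim(2) in auto)
  define \<beta> where "\<beta> s = (forcing x \<omega> s + drift (\<lambda>r. W x r \<omega>) s) / E s \<omega>" for s
  have fd: "set_integrable lborel {0..T} (\<lambda>s. forcing x \<omega> s + drift (\<lambda>r. W x r \<omega>) s)"
    by (rule set_integral_add(1)[OF forcing_integrable[OF x \<omega>] Drift_W_integrable[OF \<omega>]])
  have \<beta>: "set_integrable lborel {0..T} \<beta>" unfolding \<beta>_def[abs_def] by (rule div_E_integrable[OF fd])
  have Yu: "Y x t \<omega> = E t \<omega> * (fst x + Lint \<beta> 0 t)" if "t \<in> {0..T}" for t
    using W_solves(1)[OF x \<omega>] that by (auto simp: solves_def Picard_def Y_def \<beta>_def[abs_def])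
  have lim: "uniform_limit {0..T} (\<lambda>m t. \<Sum>j<2^m. Y x (grid T m j) \<omega> * incr (\<lambda>t. B t \<omega>) T m t j)
      (\<lambda>t. Y x t \<omega> - Y x 0 \<omega> - Lint (\<lambda>s. E s \<omega> * \<beta> s) 0 t) sequentially"
    by (rule qv.dyadic_sums_converge[OF _ \<beta> refl Yu]) (simp_all add: E_def)
  have E\<beta>: "E s \<omega> * \<beta> s = forcing x \<omega> s + drift (\<lambda>r. W x r \<omega>) s" for s
    using delayed_sde.E_pos[OF delayed_sde_axioms, of s \<omega>] by (simp add: \<beta>_def)
  have itoeq: "Y x t \<omega> - Y x 0 \<omega> - Lint (\<lambda>s. E s \<omega> * \<beta> s) 0 t = ito x t \<omega>" if t: "t \<in> {0..T}" for t
  proof -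
    have sub: "set_integrable lborel {0..t} p" if "set_integrable lborel {0..T} p" for p :: "real => real"
      using set_integrable_sub[OF that, of 0 t] t by auto
    have "Lint (\<lambda>s. E s \<omega> * \<beta> s) 0 t = Lint (forcing x \<omega>) 0 t + Lint (drift (\<lambda>r. W x r \<omega>)) 0 t"
      unfolding E\<beta> by (rule set_integral_add(2)[OF sub[OF forcing_integrable[OF x \<omega>]] sub[OF Drift_W_integrable[OF \<omega>]]])
    moreover have "Y x 0 \<omega> = fst x" using W_path(2)[OF x \<omega>] by (simp add: Y_def)
    ultimately show ?thesis by (simp add: ito_def)
  qed
  have Yc: "continuous_on {0..T} (\<lambda>t. Y x t \<omega>)" using Y_cont \<omega> by (simp add: continuous_paths_on_def)
  show ?case
  proof (rule uniform_limit_cong[THEN iffD1, OF _ _ lim])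
    show "\<forall>\<^sub>F k in sequentially. \<forall>t\<in>{0..T}. (\<Sum>j<2^k. Y x (grid T k j) \<omega> * incr (\<lambda>t. B t \<omega>) T k t j) =
        simple_ito Z (2^k) (grid T k) (dyadic_int (Y x) T \<sigma> k) t \<omega>"
      using eventually_clip_path[OF Yc]
    proof eventually_elim
      case (elim k)
      note clip = this
      show ?case
        unfolding simple_ito_def
      proof (intro ballI sum.cong refl)
        fix t j assume t: "t \<in> {0..T}" and j: "j \<in> {..<(2::nat)^k}"
        have "grid T k j \<in> {0..T}" using T j by (auto intro!: grid_nonneg grid_le_T)
        then have "clip (real k) (Y x (grid T k j) \<omega>) = Y x (grid T k j) \<omega>" using clip by blast
        moreover have "B (min t (grid T k i)) \<omega> = \<sigma> \<bullet> Z (min t (grid T k i)) \<omega>" for i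
          using BZ min_grid_bounds(1)[OF T t] by blast
        ultimately show "Y x (grid T k j) \<omega> * incr (\<lambda>t. B t \<omega>) T k t j =
          dyadic_int (Y x) T \<sigma> k j \<omega> \<bullet> (Z (min t (grid T k (Suc j))) \<omega> - Z (min t (grid T k j)) \<omega>)"
          by (simp add: dyadic_int_def incr_def inner_diff_right right_diff_distrib)
      qed
    qed
  qed (use itoeq in auto)
qed

lemma ito_integral_Y: "ito_integral M F Z T (\<lambda>t \<omega>. Y x t \<omega> *\<^sub>R \<sigma>) (ito x)"
  unfolding ito_integral_def
proof (intro conjI ito_adapted ito_cont exI allI)
  show "progressive_on F T (\<lambda>t \<omega>. Y x t \<omega> *\<^sub>R \<sigma>)"
    unfolding progressive_on_def
  proof
    fix t assume t: "t \<in> {0..T}"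
    have "(\<lambda>(s, \<omega>). Y x s \<omega>) \<in> borel_measurable (Q t)"
    proof (rule jointly_measurable[OF t])
      show "Y x s \<in> borel_measurable (F t)" if "s \<in> {0..t}" for s
        using Y_adapted that t measurable_F_mono[of "Y x s" s borel t] by (auto simp: adapted_on_def)
      show "continuous_on {0..t} (\<lambda>s. Y x s \<omega>)" if "\<omega> \<in> space M" for \<omega>
        using Y_cont that t unfolding continuous_paths_on_def by (auto elim!: continuous_on_subset dest: bspec)
    qed
    then have [measurable]: "(\<lambda>q. Y x (fst q) (snd q)) \<in> borel_measurable (Q t)" by (simp add: case_prod_beta)
    show "(\<lambda>(s, \<omega>). Y x s \<omega> *\<^sub>R \<sigma>) \<in> borel_measurable (Q t)" unfolding case_prod_beta by measurable
  qed
  show "simple_integrand M F T (2^k) (grid T k) (dyadic_int (Y x) T \<sigma> k)" for k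
    by (rule dyadic_simple[OF Y_adapted T_pos])
  show "AE \<omega> in M.
    (\<lambda>k. \<integral>\<^sup>+t\<in>{0..T}. ennreal ((norm (simple_process (2^k) (grid T k) (dyadic_int (Y x) T \<sigma> k) t \<omega> - Y x t \<omega> *\<^sub>R \<sigma>))\<^sup>2) \<partial>lborel) \<longlonglongrightarrow> 0 \<and>
    uniform_limit {0..T} (\<lambda>k t. simple_ito Z (2^k) (grid T k) (dyadic_int (Y x) T \<sigma> k) t \<omega>) (\<lambda>t. ito x t \<omega>) sequentially"
    using Y_dyadic_sums AE_space
  proof eventually_elim
    case (elim \<omega>)
    have "continuous_on {0..T} (\<lambda>t. Y x t \<omega>)" using Y_cont elim(2) by (simp add: continuous_paths_on_def)
    from dyadic_process_converges[where y="Y x" and \<omega>=\<omega>, OF this T_pos] elim(1) show ?case by blast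
  qed
qed

lemma Y_equation:
  assumes \<omega>: "\<omega> \<in> space M" and t: "t \<in> {0..T}"
  shows "Y x t \<omega> = fst x + \<mu> * Lint (\<lambda>u. Y x u \<omega>) 0 t
    + Lint (delay_ext d T (Ker \<omega>) (extend_past (snd x) (\<lambda>s. Y x s \<omega>))) 0 t + ito x t \<omega>"
proof -
  interpret pathwise_equation d T c cL "Ker \<omega>" \<mu> "\<lambda>t. E t \<omega>" by (rule pathwise[OF \<omega>])
  let ?w = "\<lambda>r. W x r \<omega>"
  let ?e = "extend_past (snd x) (\<lambda>s. Y x s \<omega>)"
  have x1: "snd x \<in> L2_space {-d..<0}" using x by (auto simp: M2_space_def)
  have Yc: "continuous_on {0..T} (\<lambda>t. Y x t \<omega>)" using Y_cont \<omega> by (simp add: continuous_paths_on_def)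
  have sub: "set_integrable lborel {0..t} p" if "set_integrable lborel {0..T} p" for p :: "real => real"
    using set_integrable_sub[OF that, of 0 t] t by auto
  have iY: "set_integrable lborel {0..t} (\<lambda>s. \<mu> * Y x s \<omega>)"
    using Yc by (intro sub borel_integrable_atLeastAtMost' continuous_intros)
  have iL: "set_integrable lborel {0..t} (Lx ?e)" by (rule sub[OF Lx_integrable[OF extend_past_L2(1)[OF x1 Yc d T]]])
  have if': "set_integrable lborel {0..t} (forcing x \<omega>)" by (rule sub[OF forcing_integrable[OF x \<omega>]])
  have id: "set_integrable lborel {0..t} (drift ?w)" by (rule sub[OF Drift_W_integrable[OF \<omega>]])
  have "AE s in lborel. s \<in> {0..T} \<longrightarrow> Lx ?e s = Lx (xbar x) s + dop (ext0 ?w) s"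
    using Lx_extend_past[OF x1 _ W_pathwise[OF \<omega>], of "\<lambda>_. fst x"] by (simp add: xbar_def Y_def)
  then have "AE s in lborel. s \<in> {0..t} \<longrightarrow> \<mu> * Y x s \<omega> + Lx ?e s = forcing x \<omega> s + drift ?w s"
    by eventually_elim (use t in \<open>auto simp: forcing_def drift_def Y_def algebra_simps\<close>)
  then have "Lint (\<lambda>s. \<mu> * Y x s \<omega> + Lx ?e s) 0 t = Lint (\<lambda>s. forcing x \<omega> s + drift ?w s) 0 t"
    by (rule Lint_cong_AE[OF set_integral_add(1)[OF iY iL] set_integral_add(1)[OF if' id]])
  then have "Lint (\<lambda>s. \<mu> * Y x s \<omega>) 0 t + Lint (Lx ?e) 0 t = Lint (forcing x \<omega>) 0 t + Lint (drift ?w) 0 t"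
    unfolding set_integral_add(2)[OF iY iL] set_integral_add(2)[OF if' id] .
  moreover have "Lint (\<lambda>s. \<mu> * Y x s \<omega>) 0 t = \<mu> * Lint (\<lambda>u. Y x u \<omega>) 0 t" by (rule set_integral_mult_right)
  ultimately show ?thesis unfolding ito_def by linarith
qed

lemma Y_strong_solution: "strong_solution M Z d T \<mu> \<sigma> \<kappa> x (Y x)"
  unfolding strong_solution_def using Y_adapted Y_cont ito_integral_Y Y_equation AE_space by (auto intro!: exI[of _ "ito x"])

end

end

section \<open>The supremum norm as a random variable\<close>

lemma bdd_above_abs_path:
  fixes f :: "real => real"
  assumes "continuous_on {0..T} f" "S \<subseteq> {0..T}" shows "bdd_above ((\<lambda>t. \<bar>f t\<bar>) ` S)"
proof -
  obtain B where "\<And>t. t \<in> {0..T} ==> \<bar>f t\<bar> \<le> B" using continuous_on_bounded[OF assms(1)] by blast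
  then show ?thesis using assms(2) by (intro bdd_aboveI[of _ B]) auto
qed

lemma abs_le_sup_norm: "continuous_on {0..T} f ==> t \<in> {0..T} ==> \<bar>f t\<bar> \<le> sup_norm T f"
  unfolding sup_norm_def by (rule cSUP_upper[OF _ bdd_above_abs_path]) auto

lemma sup_norm_le: "T \<ge> 0 ==> (\<And>t. t \<in> {0..T} ==> \<bar>f t\<bar> \<le> b) ==> sup_norm T f \<le> b"
  unfolding sup_norm_def by (rule cSUP_least) auto

lemma sup_norm_nonneg: "T \<ge> 0 ==> continuous_on {0..T} f ==> 0 \<le> sup_norm T f"
  using abs_le_sup_norm[of T f 0] by simp

lemma powr_2_eq_sq: "a \<ge> 0 ==> a powr 2 = (a::real)\<^sup>2"
  by (cases "a = 0") (simp_all add: powr_numeral)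

text \<open>For continuous paths the supremum may be taken over the countably many dyadic
  times.\<close>

lemma sup_norm_measurable:
  assumes T: "T > 0" and y: "\<And>t. t \<in> {0..T} ==> y t \<in> borel_measurable M" and c: "continuous_paths_on M T y"
  shows "(\<lambda>\<omega>. sup_norm T (\<lambda>t. y t \<omega>)) \<in> borel_measurable M"
proof -
  define I where "I = (\<Union>m. grid T m ` {..<2^m})"
  have I: "countable I" "I \<subseteq> {0..T}" "I \<noteq> {}"
    using T by (auto simp: I_def lessThan_empty_iff intro!: grid_nonneg grid_le_T)
  have yc: "continuous_on {0..T} (\<lambda>t. y t \<omega>)" if "\<omega> \<in> space M" for \<omega> using c that by (simp add: continuous_paths_on_def)
  have "(\<lambda>\<omega>. SUP t\<in>I. \<bar>y t \<omega>\<bar>) \<in> borel_measurable M"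
  proof (rule borel_measurable_cSUP[OF I(1)])
    show "(\<lambda>\<omega>. \<bar>y t \<omega>\<bar>) \<in> borel_measurable M" if "t \<in> I" for t using y[of t] that I(2) by auto
    show "bdd_above ((\<lambda>t. \<bar>y t \<omega>\<bar>) ` I)" if "\<omega> \<in> space M" for \<omega> by (rule bdd_above_abs_path[OF yc[OF that] I(2)])
  qed
  then show ?thesis
  proof (rule measurable_cong[THEN iffD1, rotated])
    fix \<omega> assume \<omega>: "\<omega> \<in> space M"
    let ?s = "SUP t\<in>I. \<bar>y t \<omega>\<bar>"
    have "sup_norm T (\<lambda>t. y t \<omega>) \<le> ?s"
    proof (rule sup_norm_le[OF less_imp_le[OF T]], rule field_le_epsilon)
      fix t e :: real assume t: "t \<in> {0..T}" and e: "e > 0"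
      obtain k where k: "\<forall>s\<in>{0..T}. \<forall>u\<in>{0..T}. \<bar>s - u\<bar> \<le> T / 2^k \<longrightarrow> \<bar>y s \<omega> - y u \<omega>\<bar> < e"
        using eventually_happens[OF eventually_uniform_grid[OF yc[OF \<omega>] T e]] by auto
      obtain j where j: "j < 2^k" "\<bar>grid T k j - t\<bar> \<le> T / 2^k" using ex_near_grid[OF T t] by blast
      have gI: "grid T k j \<in> I" using j(1) by (auto simp: I_def)
      then have "\<bar>y (grid T k j) \<omega>\<bar> \<le> ?s" by (rule cSUP_upper[OF _ bdd_above_abs_path[OF yc[OF \<omega>] I(2)]])
      moreover have "\<bar>y (grid T k j) \<omega> - y t \<omega>\<bar> < e" using k t j(2) gI I(2) by blast
      ultimately show "\<bar>y t \<omega>\<bar> \<le> ?s + e" by linarith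
    qed
    moreover have "?s \<le> sup_norm T (\<lambda>t. y t \<omega>)"
      using I(2) by (intro cSUP_least[OF I(3)] abs_le_sup_norm[OF yc[OF \<omega>]]) auto
    ultimately show "?s = sup_norm T (\<lambda>t. y t \<omega>)" by simp
  qed
qed

section \<open>Uniqueness\<close>

context delayed_sde
begin

text \<open>Lets the initial value be read off from the equation. Then the difference of two
  solutions vanishes at 0 and has a continuous prolongation into the past.\<close>

lemma ito_integral_0:
  assumes I: "ito_integral M F Z T H I" shows "AE \<omega> in M. I 0 \<omega> = 0"
proof -
  obtain m \<tau> \<xi> where s: "\<And>k. simple_integrand M F T (m k) (\<tau> k) (\<xi> k)"
    and lim: "AE \<omega> in M. uniform_limit {0..T} (\<lambda>k t. simple_ito Z (m k) (\<tau> k) (\<xi> k) t \<omega>) (\<lambda>t. I t \<omega>) sequentially"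
    using I unfolding ito_integral_def by (auto simp: AE_conj_iff)
  have 0: "simple_ito Z (m k) (\<tau> k) (\<xi> k) 0 \<omega> = 0" for k \<omega>
    unfolding simple_ito_def
  proof (intro sum.neutral ballI)
    fix j assume "j \<in> {..<m k}"
    then have "0 \<le> \<tau> k j" "0 \<le> \<tau> k (Suc j)" using simple_integrandD(2)[OF s[of k]] by auto
    then show "\<xi> k j \<omega> \<bullet> (Z (min 0 (\<tau> k (Suc j))) \<omega> - Z (min 0 (\<tau> k j)) \<omega>) = 0" by (simp add: min_absorb1)
  qed
  from lim show ?thesis
  proof eventually_elim
    case (elim \<omega>)
    have "(\<lambda>k. simple_ito Z (m k) (\<tau> k) (\<xi> k) 0 \<omega>) \<longlonglongrightarrow> I 0 \<omega>"
      by (rule tendsto_uniform_limitI[OF elim]) (use T_pos in simp)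
    then have "(\<lambda>k. 0) \<longlonglongrightarrow> I 0 \<omega>" unfolding 0 .
    then show ?case by (simp add: LIMSEQ_const_iff)
  qed
qed

lemma LpC_2_dominates:
  assumes y: "y \<in> LpC_space M 2 T"
  shows "integrable M (\<lambda>\<omega>. (sup_norm T (\<lambda>t. y t \<omega>))\<^sup>2)"
    "\<And>\<omega> t. \<omega> \<in> space M ==> t \<in> {0..T} ==> (y t \<omega>)\<^sup>2 \<le> (sup_norm T (\<lambda>t. y t \<omega>))\<^sup>2"
proof -
  have c: "continuous_on {0..T} (\<lambda>t. y t \<omega>)" if "\<omega> \<in> space M" for \<omega> using y that by (simp add: LpC_space_def continuous_paths_on_def)
  have "integrable M (\<lambda>\<omega>. sup_norm T (\<lambda>t. y t \<omega>) powr 2)" using y by (simp add: LpC_space_def)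
  then show "integrable M (\<lambda>\<omega>. (sup_norm T (\<lambda>t. y t \<omega>))\<^sup>2)"
    by (rule Bochner_Integration.integrable_cong[THEN iffD1, rotated 2])
      (use T_pos c in \<open>auto intro!: powr_2_eq_sq sup_norm_nonneg\<close>)
  show "(y t \<omega>)\<^sup>2 \<le> (sup_norm T (\<lambda>t. y t \<omega>))\<^sup>2" if "\<omega> \<in> space M" "t \<in> {0..T}" for \<omega> t
    using abs_le_sup_norm[OF c[OF that(1)] that(2)] abs_le_square_iff[of "y t \<omega>" "sup_norm T (\<lambda>t. y t \<omega>)"] by simp
qed

lemma strong_solution_unique:
  assumes x: "x \<in> M2_space d"
    and s1: "strong_solution M Z d T \<mu> \<sigma> \<kappa> x y1" "y1 \<in> LpC_space M 2 T"
    and s2: "strong_solution M Z d T \<mu> \<sigma> \<kappa> x y2" "y2 \<in> LpC_space M 2 T"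
  shows "AE \<omega> in M. \<forall>t\<in>{0..T}. y1 t \<omega> = y2 t \<omega>"
proof -
  let ?eq = "\<lambda>y I \<omega>. \<forall>t\<in>{0..T}. y t \<omega> = fst x + \<mu> * Lint (\<lambda>u. y u \<omega>) 0 t
    + Lint (delay_ext d T (Ker \<omega>) (extend_past (snd x) (\<lambda>s. y s \<omega>))) 0 t + I t \<omega>"
  obtain I1 where I1: "ito_integral M F Z T (\<lambda>t \<omega>. y1 t \<omega> *\<^sub>R \<sigma>) I1" and e1: "AE \<omega> in M. ?eq y1 I1 \<omega>"
    using s1(1) unfolding strong_solution_def by blast
  obtain I2 where I2: "ito_integral M F Z T (\<lambda>t \<omega>. y2 t \<omega> *\<^sub>R \<sigma>) I2" and e2: "AE \<omega> in M. ?eq y2 I2 \<omega>"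
    using s2(1) unfolding strong_solution_def by blast
  have y1: "adapted_on F T y1" "continuous_paths_on M T y1" and y2: "adapted_on F T y2" "continuous_paths_on M T y2"
    using s1(1) s2(1) by (simp_all add: strong_solution_def)
  have x1: "snd x \<in> L2_space {-d..<0}" using x by (auto simp: M2_space_def)
  define v where "v t \<omega> = y1 t \<omega> - y2 t \<omega>" for t \<omega>
  have vm: "v t \<in> borel_measurable M" if "t \<in> {0..T}" for t
    using that s1(2) s2(2) unfolding v_def[abs_def] by (intro borel_measurable_diff) (simp_all add: LpC_space_def)
  have vc: "continuous_paths_on M T v"
    using y1(2) y2(2) by (auto simp: continuous_paths_on_def v_def intro!: continuous_intros)
  define A where "A = T * (2 * \<mu>\<^sup>2 + 2 * cL\<^sup>2)"
  have A0: "A \<ge> 0" using T_pos by (simp add: A_def)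
  \<comment> \<open>The difference of the two equations at a fixed time: the common datum cancels,
    leaving the drift of \<open>v\<close> and the difference of the two integrals.\<close>
  have pw: "AE \<omega> in M. \<forall>t\<in>{0..T}. (v t \<omega>)\<^sup>2 \<le> 2 * (A * Lint (\<lambda>s. (v s \<omega>)\<^sup>2) 0 t) + 2 * (I1 t \<omega> - I2 t \<omega>)\<^sup>2"
    using e1 e2 ito_integral_0[OF I1] ito_integral_0[OF I2] AE_space
  proof eventually_elim
    case (elim \<omega>)
    interpret pathwise_equation d T c cL "Ker \<omega>" \<mu> "\<lambda>t. E t \<omega>" by (rule pathwise[OF elim(5)])
    let ?v = "\<lambda>t. v t \<omega>" and ?z1 = "Lx (extend_past (snd x) (\<lambda>s. y1 s \<omega>))" and ?z2 = "Lx (extend_past (snd x) (\<lambda>s. y2 s \<omega>))"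
    have c1: "continuous_on {0..T} (\<lambda>t. y1 t \<omega>)" and c2: "continuous_on {0..T} (\<lambda>t. y2 t \<omega>)"
      using y1(2) y2(2) elim(5) by (simp_all add: continuous_paths_on_def)
    have "y1 0 \<omega> = fst x" "y2 0 \<omega> = fst x"
      using elim(1,2)[rule_format, of 0, unfolded Lint_singleton] elim(3,4) T by simp_all
    then have pv: "path ?v" using c1 c2 by (auto simp: path_def v_def intro!: continuous_intros)
    have ae: "AE s in lborel. s \<in> {0..T} \<longrightarrow> ?z1 s = ?z2 s + dop (ext0 ?v) s"
      using Lx_extend_past[OF x1 c2 pv] by (simp add: v_def)
    show ?case
    proof
      fix t assume t: "t \<in> {0..T}"
      have sub: "set_integrable lborel {0..t} p" if "set_integrable lborel {0..T} p" for p :: "real => real"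
        using set_integrable_sub[OF that, of 0 t] t by auto
      have i1: "set_integrable lborel {0..t} (\<lambda>s. \<mu> * y1 s \<omega>)"
        by (intro sub borel_integrable_atLeastAtMost' continuous_intros c1)
      have i2: "set_integrable lborel {0..t} (\<lambda>s. \<mu> * y2 s \<omega>)"
        by (intro sub borel_integrable_atLeastAtMost' continuous_intros c2)
      have iz1: "set_integrable lborel {0..t} ?z1" and iz2: "set_integrable lborel {0..t} ?z2"
        by (intro sub Lx_integrable extend_past_L2(1)[OF x1 _ d T] c1 c2)+
      note a1 = set_integral_add[OF i1 iz1] and a2 = set_integral_add[OF i2 iz2]
      have "Lint (\<lambda>s. (\<mu> * y1 s \<omega> + ?z1 s) - (\<mu> * y2 s \<omega> + ?z2 s)) 0 t = Lint (drift ?v) 0 t"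
      proof (rule Lint_cong_AE[OF set_integral_diff(1)[OF a1(1) a2(1)] sub[OF drift_integrable[OF pv]]])
        show "AE s in lborel. s \<in> {0..t} \<longrightarrow> (\<mu> * y1 s \<omega> + ?z1 s) - (\<mu> * y2 s \<omega> + ?z2 s) = drift ?v s"
          using ae by eventually_elim (use t in \<open>auto simp: drift_def v_def algebra_simps\<close>)
      qed
      then have "(Lint (\<lambda>s. \<mu> * y1 s \<omega>) 0 t + Lint ?z1 0 t) - (Lint (\<lambda>s. \<mu> * y2 s \<omega>) 0 t + Lint ?z2 0 t) = Lint (drift ?v) 0 t"
        by (simp only: Lint_diff[OF a1(1) a2(1)] a1(2) a2(2))
      moreover have "Lint (\<lambda>s. \<mu> * y1 s \<omega>) 0 t = \<mu> * Lint (\<lambda>s. y1 s \<omega>) 0 t" "Lint (\<lambda>s. \<mu> * y2 s \<omega>) 0 t = \<mu> * Lint (\<lambda>s. y2 s \<omega>) 0 t"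
        by (rule set_integral_mult_right)+
      ultimately have "v t \<omega> = Lint (drift ?v) 0 t + (I1 t \<omega> - I2 t \<omega>)"
        using elim(1,2)[rule_format, OF t] unfolding v_def by linarith
      then have "(v t \<omega>)\<^sup>2 \<le> 2 * (Lint (drift ?v) 0 t)\<^sup>2 + 2 * (I1 t \<omega> - I2 t \<omega>)\<^sup>2" by (simp only: sq_add_le)
      moreover have "(Lint (drift ?v) 0 t)\<^sup>2 \<le> A * Lint (\<lambda>s. (v s \<omega>)\<^sup>2) 0 t"
        using Lint_drift_sq_le[OF pv t] by (simp add: A_def mult.assoc)
      ultimately show "(v t \<omega>)\<^sup>2 \<le> 2 * (A * Lint (\<lambda>s. (v s \<omega>)\<^sup>2) 0 t) + 2 * (I1 t \<omega> - I2 t \<omega>)\<^sup>2" by linarith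
    qed
  qed
  \<comment> \<open>Membership in \<open>LpC_space M 2 T\<close> supplies an integrable majorant,
    used in \<open>ito_diff_bound\<close> and as the a priori bound in the Gronwall
    argument.\<close>
  define g where "g \<omega> = 2 * (sup_norm T (\<lambda>t. y1 t \<omega>))\<^sup>2 + 2 * (sup_norm T (\<lambda>t. y2 t \<omega>))\<^sup>2" for \<omega>
  have gi: "integrable M g" unfolding g_def[abs_def] using LpC_2_dominates(1)[OF s1(2)] LpC_2_dominates(1)[OF s2(2)] by simp
  have vg: "(y1 t \<omega> - y2 t \<omega>)\<^sup>2 \<le> g \<omega>" if "\<omega> \<in> space M" "t \<in> {0..T}" for \<omega> t
    using sq_add_le[of "y1 t \<omega>" "- y2 t \<omega>"] LpC_2_dominates(2)[OF s1(2) that] LpC_2_dominates(2)[OF s2(2) that]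
    unfolding g_def by simp
  have g0: "g \<omega> \<ge> 0" for \<omega> by (simp add: g_def)
  have "AE \<omega> in M. \<forall>t\<in>{0..T}. v t \<omega> = 0"
  proof (rule second_moment_Gronwall[OF vm vc T_pos])
    show "0 \<le> 2 * A + 2 * (norm \<sigma>)\<^sup>2" "0 \<le> expectation g" using A0 g0 by auto
    fix t assume t: "t \<in> {0..T}"
    have "(\<integral>\<^sup>+\<omega>. ennreal ((v t \<omega>)\<^sup>2) \<partial>M) \<le> (\<integral>\<^sup>+\<omega>. ennreal (g \<omega>) \<partial>M)"
      using vg t by (intro nn_integral_mono ennreal_leI) (simp add: v_def)
    also have "... = ennreal (expectation g)" by (rule nn_integral_eq_integral[OF gi]) (simp add: g0)
    finally show "(\<integral>\<^sup>+\<omega>. ennreal ((v t \<omega>)\<^sup>2) \<partial>M) \<le> ennreal (expectation g)" .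
    have Lm: "(\<lambda>\<omega>. Lint (\<lambda>s. (v s \<omega>)\<^sup>2) 0 t) \<in> borel_measurable M" by (rule Lint_sq_measurable[OF vm vc T_pos t])
    have L0: "0 \<le> Lint (\<lambda>s. (v s \<omega>)\<^sup>2) 0 t" for \<omega> by (rule Lint_nonneg) simp
    have "I1 t \<in> borel_measurable (F t)" "I2 t \<in> borel_measurable (F t)"
      using I1 I2 t by (simp_all add: ito_integral_def adapted_on_def)
    then have Im: "(\<lambda>\<omega>. (I1 t \<omega> - I2 t \<omega>)\<^sup>2) \<in> borel_measurable M"
      using measurable_F_M by (intro borel_measurable_power borel_measurable_diff)
    let ?L = "\<integral>\<^sup>+\<omega>. ennreal (Lint (\<lambda>s. (v s \<omega>)\<^sup>2) 0 t) \<partial>M"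
    have "(\<integral>\<^sup>+\<omega>. ennreal ((v t \<omega>)\<^sup>2) \<partial>M) \<le>
        (\<integral>\<^sup>+\<omega>. ennreal (2 * A) * ennreal (Lint (\<lambda>s. (v s \<omega>)\<^sup>2) 0 t) + ennreal 2 * ennreal ((I1 t \<omega> - I2 t \<omega>)\<^sup>2) \<partial>M)"
    proof (rule nn_integral_mono_AE)
      show "AE \<omega> in M. ennreal ((v t \<omega>)\<^sup>2) \<le> ennreal (2 * A) * ennreal (Lint (\<lambda>s. (v s \<omega>)\<^sup>2) 0 t) + ennreal 2 * ennreal ((I1 t \<omega> - I2 t \<omega>)\<^sup>2)"
        using pw
      proof eventually_elim
        case (elim \<omega>)
        have "ennreal ((v t \<omega>)\<^sup>2) \<le> ennreal ((2 * A) * Lint (\<lambda>s. (v s \<omega>)\<^sup>2) 0 t + 2 * (I1 t \<omega> - I2 t \<omega>)\<^sup>2)"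
          using elim t by (intro ennreal_leI) (simp only: mult.assoc)
        also have "... = ennreal ((2 * A) * Lint (\<lambda>s. (v s \<omega>)\<^sup>2) 0 t) + ennreal (2 * (I1 t \<omega> - I2 t \<omega>)\<^sup>2)"
          using A0 L0[of \<omega>] by (intro ennreal_plus) auto
        also have "... = ennreal (2 * A) * ennreal (Lint (\<lambda>s. (v s \<omega>)\<^sup>2) 0 t) + ennreal 2 * ennreal ((I1 t \<omega> - I2 t \<omega>)\<^sup>2)"
          using A0 L0[of \<omega>] by (intro arg_cong2[where f="(+)"] ennreal_mult) auto
        finally show ?case .
      qed
    qed
    also have "... = ennreal (2 * A) * ?L + ennreal 2 * (\<integral>\<^sup>+\<omega>. ennreal ((I1 t \<omega> - I2 t \<omega>)\<^sup>2) \<partial>M)"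
      using Lm Im by (subst nn_integral_add) (auto simp: nn_integral_cmult)
    also have "... \<le> ennreal (2 * A) * ?L + ennreal 2 * (ennreal ((norm \<sigma>)\<^sup>2) * ?L)"
      using ito_diff_bound[OF I1 y1 I2 y2 T_pos t gi vg] unfolding v_def by (intro add_left_mono mult_left_mono) auto
    also have "... = ennreal (2 * A + 2 * (norm \<sigma>)\<^sup>2) * ?L"
      using A0 by (simp add: ennreal_plus ennreal_mult distrib_right mult.assoc)
    finally show "(\<integral>\<^sup>+\<omega>. ennreal ((v t \<omega>)\<^sup>2) \<partial>M) \<le> ennreal (2 * A + 2 * (norm \<sigma>)\<^sup>2) * ?L" .
  qed
  then show ?thesis by (simp add: v_def)
qed

end

section \<open>Moments and continuous dependence\<close>

text \<open>A point of level \<open>n\<close> is reached from 0 by at most one increment of each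
  level. The partial sums of the powers of 3/4 are \<open>4 - 3 * (3/4)^n\<close>, which explains
  the total \<open>4 * \<rho>\<close>.\<close>

lemma dyadic_chaining:
  fixes f :: "real => real"
  assumes h: "h > 0" and f: "continuous_on {0..h} f" and \<rho>: "\<rho> \<ge> 0"
    and inc: "\<And>n l. l < 2^n ==> \<bar>f (grid h n (Suc l)) - f (grid h n l)\<bar> \<le> \<rho> * (3/4)^n"
    and t: "t \<in> {0..h}"
  shows "\<bar>f t - f 0\<bar> \<le> 4 * \<rho>"
proof -
  have dyadic: "\<bar>f (grid h n l) - f 0\<bar> \<le> \<rho> * (4 - 3 * (3/4)^n)" if "l \<le> 2^n" for n l
    using that
  proof (induction n arbitrary: l)
    case 0
    then have "l = 0 \<or> l = 1" by auto
    then show ?case using inc[of 0 0] \<rho> by auto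
  next
    case (Suc n)
    have fine: "grid h (Suc n) (2 * i) = grid h n i" for i by (simp add: grid_def)
    have half: "\<rho> * (4 - 3 * (3/4)^n) + \<rho> * (3/4)^Suc n = \<rho> * (4 - 3 * (3/4)^Suc n)" by (simp add: algebra_simps)
    define a where "a = \<rho> * (3/4)^Suc n"
    have a0: "a \<ge> 0" using \<rho> by (simp add: a_def)
    show ?case
    proof (cases "even l")
      case True
      then obtain i where i: "l = 2 * i" by blast
      then have "\<bar>f (grid h (Suc n) l) - f 0\<bar> \<le> \<rho> * (4 - 3 * (3/4)^n)" using Suc by (simp only: i fine) simp
      then show ?thesis using half a0 unfolding a_def by linarith
    next
      case False
      then obtain i where i: "l = 2 * i + 1" by (rule oddE)
      then have "\<bar>f (grid h n i) - f 0\<bar> \<le> \<rho> * (4 - 3 * (3/4)^n)" using Suc by simp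
      moreover have "\<bar>f (grid h (Suc n) l) - f (grid h n i)\<bar> \<le> \<rho> * (3/4)^Suc n"
        using inc[of "2 * i" "Suc n"] Suc.prems by (simp add: i fine del: power_Suc)
      ultimately show ?thesis using half by linarith
    qed
  qed
  show ?thesis
  proof (rule field_le_epsilon)
    fix e :: real assume e: "e > 0"
    obtain k where k: "\<forall>s\<in>{0..h}. \<forall>u\<in>{0..h}. \<bar>s - u\<bar> \<le> h / 2^k \<longrightarrow> \<bar>f s - f u\<bar> < e"
      using eventually_happens[OF eventually_uniform_grid[OF f h e]] by auto
    obtain j where j: "j < 2^k" "\<bar>grid h k j - t\<bar> \<le> h / 2^k" using ex_near_grid[OF h t] by blast
    have "grid h k j \<in> {0..h}" using h j(1) by (auto intro!: grid_nonneg grid_le_T)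
    then have "\<bar>f (grid h k j) - f t\<bar> < e" using k t j(2) by blast
    moreover have "\<bar>f (grid h k j) - f 0\<bar> \<le> \<rho> * (4 - 3 * (3/4)^k)" using dyadic j(1) by simp
    moreover have "\<rho> * (4 - 3 * (3/4)^k) \<le> \<rho> * 4" using \<rho> by (intro mult_left_mono) auto
    ultimately show "\<bar>f t - f 0\<bar> \<le> 4 * \<rho> + e" by linarith
  qed
qed

lemma xbar_diff:
  "xbar (fst x - fst x', \<lambda>s. snd x s - snd x' s) = (\<lambda>s. 1 * xbar x s + (- 1) * xbar x' s)"
  by (auto simp: xbar_def extend_past_def)

lemma M2_space_diff:
  assumes "x \<in> M2_space d" "x' \<in> M2_space d" shows "(fst x - fst x', \<lambda>s. snd x s - snd x' s) \<in> M2_space d"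
  using assms L2_space_diff[of "snd x" "{-d..<0}" "snd x'"] by (auto simp: M2_space_def)

lemma M2_norm_nonneg: "0 \<le> M2_norm d x"
  by (simp add: M2_norm_def)

lemma abs_fst_le_M2_norm: "\<bar>fst x\<bar> \<le> M2_norm d x"
  unfolding M2_norm_def by (rule real_le_rsqrt) simp

lemma exp_minus_2_le: "exp (- 2) \<le> (1/4 :: real)"
proof -
  have "(2::real) \<le> exp 1" using exp_ge_add_one_self[of 1] by simp
  then have "2 * 2 \<le> exp 1 * exp (1::real)" by (intro mult_mono) auto
  then have "4 \<le> exp (2::real)" by (simp add: exp_add[symmetric])
  then show ?thesis by (simp add: exp_minus field_simps)
qed

section \<open>Oscillation over dyadic cells and moments of the growth factor\<close>

context delayed_sde
begin

text \<open>The ratio 3/4 lies between \<open>1 / sqrt 2\<close>, the rate at which typical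
  increments shrink per level, and 1. It is large enough for the probabilities to decay in
  \<open>j\<close> and small enough for the chaining sum to converge.\<close>

definition bad :: "real => nat => nat => 'a set" where
  "bad \<rho> k j = (\<Union>i<2^(k + j). {\<omega>\<in>space M. \<bar>B (grid T (k + j) (Suc i)) \<omega> - B (grid T (k + j) i) \<omega>\<bar> > \<rho> * (3/4)^j})"

lemma grid_in: "i \<le> 2^m ==> grid T m i \<in> {0..T}"
  using T_pos by (auto intro!: grid_nonneg grid_le_T)

lemma B_measurable: "t \<in> {0..T} ==> B t \<in> borel_measurable M"
  using B_adapted measurable_F_M by blast

lemma sets_bad1: "i < 2^m ==> {\<omega>\<in>space M. \<bar>B (grid T m (Suc i)) \<omega> - B (grid T m i) \<omega>\<bar> > l} \<in> sets M"
  using B_measurable[OF grid_in[of "Suc i" m]] B_measurable[OF grid_in[of i m]] by measurable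

lemma sets_bad [measurable]: "bad \<rho> k j \<in> sets M"
  unfolding bad_def by (intro sets.finite_UN) (auto intro: sets_bad1)

text \<open>Adding 1 keeps the variance bound positive when the volatility vector vanishes.\<close>

definition "varS = (norm \<sigma>)\<^sup>2 + 1"

text \<open>Threshold and variance combine to an exponent proportional to \<open>(9/8)^j\<close>,
  which is at least \<open>1 + j / 8\<close> by Bernoulli's inequality. Since \<open>q\<close> is at
  least 16, level \<open>j\<close> gains a factor \<open>exp (- 2)^j\<close>, at most
  \<open>(1/4)^j\<close>, against the \<open>2^j\<close> additional increments of that
  level.\<close>

lemma prob_bad:
  assumes \<rho>: "\<rho> > 0" and \<kappa>: "\<rho>\<^sup>2 / (2 * varS * T) \<ge> 16"
  shows "prob (bad \<rho> k j) \<le> 2 * 2^k * exp (- (\<rho>\<^sup>2 / (2 * varS * T)) * 2^k) * (1/2)^j"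
proof -
  define q where "q = \<rho>\<^sup>2 / (2 * varS * T)"
  have S: "varS > 0" "(norm \<sigma>)\<^sup>2 \<le> varS" by (auto simp: varS_def add_nonneg_pos)
  have single: "prob {\<omega>\<in>space M. \<bar>B (grid T (k + j) (Suc i)) \<omega> - B (grid T (k + j) i) \<omega>\<bar> > \<rho> * (3/4)^j} \<le> 2 * exp (- (q * 2^k * (9/8)^j))"
    if i: "i < 2^(k + j)" for i
  proof -
    let ?t = "grid T (k + j) (Suc i)" and ?s = "grid T (k + j) i"
    have st: "?s \<in> {0..T}" "?t \<in> {0..T}" "?s < ?t" "?t - ?s = T / 2^(k + j)"
      using grid_in[of i "k + j"] grid_in[of "Suc i" "k + j"] i T_pos unfolding grid_Suc by auto
    have [measurable]: "Z ?t \<in> borel_measurable M" "Z ?s \<in> borel_measurable M" using st Z_measurable by auto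
    have "prob {\<omega>\<in>space M. \<bar>B ?t \<omega> - B ?s \<omega>\<bar> > \<rho> * (3/4)^j} = prob {\<omega>\<in>space M. \<bar>\<sigma> \<bullet> (Z ?t \<omega> - Z ?s \<omega>)\<bar> > \<rho> * (3/4)^j}"
    proof (rule measure_eq_AE)
      show "AE \<omega> in M. \<omega> \<in> {\<omega>\<in>space M. \<bar>B ?t \<omega> - B ?s \<omega>\<bar> > \<rho> * (3/4)^j} \<longleftrightarrow> \<omega> \<in> {\<omega>\<in>space M. \<bar>\<sigma> \<bullet> (Z ?t \<omega> - Z ?s \<omega>)\<bar> > \<rho> * (3/4)^j}"
        using B_Z by eventually_elim (use st in \<open>simp add: inner_diff_right\<close>)
    qed (use sets_bad1[OF i] in auto)
    also have "... \<le> 2 * exp (- (\<rho> * (3/4)^j)\<^sup>2 / (2 * varS * (?t - ?s)))"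
      using st \<rho> by (intro increment_tail S) auto
    also have "- (\<rho> * (3/4)^j)\<^sup>2 / (2 * varS * (?t - ?s)) = - (q * 2^k * (9/8)^j)"
    proof -
      have e: "((3/4)^j)\<^sup>2 * 2^j = (9/8 :: real)^j"
        by (simp add: power_mult[symmetric] mult.commute[of j] power_mult power_mult_distrib[symmetric] power2_eq_square)
      have "(\<rho> * (3/4)^j)\<^sup>2 / (2 * varS * (T / 2^(k + j))) = q * 2^k * (((3/4)^j)\<^sup>2 * 2^j)"
        using T_pos S(1) by (simp add: q_def power_mult_distrib power_add field_simps)
      then show ?thesis unfolding st(4) e minus_divide_left[symmetric] by (simp only:)
    qed
    finally show ?thesis .
  qed
  have "prob (bad \<rho> k j) \<le> (\<Sum>i<2^(k + j). prob {\<omega>\<in>space M. \<bar>B (grid T (k + j) (Suc i)) \<omega> - B (grid T (k + j) i) \<omega>\<bar> > \<rho> * (3/4)^j})"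
    unfolding bad_def by (rule finite_measure_subadditive_finite) (auto intro: sets_bad1)
  also have "... \<le> (\<Sum>i<(2::nat)^(k + j). 2 * exp (- (q * 2^k * (9/8)^j)))" by (intro sum_mono single) simp
  also have "... = 2^(k + j) * (2 * exp (- (q * 2^k * (9/8)^j)))" by simp
  also have "... \<le> 2^(k + j) * (2 * (exp (- q * 2^k) * (1/4)^j))"
  proof -
    have q16: "q \<ge> 16" using \<kappa> by (simp add: q_def)
    have bern: "1 + real j * (1/8) \<le> (1 + 1/8 :: real)^j" by (rule Bernoulli_inequality) simp
    have "q * 2^k * (1 + real j * (1/8)) \<le> q * 2^k * (9/8)^j"
      using bern q16 by (intro mult_left_mono) auto
    moreover have "q * 2^k * (1 + real j * (1/8)) \<ge> q * 2^k + 2 * real j"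
    proof -
      have "16 * 1 \<le> q * 2^k" using q16 by (intro mult_mono) auto
      then have "16 * (real j * (1/8)) \<le> q * 2^k * (real j * (1/8))" by (intro mult_right_mono) auto
      then show ?thesis by (simp add: distrib_left)
    qed
    ultimately have "exp (- (q * 2^k * (9/8)^j)) \<le> exp (- q * 2^k + real j * (- 2))" by simp
    also have "... = exp (- q * 2^k) * exp (- 2)^j" by (simp only: exp_add exp_of_nat_mult)
    also have "... \<le> exp (- q * 2^k) * (1/4)^j"
    proof (intro mult_left_mono power_mono)
      show "exp (- 2) \<le> (1/4 :: real)" using exp_minus_2_le by simp
    qed auto
    finally show ?thesis by (intro mult_left_mono) auto
  qed
  also have "... = 2 * 2^k * exp (- q * 2^k) * (2^j * (1/4)^j)" by (simp add: power_add)
  also have "2^j * (1/4)^j = (1/2 :: real)^j" by (simp add: power_mult_distrib[symmetric])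
  finally show ?thesis by (simp add: q_def)
qed

lemma prob_Union_bad:
  assumes "\<rho> > 0" "\<rho>\<^sup>2 / (2 * varS * T) \<ge> 16"
  shows "prob (\<Union>j. bad \<rho> k j) \<le> 4 * 2^k * exp (- (\<rho>\<^sup>2 / (2 * varS * T)) * 2^k)"
proof -
  define C where "C = 2 * 2^k * exp (- (\<rho>\<^sup>2 / (2 * varS * T)) * 2^k)"
  have le: "prob (bad \<rho> k j) \<le> C * (1/2)^j" for j using prob_bad[OF assms, of k j] by (simp add: C_def)
  have s: "(\<lambda>j. C * (1/2)^j) sums (C * 2)" by (intro sums_mult) (use geometric_sums[of "1/2 :: real"] in simp)
  have sp: "summable (\<lambda>j. prob (bad \<rho> k j))"
    by (rule summable_comparison_test'[OF sums_summable[OF s]]) (use le in simp)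
  have "prob (\<Union>j. bad \<rho> k j) \<le> (\<Sum>j. prob (bad \<rho> k j))" by (rule finite_measure_subadditive_countably[OF _ sp]) auto
  also have "... \<le> (\<Sum>j. C * (1/2)^j)" by (rule suminf_le[OF le sp sums_summable[OF s]])
  also have "... = 4 * 2^k * exp (- (\<rho>\<^sup>2 / (2 * varS * T)) * 2^k)" using sums_unique[OF s] by (simp add: C_def)
  finally show ?thesis .
qed

text \<open>Two points of a cell are each within \<open>4 * \<rho>\<close> of its left endpoint by
  chaining, hence the 8 in the exponent. The deterministic term in the exponent of \<open>E\<close>
  only decreases in time.\<close>

lemma growth_off_bad:
  assumes \<omega>: "\<omega> \<in> space M" "\<omega> \<notin> (\<Union>j. bad \<rho> k j)" and \<rho>: "\<rho> > 0"
    and fine: "exp (8 * \<rho>) * (T / 2^k) * (\<bar>\<mu>\<bar> + c) \<le> 1/2"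
    and f: "set_integrable lborel {0..T} f"
    and w: "pathwise_equation.solves d T (Ker \<omega>) \<mu> (\<lambda>t. E t \<omega>) x0 f w" and t: "t \<in> {0..T}"
  shows "\<bar>w t\<bar> \<le> (5 * exp (8 * \<rho>))^(2^k) * (\<bar>x0\<bar> + Lint (\<lambda>s. \<bar>f s\<bar>) 0 T)"
proof (rule pathwise_equation.solves_growth[OF pathwise[OF \<omega>(1)] f w])
  fix i s t assume i: "i < (2::nat)^k" and s: "s \<in> {T / real (2^k) * real i..T / real (2^k) * real (i + 1)}" and t: "t \<in> {s..T / real (2^k) * real (i + 1)}"
  define h where "h = T / 2^k"
  have h: "h > 0" using T_pos by (simp add: h_def)
  define a where "a = grid T k i"
  have a: "a = T / real (2^k) * real i" "a + h = T / real (2^k) * real (i + 1)"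
    by (simp_all add: a_def h_def grid_def field_simps)
  have a0: "0 \<le> a" "a + h \<le> T"
    using grid_in[of i k] grid_in[of "Suc i" k] i unfolding grid_Suc a_def h_def by auto
  have chain: "\<bar>B u \<omega> - B a \<omega>\<bar> \<le> 4 * \<rho>" if u: "u \<in> {a..a + h}" for u
  proof -
    have "\<bar>(\<lambda>v. B (a + v) \<omega>) (u - a) - (\<lambda>v. B (a + v) \<omega>) 0\<bar> \<le> 4 * \<rho>"
    proof (rule dyadic_chaining[OF h])
      show "continuous_on {0..h} (\<lambda>v. B (a + v) \<omega>)"
        by (rule continuous_on_compose2[OF B_cont[OF \<omega>(1)]]) (use a0 in \<open>auto intro!: continuous_intros\<close>)
      fix n l :: nat assume l: "l < 2^n"
      have pt: "a + grid h n m = grid T (k + n) (i * 2^n + m)" for m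
        by (simp add: a_def h_def grid_def power_add field_simps)
      have "(i + 1) * 2^n \<le> 2^k * 2^n" using i by (intro mult_right_mono) auto
      then have "i * 2^n + l < 2^(k + n)" using l by (simp add: power_add)
      then show "\<bar>B (a + grid h n (Suc l)) \<omega> - B (a + grid h n l) \<omega>\<bar> \<le> \<rho> * (3/4)^n"
        using \<omega> unfolding pt by (auto simp: bad_def not_less)
    qed (use \<rho> u in auto)
    then show ?thesis by simp
  qed
  have "B t \<omega> - B s \<omega> \<le> 8 * \<rho>"
    using chain[of t] chain[of s] s t unfolding a(1)[symmetric] a(2)[symmetric] by auto
  moreover have "(norm \<sigma>)\<^sup>2 * s \<le> (norm \<sigma>)\<^sup>2 * t" using t by (intro mult_left_mono) auto
  ultimately show "E t \<omega> \<le> exp (8 * \<rho>) * E s \<omega>" unfolding E_def exp_add[symmetric] by simp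
qed (use \<rho> fine t in auto)

text \<open>The growth factor \<open>5 * exp (8 * \<rho>)\<close> per cell, raised to \<open>2^k\<close>, is beaten by the probability \<open>exp (- q * 2^k)\<close>
  of the bad event once \<open>\<rho>\<close> is large, because \<open>q\<close> is quadratic in \<open>\<rho>\<close>.\<close>

lemma uniform_growth:
  fixes P :: nat
  shows "\<exists>G :: 'a => ennreal. G \<in> borel_measurable M \<and> (\<integral>\<^sup>+\<omega>. G \<omega> \<partial>M) < \<infinity> \<and>
    (AE \<omega> in M. \<exists>r\<ge>1. ennreal (r^P) \<le> G \<omega> \<and> (\<forall>x0 f w t. set_integrable lborel {0..T} f \<longrightarrow>
      pathwise_equation.solves d T (Ker \<omega>) \<mu> (\<lambda>t. E t \<omega>) x0 f w \<longrightarrow> t \<in> {0..T} \<longrightarrow>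
      \<bar>w t\<bar> \<le> r * (\<bar>x0\<bar> + Lint (\<lambda>s. \<bar>f s\<bar>) 0 T)))"
proof -
  define u where "u = 2 * varS * T"
  have u: "u > 0" using T_pos by (simp add: u_def varS_def add_nonneg_pos)
  \<comment> \<open>Chosen so that \<open>q = \<rho>\<^sup>2 / u\<close> is at least
    \<open>(22 * P + 18) * \<rho>\<close>. As \<open>\<rho>\<close> is at least 1, this covers both
    16 and \<open>2 * P * (8 * \<rho> + 3) + 2\<close>, the two lower bounds on \<open>q\<close>
    used below.\<close>
  define \<rho> where "\<rho> = u * (22 * real P + 18) + 1"
  have \<rho>: "\<rho> \<ge> 1" using u by (simp add: \<rho>_def)
  define q where "q = \<rho>\<^sup>2 / u"
  have qL: "q \<ge> (22 * real P + 18) * \<rho>"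
  proof -
    have "u * (22 * real P + 18) * \<rho> \<le> \<rho> * \<rho>" using \<rho> by (intro mult_right_mono) (auto simp: \<rho>_def)
    then show ?thesis using u by (simp add: q_def power2_eq_square le_divide_eq ac_simps)
  qed
  have P\<rho>: "real P \<le> real P * \<rho>" using mult_left_mono[OF \<rho>, of "real P"] by simp
  have q16: "q \<ge> 16" and qP: "q \<ge> 2 * real P * (8 * \<rho> + 3) + 2"
    using qL P\<rho> \<rho> by (auto simp: algebra_simps intro: order_trans[rotated])
  define R where "R = 5 * exp (8 * \<rho>)"
  have "1 \<le> exp (8 * \<rho>)" using \<rho> by simp
  then have R1: "R \<ge> 1" unfolding R_def by linarith
  have Rle: "R \<le> exp (8 * \<rho> + 3)"
  proof -
    have "(2::real) \<le> exp 1" using exp_ge_add_one_self[of 1] by simp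
    then have "2^3 \<le> exp (1::real)^3" by (rule power_mono) simp
    then have "5 \<le> exp (3::real)" by (simp add: exp_of_nat_mult[symmetric])
    then show ?thesis unfolding R_def exp_add by (simp add: mult.commute)
  qed
  define b where "b k = (\<Union>j. bad \<rho> k j)" for k
  have bs [measurable]: "b k \<in> sets M" for k unfolding b_def by measurable
  \<comment> \<open>The growth factor of level \<open>Suc k\<close> is charged to the bad event of
    level \<open>k\<close>: that finer level comes into play only when level \<open>k\<close> has
    failed.\<close>
  have term_le: "R^(2^Suc k * P) * prob (b k) \<le> 4 * (1/2)^k" for k
  proof -
    have "R^(2^Suc k * P) * prob (b k) \<le> exp (8 * \<rho> + 3)^(2^Suc k * P) * (4 * 2^k * exp (- q * 2^k))"
      using prob_Union_bad[of \<rho> k] Rle R1 q16 \<rho> unfolding b_def q_def u_def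
      by (intro mult_mono power_mono) auto
    also have "... = 4 * 2^k * exp (real (2^Suc k * P) * (8 * \<rho> + 3) + - q * 2^k)"
      unfolding exp_add exp_of_nat_mult by simp
    also have "real (2^Suc k * P) * (8 * \<rho> + 3) + - q * 2^k = (2 * real P * (8 * \<rho> + 3) - q) * 2^k" by (simp add: algebra_simps)
    also have "4 * 2^k * exp ((2 * real P * (8 * \<rho> + 3) - q) * 2^k) \<le> 4 * 2^k * exp (real k * (- 2))"
    proof (intro mult_left_mono exp_le_cancel_iff[THEN iffD2])
      have "(2 * real P * (8 * \<rho> + 3) - q) * 2^k \<le> - 2 * 2^k" using qP by (intro mult_right_mono) auto
      also have "... \<le> - 2 * real k" using of_nat_less_two_power[of k, where 'a=real] by simp
      finally show "(2 * real P * (8 * \<rho> + 3) - q) * 2^k \<le> real k * (- 2)" by simp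
    qed auto
    also have "... = 4 * (2 * exp (- 2))^k" by (simp only: exp_of_nat_mult power_mult_distrib mult.assoc)
    also have "... \<le> 4 * (1/2)^k"
    proof (intro mult_left_mono power_mono)
      show "2 * exp (- 2) \<le> (1/2 :: real)" using exp_minus_2_le by simp
    qed auto
    finally show ?thesis .
  qed
  have hs: "summable (\<lambda>k. 4 * (1/2)^k :: real)" by (intro summable_mult summable_geometric) simp
  have "prob (b k) \<le> 4 * (1/2)^k" for k
    using term_le[of k] R1 mult_right_mono[of 1 "R^(2^Suc k * P)" "prob (b k)"] by simp
  then have "summable (\<lambda>k. prob (b k))" by (intro summable_comparison_test'[OF hs]) auto
  then have BC: "AE \<omega> in M. \<forall>\<^sub>F k in sequentially. \<omega> \<in> space M - b k"
    by (intro borel_cantelli_AE1) (auto simp: emeasure_eq_measure)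
  have "(\<lambda>k. exp (8 * \<rho>) * (T * (1/2)^k) * (\<bar>\<mu>\<bar> + c)) \<longlonglongrightarrow> exp (8 * \<rho>) * (T * 0) * (\<bar>\<mu>\<bar> + c)"
    by (intro tendsto_intros LIMSEQ_power_zero) simp
  then have "\<forall>\<^sub>F k in sequentially. exp (8 * \<rho>) * (T * (1/2)^k) * (\<bar>\<mu>\<bar> + c) < 1/2"
    by (intro order_tendstoD(2)[where y="exp (8 * \<rho>) * (T * 0) * (\<bar>\<mu>\<bar> + c)"]) auto
  then obtain k0 where k0: "\<And>k. k \<ge> k0 ==> exp (8 * \<rho>) * (T * (1/2)^k) * (\<bar>\<mu>\<bar> + c) < 1/2"
    by (auto simp: eventually_sequentially)
  \<comment> \<open>From level \<open>k0\<close> on the cells are fine enough. If \<open>k\<close>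
    is the first good level from there, then either \<open>k = k0\<close>, or level
    \<open>k - 1\<close> is bad and its term in the series is the required power. \<open>G\<close>
    serves as a measurable majorant for the power of the growth factor.\<close>
  define G where "G \<omega> = ennreal (R^(2^k0 * P)) + (\<Sum>k. ennreal (R^(2^Suc k * P)) * indicator (b k) \<omega>)" for \<omega>
  have [measurable]: "G \<in> borel_measurable M" unfolding G_def[abs_def] by measurable
  have Gint: "(\<integral>\<^sup>+\<omega>. G \<omega> \<partial>M) = ennreal (R^(2^k0 * P)) + (\<Sum>k. ennreal (R^(2^Suc k * P)) * emeasure M (b k))"
    unfolding G_def by (simp add: nn_integral_add nn_integral_suminf nn_integral_cmult emeasure_space_1)
  have "(\<Sum>k. ennreal (R^(2^Suc k * P)) * emeasure M (b k)) \<le> (\<Sum>k. ennreal (4 * (1/2)^k))"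
    using R1 term_le by (intro suminf_le) (auto simp: emeasure_eq_measure ennreal_mult[symmetric] intro!: ennreal_leI simp del: power_Suc)
  also have "... = ennreal (\<Sum>k. 4 * (1/2)^k)" by (rule suminf_ennreal2[OF _ hs]) simp
  finally have "(\<integral>\<^sup>+\<omega>. G \<omega> \<partial>M) \<le> ennreal (R^(2^k0 * P)) + ennreal (\<Sum>k. 4 * (1/2)^k)"
    unfolding Gint by (rule add_left_mono)
  then have Gfin: "(\<integral>\<^sup>+\<omega>. G \<omega> \<partial>M) < \<infinity>"
    by (rule order_le_less_trans) (unfold infinity_ennreal_def ennreal_add_less_top, intro conjI ennreal_less_top)
  have "AE \<omega> in M. \<exists>r\<ge>1. ennreal (r^P) \<le> G \<omega> \<and> (\<forall>x0 f w t. set_integrable lborel {0..T} f \<longrightarrow>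
      pathwise_equation.solves d T (Ker \<omega>) \<mu> (\<lambda>t. E t \<omega>) x0 f w \<longrightarrow> t \<in> {0..T} \<longrightarrow>
      \<bar>w t\<bar> \<le> r * (\<bar>x0\<bar> + Lint (\<lambda>s. \<bar>f s\<bar>) 0 T))"
    using BC AE_space
  proof eventually_elim
    case (elim \<omega>)
    have "\<exists>k. k \<ge> k0 \<and> \<omega> \<notin> b k" using elim(1) unfolding eventually_sequentially by (metis DiffD2 le_cases order_refl)
    then obtain k where k: "k \<ge> k0" "\<omega> \<notin> b k" and least: "\<And>j. j < k ==> \<not> (j \<ge> k0 \<and> \<omega> \<notin> b j)"
      using exists_least_iff[of "\<lambda>k. k \<ge> k0 \<and> \<omega> \<notin> b k"] by auto
    have "ennreal ((R^(2^k))^P) \<le> G \<omega>"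
    proof (cases "k = k0")
      case True
      then show ?thesis by (simp add: G_def power_mult[symmetric])
    next
      case False
      then obtain j where j: "k = Suc j" "j \<ge> k0" using k(1) by (cases k) auto
      then have "\<omega> \<in> b j" using least[of j] by auto
      then have "ennreal ((R^(2^k))^P) = ennreal (R^(2^Suc j * P)) * indicator (b j) \<omega>"
        by (simp add: j power_mult[symmetric])
      also have "... \<le> (\<Sum>k. ennreal (R^(2^Suc k * P)) * indicator (b k) \<omega>)" by (rule le_suminf_ennreal)
      also have "... \<le> G \<omega>" unfolding G_def by simp
      finally show ?thesis .
    qed
    moreover have "exp (8 * \<rho>) * (T / 2^k) * (\<bar>\<mu>\<bar> + c) \<le> 1/2"
    proof -
      have "T * (1/2)^k = T / 2^k" by (simp add: power_one_over)
      from k0[OF k(1), unfolded this] show ?thesis by (rule less_imp_le)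
    qed
    then have "\<bar>w t\<bar> \<le> R^(2^k) * (\<bar>x0\<bar> + Lint (\<lambda>s. \<bar>f s\<bar>) 0 T)"
      if "set_integrable lborel {0..T} f" "pathwise_equation.solves d T (Ker \<omega>) \<mu> (\<lambda>t. E t \<omega>) x0 f w" "t \<in> {0..T}" for x0 f w t
      using growth_off_bad[of \<omega> \<rho> k f x0 w t] that elim(2) k(2) \<rho> unfolding R_def b_def by simp
    moreover have "R^(2^k) \<ge> 1" using R1 by simp
    ultimately show ?case by blast
  qed
  then show ?thesis using Gfin \<open>G \<in> borel_measurable M\<close> by blast
qed

text \<open>Apart from one unit, this bounds the initial value plus the L^1 norm of the forcing in
  terms of the datum; the extra unit pays for the initial value added back in
  \<open>Y\<close>.\<close>

definition "data_bound = 2 + T * \<bar>\<mu>\<bar> + sqrt (T * (4 * cL\<^sup>2 * (1 + T)))"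

lemma forcing_bound:
  assumes x: "x \<in> M2_space d" and \<omega>: "\<omega> \<in> space M" and r: "r \<ge> 1"
  shows "\<bar>fst x\<bar> + r * (\<bar>fst x\<bar> + Lint (\<lambda>s. \<bar>forcing x \<omega> s\<bar>) 0 T) \<le> r * (data_bound * M2_norm d x)"
proof -
  note L = delay_ext_xbar[OF x \<omega>]
  let ?L = "delay_ext d T (Ker \<omega>) (xbar x)"
  have "Lint (\<lambda>s. \<bar>forcing x \<omega> s\<bar>) 0 T \<le> Lint (\<lambda>s. \<bar>\<mu> * fst x\<bar> + \<bar>?L s\<bar>) 0 T"
    by (intro Lint_mono set_integrable_abs forcing_integrable[OF x \<omega>] set_integral_add const_integrable L(1))
      (simp only: forcing_def abs_triangle_ineq)
  also have "... = Lint (\<lambda>s. \<bar>\<mu> * fst x\<bar>) 0 T + Lint (\<lambda>s. \<bar>?L s\<bar>) 0 T"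
    by (intro set_integral_add set_integrable_abs const_integrable L(1))
  also have "Lint (\<lambda>s. \<bar>\<mu> * fst x\<bar>) 0 T = T * \<bar>\<mu>\<bar> * \<bar>fst x\<bar>"
    using T_pos by (simp add: set_lebesgue_integral_def abs_mult)
  also have "Lint (\<lambda>s. \<bar>?L s\<bar>) 0 T \<le> sqrt (T * (4 * cL\<^sup>2 * (1 + T))) * M2_norm d x"
  proof -
    have "T * (4 * cL\<^sup>2 * ((1 + T) * (M2_norm d x)\<^sup>2)) = T * (4 * cL\<^sup>2 * (1 + T)) * (M2_norm d x)\<^sup>2" by simp
    then have "(Lint (\<lambda>s. \<bar>?L s\<bar>) 0 T)\<^sup>2 \<le> T * (4 * cL\<^sup>2 * (1 + T)) * (M2_norm d x)\<^sup>2" using L(2) by simp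
    then have "Lint (\<lambda>s. \<bar>?L s\<bar>) 0 T \<le> sqrt (T * (4 * cL\<^sup>2 * (1 + T)) * (M2_norm d x)\<^sup>2)" by (rule real_le_rsqrt)
    then show ?thesis by (simp add: real_sqrt_mult M2_norm_nonneg)
  qed
  also have "T * \<bar>\<mu>\<bar> * \<bar>fst x\<bar> \<le> T * \<bar>\<mu>\<bar> * M2_norm d x"
    using T_pos by (intro mult_left_mono abs_fst_le_M2_norm) auto
  finally have "\<bar>fst x\<bar> + Lint (\<lambda>s. \<bar>forcing x \<omega> s\<bar>) 0 T \<le> (data_bound - 1) * M2_norm d x"
    using abs_fst_le_M2_norm[of x d] by (simp add: data_bound_def algebra_simps)
  then have "r * (\<bar>fst x\<bar> + Lint (\<lambda>s. \<bar>forcing x \<omega> s\<bar>) 0 T) \<le> r * ((data_bound - 1) * M2_norm d x)"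
    using r by (intro mult_left_mono) auto
  moreover have "1 * \<bar>fst x\<bar> \<le> r * M2_norm d x" using r by (intro mult_mono abs_fst_le_M2_norm) auto
  ultimately show ?thesis by (simp add: algebra_simps)
qed

lemma data_bound_nonneg: "data_bound \<ge> 0"
  using T_pos by (simp add: data_bound_def)

text \<open>\<open>\<Gamma>\<close> is the expectation of the majorant \<open>G\<close> and hence
  the same for all data. The second estimate is the growth bound for the difference, which solves
  the equation with the difference of the forcings.\<close>

lemma moment_bound:
  fixes P :: nat
  obtains \<Gamma> where "\<Gamma> \<ge> 0"
    "\<And>x. x \<in> M2_space d ==> (\<integral>\<^sup>+\<omega>. ennreal (sup_norm T (\<lambda>t. Y x t \<omega>)^P) \<partial>M) \<le> ennreal ((data_bound * M2_norm d x)^P * \<Gamma>)"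
    "\<And>x x'. x \<in> M2_space d ==> x' \<in> M2_space d ==>
      (\<integral>\<^sup>+\<omega>. ennreal (sup_norm T (\<lambda>t. Y x t \<omega> - Y x' t \<omega>)^P) \<partial>M) \<le> ennreal ((data_bound * M2_dist d x x')^P * \<Gamma>)"
proof -
  obtain G where G: "G \<in> borel_measurable M" "(\<integral>\<^sup>+\<omega>. G \<omega> \<partial>M) < \<infinity>"
    and grow: "AE \<omega> in M. \<exists>r\<ge>1. ennreal (r^P) \<le> G \<omega> \<and> (\<forall>x0 f w t. set_integrable lborel {0..T} f \<longrightarrow>
      pathwise_equation.solves d T (Ker \<omega>) \<mu> (\<lambda>t. E t \<omega>) x0 f w \<longrightarrow> t \<in> {0..T} \<longrightarrow>
      \<bar>w t\<bar> \<le> r * (\<bar>x0\<bar> + Lint (\<lambda>s. \<bar>f s\<bar>) 0 T))" (is "AE \<omega> in M. \<exists>r\<ge>1. _ \<and> ?grow \<omega> r")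
    using uniform_growth[of P] by blast
  define \<Gamma> where "\<Gamma> = enn2real (\<integral>\<^sup>+\<omega>. G \<omega> \<partial>M)"
  have \<Gamma>: "(\<integral>\<^sup>+\<omega>. G \<omega> \<partial>M) = ennreal \<Gamma>" "\<Gamma> \<ge> 0" using G(2) by (simp_all add: \<Gamma>_def)
  have int: "(\<integral>\<^sup>+\<omega>. ennreal (sup_norm T (\<lambda>t. y t \<omega>)^P) \<partial>M) \<le> ennreal ((data_bound * n)^P * \<Gamma>)"
    if yc: "\<And>\<omega>. \<omega> \<in> space M ==> continuous_on {0..T} (\<lambda>t. y t \<omega>)" and n: "n \<ge> 0"
      and le: "\<And>\<omega> r t. \<omega> \<in> space M ==> r \<ge> 1 ==> ?grow \<omega> r ==> t \<in> {0..T} ==> \<bar>y t \<omega>\<bar> \<le> r * (data_bound * n)" for y n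
  proof -
    have "AE \<omega> in M. ennreal (sup_norm T (\<lambda>t. y t \<omega>)^P) \<le> ennreal ((data_bound * n)^P) * G \<omega>"
      using grow AE_space
    proof eventually_elim
      case (elim \<omega>)
      then obtain r where r: "r \<ge> 1" "ennreal (r^P) \<le> G \<omega>" "?grow \<omega> r" by blast
      have "sup_norm T (\<lambda>t. y t \<omega>) \<le> r * (data_bound * n)"
        using T_pos le[OF elim(2) r(1,3)] by (intro sup_norm_le) auto
      then have "sup_norm T (\<lambda>t. y t \<omega>)^P \<le> (r * (data_bound * n))^P"
        using T_pos yc[OF elim(2)] by (intro power_mono sup_norm_nonneg) auto
      then have "ennreal (sup_norm T (\<lambda>t. y t \<omega>)^P) \<le> ennreal ((data_bound * n)^P) * ennreal (r^P)"
        using n data_bound_nonneg r(1) by (subst ennreal_mult[symmetric]) (auto simp: power_mult_distrib mult.commute intro!: ennreal_leI)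
      also have "... \<le> ennreal ((data_bound * n)^P) * G \<omega>" by (intro mult_left_mono r) simp
      finally show ?case .
    qed
    then have "(\<integral>\<^sup>+\<omega>. ennreal (sup_norm T (\<lambda>t. y t \<omega>)^P) \<partial>M) \<le> (\<integral>\<^sup>+\<omega>. ennreal ((data_bound * n)^P) * G \<omega> \<partial>M)"
      by (rule nn_integral_mono_AE)
    also have "... = ennreal ((data_bound * n)^P * \<Gamma>)"
      using G(1) \<Gamma> n data_bound_nonneg by (simp add: nn_integral_cmult ennreal_mult)
    finally show ?thesis .
  qed
  show ?thesis
  proof (rule that[OF \<Gamma>(2)])
    fix x assume x: "x \<in> M2_space d"
    have Yc: "continuous_on {0..T} (\<lambda>t. Y x t \<omega>)" if "\<omega> \<in> space M" for \<omega> using Y_cont[OF x] that by (simp add: continuous_paths_on_def)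
    show "(\<integral>\<^sup>+\<omega>. ennreal (sup_norm T (\<lambda>t. Y x t \<omega>)^P) \<partial>M) \<le> ennreal ((data_bound * M2_norm d x)^P * \<Gamma>)"
    proof (rule int[OF Yc M2_norm_nonneg])
      fix \<omega> r t assume \<omega>: "\<omega> \<in> space M" and r: "r \<ge> 1" "?grow \<omega> r" and t: "t \<in> {0..T}"
      have "\<bar>W x t \<omega>\<bar> \<le> r * (\<bar>fst x\<bar> + Lint (\<lambda>s. \<bar>forcing x \<omega> s\<bar>) 0 T)"
        using r(2) forcing_integrable[OF x \<omega>] W_solves(1)[OF x \<omega>] t by blast
      then show "\<bar>Y x t \<omega>\<bar> \<le> r * (data_bound * M2_norm d x)" using forcing_bound[OF x \<omega> r(1)] unfolding Y_def by linarith
    qed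
    fix x' assume x': "x' \<in> M2_space d"
    have Yc': "continuous_on {0..T} (\<lambda>t. Y x' t \<omega>)" if "\<omega> \<in> space M" for \<omega> using Y_cont[OF x'] that by (simp add: continuous_paths_on_def)
    let ?x = "(fst x - fst x', \<lambda>s. snd x s - snd x' s)"
    have dx: "?x \<in> M2_space d" by (rule M2_space_diff[OF x x'])
    show "(\<integral>\<^sup>+\<omega>. ennreal (sup_norm T (\<lambda>t. Y x t \<omega> - Y x' t \<omega>)^P) \<partial>M) \<le> ennreal ((data_bound * M2_dist d x x')^P * \<Gamma>)"
      unfolding M2_dist_def
    proof (rule int[OF _ M2_norm_nonneg])
      show "continuous_on {0..T} (\<lambda>t. Y x t \<omega> - Y x' t \<omega>)" if "\<omega> \<in> space M" for \<omega> by (intro continuous_intros Yc Yc' that)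
      fix \<omega> r t assume \<omega>: "\<omega> \<in> space M" and r: "r \<ge> 1" "?grow \<omega> r" and t: "t \<in> {0..T}"
      interpret pathwise_equation d T c cL "Ker \<omega>" \<mu> "\<lambda>t. E t \<omega>" by (rule pathwise[OF \<omega>])
      note i = forcing_integrable[OF x \<omega>] forcing_integrable[OF x' \<omega>] and id = forcing_integrable[OF dx \<omega>]
      have "solves (fst x - fst x') (\<lambda>s. forcing x \<omega> s - forcing x' \<omega> s) (\<lambda>t. W x t \<omega> - W x' t \<omega>)"
        by (rule solves_diff[OF i W_solves(1)[OF x \<omega>] W_solves(1)[OF x' \<omega>]])
      then have "\<bar>W x t \<omega> - W x' t \<omega>\<bar> \<le> r * (\<bar>fst x - fst x'\<bar> + Lint (\<lambda>s. \<bar>forcing x \<omega> s - forcing x' \<omega> s\<bar>) 0 T)"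
        using r(2) set_integral_diff(1)[OF i] t by blast
      \<comment> \<open>The extension is linear only almost everywhere, so the forcing of the
        difference is identified under the integral.\<close>
      also have "Lint (\<lambda>s. \<bar>forcing x \<omega> s - forcing x' \<omega> s\<bar>) 0 T = Lint (\<lambda>s. \<bar>forcing ?x \<omega> s\<bar>) 0 T"
      proof (rule Lint_cong_AE[OF set_integrable_abs[OF set_integral_diff(1)[OF i]] set_integrable_abs[OF id]])
        show "AE s in lborel. s \<in> {0..T} \<longrightarrow> \<bar>forcing x \<omega> s - forcing x' \<omega> s\<bar> = \<bar>forcing ?x \<omega> s\<bar>"
          using Lx_lincomb[OF xbar_L2(1)[OF x d T] xbar_L2(1)[OF x' d T], of 1 "-1", folded xbar_diff]
          by eventually_elim (auto simp: forcing_def algebra_simps)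
      qed
      finally show "\<bar>Y x t \<omega> - Y x' t \<omega>\<bar> \<le> r * (data_bound * M2_norm d ?x)"
        using forcing_bound[OF dx \<omega> r(1)] unfolding Y_def fst_conv by linarith
    qed
  qed
qed

lemma Y_measurable: "x \<in> M2_space d ==> t \<in> {0..T} ==> Y x t \<in> borel_measurable M"
  using Y_adapted[of x] measurable_F_M[of "Y x t" t borel] by (simp add: adapted_on_def)

lemma Y_in_LpC:
  assumes x: "x \<in> M2_space d" and p: "p > 0" shows "Y x \<in> LpC_space M p T"
proof -
  \<comment> \<open>Moments were bounded for natural exponents; a real exponent is rounded up, and
    \<open>a powr p\<close> is then at most \<open>1 + a^P\<close>.\<close>
  define P where "P = nat \<lceil>p\<rceil>"
  have P: "p \<le> real P" "P > 0" using p by (auto simp: P_def)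
  let ?s = "\<lambda>\<omega>. sup_norm T (\<lambda>t. Y x t \<omega>)"
  have m [measurable]: "?s \<in> borel_measurable M" by (rule sup_norm_measurable[OF T_pos Y_measurable[OF x] Y_cont[OF x]])
  have s0: "?s \<omega> \<ge> 0" if "\<omega> \<in> space M" for \<omega> using Y_cont[OF x] T_pos that by (intro sup_norm_nonneg) (auto simp: continuous_paths_on_def)
  obtain \<Gamma> where \<Gamma>: "(\<integral>\<^sup>+\<omega>. ennreal (?s \<omega>^P) \<partial>M) \<le> ennreal ((data_bound * M2_norm d x)^P * \<Gamma>)"
    using moment_bound[of P] x by metis
  have le: "a powr p \<le> 1 + a^P" if "a \<ge> 0" for a :: real
  proof (cases "a \<le> 1")
    case True
    then have "a powr p \<le> 1" using that p by (simp add: powr_le1)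
    then show ?thesis using that by (simp add: add_increasing2)
  next
    case False
    then have "a powr p \<le> a powr real P" using P by (intro powr_mono) auto
    then show ?thesis using False by (simp add: powr_realpow)
  qed
  have "integrable M (\<lambda>\<omega>. ?s \<omega> powr p)"
  proof (rule integrableI_nonneg)
    have "(\<integral>\<^sup>+\<omega>. ennreal (?s \<omega> powr p) \<partial>M) \<le> (\<integral>\<^sup>+\<omega>. 1 + ennreal (?s \<omega>^P) \<partial>M)"
    proof (intro nn_integral_mono)
      fix \<omega> assume "\<omega> \<in> space M"
      then have "ennreal (?s \<omega> powr p) \<le> ennreal (1 + ?s \<omega>^P)" by (intro ennreal_leI le s0)
      also have "... = 1 + ennreal (?s \<omega>^P)" using s0[OF \<open>\<omega> \<in> space M\<close>] by simp
      finally show "ennreal (?s \<omega> powr p) \<le> 1 + ennreal (?s \<omega>^P)" .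
    qed
    also have "... = 1 + (\<integral>\<^sup>+\<omega>. ennreal (?s \<omega>^P) \<partial>M)" by (simp add: nn_integral_add emeasure_space_1)
    also have "... \<le> 1 + ennreal ((data_bound * M2_norm d x)^P * \<Gamma>)" by (intro add_left_mono \<Gamma>)
    also have "... < \<infinity>" by simp
    finally show "(\<integral>\<^sup>+\<omega>. ennreal (?s \<omega> powr p) \<partial>M) < \<infinity>" .
  qed auto
  then show ?thesis using Y_measurable[OF x] Y_cont[OF x] by (simp add: LpC_space_def)
qed

lemma Y_continuous_in_data:
  assumes x: "x \<in> M2_space d" and \<epsilon>: "\<epsilon> > 0"
  shows "\<exists>\<delta>>0. \<forall>x'\<in>M2_space d. M2_dist d x x' < \<delta> \<longrightarrow> LpC_norm M 2 T (\<lambda>t \<omega>. Y x t \<omega> - Y x' t \<omega>) < \<epsilon>"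
proof -
  obtain \<Gamma> where \<Gamma>: "\<Gamma> \<ge> 0"
    "\<And>x. x \<in> M2_space d ==> (\<integral>\<^sup>+\<omega>. ennreal ((sup_norm T (\<lambda>t. Y x t \<omega>))\<^sup>2) \<partial>M) \<le> ennreal ((data_bound * M2_norm d x)\<^sup>2 * \<Gamma>)"
    "\<And>x x'. x \<in> M2_space d ==> x' \<in> M2_space d ==>
      (\<integral>\<^sup>+\<omega>. ennreal ((sup_norm T (\<lambda>t. Y x t \<omega> - Y x' t \<omega>))\<^sup>2) \<partial>M) \<le> ennreal ((data_bound * M2_dist d x x')\<^sup>2 * \<Gamma>)"
    by (rule moment_bound[of 2]) (rule that)
  define L where "L = data_bound * sqrt \<Gamma>"
  have L0: "L \<ge> 0" using \<Gamma>(1) data_bound_nonneg by (simp add: L_def)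
  have le: "LpC_norm M 2 T (\<lambda>t \<omega>. Y x t \<omega> - Y x' t \<omega>) \<le> L * M2_dist d x x'" if x': "x' \<in> M2_space d" for x'
  proof -
    let ?s = "\<lambda>\<omega>. sup_norm T (\<lambda>t. Y x t \<omega> - Y x' t \<omega>)"
    have s0: "?s \<omega> \<ge> 0" if "\<omega> \<in> space M" for \<omega>
      using Y_cont[OF x] Y_cont[OF x'] T_pos that by (intro sup_norm_nonneg continuous_on_diff) (auto simp: continuous_paths_on_def)
    have dist0: "M2_dist d x x' \<ge> 0" by (simp add: M2_dist_def M2_norm_nonneg)
    have "(\<integral>\<omega>. ?s \<omega> powr 2 \<partial>M) = (\<integral>\<omega>. (?s \<omega>)\<^sup>2 \<partial>M)" by (intro Bochner_Integration.integral_cong powr_2_eq_sq s0 refl)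
    also have "... \<le> (data_bound * M2_dist d x x')\<^sup>2 * \<Gamma>" using \<Gamma>(1,3) x x' by (intro integral_real_bounded) auto
    finally have "(\<integral>\<omega>. ?s \<omega> powr 2 \<partial>M) powr (1/2) \<le> ((data_bound * M2_dist d x x')\<^sup>2 * \<Gamma>) powr (1/2)" by (intro powr_mono2) auto
    also have "... = sqrt ((data_bound * M2_dist d x x')\<^sup>2 * \<Gamma>)" using \<Gamma>(1) by (intro powr_half_sqrt) simp
    also have "... = L * M2_dist d x x'" using dist0 data_bound_nonneg by (simp add: L_def real_sqrt_mult)
    finally show ?thesis by (simp add: LpC_norm_def)
  qed
  show ?thesis
  proof (intro exI[of _ "\<epsilon> / (L + 1)"] conjI ballI impI)
    show "\<epsilon> / (L + 1) > 0" using \<epsilon> L0 by simp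
    fix x' assume x': "x' \<in> M2_space d" and D: "M2_dist d x x' < \<epsilon> / (L + 1)"
    have "L * M2_dist d x x' \<le> (L + 1) * M2_dist d x x'" by (simp add: M2_dist_def M2_norm_nonneg distrib_right)
    also have "... < \<epsilon>" using D L0 by (simp add: less_divide_eq mult.commute)
    finally show "LpC_norm M 2 T (\<lambda>t \<omega>. Y x t \<omega> - Y x' t \<omega>) < \<epsilon>" using le[OF x'] by linarith
  qed
qed

end

section \<open>Reduction of the almost sure hypotheses to hypotheses on every path\<close>

lemma strong_solution_cong_kernel:
  assumes eq: "AE \<omega> in M. \<forall>s. \<phi> s \<omega> = \<psi> s \<omega>" and y: "strong_solution M Z d T \<mu> \<sigma> \<phi> x y"
  shows "strong_solution M Z d T \<mu> \<sigma> \<psi> x y"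
proof -
  obtain I where I: "ito_integral M (augmented_filtration M Z) Z T (\<lambda>t \<omega>. y t \<omega> *\<^sub>R \<sigma>) I"
    and e: "AE \<omega> in M. \<forall>t\<in>{0..T}. y t \<omega> = fst x + \<mu> * Lint (\<lambda>u. y u \<omega>) 0 t
      + Lint (delay_ext d T (\<lambda>s. \<phi> s \<omega>) (extend_past (snd x) (\<lambda>s. y s \<omega>))) 0 t + I t \<omega>"
    using y unfolding strong_solution_def by blast
  have "AE \<omega> in M. \<forall>t\<in>{0..T}. y t \<omega> = fst x + \<mu> * Lint (\<lambda>u. y u \<omega>) 0 t
      + Lint (delay_ext d T (\<lambda>s. \<psi> s \<omega>) (extend_past (snd x) (\<lambda>s. y s \<omega>))) 0 t + I t \<omega>"
    using eq e
  proof eventually_elim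
    case (elim \<omega>)
    have "(\<lambda>s. \<phi> s \<omega>) = (\<lambda>s. \<psi> s \<omega>)" using elim(1) by blast
    then show ?case using elim(2) by simp
  qed
  then show ?thesis using y I unfolding strong_solution_def by blast
qed

text \<open>Off a null set \<open>N\<close> all pathwise hypotheses hold. On \<open>N\<close> the kernel is replaced by its value at a good
  point and the Brownian path by \<open>0\<close>, so that every path can be treated alike; since \<open>N\<close> belongs to the
  augmented filtration, this does not affect progressive measurability.\<close>

lemma (in brownian) ex_regular_version:
  fixes \<sigma> :: "real^'n" and \<phi> :: "real => 'a => real set => real"
  assumes d: "d > 0" and T: "T > 0" and K: "K \<subseteq> M0 d" and \<phi>: "admissible_kernel M F d K \<phi>" and L2: "delay_L2_bounded M d T \<phi>"
  obtains c cL \<kappa> B where "delayed_sde M Z d T c cL \<sigma> \<kappa> B" "AE \<omega> in M. \<forall>s. \<phi> s \<omega> = \<kappa> s \<omega>"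
proof -
  obtain c where c: "c \<ge> 0" "AE \<omega> in M. \<forall>t\<in>{0..T}. total_variation d (\<phi> t \<omega>) \<le> c"
    using \<phi> T unfolding admissible_kernel_def by blast
  obtain cL where cL: "cL \<ge> 0" "AE \<omega> in M. \<forall>z. continuous_on {-d..T} z \<longrightarrow>
      L2_norm {0..T} (delay_op d (\<lambda>t. \<phi> t \<omega>) z) \<le> cL * L2_norm {-d..T} z"
    using L2 unfolding delay_L2_bounded_def by blast
  have Z: "AE \<omega> in M. Z 0 \<omega> = 0" "AE \<omega> in M. continuous_on {0..} (\<lambda>t. Z t \<omega>)"
    using BM by (simp_all add: brownian_motion_def)
  define good where "good \<omega> \<longleftrightarrow> (\<forall>t\<in>{0..T}. total_variation d (\<phi> t \<omega>) \<le> c) \<and>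
    (\<forall>z. continuous_on {-d..T} z \<longrightarrow> L2_norm {0..T} (delay_op d (\<lambda>t. \<phi> t \<omega>) z) \<le> cL * L2_norm {-d..T} z) \<and>
    Z 0 \<omega> = 0 \<and> continuous_on {0..} (\<lambda>t. Z t \<omega>)" for \<omega>
  have "AE \<omega> in M. good \<omega>" using c(2) cL(2) Z by eventually_elim (simp add: good_def)
  then obtain N where N: "{\<omega>\<in>space M. \<not> good \<omega>} \<subseteq> N" "emeasure M N = 0" "N \<in> sets M" by (rule AE_E)
  have N0: "N \<in> null_sets M" using N by (simp add: null_sets_def)
  have NF [measurable]: "N \<in> sets (F t)" for t by (rule null_sets_F[OF N0])
  have "\<not> space M \<subseteq> N"
  proof
    assume "space M \<subseteq> N"
    then have "emeasure M (space M) \<le> emeasure M N" by (rule emeasure_mono[OF _ N(3)])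
    then show False using N(2) emeasure_space_1 by simp
  qed
  then obtain \<omega>0 where \<omega>0: "\<omega>0 \<in> space M" "\<omega>0 \<notin> N" by blast
  define \<kappa> where "\<kappa> t \<omega> = \<phi> t (if \<omega> \<in> N then \<omega>0 else \<omega>)" for t \<omega>
  define B where "B t \<omega> = (if \<omega> \<in> N then 0 else \<sigma> \<bullet> Z t \<omega>)" for t \<omega>
  have prog: "(\<lambda>(s, \<omega>). \<phi> s \<omega> A) \<in> borel_measurable (restrict_space borel {0..t} \<Otimes>\<^sub>M F t)"
    if "A \<in> sets borel" "A \<subseteq> {-d..<0}" "t \<ge> 0" for A t
    using \<phi> that unfolding admissible_kernel_def progressive_on_def by auto
  have slice: "(\<lambda>s. \<phi> s \<omega> A) \<in> borel_measurable (restrict_space borel {0..t})"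
    if "A \<in> sets borel" "A \<subseteq> {-d..<0}" "t \<ge> 0" "\<omega> \<in> space M" for A t \<omega>
    using measurable_compose[OF measurable_Pair2'[of \<omega> "F t" "restrict_space borel {0..t}"] prog[OF that(1-3)]] that(4) by simp
  have kernel: "delay_kernel d T c cL (\<lambda>t. \<phi> t \<omega>)" if \<omega>: "\<omega> \<in> space M" "\<omega> \<notin> N" for \<omega>
  proof
    have "good \<omega>" using N(1) \<omega> by blast
    then show "total_variation d (\<phi> t \<omega>) \<le> c" if "t \<in> {0..T}" for t using that by (simp add: good_def)
    show "\<phi> t \<omega> \<in> M0 d" if "t \<in> {0..T}" for t
      using \<phi> K \<omega> that unfolding admissible_kernel_def by auto
    show "(\<lambda>t. \<phi> t \<omega> A) \<in> borel_measurable (restrict_space borel {0..T})" if "A \<in> sets borel" "A \<subseteq> {-d..<0}" for A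
      by (rule slice[OF that less_imp_le[OF T] \<omega>(1)])
    show "L2_norm {0..T} (delay_op d (\<lambda>t. \<phi> t \<omega>) z) \<le> cL * L2_norm {-d..T} z" if "continuous_on {-d..T} z" for z
      using \<open>good \<omega>\<close> that by (simp add: good_def)
  qed (use d T c cL in auto)
  have "delayed_sde M Z d T c cL \<sigma> \<kappa> B"
  proof (intro delayed_sde.intro delayed_sde_axioms.intro)
    show "brownian M Z" by (rule brownian_axioms)
    show "delay_kernel d T c cL (\<lambda>t. \<kappa> t \<omega>)" if "\<omega> \<in> space M" for \<omega>
      using kernel[of "if \<omega> \<in> N then \<omega>0 else \<omega>"] that \<omega>0 by (simp add: \<kappa>_def split: if_splits)
    show "(\<lambda>(s, \<omega>). \<kappa> s \<omega> A) \<in> borel_measurable (restrict_space borel {0..t} \<Otimes>\<^sub>M F t)"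
      if A: "A \<in> sets borel" "A \<subseteq> {-d..<0}" and t: "t \<in> {0..T}" for A t
    proof -
      have t0: "t \<ge> 0" using t by simp
      have [measurable]: "(\<lambda>q. \<phi> (fst q) (snd q) A) \<in> borel_measurable (restrict_space borel {0..t} \<Otimes>\<^sub>M F t)"
        using prog[OF A t0] by (simp add: case_prod_beta)
      have [measurable]: "(\<lambda>s. \<phi> s \<omega>0 A) \<in> borel_measurable (restrict_space borel {0..t})"
        by (rule slice[OF A t0 \<omega>0(1)])
      have "(\<lambda>q. if snd q \<in> N then \<phi> (fst q) \<omega>0 A else \<phi> (fst q) (snd q) A) \<in> borel_measurable (restrict_space borel {0..t} \<Otimes>\<^sub>M F t)"
        by measurable
      then show ?thesis by (simp add: \<kappa>_def case_prod_beta if_distrib[of "\<lambda>\<omega>. \<phi> _ \<omega> A"] cong: if_cong)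
    qed
    show "B t \<in> borel_measurable (F t)" if "t \<in> {0..T}" for t
    proof -
      have [measurable]: "Z t \<in> borel_measurable (F t)" using that by (intro Z_F_measurable) auto
      show ?thesis unfolding B_def[abs_def] by measurable
    qed
    fix \<omega> assume \<omega>: "\<omega> \<in> space M"
    have "continuous_on {0..T} (\<lambda>t. B t \<omega>) \<and> B 0 \<omega> = 0"
    proof (cases "\<omega> \<in> N")
      case False
      then have "good \<omega>" using N(1) \<omega> by blast
      then have "continuous_on {0..T} (\<lambda>t. Z t \<omega>)" "Z 0 \<omega> = 0" by (auto simp: good_def elim: continuous_on_subset)
      then show ?thesis using False by (simp add: B_def continuous_on_inner)
    qed (simp add: B_def)
    then show "continuous_on {0..T} (\<lambda>t. B t \<omega>)" "B 0 \<omega> = 0" by blast+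
  next
    show "AE \<omega> in M. \<forall>t\<in>{0..T}. B t \<omega> = \<sigma> \<bullet> Z t \<omega>"
      using AE_not_in[OF N0] by eventually_elim (simp add: B_def)
  qed
  moreover have "AE \<omega> in M. \<forall>s. \<phi> s \<omega> = \<kappa> s \<omega>" using AE_not_in[OF N0] by eventually_elim (simp add: \<kappa>_def)
  ultimately show ?thesis by (rule that)
qed

theorem propositionB2:
  fixes M :: "'a measure" and Z :: "real \<Rightarrow> 'a \<Rightarrow> real^'n"
    and d \<mu>y T :: real and \<sigma>y :: "real^'n"
    and K :: "(real set \<Rightarrow> real) set" and \<phi> :: "real \<Rightarrow> 'a \<Rightarrow> real set \<Rightarrow> real"
  assumes "prob_space M" and "brownian_motion M Z"
    and "d > 0"
    and "K \<subseteq> M0 d" and "has_order_minimum d K"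
    and "admissible_kernel M (augmented_filtration M Z) d K \<phi>"
    and "T > 0"
    and "delay_L2_bounded M d T \<phi>"
  shows "\<exists>Y :: real \<times> (real \<Rightarrow> real) \<Rightarrow> real \<Rightarrow> 'a \<Rightarrow> real. \<forall>x\<in>M2_space d.
      strong_solution M Z d T \<mu>y \<sigma>y \<phi> x (Y x) \<and> Y x \<in> LpC_space M 2 T \<and>
      (\<forall>y. strong_solution M Z d T \<mu>y \<sigma>y \<phi> x y \<and> y \<in> LpC_space M 2 T \<longrightarrow>
         (AE \<omega> in M. \<forall>t\<in>{0..T}. y t \<omega> = Y x t \<omega>)) \<and>
      (\<forall>\<epsilon>>0. \<exists>\<delta>>0. \<forall>x'\<in>M2_space d. M2_dist d x x' < \<delta> \<longrightarrow>
         LpC_norm M 2 T (\<lambda>t \<omega>. Y x t \<omega> - Y x' t \<omega>) < \<epsilon>) \<and>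
      (\<forall>p\<ge>2. Y x \<in> LpC_space M p T)"
proof -
  interpret bm: brownian M Z
    using assms(1,2) by (simp add: brownian_def brownian_axioms_def)
  \<comment> \<open>The regular version depends neither on the datum nor on a competing solution, so
    one replacement of the kernel serves existence, uniqueness and continuity alike.\<close>
  obtain c cL \<kappa> B where "delayed_sde M Z d T c cL \<sigma>y \<kappa> B" and \<kappa>: "AE \<omega> in M. \<forall>s. \<phi> s \<omega> = \<kappa> s \<omega>"
    by (rule bm.ex_regular_version[OF assms(3,7,4,6,8), where \<sigma>=\<sigma>y])
  then interpret delayed_sde M Z d T c cL \<mu>y \<sigma>y \<kappa> B by simp
  have \<kappa>': "AE \<omega> in M. \<forall>s. \<kappa> s \<omega> = \<phi> s \<omega>" using \<kappa> by eventually_elim simp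
  have "AE \<omega> in M. \<forall>t\<in>{0..T}. y t \<omega> = Y x t \<omega>"
    if x: "x \<in> M2_space d" and y: "strong_solution M Z d T \<mu>y \<sigma>y \<phi> x y" "y \<in> LpC_space M 2 T" for x y
    using strong_solution_unique[OF x strong_solution_cong_kernel[OF \<kappa> y(1)] y(2) Y_strong_solution[OF x] Y_in_LpC[OF x]] by simp
  then show ?thesis
    using strong_solution_cong_kernel[OF \<kappa>' Y_strong_solution] Y_in_LpC Y_continuous_in_data
    by (intro exI[of _ Y]) auto
qed


end
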